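(* Let $p$ be a prime. Suppose $B_1,\ldots,B_n\in\mathbb{Z}$ ($n\ge1$) are positive multiples of $p-1$ such that there is no carry when $B_1,\ldots,B_n$ are added together in base $p$. Let $B=B_1+\cdots+B_n$. Then the following elements are indecomposable in their respective rings: (i) $i_\ast(E_{B_1}\circ\cdots\circ E_{B_n})\in H_{2B}(\mathrm{Aut}(F_{p^n});\mathbb{F}_p)$ in $H_\ast\big(\bigsqcup_{k\geq0}B\mathrm{Aut}(F_k);\mathbb{F}_p\big)$; (ii) $E^{\mathbb{Z}}_{B_1}\circ\cdots\circ E^{\mathbb{Z}}_{B_n}\in H_{2B}(GL_{p^n}(\mathbb{Z});\mathbb{F}_p)$ in $H_\ast\big(\bigsqcup_{k\geq0}BGL_k(\mathbb{Z});\mathbb{F}_p\big)$; (iii) $E^{\mathbb{F}_p}_{B_1}\circ\cdots\circ E^{\mathbb{F}_p}_{B_n}\in H_{2B}(GL_{p^n}(\mathbb{F}_p);\mathbb{F}_p)$ in $H_\ast\big(\bigsqcup_{k\geq0}BGL_k(\mathbb{F}_p);\mathbb{F}_p\big)$. (For $p=2$, replace $2B$ by $B$.)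
   Context: Homology and cohomology are with $\mathbb{F}_p$-coefficients. $F_k$ is the free group on $k$ generators and $\Sigma_k$ the symmetric group. Ring structures. The homology of each of $\bigsqcup_{k\ge0}B\Sigma_k$, $\bigsqcup_{k\ge0}B\mathrm{Aut}(F_k)$, $\bigsqcup_{k\ge0}BGL_k(\mathbb{Z})$, $\bigsqcup_{k\ge0}BGL_k(\mathbb{F}_p)$ is a ring, with product induced respectively by the homomorphisms $\Sigma_k\times\Sigma_m\to\Sigma_{k+m}$ (disjoint union of sets), $\mathrm{Aut}(F_k)\times\mathrm{Aut}(F_m)\to\mathrm{Aut}(F_{k+m})$ (free product), and block sum $GL_k\times GL_m\to GL_{k+m}$. An element of such a ring is indecomposable if it is not a sum of products $ab$ with $a$ and $b$ both in the ideal given by the homology of the components indexed by $k\geq1$. The $\circ$-products. There is an additional product $\circ$ on the homology of $\bigsqcup_k B\Sigma_k$, induced by $\Sigma_k\times\Sigma_m\to\Sigma_{km}$ (direct product of sets), and on the homology of $\bigsqcup_kBGL_k(R)$ for $R=\mathbb{Z},\mathbb{F}_p$, induced by $GL_k(R)\times GL_m(R)\to GL_{km}(R)$ (tensor product of free modules). Maps. $i\colon\Sigma_k\to\mathrm{Aut}(F_k)$ sends a permutation to the automorphism permuting the generators; $\pi_{\mathrm{ab}}\colon\mathrm{Aut}(F_k)\to GL_k(\mathbb{Z})$ is given by abelianization; $\rho_{\mathrm{can}}\colon GL_k(\mathbb{Z})\to GL_k(\mathbb{F}_p)$ is reduction mod $p$; $c\colon\mathbb{F}_p\to\Sigma_p$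 is the Cayley embedding of the additive group $\mathbb{F}_p$. Elements. For $p$ odd, $H^\ast(\mathbb{F}_p)$ is the tensor product of the exterior algebra on $x$ ($\deg x=1$) and the polynomial algebra on $y$ ($\deg y=2$); for $p=2$ it is $\mathbb{F}_2[y]$ with $\deg y=1$. Let $z_k\in H_\ast(\mathbb{F}_p)$ be the dual of $y^k$ (with respect to the monomial basis), and put $E_k=c_\ast(z_k)\in H_\ast(\Sigma_p)$, $E^{\mathbb{Z}}_k=(\pi_{\mathrm{ab}}i)_\ast(E_k)\in H_\ast(GL_p(\mathbb{Z}))$, $E^{\mathbb{F}_p}_k=(\rho_{\mathrm{can}})_\ast(E^{\mathbb{Z}}_k)\in H_\ast(GL_p(\mathbb{F}_p))$. *)

theory Defs
  imports
    "HOL-Algebra.Bij"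
    "HOL-Algebra.Ideal_Product"
    "HOL-Algebra.QuotRing"
    "HOL-Algebra.Sym_Groups"
    "HOL-Library.Poly_Mapping"
    "Jordan_Normal_Form.VS_Connect"
    "Berlekamp_Zassenhaus.Finite_Field"
begin

hide_const (open) Multiset.mult
hide_const (open) Polynomial.smult
hide_const (open) Modules.module

section \<open>Linear extension on free modules\<close>

definition lin_ext :: "('a \<Rightarrow> ('b \<Rightarrow>\<^sub>0 'k)) \<Rightarrow> ('a \<Rightarrow>\<^sub>0 'k) \<Rightarrow> ('b \<Rightarrow>\<^sub>0 'k::comm_ring_1)" where
  "lin_ext f c =
     (\<Sum>x\<in>Poly_Mapping.keys c. Poly_Mapping.map ((*) (Poly_Mapping.lookup c x)) (f x))"

definition bilin_ext ::
  "('a \<Rightarrow> 'b \<Rightarrow> ('c \<Rightarrow>\<^sub>0 'k)) \<Rightarrow> ('a \<Rightarrow>\<^sub>0 'k) \<Rightarrow> ('b \<Rightarrow>\<^sub>0 'k) \<Rightarrow> ('c \<Rightarrow>\<^sub>0 'k::comm_ring_1)" where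
  "bilin_ext f a b = lin_ext (\<lambda>x. lin_ext (f x) b) a"

definition pushforward :: "('a \<Rightarrow> 'b) \<Rightarrow> ('a \<Rightarrow>\<^sub>0 'k) \<Rightarrow> ('b \<Rightarrow>\<^sub>0 'k::comm_ring_1)" where
  "pushforward f = lin_ext (\<lambda>x. Poly_Mapping.single (f x) 1)"

definition chains_on :: "'a set \<Rightarrow> ('a \<Rightarrow>\<^sub>0 'k::comm_ring_1) set" where
  "chains_on X = {c. Poly_Mapping.keys c \<subseteq> X}"


section \<open>Homology and cohomology of a group\<close>

text \<open>The simplices of the standard model (nerve) of the classifying space \<open>BG\<close> are the bar symbols
  \<open>[g\<^sub>1|\<dots>|g\<^sub>n]\<close>, represented as lists; the dimension is the length. All dimensions are treated at
  once: chains are finite linear combinations of simplices of arbitrary dimensions, so that the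
  kernel of the boundary modulo its image is the direct sum of the homology groups.\<close>

definition bar_face :: "('g, 'm) monoid_scheme \<Rightarrow> nat \<Rightarrow> 'g list \<Rightarrow> 'g list" where
  "bar_face G i xs =
     (if i = 0 then tl xs
      else if i = length xs then butlast xs
      else take (i - 1) xs @ [xs ! (i - 1) \<otimes>\<^bsub>G\<^esub> xs ! i] @ drop (i + 1) xs)"

definition bar_boundary :: "('g, 'm) monoid_scheme \<Rightarrow> 'g list \<Rightarrow> ('g list \<Rightarrow>\<^sub>0 'k::comm_ring_1)" where
  "bar_boundary G xs =
     (if xs = [] then 0 else \<Sum>i\<le>length xs. Poly_Mapping.single (bar_face G i xs) ((- 1) ^ i))"

definition bar_cycles :: "('g, 'm) monoid_scheme \<Rightarrow> ('g list \<Rightarrow>\<^sub>0 'k::comm_ring_1) set" where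
  "bar_cycles G = {c \<in> chains_on (lists (carrier G)). lin_ext (bar_boundary G) c = 0}"

definition bar_boundaries :: "('g, 'm) monoid_scheme \<Rightarrow> ('g list \<Rightarrow>\<^sub>0 'k::comm_ring_1) set" where
  "bar_boundaries G = lin_ext (bar_boundary G) ` chains_on (lists (carrier G))"

definition homology_group :: "('g, 'm) monoid_scheme \<Rightarrow> ('g list \<Rightarrow>\<^sub>0 'k::comm_ring_1) set monoid" where
  "homology_group G =
     \<lparr>carrier = bar_cycles G, mult = (+), one = 0\<rparr> Mod bar_boundaries G"

definition evaluate :: "('a \<Rightarrow> 'k) \<Rightarrow> ('a \<Rightarrow>\<^sub>0 'k) \<Rightarrow> 'k::comm_ring_1" where
  "evaluate u c = (\<Sum>x\<in>Poly_Mapping.keys c. Poly_Mapping.lookup c x * u x)"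

text \<open>Cochains are bounded in degree, so that cohomology is the direct sum (not the product) of its
  homogeneous parts.\<close>

definition cochains :: "('g, 'm) monoid_scheme \<Rightarrow> ('g list \<Rightarrow> 'k::comm_ring_1) set" where
  "cochains G =
     {u. (\<forall>xs. xs \<notin> lists (carrier G) \<longrightarrow> u xs = 0) \<and> (\<exists>N. \<forall>xs. length xs > N \<longrightarrow> u xs = 0)}"

definition coboundary ::
  "('g, 'm) monoid_scheme \<Rightarrow> ('g list \<Rightarrow> 'k) \<Rightarrow> ('g list \<Rightarrow> 'k::comm_ring_1)" where
  "coboundary G u =
     (\<lambda>xs. if xs \<in> lists (carrier G) then evaluate u (bar_boundary G xs) else 0)"

definition cup :: "('g list \<Rightarrow> 'k) \<Rightarrow> ('g list \<Rightarrow> 'k) \<Rightarrow> ('g list \<Rightarrow> 'k::comm_ring_1)" where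
  "cup u v = (\<lambda>xs. \<Sum>i\<le>length xs. u (take i xs) * v (drop i xs))"

definition coboundaries :: "('g, 'm) monoid_scheme \<Rightarrow> ('g list \<Rightarrow> 'k::comm_ring_1) set" where
  "coboundaries G = coboundary G ` cochains G"

definition cocycle_ring :: "('g, 'm) monoid_scheme \<Rightarrow> ('g list \<Rightarrow> 'k::comm_ring_1) ring" where
  "cocycle_ring G =
     \<lparr>carrier = {u \<in> cochains G. coboundary G u = (\<lambda>xs. 0)},
      mult = cup,
      one = (\<lambda>xs. if xs = [] then 1 else 0),
      zero = (\<lambda>xs. 0),
      add = (\<lambda>u v xs. u xs + v xs)\<rparr>"

text \<open>The cohomology algebra: the quotient ring of the cocycles by the coboundaries, with its scalar
  multiplication.\<close>

definition cohomology_algebra ::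
  "('g, 'm) monoid_scheme \<Rightarrow> ('k, ('g list \<Rightarrow> 'k::comm_ring_1) set) module" where
  "cohomology_algebra G =
     ring.extend (cocycle_ring G Quot coboundaries G)
       (module.fields (\<lambda>c U. \<Union>u\<in>U. coboundaries G +>\<^bsub>cocycle_ring G\<^esub> (\<lambda>xs. c * u xs)))"

definition cohomology_degree ::
  "('g, 'm) monoid_scheme \<Rightarrow> nat \<Rightarrow> ('g list \<Rightarrow> 'k::comm_ring_1) set set" where
  "cohomology_degree G d =
     {U \<in> carrier (cohomology_algebra G). \<exists>u\<in>U. \<forall>xs. length xs \<noteq> d \<longrightarrow> u xs = 0}"

definition kronecker ::
  "('g list \<Rightarrow> 'k) set \<Rightarrow> ('g list \<Rightarrow>\<^sub>0 'k) set \<Rightarrow> 'k::comm_ring_1" where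
  "kronecker U A = the_elem {evaluate u a | u a. u \<in> U \<and> a \<in> A}"


section \<open>Homology of a disjoint union of classifying spaces\<close>

text \<open>The simplices of \<open>\<Squnion>\<^sub>k BG\<^sub>k\<close> are the pairs of an index \<open>k\<close> and a simplex of \<open>BG\<^sub>k\<close>.\<close>

definition union_boundary ::
  "(nat \<Rightarrow> 'g monoid) \<Rightarrow> nat \<times> 'g list \<Rightarrow> (nat \<times> 'g list \<Rightarrow>\<^sub>0 'k::comm_ring_1)" where
  "union_boundary G = (\<lambda>(k, xs). pushforward (Pair k) (bar_boundary (G k) xs))"

definition union_chains :: "(nat \<Rightarrow> 'g monoid) \<Rightarrow> (nat \<times> 'g list \<Rightarrow>\<^sub>0 'k::comm_ring_1) set" where
  "union_chains G = chains_on (SIGMA k:UNIV. lists (carrier (G k)))"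

definition union_cycles :: "(nat \<Rightarrow> 'g monoid) \<Rightarrow> (nat \<times> 'g list \<Rightarrow>\<^sub>0 'k::comm_ring_1) set" where
  "union_cycles G = {c \<in> union_chains G. lin_ext (union_boundary G) c = 0}"

definition union_boundaries :: "(nat \<Rightarrow> 'g monoid) \<Rightarrow> (nat \<times> 'g list \<Rightarrow>\<^sub>0 'k::comm_ring_1) set" where
  "union_boundaries G = lin_ext (union_boundary G) ` union_chains G"

text \<open>Signed sum over all shuffles of two lists.\<close>

fun shuffle_sum :: "'g list \<Rightarrow> 'g list \<Rightarrow> ('g list \<Rightarrow>\<^sub>0 'k::comm_ring_1)" where
  "shuffle_sum [] ys = Poly_Mapping.single ys 1"
| "shuffle_sum (x # xs) [] = Poly_Mapping.single (x # xs) 1"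
| "shuffle_sum (x # xs) (y # ys) =
     pushforward (Cons x) (shuffle_sum xs (y # ys))
     + Poly_Mapping.map ((*) ((- 1) ^ length (x # xs)))
         (pushforward (Cons y) (shuffle_sum (x # xs) ys))"

text \<open>The Eilenberg--Zilber map \<open>C(BG) \<otimes> C(BH) \<rightarrow> C(B(G \<times> H))\<close>: a degeneracy inserts a unit into a bar
  symbol, so the product of two simplices is the signed sum of the shuffles of the
  \<open>(g\<^sub>i, 1)\<close> with the \<open>(1, h\<^sub>j)\<close>.\<close>

definition cross_product ::
  "('g, 'm) monoid_scheme \<Rightarrow> ('h, 'n) monoid_scheme \<Rightarrow> 'g list \<Rightarrow> 'h list \<Rightarrow>
     (('g \<times> 'h) list \<Rightarrow>\<^sub>0 'k::comm_ring_1)" where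
  "cross_product G H xs ys =
     shuffle_sum (map (\<lambda>g. (g, \<one>\<^bsub>H\<^esub>)) xs) (map (\<lambda>h. (\<one>\<^bsub>G\<^esub>, h)) ys)"

text \<open>The chain-level product induced by homomorphisms
  \<open>\<phi> k m : G k \<times> G m \<rightarrow> G (\<mu> k m)\<close>.\<close>

definition simplex_product ::
  "(nat \<Rightarrow> 'g monoid) \<Rightarrow> (nat \<Rightarrow> nat \<Rightarrow> nat) \<Rightarrow> (nat \<Rightarrow> nat \<Rightarrow> 'g \<Rightarrow> 'g \<Rightarrow> 'g) \<Rightarrow>
     nat \<times> 'g list \<Rightarrow> nat \<times> 'g list \<Rightarrow> (nat \<times> 'g list \<Rightarrow>\<^sub>0 'k::comm_ring_1)" where
  "simplex_product G \<mu> \<phi> = (\<lambda>(k, xs) (m, ys).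
     pushforward (\<lambda>zs. (\<mu> k m, map (case_prod (\<phi> k m)) zs))
       (cross_product (G k) (G m) xs ys))"

text \<open>The homology of \<open>\<Squnion>\<^sub>k BG\<^sub>k\<close> with the product induced by \<open>\<phi>\<close>. The unit is the
  class of the vertex of the component indexed by \<open>e\<close>, where \<open>e\<close> is meant to be neutral
  for \<open>\<mu>\<close>; below, this is
  addition with \<open>e = 0\<close> or multiplication with \<open>e = 1\<close>.\<close>

definition union_cycle_ring ::
  "(nat \<Rightarrow> 'g monoid) \<Rightarrow> (nat \<Rightarrow> nat \<Rightarrow> nat) \<Rightarrow> nat \<Rightarrow> (nat \<Rightarrow> nat \<Rightarrow> 'g \<Rightarrow> 'g \<Rightarrow> 'g) \<Rightarrow>
     (nat \<times> 'g list \<Rightarrow>\<^sub>0 'k::comm_ring_1) ring" where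
  "union_cycle_ring G \<mu> e \<phi> =
     \<lparr>carrier = union_cycles G,
      mult = bilin_ext (simplex_product G \<mu> \<phi>),
      one = Poly_Mapping.single (e, []) 1,
      zero = 0,
      add = (+)\<rparr>"

definition homology_ring ::
  "(nat \<Rightarrow> 'g monoid) \<Rightarrow> (nat \<Rightarrow> nat \<Rightarrow> nat) \<Rightarrow> nat \<Rightarrow> (nat \<Rightarrow> nat \<Rightarrow> 'g \<Rightarrow> 'g \<Rightarrow> 'g) \<Rightarrow>
     (nat \<times> 'g list \<Rightarrow>\<^sub>0 'k::comm_ring_1) set ring" where
  "homology_ring G \<mu> e \<phi> = union_cycle_ring G \<mu> e \<phi> Quot union_boundaries G"

text \<open>The summand \<open>H\<^sub>d(BG\<^sub>k)\<close> of the homology of \<open>\<Squnion>\<^sub>k BG\<^sub>k\<close>.\<close>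

definition homology_part ::
  "(nat \<Rightarrow> 'g monoid) \<Rightarrow> nat \<Rightarrow> nat \<Rightarrow> (nat \<times> 'g list \<Rightarrow>\<^sub>0 'k::comm_ring_1) set set" where
  "homology_part G k d =
     {{b + a | b. b \<in> union_boundaries G} | a.
        a \<in> union_cycles G \<and> Poly_Mapping.keys a \<subseteq> {k} \<times> {xs. length xs = d}}"

definition positive_ideal ::
  "(nat \<Rightarrow> 'g monoid) \<Rightarrow> (nat \<times> 'g list \<Rightarrow>\<^sub>0 'k::comm_ring_1) set set" where
  "positive_ideal G =
     {{b + a | b. b \<in> union_boundaries G} | a.
        a \<in> union_cycles G \<and> Poly_Mapping.keys a \<subseteq> {k. k \<ge> 1} \<times> UNIV}"

text \<open>The members of \<^const>\<open>ideal_prod\<close> are the finite sums of products.\<close>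

definition indecomposable ::
  "(nat \<Rightarrow> 'g monoid) \<Rightarrow> (nat \<Rightarrow> nat \<Rightarrow> 'g \<Rightarrow> 'g \<Rightarrow> 'g) \<Rightarrow>
     (nat \<times> 'g list \<Rightarrow>\<^sub>0 'k::comm_ring_1) set \<Rightarrow> bool" where
  "indecomposable G \<phi> A \<longleftrightarrow>
     A \<in> carrier (homology_ring G (+) 0 \<phi>) \<and>
     A \<notin> ideal_prod (homology_ring G (+) 0 \<phi>) (positive_ideal G) (positive_ideal G)"

text \<open>The map on homology classes induced by a map \<open>f\<close> on simplices, for a target with boundaries
  \<open>N\<close>.\<close>

definition induced_map ::
  "('b \<Rightarrow>\<^sub>0 'k) set \<Rightarrow> ('a \<Rightarrow> 'b) \<Rightarrow> ('a \<Rightarrow>\<^sub>0 'k) set \<Rightarrow> ('b \<Rightarrow>\<^sub>0 'k::comm_ring_1) set" where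
  "induced_map N f A = {b + pushforward f a | a b. a \<in> A \<and> b \<in> N}"

text \<open>Induced by a family of homomorphisms \<open>f k : G k \<rightarrow> H k\<close>.\<close>

definition homology_map ::
  "(nat \<Rightarrow> 'h monoid) \<Rightarrow> (nat \<Rightarrow> 'g \<Rightarrow> 'h) \<Rightarrow>
     (nat \<times> 'g list \<Rightarrow>\<^sub>0 'k) set \<Rightarrow> (nat \<times> 'h list \<Rightarrow>\<^sub>0 'k::comm_ring_1) set" where
  "homology_map H f = induced_map (union_boundaries H) (\<lambda>(k, xs). (k, map (f k) xs))"

text \<open>Induced by a homomorphism \<open>f : G \<rightarrow> H k\<close> from a single group into the component
  indexed by \<open>k\<close>.\<close>

definition homology_map_into ::
  "(nat \<Rightarrow> 'h monoid) \<Rightarrow> nat \<Rightarrow> ('g \<Rightarrow> 'h) \<Rightarrow>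
     ('g list \<Rightarrow>\<^sub>0 'k) set \<Rightarrow> (nat \<times> 'h list \<Rightarrow>\<^sub>0 'k::comm_ring_1) set" where
  "homology_map_into H k f = induced_map (union_boundaries H) (\<lambda>xs. (k, map f xs))"


section \<open>Symmetric groups\<close>

text \<open>Products of permutations, where \<open>{1..k} \<times> {1..m}\<close> is identified with \<open>{1..k * m}\<close> in
  lexicographic order.\<close>

definition perm_product :: "nat \<Rightarrow> nat \<Rightarrow> (nat \<Rightarrow> nat) \<Rightarrow> (nat \<Rightarrow> nat) \<Rightarrow> (nat \<Rightarrow> nat)" where
  "perm_product k m \<sigma> \<tau> = (\<lambda>i. if i \<in> {1..k * m}
     then (\<sigma> ((i - 1) div m + 1) - 1) * m + \<tau> ((i - 1) mod m + 1) else i)"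

definition circ_sym ::
  "(nat \<times> (nat \<Rightarrow> nat) list \<Rightarrow>\<^sub>0 'k) set \<Rightarrow> (nat \<times> (nat \<Rightarrow> nat) list \<Rightarrow>\<^sub>0 'k) set \<Rightarrow>
     (nat \<times> (nat \<Rightarrow> nat) list \<Rightarrow>\<^sub>0 'k::comm_ring_1) set" where
  "circ_sym = mult (homology_ring sym_group (*) 1 perm_product)"


section \<open>Automorphism groups of free groups\<close>

text \<open>Elements of free groups are reduced words, with \<open>(s, True)\<close> standing for the generator \<open>s\<close> and
  \<open>(s, False)\<close> for its inverse.\<close>

type_synonym 'a word = "('a \<times> bool) list"

definition letter_inv :: "'a \<times> bool \<Rightarrow> 'a \<times> bool" where
  "letter_inv = (\<lambda>(s, b). (s, \<not> b))"

definition reduced :: "'a word \<Rightarrow> bool" where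
  "reduced = successively (\<lambda>a b. b \<noteq> letter_inv a)"

fun cons_reduced :: "'a \<times> bool \<Rightarrow> 'a word \<Rightarrow> 'a word" where
  "cons_reduced a [] = [a]"
| "cons_reduced a (b # w) = (if b = letter_inv a then w else a # b # w)"

definition free_group_on :: "'a set \<Rightarrow> 'a word monoid" where
  "free_group_on S =
     \<lparr>carrier = {w. fst ` set w \<subseteq> S \<and> reduced w},
      mult = (\<lambda>u v. foldr cons_reduced u v),
      one = []\<rparr>"

definition free_gen :: "'a \<Rightarrow> 'a word" where
  "free_gen s = [(s, True)]"

text \<open>The homomorphic extension of a map on the generators.\<close>

definition free_extend :: "('g, 'm) monoid_scheme \<Rightarrow> ('a \<Rightarrow> 'g) \<Rightarrow> 'a word \<Rightarrow> 'g" where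
  "free_extend G f w =
     foldr (\<lambda>(s, b) g. (if b then f s else inv\<^bsub>G\<^esub> f s) \<otimes>\<^bsub>G\<^esub> g) w \<one>\<^bsub>G\<^esub>"

abbreviation free_group :: "nat \<Rightarrow> nat word monoid" where
  "free_group k \<equiv> free_group_on {1..k}"

definition aut_free :: "nat \<Rightarrow> (nat word \<Rightarrow> nat word) monoid" where
  "aut_free k = AutoGroup (free_group k)"

text \<open>The free product of automorphisms, where \<open>F\<^sub>k * F\<^sub>m\<close> is identified with \<open>F\<^sub>k\<^sub>+\<^sub>m\<close> by
  shifting the generators of \<open>F\<^sub>m\<close>.\<close>

definition aut_sum ::
  "nat \<Rightarrow> nat \<Rightarrow> (nat word \<Rightarrow> nat word) \<Rightarrow> (nat word \<Rightarrow> nat word) \<Rightarrow> (nat word \<Rightarrow> nat word)" where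
  "aut_sum k m \<alpha> \<beta> = (\<lambda>w \<in> carrier (free_group (k + m)).
     free_extend (free_group (k + m))
       (\<lambda>i. if i \<le> k then \<alpha> (free_gen i)
            else map (\<lambda>(j, b). (j + k, b)) (\<beta> (free_gen (i - k)))) w)"

definition perm_aut :: "nat \<Rightarrow> (nat \<Rightarrow> nat) \<Rightarrow> (nat word \<Rightarrow> nat word)" where
  "perm_aut k \<sigma> = (\<lambda>w \<in> carrier (free_group k). map (\<lambda>(i, b). (\<sigma> i, b)) w)"


section \<open>General linear groups\<close>

definition GL :: "nat \<Rightarrow> 'a::comm_ring_1 mat monoid" where
  "GL k = units_of (ring_mat TYPE('a) k ())"

definition block_sum :: "nat \<Rightarrow> nat \<Rightarrow> 'a::comm_ring_1 mat \<Rightarrow> 'a mat \<Rightarrow> 'a mat" where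
  "block_sum k m A B = four_block_mat A (0\<^sub>m k m) (0\<^sub>m m k) B"

text \<open>Tensor product of endomorphisms of free modules (Kronecker product of matrices), with the basis
  of the tensor product in lexicographic order.\<close>

definition mat_tensor :: "nat \<Rightarrow> nat \<Rightarrow> 'a::comm_ring_1 mat \<Rightarrow> 'a mat \<Rightarrow> 'a mat" where
  "mat_tensor k m A B =
     mat (k * m) (k * m) (\<lambda>(i, j). A $$ (i div m, j div m) * B $$ (i mod m, j mod m))"

definition circ_GL ::
  "(nat \<times> 'a::comm_ring_1 mat list \<Rightarrow>\<^sub>0 'k) set \<Rightarrow> (nat \<times> 'a mat list \<Rightarrow>\<^sub>0 'k) set \<Rightarrow>
     (nat \<times> 'a mat list \<Rightarrow>\<^sub>0 'k::comm_ring_1) set" where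
  "circ_GL = mult (homology_ring GL (*) 1 mat_tensor)"

definition exponent_sum :: "'a \<Rightarrow> 'a word \<Rightarrow> int" where
  "exponent_sum s w = (\<Sum>(t, b)\<leftarrow>w. if t = s then (if b then 1 else - 1) else 0)"

text \<open>The matrix of the automorphism induced on the abelianization of \<open>F\<^sub>k\<close>, which is free abelian on the
  classes of the generators. Matrix indices start at \<open>0\<close>, generators at \<open>1\<close>.\<close>

definition abelianize :: "nat \<Rightarrow> (nat word \<Rightarrow> nat word) \<Rightarrow> int mat" where
  "abelianize k \<alpha> = mat k k (\<lambda>(i, j). exponent_sum (i + 1) (\<alpha> (free_gen (j + 1))))"

definition reduce_mod :: "int mat \<Rightarrow> 'p::prime_card mod_ring mat" where
  "reduce_mod = map_mat of_int"


section \<open>The homology classes\<close>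

abbreviation additive_Fp :: "'p::prime_card mod_ring monoid" where
  "additive_Fp \<equiv> add_monoid class_ring"

text \<open>The Cayley embedding, where \<open>a \<in> \<F>\<^sub>p\<close> is identified with the element of \<open>{1..p}\<close> that is
  one more than the representative of \<open>a\<close> in \<open>{0..<p}\<close>.\<close>

definition cayley :: "'p::prime_card mod_ring \<Rightarrow> nat \<Rightarrow> nat" where
  "cayley g = (\<lambda>i. if i \<in> {1..CARD('p)}
     then nat (to_int_mod_ring (g + of_nat (i - 1))) + 1 else i)"

type_synonym 'p cohomology_class = "('p mod_ring list \<Rightarrow> 'p mod_ring) set"

definition cohomology_monomial ::
  "'p::prime_card cohomology_class \<Rightarrow> 'p cohomology_class \<Rightarrow> nat \<Rightarrow> nat \<Rightarrow> 'p cohomology_class" where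
  "cohomology_monomial x y \<epsilon> k =
     (x [^]\<^bsub>cohomology_algebra additive_Fp\<^esub> \<epsilon>) \<otimes>\<^bsub>cohomology_algebra additive_Fp\<^esub>
     (y [^]\<^bsub>cohomology_algebra additive_Fp\<^esub> k)"

text \<open>For \<open>p = 2\<close> the class \<open>x\<close> plays no role.\<close>

definition monomial_basis ::
  "'p::prime_card cohomology_class \<Rightarrow> 'p cohomology_class \<Rightarrow> 'p cohomology_class set" where
  "monomial_basis x y =
     (if CARD('p) = 2 then {cohomology_monomial x y 0 k | k. True}
      else {cohomology_monomial x y \<epsilon> k | \<epsilon> k. \<epsilon> \<le> 1})"

text \<open>\<open>H\<^sup>*(\<F>\<^sub>p)\<close> is \<open>\<Lambda>[x] \<otimes> \<F>\<^sub>p[y]\<close> for odd \<open>p\<close> and \<open>\<F>\<^sub>2[y]\<close> for \<open>p = 2\<close>.\<close>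

definition cohomology_generators ::
  "'p::prime_card cohomology_class \<Rightarrow> 'p cohomology_class \<Rightarrow> bool" where
  "cohomology_generators x y \<longleftrightarrow>
     (let H = cohomology_algebra (additive_Fp :: 'p mod_ring monoid) in
      (if CARD('p) = 2 then y \<in> cohomology_degree additive_Fp 1
       else x \<in> cohomology_degree additive_Fp 1 \<and> y \<in> cohomology_degree additive_Fp 2 \<and>
            x \<otimes>\<^bsub>H\<^esub> x = \<zero>\<^bsub>H\<^esub> \<and> x \<otimes>\<^bsub>H\<^esub> y = y \<otimes>\<^bsub>H\<^esub> x) \<and>
      vectorspace.basis class_ring H (monomial_basis x y))"

definition dual_class ::
  "'p::prime_card cohomology_class \<Rightarrow> 'p cohomology_class \<Rightarrow> nat \<Rightarrow>
     ('p mod_ring list \<Rightarrow>\<^sub>0 'p mod_ring) set" where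
  "dual_class x y k =
     (THE z. z \<in> carrier (homology_group additive_Fp) \<and>
        (\<forall>w\<in>monomial_basis x y.
           kronecker w z = (if w = cohomology_monomial x y 0 k then 1 else 0)))"

definition E_sym ::
  "'p::prime_card cohomology_class \<Rightarrow> 'p cohomology_class \<Rightarrow> nat \<Rightarrow>
     (nat \<times> (nat \<Rightarrow> nat) list \<Rightarrow>\<^sub>0 'p mod_ring) set" where
  "E_sym x y k = homology_map_into sym_group CARD('p) cayley (dual_class x y k)"

definition E_Z ::
  "'p::prime_card cohomology_class \<Rightarrow> 'p cohomology_class \<Rightarrow> nat \<Rightarrow>
     (nat \<times> int mat list \<Rightarrow>\<^sub>0 'p mod_ring) set" where
  "E_Z x y k = homology_map GL (\<lambda>m. abelianize m \<circ> perm_aut m) (E_sym x y k)"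

definition E_Fp ::
  "'p::prime_card cohomology_class \<Rightarrow> 'p cohomology_class \<Rightarrow> nat \<Rightarrow>
     (nat \<times> 'p mod_ring mat list \<Rightarrow>\<^sub>0 'p mod_ring) set" where
  "E_Fp x y k = homology_map GL (\<lambda>m. reduce_mod) (E_Z x y k)"

text \<open>\<open>iterated_product f [a\<^sub>1, \<dots>, a\<^sub>n] = f (\<dots> (f a\<^sub>1 a\<^sub>2) \<dots>) a\<^sub>n\<close> for \<open>n \<ge> 1\<close>.\<close>

definition iterated_product :: "('a \<Rightarrow> 'a \<Rightarrow> 'a) \<Rightarrow> 'a list \<Rightarrow> 'a" where
  "iterated_product f as = foldl f (hd as) (tl as)"


section \<open>Carries\<close>

text \<open>Adding numbers in base \<open>p\<close> produces no carry iff no column of digits has sum \<open>\<ge> p\<close>: the first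
  carry arises from a column whose digits alone sum to at least \<open>p\<close>.\<close>

definition no_carry :: "nat \<Rightarrow> nat list \<Rightarrow> bool" where
  "no_carry p Bs \<longleftrightarrow> (\<forall>j. (\<Sum>B\<leftarrow>Bs. B div p ^ j mod p) < p)"

end

theory Submission
  imports Defs
begin

text \<open>All three classes map to \<open>GL\<^sub>N(\<F>\<^sub>p)\<close>, \<open>N = p\<^sup>n\<close>, compatibly with the sums, so it suffices to detect
  them there by a cocycle that vanishes on decomposables. Let \<open>GL\<^sub>N(\<F>\<^sub>p)\<close> act on the pairs of a nonzero
  row vector \<open>v\<close> and a representative \<open>u\<close> modulo \<open>v\<close>. Normalising \<open>u A\<close> modulo \<open>v A\<close> splits off a multiple
  of \<open>v A\<close>, whose coefficient is an additive cocycle with values in \<open>\<F>\<^sub>p\<close>; the detecting cocycle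
  is the transfer of the \<open>B\<close>-th power of the polynomial generator of \<open>H\<^sup>*(\<F>\<^sub>p)\<close> along it. It vanishes on
  block sums, because a path of pairs depends on one block only and the sum over the other block is
  divisible by \<open>p\<close>.

  The classes come from the regular representation of \<open>\<F>\<^sub>p\<^sup>n\<close>. Free orbits contribute nothing to the transfer.
  At a fixed pair the cocycle is a linear form \<open>t\<close>, and every \<open>t\<close> occurs \<open>p - 1\<close> times, so the value
  is, up to a unit, the multinomial coefficient of \<open>B\<^sub>1, \<dots>, B\<^sub>n\<close> times the sum of
  \<open>t\<^sub>1^B\<^sub>1 \<dots> t\<^sub>n^B\<^sub>n\<close> over all \<open>t\<close>. That sum is \<open>\<plusminus>1\<close> because the \<open>B\<^sub>i\<close> are positive multiples
  of \<open>p - 1\<close>, and the coefficient is a unit because the addition has no carries.\<close>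

section \<open>Chains and linear functionals\<close>

text \<open>Where the cocycle comes from: for nonzero v, adding multiples of v to u makes the set of
  all pairs (v, u) an F_p-torsor over the pairs taken modulo v. The cocycle is the class of this
  torsor, computed with the normalised u as a section. On the stabiliser of a pair it is the
  homomorphism g -> c with u g = u + c v. Two obstacles shape the proof. The generator y is given by
  algebraic properties only, so the dual classes are determined up to powers of an unknown unit
  \<mu>; the final value only acquires powers of \<mu>. Moreover, a class in the positive ideal has
  representatives with simplices in the component k = 0, which come from boundaries, and the
  detecting cocycle has to kill products with these as well. Such simplices have at least one
  letter, and in a block sum that letter becomes an identity matrix; hence the cocycles on F_p are
  chosen normalised, that is, zero on symbols with a letter 0. The sum over all t splits into one
  power sum over F_p for each B_i; by Fermat each of them counts the nonzero elements, which gives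
  -1.\<close>

lemma lookup_map_times [simp]:
  "Poly_Mapping.lookup (Poly_Mapping.map ((*) a) c) x = a * Poly_Mapping.lookup c x"
  for a :: "'k::comm_ring_1"
  by (simp add: Poly_Mapping.map.rep_eq when_def)

lemma evaluate_superset:
  assumes "finite A" "Poly_Mapping.keys c \<subseteq> A"
  shows "evaluate u c = (\<Sum>x\<in>A. Poly_Mapping.lookup c x * u x)"
  unfolding evaluate_def
  by (rule sum.mono_neutral_left) (use assms in \<open>auto simp: in_keys_iff\<close>)

lemma evaluate_zero [simp]: "evaluate u 0 = 0"
  by (simp add: evaluate_def)

lemma evaluate_add: "evaluate u (c + d) = evaluate u c + evaluate u d"
proof -
  let ?A = "Poly_Mapping.keys c \<union> Poly_Mapping.keys d"
  have "Poly_Mapping.keys (c + d) \<subseteq> ?A"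
    by (rule keys_add)
  then show ?thesis
    by (simp add: evaluate_superset[of ?A] lookup_add sum.distrib algebra_simps)
qed

lemma evaluate_scale: "evaluate u (Poly_Mapping.map ((*) a) c) = a * evaluate u c"
proof -
  have "Poly_Mapping.keys (Poly_Mapping.map ((*) a) c) \<subseteq> Poly_Mapping.keys c"
    by (auto simp: in_keys_iff)
  then show ?thesis
    by (simp add: evaluate_superset[of "Poly_Mapping.keys c"] sum_distrib_left algebra_simps)
qed

lemma evaluate_single [simp]: "evaluate u (Poly_Mapping.single x a) = a * u x"
  by (simp add: evaluate_superset[of "{x}"])

lemma evaluate_sum: "evaluate u (sum f A) = (\<Sum>x\<in>A. evaluate u (f x))"
  by (induction A rule: infinite_finite_induct) (auto simp: evaluate_add)

lemma evaluate_cong: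
  assumes "\<And>x. x \<in> Poly_Mapping.keys c \<Longrightarrow> u x = v x"
  shows "evaluate u c = evaluate v c"
  using assms by (simp add: evaluate_def)

lemma evaluate_eq_0:
  assumes "\<And>x. x \<in> Poly_Mapping.keys c \<Longrightarrow> u x = 0"
  shows "evaluate u c = 0"
  using assms by (simp add: evaluate_def)

lemma evaluate_fun_zero [simp]: "evaluate (\<lambda>x. 0) c = 0"
  by (simp add: evaluate_def)

lemma evaluate_fun_add: "evaluate (\<lambda>x. u x + v x) c = evaluate u c + evaluate v c"
  by (simp add: evaluate_def sum.distrib algebra_simps)

lemma evaluate_fun_diff: "evaluate (\<lambda>x. u x - v x) c = evaluate u c - evaluate v c"
  by (simp add: evaluate_def sum_subtractf algebra_simps)

lemma evaluate_fun_uminus: "evaluate (\<lambda>x. - u x) c = - evaluate u c"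
  by (simp add: evaluate_def sum_negf)

lemma evaluate_fun_scale: "evaluate (\<lambda>x. a * u x) c = a * evaluate u c"
  by (simp add: evaluate_def sum_distrib_left algebra_simps)

lemma evaluate_fun_sum: "evaluate (\<lambda>x. \<Sum>s\<in>S. u s x) c = (\<Sum>s\<in>S. evaluate (u s) c)"
  by (induction S rule: infinite_finite_induct) (auto simp: evaluate_fun_add)

lemma evaluate_indicator: "evaluate (\<lambda>y. if y = x then 1 else 0) c = Poly_Mapping.lookup c x"
  by (simp add: evaluate_def if_distrib[of "(*) _"] in_keys_iff cong: if_cong)

text \<open>The indicator functional of a simplex reads off its coefficient, so functionals separate
  chains. Chain identities are proved by pairing both sides with an arbitrary functional, which
  turns \<open>lin_ext\<close>, \<open>pushforward\<close> and \<open>bilin_ext\<close> into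
  substitutions inside \<open>evaluate\<close>.\<close>

lemma chain_eqI:
  assumes "\<And>u. evaluate u a = evaluate u b"
  shows "a = b"
  by (rule poly_mapping_eqI) (metis assms evaluate_indicator)

lemma evaluate_lin_ext: "evaluate u (lin_ext f c) = evaluate (\<lambda>x. evaluate u (f x)) c"
  unfolding lin_ext_def evaluate_sum evaluate_scale by (simp add: evaluate_def)

lemma evaluate_pushforward: "evaluate u (pushforward f c) = evaluate (\<lambda>x. u (f x)) c"
  by (simp add: pushforward_def evaluate_lin_ext)

lemma evaluate_bilin_ext:
  "evaluate u (bilin_ext f a b) = evaluate (\<lambda>x. evaluate (\<lambda>y. evaluate u (f x y)) b) a"
  by (simp add: bilin_ext_def evaluate_lin_ext)

text \<open>The coefficient at \<open>y\<close> is the value on \<open>c\<close> of the functional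
  sending \<open>x\<close> to the coefficient of \<open>f x\<close> at \<open>y\<close>; it vanishes
  unless some \<open>x\<close> in the support contributes.\<close>

lemma keys_lin_ext: "Poly_Mapping.keys (lin_ext f c) \<subseteq> (\<Union>x\<in>Poly_Mapping.keys c. Poly_Mapping.keys (f x))"
proof
  fix y assume "y \<in> Poly_Mapping.keys (lin_ext f c)"
  moreover have "Poly_Mapping.lookup (lin_ext f c) y = evaluate (\<lambda>x. Poly_Mapping.lookup (f x) y) c"
    using evaluate_lin_ext[of "\<lambda>z. if z = y then 1 else 0" f c] by (simp only: evaluate_indicator)
  ultimately have "evaluate (\<lambda>x. Poly_Mapping.lookup (f x) y) c \<noteq> 0"
    by (simp add: in_keys_iff)
  then obtain x where "x \<in> Poly_Mapping.keys c" "Poly_Mapping.lookup (f x) y \<noteq> 0"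
    by (meson evaluate_eq_0)
  then show "y \<in> (\<Union>x\<in>Poly_Mapping.keys c. Poly_Mapping.keys (f x))"
    by (auto simp: in_keys_iff)
qed

lemma keys_pushforward: "Poly_Mapping.keys (pushforward f c) \<subseteq> f ` Poly_Mapping.keys c"
  using keys_lin_ext[of "\<lambda>x. Poly_Mapping.single (f x) 1" c]
  by (auto simp: pushforward_def split: if_splits)

lemma keys_bilin_ext:
  "Poly_Mapping.keys (bilin_ext f a b) \<subseteq>
     (\<Union>x\<in>Poly_Mapping.keys a. \<Union>y\<in>Poly_Mapping.keys b. Poly_Mapping.keys (f x y))"
  unfolding bilin_ext_def
  by (rule order_trans[OF keys_lin_ext]) (intro UN_mono order_refl keys_lin_ext)

lemma lin_ext_zero [simp]: "lin_ext f 0 = 0"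
  by (simp add: lin_ext_def)

lemma lin_ext_add: "lin_ext f (a + b) = lin_ext f a + lin_ext f b"
  by (rule chain_eqI) (simp add: evaluate_lin_ext evaluate_add)

lemma lin_ext_scale: "lin_ext f (Poly_Mapping.map ((*) a) c) = Poly_Mapping.map ((*) a) (lin_ext f c)"
  by (rule chain_eqI) (simp add: evaluate_lin_ext evaluate_scale)

lemma evaluate_uminus: "evaluate u (- c) = - evaluate u c"
  using evaluate_add[of u c "- c"] by (simp add: add_eq_0_iff)

lemma evaluate_diff: "evaluate u (c - d) = evaluate u c - evaluate u d"
  using evaluate_add[of u c "- d"] by (simp add: evaluate_uminus)

lemma lin_ext_uminus: "lin_ext f (- c) = - lin_ext f c"
  by (rule chain_eqI) (simp add: evaluate_lin_ext evaluate_uminus)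

lemma lin_ext_diff: "lin_ext f (c - d) = lin_ext f c - lin_ext f d"
  by (rule chain_eqI) (simp add: evaluate_lin_ext evaluate_diff)

lemma bilin_ext_add_left: "bilin_ext f (a + a') b = bilin_ext f a b + bilin_ext f a' b"
  by (simp add: bilin_ext_def lin_ext_add)

lemma bilin_ext_add_right: "bilin_ext f a (b + b') = bilin_ext f a b + bilin_ext f a b'"
  by (rule chain_eqI) (simp add: evaluate_bilin_ext evaluate_add evaluate_fun_add)

lemma bilin_ext_zero_right [simp]: "bilin_ext f a 0 = 0"
  by (rule chain_eqI) (simp add: evaluate_bilin_ext)

lemma bilin_ext_zero_left [simp]: "bilin_ext f 0 b = 0"
  by (rule chain_eqI) (simp add: evaluate_bilin_ext)

lemma pushforward_zero [simp]: "pushforward f 0 = 0"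
  by (simp add: pushforward_def)

lemma pushforward_add: "pushforward f (a + b) = pushforward f a + pushforward f b"
  by (simp add: pushforward_def lin_ext_add)

lemma pushforward_pushforward: "pushforward f (pushforward g c) = pushforward (\<lambda>x. f (g x)) c"
  by (rule chain_eqI) (simp add: evaluate_pushforward)

lemma chains_on_add: "a \<in> chains_on X \<Longrightarrow> b \<in> chains_on X \<Longrightarrow> a + b \<in> chains_on X"
  using keys_add[of a b] by (auto simp: chains_on_def)

lemma chains_on_zero [simp]: "0 \<in> chains_on X"
  by (simp add: chains_on_def)

lemma chains_on_uminus: "a \<in> chains_on X \<Longrightarrow> - a \<in> chains_on X"
  by (auto simp: chains_on_def in_keys_iff subset_iff)

lemma chains_on_scale: "a \<in> chains_on X \<Longrightarrow> Poly_Mapping.map ((*) c) a \<in> chains_on X"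
  for c :: "'k::comm_ring_1"
  by (simp add: chains_on_def in_keys_iff subset_iff) (metis mult_zero_right)

section \<open>The bar differential on functions\<close>

text \<open>The dual of the bar differential with the zeroth face left out. All remaining faces keep
  the first letter or merge it with the second, which gives a recursion on lists; the zeroth face is
  always added by hand.\<close>

fun inner_coboundary ::
  "('g, 'm) monoid_scheme \<Rightarrow> ('g list \<Rightarrow> 'k) \<Rightarrow> 'g list \<Rightarrow> 'k::comm_ring_1" where
  "inner_coboundary G f [] = 0"
| "inner_coboundary G f [x] = - f []"
| "inner_coboundary G f (x # y # w) =
     - f ((x \<otimes>\<^bsub>G\<^esub> y) # w) - inner_coboundary G (\<lambda>r. f (x # r)) (y # w)"

lemma bar_face_Cons_Cons:
  assumes "Suc i \<le> length (y # w)"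
  shows "bar_face G (Suc (Suc i)) (x # y # w) = x # bar_face G (Suc i) (y # w)"
  using assms by (auto simp: bar_face_def)

lemma inner_coboundary_eq_sum:
  "inner_coboundary G f xs = (\<Sum>i<length xs. (- 1) ^ Suc i * f (bar_face G (Suc i) xs))"
proof (induction G f xs rule: inner_coboundary.induct)
  case (2 G f x)
  then show ?case by (simp add: bar_face_def)
next
  case (3 G f x y w)
  have "(\<Sum>i<length (x # y # w). (- 1) ^ Suc i * f (bar_face G (Suc i) (x # y # w)))
      = (- 1) * f (bar_face G (Suc 0) (x # y # w))
        + (\<Sum>i<length (y # w). (- 1) ^ Suc (Suc i) * f (bar_face G (Suc (Suc i)) (x # y # w)))"
    by (subst length_Cons, subst sum.lessThan_Suc_shift) simp
  also have "(\<Sum>i<length (y # w). (- 1) ^ Suc (Suc i) * f (bar_face G (Suc (Suc i)) (x # y # w)))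
      = - (\<Sum>i<length (y # w). (- 1) ^ Suc i * f (x # bar_face G (Suc i) (y # w)))"
    unfolding sum_negf[symmetric]
    by (intro sum.cong refl) (subst bar_face_Cons_Cons, auto)
  also have "\<dots> = - inner_coboundary G (\<lambda>r. f (x # r)) (y # w)"
    using 3 by simp
  finally show ?case
    by (simp add: bar_face_def)
qed simp

lemma evaluate_bar_boundary_Nil [simp]: "evaluate f (bar_boundary G []) = 0"
  by (simp add: bar_boundary_def)

lemma evaluate_bar_boundary_Cons:
  "evaluate f (bar_boundary G (x # w)) = f w + inner_coboundary G f (x # w)"
proof -
  have "evaluate f (bar_boundary G (x # w)) =
      (\<Sum>i\<le>length (x # w). (- 1) ^ i * f (bar_face G i (x # w)))"
    by (simp add: bar_boundary_def evaluate_sum del: sum.atMost_Suc)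
  also have "\<dots> = f w + inner_coboundary G f (x # w)"
    unfolding inner_coboundary_eq_sum
    by (simp only: lessThan_Suc_atMost[symmetric] sum.lessThan_Suc_shift)
       (simp add: bar_face_def)
  finally show ?thesis .
qed

lemma inner_coboundary_cong:
  assumes "\<And>r. Suc (length r) = length xs \<Longrightarrow> f r = g r"
  shows "inner_coboundary G f xs = inner_coboundary G g xs"
  using assms
proof (induction xs arbitrary: f g rule: induct_list012)
  case (3 x y w)
  have "inner_coboundary G (\<lambda>r. f (x # r)) (y # w) = inner_coboundary G (\<lambda>r. g (x # r)) (y # w)"
    by (rule "3.IH"(2)) (simp add: "3.prems")
  moreover have "f ((x \<otimes>\<^bsub>G\<^esub> y) # w) = g ((x \<otimes>\<^bsub>G\<^esub> y) # w)"
    by (simp add: "3.prems")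
  ultimately show ?case by simp
qed auto

lemma inner_coboundary_add:
  "inner_coboundary G (\<lambda>r. f r + g r) xs = inner_coboundary G f xs + inner_coboundary G g xs"
  by (simp only: inner_coboundary_eq_sum distrib_left sum.distrib)

lemma inner_coboundary_scale:
  "inner_coboundary G (\<lambda>r. a * f r) xs = a * inner_coboundary G f xs"
  by (simp add: inner_coboundary_eq_sum sum_distrib_left mult.left_commute del: power_Suc)

text \<open>The face that multiplies \<open>x\<close> into the first letter of \<open>r\<close>. For
  empty \<open>r\<close> it is the last face, which drops \<open>x\<close>; this convention makes
  \<open>inner_coboundary_Cons\<close> hold without a case distinction.\<close>

definition merge_head :: "('g, 'm) monoid_scheme \<Rightarrow> ('g list \<Rightarrow> 'k) \<Rightarrow> 'g \<Rightarrow> 'g list \<Rightarrow> 'k" where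
  "merge_head G f x r = (case r of [] \<Rightarrow> f [] | z # r' \<Rightarrow> f ((x \<otimes>\<^bsub>G\<^esub> z) # r'))"

lemma inner_coboundary_Cons:
  "inner_coboundary G f (x # r) = - merge_head G f x r - inner_coboundary G (\<lambda>s. f (x # s)) r"
  by (cases r) (auto simp: merge_head_def)

section \<open>Shuffle products\<close>

lemma evaluate_shuffle_Nil_right [simp]: "evaluate u (shuffle_sum xs []) = u xs"
  by (cases xs) auto

lemma evaluate_shuffle_Nil_left [simp]: "evaluate u (shuffle_sum [] ys) = u ys"
  by simp

lemma evaluate_shuffle_Cons_Cons:
  "evaluate u (shuffle_sum (x # xs) (y # ys)) =
     evaluate (\<lambda>r. u (x # r)) (shuffle_sum xs (y # ys))
     + (- 1) ^ Suc (length xs) * evaluate (\<lambda>r. u (y # r)) (shuffle_sum (x # xs) ys)"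
  by (simp add: evaluate_add evaluate_pushforward evaluate_scale)

text \<open>The Leibniz rule of the Eilenberg-Zilber map, for all faces but the zeroth. A product of
  a letter of \<open>xs\<close> with an adjacent letter of \<open>ys\<close> arises from both orders
  of the two letters, with opposite signs, and cancels because they commute.\<close>

lemma shuffle_inner_coboundary:
  fixes G :: "('g, 'm) monoid_scheme" and u :: "'g list \<Rightarrow> 'k::comm_ring_1"
  assumes "\<And>x y. x \<in> set xs \<Longrightarrow> y \<in> set ys \<Longrightarrow> x \<otimes>\<^bsub>G\<^esub> y = y \<otimes>\<^bsub>G\<^esub> x"
  shows "evaluate (inner_coboundary G u) (shuffle_sum xs ys) =
     inner_coboundary G (\<lambda>z. evaluate u (shuffle_sum z ys)) xs
     + (- 1) ^ length xs * inner_coboundary G (\<lambda>z. evaluate u (shuffle_sum xs z)) ys"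
  using assms
proof (induction xs ys arbitrary: u rule: shuffle_sum.induct)
  case (1 ys)
  then show ?case by simp
next
  case (2 x xs)
  have "evaluate (inner_coboundary G u) (shuffle_sum (x # xs) []) = inner_coboundary G u (x # xs)"
    by (simp only: evaluate_shuffle_Nil_right)
  then show ?case by simp
next
  case (3 x xs y ys)
  define X where "X = x # xs"
  define Y where "Y = y # ys"
  define \<epsilon> :: 'k where "\<epsilon> = (- 1) ^ length xs"
  have \<epsilon>: "\<epsilon> * \<epsilon> = 1"
    by (simp add: \<epsilon>_def flip: power_add)
  let ?S = "\<lambda>u a b. evaluate u (shuffle_sum a b)"
  let ?ux = "\<lambda>r. u (x # r)" and ?uy = "\<lambda>r. u (y # r)"
  have xy: "x \<otimes>\<^bsub>G\<^esub> y = y \<otimes>\<^bsub>G\<^esub> x"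
    using 3 by auto
  have IH1: "?S (inner_coboundary G ?ux) xs Y = inner_coboundary G (\<lambda>z. ?S ?ux z Y) xs
      + \<epsilon> * inner_coboundary G (\<lambda>z. ?S ?ux xs z) Y"
    unfolding Y_def \<epsilon>_def by (rule 3) (use 3 in auto)
  have IH2: "?S (inner_coboundary G ?uy) X ys = inner_coboundary G (\<lambda>z. ?S ?uy z ys) X
      - \<epsilon> * inner_coboundary G (\<lambda>z. ?S ?uy X z) ys"
    using 3(2)[of ?uy] 3(3) unfolding X_def \<epsilon>_def by auto
  have lhs: "?S (inner_coboundary G u) X Y =
      - ?S (merge_head G u x) xs Y - ?S (inner_coboundary G ?ux) xs Y
      + \<epsilon> * (?S (merge_head G u y) X ys + ?S (inner_coboundary G ?uy) X ys)"
    unfolding X_def Y_def \<epsilon>_def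
    by (subst evaluate_shuffle_Cons_Cons)
       (simp add: inner_coboundary_Cons evaluate_fun_diff evaluate_fun_uminus algebra_simps)
  \<comment> \<open>In \<open>A\<close> the letter \<open>x\<close> is merged with the next letter
    of \<open>xs\<close>, in \<open>B\<close> the letter \<open>y\<close> with the next letter of
    \<open>ys\<close>. \<open>C\<close> is the mixed term with \<open>x\<close> and \<open>y\<close>
    merged; it enters \<open>m1\<close> and \<open>m2\<close> so that it cancels in
    \<open>lhs\<close>.\<close>
  define A where "A = (case xs of [] \<Rightarrow> 0 | z # zs \<Rightarrow> ?S (\<lambda>r. u ((x \<otimes>\<^bsub>G\<^esub> z) # r)) zs Y)"
  define B where "B = (case ys of [] \<Rightarrow> 0 | z # zs \<Rightarrow> ?S (\<lambda>r. u ((y \<otimes>\<^bsub>G\<^esub> z) # r)) X zs)"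
  define C where "C = ?S (\<lambda>r. u ((x \<otimes>\<^bsub>G\<^esub> y) # r)) xs ys"
  have m1: "?S (merge_head G u x) xs Y = A + \<epsilon> * C"
    unfolding Y_def A_def C_def \<epsilon>_def
    by (cases xs) (auto simp: merge_head_def evaluate_shuffle_Cons_Cons simp del: shuffle_sum.simps(3))
  have m2: "?S (merge_head G u y) X ys = C - \<epsilon> * B"
    unfolding X_def B_def C_def \<epsilon>_def xy
    by (cases ys) (auto simp: merge_head_def evaluate_shuffle_Cons_Cons simp del: shuffle_sum.simps(3))
  \<comment> \<open>The differential of \<open>xs\<close> only involves lists one letter shorter, so
    on them the shuffle sign has the constant value \<open>\<epsilon>\<close>.\<close>
  have S_len: "?S u (x # z) Y = ?S ?ux z Y + \<epsilon> * ?S ?uy (x # z) ys" if "Suc (length z) = length xs" for z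
  proof -
    have "(- 1) ^ Suc (length z) = \<epsilon>"
      using that by (simp add: \<epsilon>_def)
    then show ?thesis
      unfolding Y_def by (subst evaluate_shuffle_Cons_Cons) simp
  qed
  \<comment> \<open>\<open>M\<close> and \<open>N\<close> are merge terms of the right-hand side.
    They turn up with the same sign on the left once the induction hypotheses are expanded by
    \<open>r3\<close> and \<open>r4\<close>.\<close>
  define M where "M = merge_head G (\<lambda>z. ?S ?uy z ys) x xs"
  define N where "N = (case ys of [] \<Rightarrow> u X | z # zs \<Rightarrow> ?S ?ux xs ((y \<otimes>\<^bsub>G\<^esub> z) # zs))"
  have r1: "inner_coboundary G (\<lambda>z. ?S u z Y) X = - A - \<epsilon> * M
      - inner_coboundary G (\<lambda>z. ?S ?ux z Y) xs - \<epsilon> * inner_coboundary G (\<lambda>z. ?S ?uy (x # z) ys) xs"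
  proof -
    have "inner_coboundary G (\<lambda>z. ?S u (x # z) Y) xs =
        inner_coboundary G (\<lambda>z. ?S ?ux z Y + \<epsilon> * ?S ?uy (x # z) ys) xs"
      by (rule inner_coboundary_cong) (simp add: S_len)
    moreover have "merge_head G (\<lambda>z. ?S u z Y) x xs = A + \<epsilon> * M"
      unfolding Y_def A_def M_def \<epsilon>_def
      by (cases xs) (auto simp: merge_head_def evaluate_shuffle_Cons_Cons simp del: shuffle_sum.simps(3))
    ultimately show ?thesis
      unfolding X_def by (simp add: inner_coboundary_Cons inner_coboundary_add inner_coboundary_scale)
  qed
  have r2: "inner_coboundary G (\<lambda>z. ?S u X z) Y = - N + \<epsilon> * B
      - inner_coboundary G (\<lambda>z. ?S ?ux xs (y # z)) ys + \<epsilon> * inner_coboundary G (\<lambda>z. ?S ?uy X z) ys"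
  proof -
    have "inner_coboundary G (\<lambda>z. ?S u X (y # z)) ys =
        inner_coboundary G (\<lambda>z. ?S ?ux xs (y # z) + (- \<epsilon>) * ?S ?uy X z) ys"
      unfolding X_def \<epsilon>_def
      by (rule inner_coboundary_cong) (simp only: evaluate_shuffle_Cons_Cons, simp)
    also have "\<dots> = inner_coboundary G (\<lambda>z. ?S ?ux xs (y # z)) ys
        + (- \<epsilon>) * inner_coboundary G (\<lambda>z. ?S ?uy X z) ys"
      by (simp only: inner_coboundary_add inner_coboundary_scale)
    moreover have "merge_head G (\<lambda>z. ?S u X z) y ys = N - \<epsilon> * B"
      unfolding X_def B_def N_def \<epsilon>_def
      by (cases ys) (auto simp: merge_head_def evaluate_shuffle_Cons_Cons simp del: shuffle_sum.simps(3))
    ultimately show ?thesis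
      unfolding Y_def by (simp add: inner_coboundary_Cons)
  qed
  have r3: "inner_coboundary G (\<lambda>z. ?S ?ux xs z) Y = - N - inner_coboundary G (\<lambda>z. ?S ?ux xs (y # z)) ys"
    unfolding Y_def inner_coboundary_Cons N_def X_def by (cases ys) (simp_all add: merge_head_def)
  have r4: "inner_coboundary G (\<lambda>z. ?S ?uy z ys) X = - M - inner_coboundary G (\<lambda>z. ?S ?uy (x # z) ys) xs"
    unfolding X_def inner_coboundary_Cons M_def ..
  have \<epsilon>X: "(- 1) ^ length X = - \<epsilon>"
    by (simp add: X_def \<epsilon>_def)
  have \<epsilon>': "\<epsilon> * (\<epsilon> * z) = z" for z
    by (metis \<epsilon> mult.assoc mult_1)
  have "?S (inner_coboundary G u) X Y = inner_coboundary G (\<lambda>z. ?S u z Y) X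
      + (- 1) ^ length X * inner_coboundary G (\<lambda>z. ?S u X z) Y"
    unfolding \<epsilon>X lhs m1 m2 IH1 IH2 r1 r2 r3 r4 by (simp add: algebra_simps \<epsilon> \<epsilon>')
  then show ?case
    unfolding X_def Y_def .
qed

text \<open>The zeroth face drops the first letter of a shuffle, which is the first letter of
  \<open>xs\<close> or of \<open>ys\<close>; this is exactly the recursion of
  \<open>shuffle_sum\<close>, so the zeroth faces match and the rest is
  \<open>shuffle_inner_coboundary\<close>.\<close>

lemma shuffle_coboundary:
  fixes G :: "('g, 'm) monoid_scheme" and u :: "'g list \<Rightarrow> 'k::comm_ring_1"
  assumes "\<And>x y. x \<in> set xs \<Longrightarrow> y \<in> set ys \<Longrightarrow> x \<otimes>\<^bsub>G\<^esub> y = y \<otimes>\<^bsub>G\<^esub> x"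
  shows "evaluate (\<lambda>z. evaluate u (bar_boundary G z)) (shuffle_sum xs ys) =
     evaluate (\<lambda>z. evaluate u (shuffle_sum z ys)) (bar_boundary G xs)
     + (- 1) ^ length xs * evaluate (\<lambda>z. evaluate u (shuffle_sum xs z)) (bar_boundary G ys)"
proof (cases "xs = [] \<or> ys = []")
  case True
  then show ?thesis
    by (cases xs) (auto simp del: shuffle_sum.simps)
next
  case False
  then obtain x xs' y ys' where xs: "xs = x # xs'" and ys: "ys = y # ys'"
    by (meson neq_Nil_conv)
  have "evaluate (\<lambda>z. evaluate u (bar_boundary G z)) (shuffle_sum xs ys) =
      evaluate (\<lambda>r. u r + inner_coboundary G u (x # r)) (shuffle_sum xs' ys)
      + (- 1) ^ length xs * evaluate (\<lambda>r. u r + inner_coboundary G u (y # r)) (shuffle_sum xs ys')"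
    unfolding xs ys by (simp add: evaluate_shuffle_Cons_Cons evaluate_bar_boundary_Cons del: shuffle_sum.simps)
  also have "\<dots> = evaluate u (shuffle_sum xs' ys) + (- 1) ^ length xs * evaluate u (shuffle_sum xs ys')
      + evaluate (inner_coboundary G u) (shuffle_sum xs ys)"
    unfolding xs ys by (simp add: evaluate_shuffle_Cons_Cons evaluate_fun_add algebra_simps del: shuffle_sum.simps)
  also have "\<dots> = evaluate (\<lambda>z. evaluate u (shuffle_sum z ys)) (bar_boundary G xs)
     + (- 1) ^ length xs * evaluate (\<lambda>z. evaluate u (shuffle_sum xs z)) (bar_boundary G ys)"
    by (subst shuffle_inner_coboundary[OF assms], assumption+)
       (simp add: xs ys evaluate_bar_boundary_Cons algebra_simps del: shuffle_sum.simps)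
  finally show ?thesis .
qed

lemma evaluate_shuffle_map:
  "evaluate u (shuffle_sum (map f xs) (map f ys)) = evaluate (\<lambda>z. u (map f z)) (shuffle_sum xs ys)"
proof (induction xs ys arbitrary: u rule: shuffle_sum.induct)
  case (3 x xs y ys)
  then show ?case
    by (simp add: evaluate_shuffle_Cons_Cons del: shuffle_sum.simps)
qed (simp_all del: shuffle_sum.simps)

lemma inner_coboundary_map:
  assumes "\<And>x y. x \<in> carrier G \<Longrightarrow> y \<in> carrier G \<Longrightarrow> f (x \<otimes>\<^bsub>G\<^esub> y) = f x \<otimes>\<^bsub>H\<^esub> f y"
    and "set xs \<subseteq> carrier G"
  shows "inner_coboundary H u (map f xs) = inner_coboundary G (\<lambda>z. u (map f z)) xs"
  using assms(2)
proof (induction xs arbitrary: u rule: induct_list012)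
  case (3 x y w)
  then show ?case
    using assms(1) by (auto simp: 3(2)[of "\<lambda>r. u (f x # r)", simplified])
qed auto

lemma evaluate_bar_boundary_map:
  assumes "\<And>x y. x \<in> carrier G \<Longrightarrow> y \<in> carrier G \<Longrightarrow> f (x \<otimes>\<^bsub>G\<^esub> y) = f x \<otimes>\<^bsub>H\<^esub> f y"
    and "set xs \<subseteq> carrier G"
  shows "evaluate u (bar_boundary H (map f xs)) = evaluate (\<lambda>z. u (map f z)) (bar_boundary G xs)"
  using inner_coboundary_map[OF assms, of u] by (cases xs) (auto simp: evaluate_bar_boundary_Cons)

lemma keys_sum_subset: "Poly_Mapping.keys (sum f A) \<subseteq> (\<Union>x\<in>A. Poly_Mapping.keys (f x))"
  for f :: "'a \<Rightarrow> 'b \<Rightarrow>\<^sub>0 'c::comm_monoid_add"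
proof (induction A rule: infinite_finite_induct)
  case (insert x A)
  then show ?case using keys_add[of "f x" "sum f A"] by auto
qed auto

lemma keys_bar_boundary:
  "Poly_Mapping.keys (bar_boundary G xs) \<subseteq> (if xs = [] then {} else (\<lambda>i. bar_face G i xs) ` {..length xs})"
proof (cases "xs = []")
  case False
  then show ?thesis
    using keys_sum_subset[of "\<lambda>i. Poly_Mapping.single (bar_face G i xs) ((- 1) ^ i)" "{..length xs}"]
    by (auto simp: bar_boundary_def split: if_splits)
qed (simp add: bar_boundary_def)

lemma length_bar_face: "i \<le> length xs \<Longrightarrow> length (bar_face G i xs) = length xs - 1"
  by (auto simp: bar_face_def)

lemma set_bar_face:
  assumes "monoid G" "i \<le> length xs" "set xs \<subseteq> carrier G"
  shows "set (bar_face G i xs) \<subseteq> carrier G"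
proof -
  interpret monoid G by fact
  show ?thesis
  proof (cases "i = 0 \<or> i = length xs")
    case True
    then show ?thesis
      using assms(3) by (auto simp: bar_face_def dest: list.set_sel(2) in_set_butlastD)
         (metis list.sel(2) list.set_sel(2) subsetD)
  next
    case False
    then have "xs ! (i - 1) \<in> carrier G" "xs ! i \<in> carrier G"
      using assms by (auto intro!: subsetD[OF assms(3)] nth_mem)
    then show ?thesis
      using False assms(3) by (auto simp: bar_face_def dest: in_set_takeD in_set_dropD)
  qed
qed

lemma keys_bar_boundary_length:
  "z \<in> Poly_Mapping.keys (bar_boundary G xs) \<Longrightarrow> Suc (length z) = length xs"
  using keys_bar_boundary[of G xs] length_bar_face[of _ xs G] by (auto split: if_splits)

lemma keys_bar_boundary_carrier:
  assumes "monoid G" "set xs \<subseteq> carrier G" "z \<in> Poly_Mapping.keys (bar_boundary G xs)"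
  shows "set z \<subseteq> carrier G"
  using keys_bar_boundary[of G xs] set_bar_face[OF assms(1) _ assms(2)] assms(3)
  by (force split: if_splits)

lemma keys_shuffle_sum:
  assumes "z \<in> Poly_Mapping.keys (shuffle_sum xs ys :: _ \<Rightarrow>\<^sub>0 'k::comm_ring_1)"
  shows "length z = length xs + length ys \<and> set z = set xs \<union> set ys"
  using assms
proof (induction xs ys arbitrary: z rule: shuffle_sum.induct)
  case (3 x xs y ys)
  let ?a = "pushforward (Cons x) (shuffle_sum xs (y # ys)) :: _ \<Rightarrow>\<^sub>0 'k"
  let ?b = "pushforward (Cons y) (shuffle_sum (x # xs) ys) :: _ \<Rightarrow>\<^sub>0 'k"
  let ?c = "Poly_Mapping.map ((*) ((- 1) ^ length (x # xs))) ?b"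
  have "Poly_Mapping.keys ?c \<subseteq> Poly_Mapping.keys ?b"
    by (auto simp: in_keys_iff)
  moreover have "z \<in> Poly_Mapping.keys ?a \<or> z \<in> Poly_Mapping.keys ?c"
    using 3(3) keys_add[of ?a ?c] by auto
  ultimately have "z \<in> Poly_Mapping.keys ?a \<or> z \<in> Poly_Mapping.keys ?b"
    by blast
  then consider w where "w \<in> Poly_Mapping.keys (shuffle_sum xs (y # ys) :: _ \<Rightarrow>\<^sub>0 'k)" "z = x # w"
    | w where "w \<in> Poly_Mapping.keys (shuffle_sum (x # xs) ys :: _ \<Rightarrow>\<^sub>0 'k)" "z = y # w"
    using keys_pushforward[of "Cons x" "shuffle_sum xs (y # ys) :: _ \<Rightarrow>\<^sub>0 'k"]
      keys_pushforward[of "Cons y" "shuffle_sum (x # xs) ys :: _ \<Rightarrow>\<^sub>0 'k"] by (auto dest!: subsetD)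
  then show ?case
    by cases (use 3 in \<open>fastforce+\<close>)
qed auto

section \<open>Products on the homology of disjoint unions\<close>

lemma evaluate_swap:
  "evaluate (\<lambda>x. evaluate (\<lambda>y. u x y) b) a = evaluate (\<lambda>y. evaluate (\<lambda>x. u x y) a) b"
  unfolding evaluate_def sum_distrib_left
  by (subst sum.swap) (simp add: algebra_simps)

lemma evaluate_union_boundary:
  "evaluate u (union_boundary G (k, xs)) = evaluate (\<lambda>z. u (k, z)) (bar_boundary (G k) xs)"
  by (simp add: union_boundary_def evaluate_pushforward)

lemma union_chains_iff:
  "c \<in> union_chains G \<longleftrightarrow> (\<forall>k xs. (k, xs) \<in> Poly_Mapping.keys c \<longrightarrow> set xs \<subseteq> carrier (G k))"
  by (auto simp: union_chains_def chains_on_def in_lists_conv_set)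

lemma keys_union_boundary:
  "Poly_Mapping.keys (union_boundary G (k, xs) :: _ \<Rightarrow>\<^sub>0 'k::comm_ring_1) \<subseteq>
     Pair k ` Poly_Mapping.keys (bar_boundary (G k) xs :: _ \<Rightarrow>\<^sub>0 'k)"
  unfolding union_boundary_def prod.case by (rule keys_pushforward)

lemma union_boundary_in_chains:
  fixes c :: "nat \<times> 'g list \<Rightarrow>\<^sub>0 'k::comm_ring_1"
  assumes "\<And>k. monoid (G k)" "c \<in> union_chains G"
  shows "lin_ext (union_boundary G) c \<in> union_chains G"
  unfolding union_chains_iff
proof (intro allI impI)
  fix k xs assume "(k, xs) \<in> Poly_Mapping.keys (lin_ext (union_boundary G) c)"
  then obtain k' ys where ys: "(k', ys) \<in> Poly_Mapping.keys c"
      "(k, xs) \<in> Poly_Mapping.keys (union_boundary G (k', ys) :: _ \<Rightarrow>\<^sub>0 'k)"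
    using subsetD[OF keys_lin_ext] by fast
  then have "k' = k" "xs \<in> Poly_Mapping.keys (bar_boundary (G k) ys :: _ \<Rightarrow>\<^sub>0 'k)"
    using keys_union_boundary[of G k' ys] by (auto dest!: subsetD)
  moreover have "set ys \<subseteq> carrier (G k)"
    using ys(1) assms(2) \<open>k' = k\<close> by (simp add: union_chains_iff)
  ultimately show "set xs \<subseteq> carrier (G k)"
    by (metis keys_bar_boundary_carrier[OF assms(1)])
qed

text \<open>Chains of all degrees are treated together, so the sign (-1)^d in the Leibniz rule
  cannot be a scalar; it becomes this operator, which anticommutes with the boundary.\<close>

definition sign_twist :: "(nat \<times> 'g list \<Rightarrow>\<^sub>0 'k) \<Rightarrow> (nat \<times> 'g list \<Rightarrow>\<^sub>0 'k::comm_ring_1)" where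
  "sign_twist = lin_ext (\<lambda>s. Poly_Mapping.single s ((- 1) ^ length (snd s)))"

lemma evaluate_sign_twist: "evaluate u (sign_twist c) = evaluate (\<lambda>s. (- 1) ^ length (snd s) * u s) c"
  by (simp add: sign_twist_def evaluate_lin_ext)

lemma keys_sign_twist: "Poly_Mapping.keys (sign_twist c) \<subseteq> Poly_Mapping.keys c"
  using keys_lin_ext[of "\<lambda>s. Poly_Mapping.single s ((- 1) ^ length (snd s))" c]
  by (auto simp: sign_twist_def split: if_splits)

lemma sign_twist_involution [simp]: "sign_twist (sign_twist c) = c"
  for c :: "nat \<times> 'g list \<Rightarrow>\<^sub>0 'k::comm_ring_1"
proof (rule chain_eqI)
  fix u :: "nat \<times> 'g list \<Rightarrow> 'k"
  have e: "(- 1) ^ length (snd s) * ((- 1) ^ length (snd s) * u s) = u s" for s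
    by (simp only: mult.assoc[symmetric] power_add[symmetric]) simp
  show "evaluate u (sign_twist (sign_twist c)) = evaluate u c"
    unfolding evaluate_sign_twist e ..
qed

lemma boundary_sign_twist:
  fixes c :: "nat \<times> 'g list \<Rightarrow>\<^sub>0 'k::comm_ring_1"
  shows "lin_ext (union_boundary G) (sign_twist c) = - sign_twist (lin_ext (union_boundary G) c)"
proof (rule chain_eqI)
  fix u :: "nat \<times> 'g list \<Rightarrow> 'k"
  have "evaluate u (lin_ext (union_boundary G) (sign_twist c)) =
      evaluate (\<lambda>s. (- 1) ^ length (snd s) * evaluate u (union_boundary G s)) c"
    by (simp add: evaluate_lin_ext evaluate_sign_twist)
  also have "\<dots> = evaluate (\<lambda>s. - evaluate (\<lambda>s. (- 1) ^ length (snd s) * u s) (union_boundary G s)) c"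
  proof (rule evaluate_cong)
    fix s
    have "- evaluate (\<lambda>s. (- 1) ^ length (snd s) * u s) (union_boundary G s)
        = evaluate (\<lambda>t. (- 1) ^ length (snd s) * u t) (union_boundary G s)"
      unfolding evaluate_fun_uminus[symmetric]
    proof (rule evaluate_cong)
      fix t assume "t \<in> Poly_Mapping.keys (union_boundary G s)"
      then have "Suc (length (snd t)) = length (snd s)"
        using keys_union_boundary[of G "fst s" "snd s"] keys_bar_boundary_length by fastforce
      then have e: "(- 1) ^ length (snd s) = - ((- 1) ^ length (snd t) :: 'k)"
        by (metis mult_minus1 power_Suc)
      show "- ((- 1) ^ length (snd t) * u t) = (- 1) ^ length (snd s) * u t"
        unfolding e by simp
    qed
    then show "(- 1) ^ length (snd s) * evaluate u (union_boundary G s)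
        = - evaluate (\<lambda>s. (- 1) ^ length (snd s) * u s) (union_boundary G s)"
      by (simp add: evaluate_fun_scale)
  qed
  also have "\<dots> = evaluate u (- sign_twist (lin_ext (union_boundary G) c))"
    by (simp add: evaluate_uminus evaluate_sign_twist evaluate_lin_ext evaluate_fun_uminus)
  finally show "evaluate u (lin_ext (union_boundary G) (sign_twist c)) =
      evaluate u (- sign_twist (lin_ext (union_boundary G) c))" .
qed

lemma sign_twist_zero [simp]: "sign_twist 0 = 0"
  by (simp add: sign_twist_def)

lemma sign_twist_in_chains: "c \<in> union_chains G \<Longrightarrow> sign_twist c \<in> union_chains G"
  using keys_sign_twist[of c] by (auto simp: union_chains_def chains_on_def)

lemma evaluate_simplex_product:
  "evaluate u (simplex_product G \<mu> \<phi> (k, xs) (m, ys)) =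
     evaluate (\<lambda>z. u (\<mu> k m, z))
       (shuffle_sum (map (\<lambda>g. \<phi> k m g \<one>\<^bsub>G m\<^esub>) xs) (map (\<lambda>h. \<phi> k m \<one>\<^bsub>G k\<^esub> h) ys))"
proof -
  have "evaluate u (simplex_product G \<mu> \<phi> (k, xs) (m, ys)) =
      evaluate (\<lambda>z. u (\<mu> k m, map (case_prod (\<phi> k m)) z))
       (shuffle_sum (map (\<lambda>g. (g, \<one>\<^bsub>G m\<^esub>)) xs) (map (Pair \<one>\<^bsub>G k\<^esub>) ys))"
    by (simp add: simplex_product_def cross_product_def evaluate_pushforward)
  also have "\<dots> = evaluate (\<lambda>z. u (\<mu> k m, z))
       (shuffle_sum (map (case_prod (\<phi> k m)) (map (\<lambda>g. (g, \<one>\<^bsub>G m\<^esub>)) xs))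
          (map (case_prod (\<phi> k m)) (map (Pair \<one>\<^bsub>G k\<^esub>) ys)))"
    by (simp only: evaluate_shuffle_map)
  finally show ?thesis
    by (simp add: comp_def)
qed

lemma keys_simplex_product:
  assumes "(n, z) \<in> Poly_Mapping.keys (simplex_product G \<mu> \<phi> (k, xs) (m, ys))"
  shows "n = \<mu> k m \<and> length z = length xs + length ys \<and>
    set z = (\<lambda>g. \<phi> k m g \<one>\<^bsub>G m\<^esub>) ` set xs \<union> (\<lambda>h. \<phi> k m \<one>\<^bsub>G k\<^esub> h) ` set ys"
proof -
  let ?s = "shuffle_sum (map (\<lambda>g. (g, \<one>\<^bsub>G m\<^esub>)) xs) (map (Pair \<one>\<^bsub>G k\<^esub>) ys) :: _ \<Rightarrow>\<^sub>0 'b"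
  obtain w where w: "w \<in> Poly_Mapping.keys ?s" and n: "n = \<mu> k m" "z = map (case_prod (\<phi> k m)) w"
    using assms keys_pushforward[of "\<lambda>zs. (\<mu> k m, map (case_prod (\<phi> k m)) zs)" ?s]
    by (auto simp: simplex_product_def cross_product_def)
  show ?thesis
    using keys_shuffle_sum[OF w] by (auto simp: n image_Un image_image)
qed

text \<open>By \<open>hom\<close> the images of the two factors commute, as the Leibniz rule for
  shuffles demands. So the product of chains satisfies a Leibniz rule and descends to homology. The
  instances are the circle products on symmetric groups and on \<open>GL\<close>.\<close>

locale product_family =
  fixes G :: "nat \<Rightarrow> 'g monoid" and \<mu> :: "nat \<Rightarrow> nat \<Rightarrow> nat" and \<phi> :: "nat \<Rightarrow> nat \<Rightarrow> 'g \<Rightarrow> 'g \<Rightarrow> 'g"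
  assumes monoid_G: "monoid (G k)"
    and closed: "g \<in> carrier (G k) \<Longrightarrow> h \<in> carrier (G m) \<Longrightarrow> \<phi> k m g h \<in> carrier (G (\<mu> k m))"
    and hom: "g \<in> carrier (G k) \<Longrightarrow> g' \<in> carrier (G k) \<Longrightarrow> h \<in> carrier (G m) \<Longrightarrow> h' \<in> carrier (G m) \<Longrightarrow>
      \<phi> k m (g \<otimes>\<^bsub>G k\<^esub> g') (h \<otimes>\<^bsub>G m\<^esub> h') = \<phi> k m g h \<otimes>\<^bsub>G (\<mu> k m)\<^esub> \<phi> k m g' h'"
begin

abbreviation chain_product ::
  "(nat \<times> 'g list \<Rightarrow>\<^sub>0 'k) \<Rightarrow> (nat \<times> 'g list \<Rightarrow>\<^sub>0 'k) \<Rightarrow> (nat \<times> 'g list \<Rightarrow>\<^sub>0 'k::comm_ring_1)" where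
  "chain_product \<equiv> bilin_ext (simplex_product G \<mu> \<phi>)"

lemma one_closed: "\<one>\<^bsub>G k\<^esub> \<in> carrier (G k)"
  by (rule monoid.one_closed[OF monoid_G])

lemma one_mult: "g \<in> carrier (G k) \<Longrightarrow> \<one>\<^bsub>G k\<^esub> \<otimes>\<^bsub>G k\<^esub> g = g" "g \<in> carrier (G k) \<Longrightarrow> g \<otimes>\<^bsub>G k\<^esub> \<one>\<^bsub>G k\<^esub> = g"
  by (simp_all add: monoid.l_one[OF monoid_G] monoid.r_one[OF monoid_G])

lemma left_hom:
  "g \<in> carrier (G k) \<Longrightarrow> g' \<in> carrier (G k) \<Longrightarrow>
     \<phi> k m (g \<otimes>\<^bsub>G k\<^esub> g') \<one>\<^bsub>G m\<^esub> = \<phi> k m g \<one>\<^bsub>G m\<^esub> \<otimes>\<^bsub>G (\<mu> k m)\<^esub> \<phi> k m g' \<one>\<^bsub>G m\<^esub>"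
  using hom[of g k g' "\<one>\<^bsub>G m\<^esub>" m "\<one>\<^bsub>G m\<^esub>"] by (simp add: one_closed one_mult)

lemma right_hom:
  "h \<in> carrier (G m) \<Longrightarrow> h' \<in> carrier (G m) \<Longrightarrow>
     \<phi> k m \<one>\<^bsub>G k\<^esub> (h \<otimes>\<^bsub>G m\<^esub> h') = \<phi> k m \<one>\<^bsub>G k\<^esub> h \<otimes>\<^bsub>G (\<mu> k m)\<^esub> \<phi> k m \<one>\<^bsub>G k\<^esub> h'"
  using hom[of "\<one>\<^bsub>G k\<^esub>" k "\<one>\<^bsub>G k\<^esub>" h m h'] by (simp add: one_closed one_mult)

lemma left_right_commute:
  assumes "g \<in> carrier (G k)" "h \<in> carrier (G m)"
  shows "\<phi> k m g \<one>\<^bsub>G m\<^esub> \<otimes>\<^bsub>G (\<mu> k m)\<^esub> \<phi> k m \<one>\<^bsub>G k\<^esub> h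
       = \<phi> k m \<one>\<^bsub>G k\<^esub> h \<otimes>\<^bsub>G (\<mu> k m)\<^esub> \<phi> k m g \<one>\<^bsub>G m\<^esub>"
  using hom[of g k "\<one>\<^bsub>G k\<^esub>" "\<one>\<^bsub>G m\<^esub>" m h] hom[of "\<one>\<^bsub>G k\<^esub>" k g h m "\<one>\<^bsub>G m\<^esub>"] assms
  by (simp add: one_closed one_mult)

lemma chain_product_in_chains:
  fixes a b :: "nat \<times> 'g list \<Rightarrow>\<^sub>0 'k::comm_ring_1"
  assumes "a \<in> union_chains G" "b \<in> union_chains G"
  shows "chain_product a b \<in> union_chains G"
  unfolding union_chains_iff
proof (intro allI impI)
  fix n z assume "(n, z) \<in> Poly_Mapping.keys (chain_product a b)"
  then obtain k xs m ys where *: "(k, xs) \<in> Poly_Mapping.keys a" "(m, ys) \<in> Poly_Mapping.keys b"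
      "(n, z) \<in> Poly_Mapping.keys (simplex_product G \<mu> \<phi> (k, xs) (m, ys) :: _ \<Rightarrow>\<^sub>0 'k)"
    using subsetD[OF keys_bilin_ext] by fast
  then have "set xs \<subseteq> carrier (G k)" "set ys \<subseteq> carrier (G m)"
    using assms by (auto simp: union_chains_iff)
  with keys_simplex_product[OF *(3)] show "set z \<subseteq> carrier (G n)"
    using closed one_closed by auto
qed

lemma simplex_product_boundary:
  assumes "set xs \<subseteq> carrier (G k)" "set ys \<subseteq> carrier (G m)"
  shows "evaluate (\<lambda>s. evaluate u (union_boundary G s)) (simplex_product G \<mu> \<phi> (k, xs) (m, ys)) =
     evaluate (\<lambda>s. evaluate u (simplex_product G \<mu> \<phi> s (m, ys))) (union_boundary G (k, xs))
     + (- 1) ^ length xs *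
       evaluate (\<lambda>s. evaluate u (simplex_product G \<mu> \<phi> (k, xs) s)) (union_boundary G (m, ys))"
proof -
  let ?l = "\<lambda>g. \<phi> k m g \<one>\<^bsub>G m\<^esub>" and ?r = "\<lambda>h. \<phi> k m \<one>\<^bsub>G k\<^esub> h" and ?u = "\<lambda>z. u (\<mu> k m, z)"
  have "evaluate (\<lambda>s. evaluate u (union_boundary G s)) (simplex_product G \<mu> \<phi> (k, xs) (m, ys)) =
      evaluate (\<lambda>z. evaluate ?u (bar_boundary (G (\<mu> k m)) z)) (shuffle_sum (map ?l xs) (map ?r ys))"
    by (simp add: evaluate_simplex_product evaluate_union_boundary)
  also have "\<dots> = evaluate (\<lambda>z. evaluate ?u (shuffle_sum z (map ?r ys))) (bar_boundary (G (\<mu> k m)) (map ?l xs))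
     + (- 1) ^ length (map ?l xs) *
       evaluate (\<lambda>z. evaluate ?u (shuffle_sum (map ?l xs) z)) (bar_boundary (G (\<mu> k m)) (map ?r ys))"
    by (rule shuffle_coboundary) (use assms in \<open>auto intro!: left_right_commute\<close>)
  also have "\<dots> = evaluate (\<lambda>z. evaluate ?u (shuffle_sum (map ?l z) (map ?r ys))) (bar_boundary (G k) xs)
     + (- 1) ^ length xs *
       evaluate (\<lambda>z. evaluate ?u (shuffle_sum (map ?l xs) (map ?r z))) (bar_boundary (G m) ys)"
    by (simp add: evaluate_bar_boundary_map[of "G k" ?l, OF left_hom assms(1)]
        evaluate_bar_boundary_map[of "G m" ?r, OF right_hom assms(2)])
  finally show ?thesis
    by (simp add: evaluate_simplex_product evaluate_union_boundary)
qed

lemma chain_product_boundary: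
  fixes a b :: "nat \<times> 'g list \<Rightarrow>\<^sub>0 'k::comm_ring_1"
  assumes "a \<in> union_chains G" "b \<in> union_chains G"
  shows "lin_ext (union_boundary G) (chain_product a b) =
    chain_product (lin_ext (union_boundary G) a) b
    + chain_product (sign_twist a) (lin_ext (union_boundary G) b)"
proof (rule chain_eqI)
  fix u :: "nat \<times> 'g list \<Rightarrow> 'k"
  let ?P = "\<lambda>s t. evaluate u (simplex_product G \<mu> \<phi> s t)"
  have "evaluate u (lin_ext (union_boundary G) (chain_product a b)) =
      evaluate (\<lambda>s. evaluate (\<lambda>t. evaluate (\<lambda>r. evaluate u (union_boundary G r))
        (simplex_product G \<mu> \<phi> s t)) b) a"
    by (simp add: evaluate_lin_ext evaluate_bilin_ext)
  also have "\<dots> = evaluate (\<lambda>s. evaluate (\<lambda>t. evaluate (\<lambda>r. ?P r t) (union_boundary G s)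
        + (- 1) ^ length (snd s) * evaluate (\<lambda>r. ?P s r) (union_boundary G t)) b) a"
  proof (intro evaluate_cong)
    fix s t assume "s \<in> Poly_Mapping.keys a" "t \<in> Poly_Mapping.keys b"
    moreover obtain k xs m ys where "s = (k, xs)" "t = (m, ys)"
      by fastforce
    ultimately show "evaluate (\<lambda>r. evaluate u (union_boundary G r)) (simplex_product G \<mu> \<phi> s t) =
        evaluate (\<lambda>r. ?P r t) (union_boundary G s)
        + (- 1) ^ length (snd s) * evaluate (\<lambda>r. ?P s r) (union_boundary G t)"
      using simplex_product_boundary[of xs k ys m u] assms by (auto simp: union_chains_iff)
  qed
  also have "\<dots> = evaluate (\<lambda>s. evaluate (\<lambda>t. evaluate (\<lambda>r. ?P r t) (union_boundary G s)) b) a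
      + evaluate u (chain_product (sign_twist a) (lin_ext (union_boundary G) b))"
    by (simp add: evaluate_fun_add evaluate_fun_scale evaluate_bilin_ext evaluate_sign_twist evaluate_lin_ext)
  also have "evaluate (\<lambda>s. evaluate (\<lambda>t. evaluate (\<lambda>r. ?P r t) (union_boundary G s)) b) a =
      evaluate (\<lambda>s. evaluate (\<lambda>r. evaluate (\<lambda>t. ?P r t) b) (union_boundary G s)) a"
    by (intro evaluate_cong evaluate_swap)
  also have "\<dots> = evaluate u (chain_product (lin_ext (union_boundary G) a) b)"
    by (simp add: evaluate_bilin_ext evaluate_lin_ext)
  finally show "evaluate u (lin_ext (union_boundary G) (chain_product a b)) =
      evaluate u (chain_product (lin_ext (union_boundary G) a) b
        + chain_product (sign_twist a) (lin_ext (union_boundary G) b))"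
    by (simp add: evaluate_add)
qed

end

section \<open>The bar differential squares to zero\<close>

lemma inner_coboundary_fun_diff:
  "inner_coboundary G (\<lambda>r. f r - g r) xs = inner_coboundary G f xs - inner_coboundary G g xs"
  by (simp only: inner_coboundary_eq_sum right_diff_distrib sum_subtractf)

lemma inner_coboundary_fun_uminus:
  "inner_coboundary G (\<lambda>r. - f r) xs = - inner_coboundary G f xs"
  using inner_coboundary_scale[of G "- 1" f xs] by simp

text \<open>Terms that keep the first letter \<open>x\<close> vanish by induction. What remains says
  that merging \<open>x\<close> into the head commutes with the differential, and this is
  associativity.\<close>

lemma inner_coboundary_inner_coboundary:
  assumes "monoid G" "set xs \<subseteq> carrier G"
  shows "inner_coboundary G (inner_coboundary G f) xs = 0"
  using assms(2)
proof (induction xs arbitrary: f rule: induct_list012)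
  case (3 x y w)
  interpret monoid G by fact
  have IH: "inner_coboundary G (inner_coboundary G (\<lambda>r. f (x # r))) (y # w) = 0"
    using 3 by auto
  have "inner_coboundary G (inner_coboundary G f) (x # y # w) =
      - inner_coboundary G f ((x \<otimes>\<^bsub>G\<^esub> y) # w) + inner_coboundary G (merge_head G f x) (y # w)"
  proof -
    have "inner_coboundary G (\<lambda>r. inner_coboundary G f (x # r)) (y # w) =
        - inner_coboundary G (merge_head G f x) (y # w)"
      by (simp only: inner_coboundary_Cons[of G f x] inner_coboundary_fun_diff
          inner_coboundary_fun_uminus IH) simp
    then show ?thesis by simp
  qed
  also have "inner_coboundary G (merge_head G f x) (y # w) = inner_coboundary G f ((x \<otimes>\<^bsub>G\<^esub> y) # w)"
    using 3 by (cases w) (auto simp: merge_head_def m_assoc)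
  finally show ?case by simp
qed auto

lemma bar_boundary_boundary:
  assumes "monoid G" "set xs \<subseteq> carrier G"
  shows "evaluate (\<lambda>z. evaluate f (bar_boundary G z)) (bar_boundary G xs) = 0"
proof (cases xs)
  case (Cons x w)
  \<comment> \<open>The dual of the zeroth face, set to 0 on the empty symbol, so that
    \<open>?F\<close> plus \<open>inner_coboundary\<close> is the full differential on every
    list.\<close>
  let ?F = "\<lambda>z. if z = [] then 0 else f (tl z)"
  have d: "(\<lambda>z. evaluate f (bar_boundary G z)) = (\<lambda>z. ?F z + inner_coboundary G f z)"
  proof
    show "evaluate f (bar_boundary G z) = ?F z + inner_coboundary G f z" for z
      by (cases z) (auto simp: evaluate_bar_boundary_Cons)
  qed
  have "inner_coboundary G ?F (x # w) = - evaluate f (bar_boundary G w)"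
    by (cases w) (auto simp: evaluate_bar_boundary_Cons)
  then show ?thesis
    using inner_coboundary_inner_coboundary[OF assms, of f]
    by (subst d) (simp add: Cons evaluate_bar_boundary_Cons inner_coboundary_add fun_cong[OF d])
qed simp

lemma union_boundary_boundary:
  assumes "\<And>k. monoid (G k)" "c \<in> union_chains G"
  shows "lin_ext (union_boundary G) (lin_ext (union_boundary G) c) = 0"
proof (rule chain_eqI)
  fix u :: "nat \<times> 'a list \<Rightarrow> 'b"
  have "evaluate u (lin_ext (union_boundary G) (lin_ext (union_boundary G) c)) =
      evaluate (\<lambda>s. evaluate (\<lambda>t. evaluate u (union_boundary G t)) (union_boundary G s)) c"
    by (simp add: evaluate_lin_ext)
  also have "\<dots> = 0"
  proof (rule evaluate_eq_0)
    fix s assume s: "s \<in> Poly_Mapping.keys c"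
    obtain k xs where "s = (k, xs)"
      by (cases s)
    then show "evaluate (\<lambda>t. evaluate u (union_boundary G t)) (union_boundary G s) = 0"
      using bar_boundary_boundary[OF assms(1), of xs k "\<lambda>z. u (k, z)"] assms(2) s
      by (auto simp: evaluate_union_boundary union_chains_iff)
  qed
  finally show "evaluate u (lin_ext (union_boundary G) (lin_ext (union_boundary G) c)) = evaluate u 0"
    by simp
qed

text \<open>The common shape of the classes in \<open>homology_group\<close>,
  \<open>homology_ring\<close>, \<open>homology_part\<close> and \<open>positive_ideal\<close>; with
  it all operations on classes are reduced to representatives.\<close>

definition coset_of :: "'a::plus set \<Rightarrow> 'a \<Rightarrow> 'a set" where
  "coset_of N a = {b + a | b. b \<in> N}"

lemma coset_of_self: "0 \<in> N \<Longrightarrow> a \<in> coset_of N a" for a :: "'a::monoid_add"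
  by (force simp: coset_of_def)

lemma coset_of_eqI:
  fixes a :: "'a::ab_group_add"
  assumes "\<And>x y. x \<in> N \<Longrightarrow> y \<in> N \<Longrightarrow> x + y \<in> N" "\<And>x. x \<in> N \<Longrightarrow> - x \<in> N" "b - a \<in> N"
  shows "coset_of N a = coset_of N b"
proof (intro equalityI subsetI)
  fix z assume "z \<in> coset_of N a"
  then obtain x where x: "x \<in> N" "z = x + a" by (auto simp: coset_of_def)
  have "x + - (b - a) \<in> N" using assms x by blast
  moreover have "z = (x + - (b - a)) + b" using x by simp
  ultimately show "z \<in> coset_of N b" unfolding coset_of_def by blast
next
  fix z assume "z \<in> coset_of N b"
  then obtain x where x: "x \<in> N" "z = x + b" by (auto simp: coset_of_def)
  have "x + (b - a) \<in> N" using assms x by blast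
  moreover have "z = (x + (b - a)) + a" using x by simp
  ultimately show "z \<in> coset_of N a" unfolding coset_of_def by blast
qed

lemma union_boundaries_add: "a \<in> union_boundaries G \<Longrightarrow> b \<in> union_boundaries G \<Longrightarrow> a + b \<in> union_boundaries G"
  unfolding union_boundaries_def union_chains_def
  by (auto simp flip: lin_ext_add intro!: chains_on_add)

lemma union_boundaries_zero: "0 \<in> union_boundaries G"
  unfolding union_boundaries_def union_chains_def by (metis chains_on_zero imageI lin_ext_zero)

lemma union_boundaries_uminus: "a \<in> union_boundaries G \<Longrightarrow> - a \<in> union_boundaries G"
  unfolding union_boundaries_def union_chains_def
  by (auto simp flip: lin_ext_uminus intro!: chains_on_uminus)

lemma union_cycles_add: "a \<in> union_cycles G \<Longrightarrow> b \<in> union_cycles G \<Longrightarrow> a + b \<in> union_cycles G"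
  unfolding union_cycles_def union_chains_def by (auto simp: lin_ext_add intro!: chains_on_add)

lemma induced_map_coset_of:
  assumes "\<And>a. a \<in> M \<Longrightarrow> pushforward f a \<in> N" "0 \<in> M"
    "\<And>x y. x \<in> N \<Longrightarrow> y \<in> N \<Longrightarrow> x + y \<in> N"
  shows "induced_map N f (coset_of M a) = coset_of N (pushforward f a)"
proof (intro equalityI subsetI)
  fix z assume "z \<in> induced_map N f (coset_of M a)"
  then obtain b m where bm: "b \<in> N" "m \<in> M" "z = b + pushforward f (m + a)"
    by (auto simp: induced_map_def coset_of_def)
  then have "b + pushforward f m \<in> N" "z = (b + pushforward f m) + pushforward f a"
    using assms by (auto simp: pushforward_add algebra_simps)
  then show "z \<in> coset_of N (pushforward f a)"
    unfolding coset_of_def by blast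
next
  fix z assume "z \<in> coset_of N (pushforward f a)"
  moreover have "a \<in> coset_of M a"
    by (rule coset_of_self) fact
  ultimately show "z \<in> induced_map N f (coset_of M a)"
    unfolding coset_of_def induced_map_def by blast
qed

section \<open>Functoriality for chains, cycles and classes\<close>

lemma pushforward_union_boundary:
  assumes "c \<in> union_chains G"
    and "\<And>k x y. x \<in> carrier (G k) \<Longrightarrow> y \<in> carrier (G k) \<Longrightarrow> f k (x \<otimes>\<^bsub>G k\<^esub> y) = f k x \<otimes>\<^bsub>H k\<^esub> f k y"
  shows "lin_ext (union_boundary H) (pushforward (\<lambda>(k, xs). (k, map (f k) xs)) c) =
    pushforward (\<lambda>(k, xs). (k, map (f k) xs)) (lin_ext (union_boundary G) c)"
proof (rule chain_eqI)
  fix u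
  show "evaluate u (lin_ext (union_boundary H) (pushforward (\<lambda>(k, xs). (k, map (f k) xs)) c)) =
      evaluate u (pushforward (\<lambda>(k, xs). (k, map (f k) xs)) (lin_ext (union_boundary G) c))"
    unfolding evaluate_lin_ext evaluate_pushforward
  proof (rule evaluate_cong)
    fix s assume s: "s \<in> Poly_Mapping.keys c"
    obtain k xs where [simp]: "s = (k, xs)"
      by (cases s)
    have "set xs \<subseteq> carrier (G k)"
      using s assms(1) by (simp add: union_chains_iff)
    from evaluate_bar_boundary_map[OF assms(2) this]
    show "evaluate u (union_boundary H (case s of (k, xs) \<Rightarrow> (k, map (f k) xs))) =
        evaluate (\<lambda>x. u (case x of (k, xs) \<Rightarrow> (k, map (f k) xs))) (union_boundary G s)"
      by (simp add: evaluate_union_boundary)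
  qed
qed

lemma pushforward_in_union_chains:
  assumes "c \<in> union_chains G" "\<And>k x. x \<in> carrier (G k) \<Longrightarrow> f k x \<in> carrier (H k)"
  shows "pushforward (\<lambda>(k, xs). (k, map (f k) xs)) c \<in> union_chains H"
  unfolding union_chains_iff
proof (intro allI impI)
  fix k xs assume "(k, xs) \<in> Poly_Mapping.keys (pushforward (\<lambda>(k, xs). (k, map (f k) xs)) c)"
  then obtain ys where "(k, ys) \<in> Poly_Mapping.keys c" "xs = map (f k) ys"
    using subsetD[OF keys_pushforward] by fastforce
  moreover from this have "set ys \<subseteq> carrier (G k)"
    using assms(1) by (simp add: union_chains_iff)
  ultimately show "set xs \<subseteq> carrier (H k)"
    using assms(2) by auto
qed

lemma pushforward_union_cycle:
  assumes "c \<in> union_cycles G"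
    and "\<And>k x y. x \<in> carrier (G k) \<Longrightarrow> y \<in> carrier (G k) \<Longrightarrow> f k (x \<otimes>\<^bsub>G k\<^esub> y) = f k x \<otimes>\<^bsub>H k\<^esub> f k y"
    and "\<And>k x. x \<in> carrier (G k) \<Longrightarrow> f k x \<in> carrier (H k)"
  shows "pushforward (\<lambda>(k, xs). (k, map (f k) xs)) c \<in> union_cycles H"
  using assms(1) pushforward_in_union_chains[of c G f H, OF _ assms(3)]
    pushforward_union_boundary[of c G f H, OF _ assms(2)]
  by (auto simp: union_cycles_def)

lemma homology_map_coset_of:
  assumes "\<And>k x y. x \<in> carrier (G k) \<Longrightarrow> y \<in> carrier (G k) \<Longrightarrow> f k (x \<otimes>\<^bsub>G k\<^esub> y) = f k x \<otimes>\<^bsub>H k\<^esub> f k y"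
    and "\<And>k x. x \<in> carrier (G k) \<Longrightarrow> f k x \<in> carrier (H k)"
  shows "homology_map H f (coset_of (union_boundaries G) a) =
    coset_of (union_boundaries H) (pushforward (\<lambda>(k, xs). (k, map (f k) xs)) a)"
  unfolding homology_map_def
proof (rule induced_map_coset_of)
  fix c assume "c \<in> union_boundaries G"
  then obtain e where "e \<in> union_chains G" "c = lin_ext (union_boundary G) e"
    by (auto simp: union_boundaries_def)
  then have "pushforward (\<lambda>(k, xs). (k, map (f k) xs)) e \<in> union_chains H"
    "pushforward (\<lambda>(k, xs). (k, map (f k) xs)) c =
      lin_ext (union_boundary H) (pushforward (\<lambda>(k, xs). (k, map (f k) xs)) e)"
    using pushforward_in_union_chains[of e G f H, OF _ assms(2)]
      pushforward_union_boundary[of e G f H, OF _ assms(1)] by simp_all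
  then show "pushforward (\<lambda>(k, xs). (k, map (f k) xs)) c \<in> union_boundaries H"
    by (simp add: union_boundaries_def)
qed (use union_boundaries_zero union_boundaries_add in auto)

lemma bar_chains_iff: "c \<in> chains_on (lists (carrier G)) \<longleftrightarrow> (\<forall>xs\<in>Poly_Mapping.keys c. set xs \<subseteq> carrier G)"
  by (auto simp: chains_on_def in_lists_conv_set)

lemma pushforward_bar_boundary:
  assumes "c \<in> chains_on (lists (carrier G))"
    and "\<And>x y. x \<in> carrier G \<Longrightarrow> y \<in> carrier G \<Longrightarrow> f (x \<otimes>\<^bsub>G\<^esub> y) = f x \<otimes>\<^bsub>H k\<^esub> f y"
  shows "lin_ext (union_boundary H) (pushforward (\<lambda>xs. (k, map f xs)) c) =
    pushforward (\<lambda>xs. (k, map f xs)) (lin_ext (bar_boundary G) c)"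
proof (rule chain_eqI)
  fix u
  show "evaluate u (lin_ext (union_boundary H) (pushforward (\<lambda>xs. (k, map f xs)) c)) =
      evaluate u (pushforward (\<lambda>xs. (k, map f xs)) (lin_ext (bar_boundary G) c))"
    unfolding evaluate_lin_ext evaluate_pushforward
  proof (rule evaluate_cong)
    fix xs assume "xs \<in> Poly_Mapping.keys c"
    then have "set xs \<subseteq> carrier G"
      using assms(1) by (simp add: bar_chains_iff)
    from evaluate_bar_boundary_map[of G f "H k", OF assms(2) this]
    show "evaluate u (union_boundary H (k, map f xs)) = evaluate (\<lambda>x. u (k, map f x)) (bar_boundary G xs)"
      by (simp add: evaluate_union_boundary)
  qed
qed

lemma pushforward_bar_in_union_chains:
  assumes "c \<in> chains_on (lists (carrier G))" "\<And>x. x \<in> carrier G \<Longrightarrow> f x \<in> carrier (H k)"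
  shows "pushforward (\<lambda>xs. (k, map f xs)) c \<in> union_chains H"
  unfolding union_chains_iff
proof (intro allI impI)
  fix m xs assume "(m, xs) \<in> Poly_Mapping.keys (pushforward (\<lambda>xs. (k, map f xs)) c)"
  then obtain ys where "ys \<in> Poly_Mapping.keys c" "xs = map f ys" "m = k"
    using subsetD[OF keys_pushforward] by fastforce
  then show "set xs \<subseteq> carrier (H m)"
    using assms by (auto simp: bar_chains_iff)
qed

lemma pushforward_bar_cycle:
  assumes "c \<in> bar_cycles G"
    and "\<And>x y. x \<in> carrier G \<Longrightarrow> y \<in> carrier G \<Longrightarrow> f (x \<otimes>\<^bsub>G\<^esub> y) = f x \<otimes>\<^bsub>H k\<^esub> f y"
    and "\<And>x. x \<in> carrier G \<Longrightarrow> f x \<in> carrier (H k)"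
  shows "pushforward (\<lambda>xs. (k, map f xs)) c \<in> union_cycles H"
  using assms(1) pushforward_bar_in_union_chains[of c G f H, OF _ assms(3)]
    pushforward_bar_boundary[of c G f H, OF _ assms(2)]
  by (auto simp: union_cycles_def bar_cycles_def)

lemma bar_boundaries_zero: "0 \<in> bar_boundaries G"
  unfolding bar_boundaries_def by (metis chains_on_zero imageI lin_ext_zero)

lemma bar_boundaries_add: "a \<in> bar_boundaries G \<Longrightarrow> b \<in> bar_boundaries G \<Longrightarrow> a + b \<in> bar_boundaries G"
  unfolding bar_boundaries_def by (auto simp flip: lin_ext_add intro!: chains_on_add)

lemma bar_boundaries_uminus: "a \<in> bar_boundaries G \<Longrightarrow> - a \<in> bar_boundaries G"
  unfolding bar_boundaries_def by (auto simp flip: lin_ext_uminus intro!: chains_on_uminus)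

lemma homology_map_into_coset_of:
  assumes "\<And>x y. x \<in> carrier G \<Longrightarrow> y \<in> carrier G \<Longrightarrow> f (x \<otimes>\<^bsub>G\<^esub> y) = f x \<otimes>\<^bsub>H k\<^esub> f y"
    and "\<And>x. x \<in> carrier G \<Longrightarrow> f x \<in> carrier (H k)"
  shows "homology_map_into H k f (coset_of (bar_boundaries G) a) =
    coset_of (union_boundaries H) (pushforward (\<lambda>xs. (k, map f xs)) a)"
  unfolding homology_map_into_def
proof (rule induced_map_coset_of)
  fix c assume "c \<in> bar_boundaries G"
  then obtain e where "e \<in> chains_on (lists (carrier G))" "c = lin_ext (bar_boundary G) e"
    by (auto simp: bar_boundaries_def)
  then have "pushforward (\<lambda>xs. (k, map f xs)) e \<in> union_chains H"
    "pushforward (\<lambda>xs. (k, map f xs)) c = lin_ext (union_boundary H) (pushforward (\<lambda>xs. (k, map f xs)) e)"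
    using pushforward_bar_in_union_chains[of e G f H, OF _ assms(2)]
      pushforward_bar_boundary[of e G f H, OF _ assms(1)] by simp_all
  then show "pushforward (\<lambda>xs. (k, map f xs)) c \<in> union_boundaries H"
    by (simp add: union_boundaries_def)
qed (use bar_boundaries_zero union_boundaries_add in auto)

section \<open>Products of classes in the homology ring\<close>

lemma homology_ring_coset: "union_boundaries G +>\<^bsub>union_cycle_ring G \<mu> e \<phi>\<^esub> a = coset_of (union_boundaries G) a"
  by (auto simp: a_r_coset_def r_coset_def union_cycle_ring_def coset_of_def)

lemma homology_ring_carrier:
  "carrier (homology_ring G \<mu> e \<phi>) = coset_of (union_boundaries G) ` union_cycles G"
proof -
  have "carrier (homology_ring G \<mu> e \<phi>) =
      (\<Union>a\<in>carrier (union_cycle_ring G \<mu> e \<phi>). {union_boundaries G +>\<^bsub>union_cycle_ring G \<mu> e \<phi>\<^esub> a})"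
    by (simp add: homology_ring_def FactRing_def A_RCOSETS_def RCOSETS_def a_r_coset_def)
  then show ?thesis
    unfolding homology_ring_coset by (auto simp: union_cycle_ring_def)
qed

context product_family
begin

text \<open>For \<open>b\<close> the boundary of \<open>e\<close>, the product is the boundary of
  \<open>sign_twist a\<close> times \<open>e\<close>: twisting preserves cycles, and the second
  twist from the Leibniz rule undoes the first.\<close>

lemma cycle_boundary_product:
  fixes a b :: "nat \<times> 'g list \<Rightarrow>\<^sub>0 'k::comm_ring_1"
  assumes "a \<in> union_cycles G" "b \<in> union_boundaries G"
  shows "chain_product a b \<in> union_boundaries G"
proof -
  obtain e where e: "e \<in> union_chains G" "b = lin_ext (union_boundary G) e"
    using assms(2) by (auto simp: union_boundaries_def)
  have a: "a \<in> union_chains G" "lin_ext (union_boundary G) a = 0"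
    using assms(1) by (auto simp: union_cycles_def)
  have "lin_ext (union_boundary G) (chain_product (sign_twist a) e) = chain_product a b"
    using chain_product_boundary[OF sign_twist_in_chains[OF a(1)] e(1)] a(2)
    by (simp add: boundary_sign_twist e(2))
  then show ?thesis
    using chain_product_in_chains[OF sign_twist_in_chains[OF a(1)] e(1)]
    unfolding union_boundaries_def by (simp add: rev_image_eqI)
qed

lemma boundary_cycle_product:
  fixes a b :: "nat \<times> 'g list \<Rightarrow>\<^sub>0 'k::comm_ring_1"
  assumes "a \<in> union_boundaries G" "b \<in> union_cycles G"
  shows "chain_product a b \<in> union_boundaries G"
proof -
  obtain e where e: "e \<in> union_chains G" "a = lin_ext (union_boundary G) e"
    using assms(1) by (auto simp: union_boundaries_def)
  have b: "b \<in> union_chains G" "lin_ext (union_boundary G) b = 0"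
    using assms(2) by (auto simp: union_cycles_def)
  have "lin_ext (union_boundary G) (chain_product e b) = chain_product a b"
    using chain_product_boundary[OF e(1) b(1)] b(2) by (simp add: e(2))
  then show ?thesis
    using chain_product_in_chains[OF e(1) b(1)] unfolding union_boundaries_def by (simp add: rev_image_eqI)
qed

lemma cycle_product:
  fixes a b :: "nat \<times> 'g list \<Rightarrow>\<^sub>0 'k::comm_ring_1"
  assumes "a \<in> union_cycles G" "b \<in> union_cycles G"
  shows "chain_product a b \<in> union_cycles G"
  using assms chain_product_boundary[of a b] chain_product_in_chains[of a b]
  by (simp add: union_cycles_def)

lemma boundary_is_cycle: "a \<in> union_boundaries G \<Longrightarrow> a \<in> union_cycles G"
  by (auto simp: union_boundaries_def union_cycles_def union_boundary_boundary[OF monoid_G]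
      union_boundary_in_chains[OF monoid_G])

text \<open>The product in a quotient ring is a union over all pairs of representatives. It
  collapses to one coset since changing either representative by a boundary changes the product by a
  boundary.\<close>

lemma mult_coset_of:
  fixes a b :: "nat \<times> 'g list \<Rightarrow>\<^sub>0 'k::comm_ring_1"
  assumes "a \<in> union_cycles G" "b \<in> union_cycles G"
  shows "mult (homology_ring G \<mu> e \<phi>) (coset_of (union_boundaries G) a) (coset_of (union_boundaries G) b) =
    coset_of (union_boundaries G) (chain_product a b)"
proof -
  let ?N = "union_boundaries G :: (nat \<times> 'g list \<Rightarrow>\<^sub>0 'k) set"
  have eq: "coset_of ?N (chain_product (i + a) (j + b)) = coset_of ?N (chain_product a b)"
    if "i \<in> ?N" "j \<in> ?N" for i j
  proof (rule coset_of_eqI)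
    have "chain_product i (j + b) \<in> ?N"
      by (rule boundary_cycle_product[OF that(1) union_cycles_add[OF boundary_is_cycle[OF that(2)] assms(2)]])
    moreover have "chain_product a j \<in> ?N"
      by (rule cycle_boundary_product[OF assms(1) that(2)])
    ultimately have "- (chain_product i (j + b) + chain_product a j) \<in> ?N"
      by (intro union_boundaries_uminus union_boundaries_add)
    moreover have "chain_product a b - chain_product (i + a) (j + b) =
        - (chain_product i (j + b) + chain_product a j)"
      by (simp add: bilin_ext_add_left bilin_ext_add_right)
    ultimately show "chain_product a b - chain_product (i + a) (j + b) \<in> ?N"
      by simp
  qed (auto intro: union_boundaries_add union_boundaries_uminus)
  have "mult (homology_ring G \<mu> e \<phi>) (coset_of ?N a) (coset_of ?N b) =
      (\<Union>x\<in>coset_of ?N a. \<Union>y\<in>coset_of ?N b. coset_of ?N (chain_product x y))"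
    by (simp add: homology_ring_def FactRing_def rcoset_mult_def homology_ring_coset)
       (simp add: union_cycle_ring_def)
  also have "\<dots> = (\<Union>x\<in>coset_of ?N a. \<Union>y\<in>coset_of ?N b. coset_of ?N (chain_product a b))"
  proof (intro SUP_cong refl)
    fix x y assume "x \<in> coset_of ?N a" "y \<in> coset_of ?N b"
    then obtain i j where "i \<in> ?N" "j \<in> ?N" "x = i + a" "y = j + b"
      by (auto simp: coset_of_def)
    then show "coset_of ?N (chain_product x y) = coset_of ?N (chain_product a b)"
      using eq by simp
  qed
  also have "\<dots> = coset_of ?N (chain_product a b)"
    using coset_of_self[OF union_boundaries_zero, of a] coset_of_self[OF union_boundaries_zero, of b]
    by (metis SUP_constant empty_iff)
  finally show ?thesis .
qed

end

section \<open>Transfers of cocycles along finite actions\<close>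

abbreviation fp_add :: "'p::prime_card mod_ring monoid" where
  "fp_add \<equiv> \<lparr>carrier = UNIV, mult = (+), one = 0\<rparr>"

lemma additive_Fp_eq: "additive_Fp = fp_add"
  by simp

text \<open>The cocycle values met while \<open>s\<close> is moved by the letters in turn. This
  sends a bar symbol of the group, with a starting point, to a bar symbol of the coefficient
  group.\<close>

fun path :: "('g \<Rightarrow> 's \<Rightarrow> 's) \<Rightarrow> ('g \<Rightarrow> 's \<Rightarrow> 'a) \<Rightarrow> 'g list \<Rightarrow> 's \<Rightarrow> 'a list" where
  "path act lam [] s = []"
| "path act lam (g # gs) s = lam g s # path act lam gs (act g s)"

text \<open>A right action together with a functor from its action groupoid to F_p. At a point fixed
  by the whole group \<open>lam\<close> is a homomorphism to F_p.\<close>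

locale action_cocycle =
  fixes G :: "('g, 'm) monoid_scheme" and S :: "'s set" and act :: "'g \<Rightarrow> 's \<Rightarrow> 's"
    and lam :: "'g \<Rightarrow> 's \<Rightarrow> 'p::prime_card mod_ring"
  assumes finite_S: "finite S"
    and bij_act: "g \<in> carrier G \<Longrightarrow> bij_betw (act g) S S"
    and act_mult: "g \<in> carrier G \<Longrightarrow> h \<in> carrier G \<Longrightarrow> s \<in> S \<Longrightarrow> act (g \<otimes>\<^bsub>G\<^esub> h) s = act h (act g s)"
    and lam_mult: "g \<in> carrier G \<Longrightarrow> h \<in> carrier G \<Longrightarrow> s \<in> S \<Longrightarrow>
      lam (g \<otimes>\<^bsub>G\<^esub> h) s = lam g s + lam h (act g s)"
begin

lemma act_closed: "g \<in> carrier G \<Longrightarrow> s \<in> S \<Longrightarrow> act g s \<in> S"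
  using bij_act by (auto simp: bij_betw_def)

lemma sum_act: "g \<in> carrier G \<Longrightarrow> (\<Sum>s\<in>S. f (act g s)) = (\<Sum>s\<in>S. f s)"
  using sum.reindex_bij_betw[OF bij_act] .

text \<open>The rules \<open>act_mult\<close> and \<open>lam_mult\<close> say that merging two
  letters commutes with forming the path. The zeroth face is different, as it also moves the
  starting point.\<close>

lemma inner_coboundary_path:
  fixes U :: "'p mod_ring list \<Rightarrow> 'k::comm_ring_1"
  assumes "s \<in> S" "set gs \<subseteq> carrier G"
  shows "inner_coboundary G (\<lambda>z. U (path act lam z s)) gs =
    inner_coboundary fp_add U (path act lam gs s)"
  using assms
proof (induction gs arbitrary: U s rule: induct_list012)
  case (3 g h w)
  have "inner_coboundary G (\<lambda>z. U (lam g s # path act lam z (act g s))) (h # w) =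
      inner_coboundary fp_add (\<lambda>r. U (lam g s # r)) (path act lam (h # w) (act g s))"
    by (rule "3.IH"(2)) (use 3 act_closed in auto)
  then show ?case
    using "3.prems" by (simp add: act_mult lam_mult)
qed auto

definition transfer_cochain :: "('p mod_ring list \<Rightarrow> 'k::comm_ring_1) \<Rightarrow> 'g list \<Rightarrow> 'k" where
  "transfer_cochain U gs = (\<Sum>s\<in>S. U (path act lam gs s))"

text \<open>After the zeroth face the path should start at \<open>act g s\<close> instead of
  \<open>s\<close>. Summing over all starting points absorbs this, since \<open>act g\<close>
  permutes \<open>S\<close>.\<close>

lemma transfer_cocycle:
  fixes U :: "'p mod_ring list \<Rightarrow> 'k::comm_ring_1"
  assumes "\<And>xs. evaluate U (bar_boundary fp_add xs) = 0" "set gs \<subseteq> carrier G"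
  shows "evaluate (transfer_cochain U) (bar_boundary G gs) = 0"
proof (cases gs)
  case (Cons g w)
  have "evaluate (transfer_cochain U) (bar_boundary G gs) =
      (\<Sum>s\<in>S. U (path act lam w s)) + (\<Sum>s\<in>S. inner_coboundary G (\<lambda>z. U (path act lam z s)) gs)"
    unfolding transfer_cochain_def evaluate_fun_sum
    by (simp add: Cons evaluate_bar_boundary_Cons sum.distrib)
  also have "(\<Sum>s\<in>S. U (path act lam w s)) = (\<Sum>s\<in>S. U (path act lam w (act g s)))"
    using assms(2) Cons sum_act[of g "\<lambda>s. U (path act lam w s)"] by simp
  also have "(\<Sum>s\<in>S. inner_coboundary G (\<lambda>z. U (path act lam z s)) gs) =
      (\<Sum>s\<in>S. inner_coboundary fp_add U (path act lam gs s))"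
    by (intro sum.cong refl inner_coboundary_path assms(2))
  also have "(\<Sum>s\<in>S. U (path act lam w (act g s))) + \<dots> =
      (\<Sum>s\<in>S. evaluate U (bar_boundary fp_add (path act lam gs s)))"
    by (simp add: Cons evaluate_bar_boundary_Cons sum.distrib)
  also have "\<dots> = 0"
    using assms(1) by simp
  finally show ?thesis .
qed simp

end

text \<open>The chain homotopy (prism operator) between a cocycle \<open>lam\<close> and the cohomologous cocycle
  \<open>lam'\<close>, \<open>lam' g s = lam g s + h (act g s) - h s\<close>.\<close>

fun prism :: "('g \<Rightarrow> 's \<Rightarrow> 's) \<Rightarrow> ('g \<Rightarrow> 's \<Rightarrow> 'a) \<Rightarrow> ('g \<Rightarrow> 's \<Rightarrow> 'a) \<Rightarrow> ('s \<Rightarrow> 'a) \<Rightarrow>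
    ('a list \<Rightarrow> 'k::comm_ring_1) \<Rightarrow> 'g list \<Rightarrow> 's \<Rightarrow> 'k" where
  "prism act lam lam' h U [] s = U [h s]"
| "prism act lam lam' h U (g # w) s =
     U (h s # path act lam' (g # w) s) - prism act lam lam' h (\<lambda>r. U (lam g s # r)) w (act g s)"

lemma prism_diff:
  "prism act lam lam' h (\<lambda>r. U r - V r) gs s = prism act lam lam' h U gs s - prism act lam lam' h V gs s"
  by (induction gs arbitrary: U V s) auto

lemma prism_uminus:
  "prism act lam lam' h (\<lambda>r. - U r) gs s = - prism act lam lam' h U gs s"
  by (induction gs arbitrary: U s) auto

lemma prism_add:
  "prism act lam lam' h (\<lambda>r. U r + V r) gs s = prism act lam lam' h U gs s + prism act lam lam' h V gs s"
  by (induction gs arbitrary: U V s) auto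

context action_cocycle
begin

text \<open>The prism inserts \<open>h\<close> after i letters with sign (-1)^i, with values of
  \<open>lam\<close> before it and of \<open>lam'\<close> after it. Merging \<open>h\<close> to the
  right in one term and to the left in the next gives the same symbol, since h s + lam' g s = lam g
  s + h (act g s); these cancel. What survives is the last face with \<open>h\<close> at the very
  end, the path of \<open>lam\<close>.\<close>

lemma prism_inner_coboundary:
  assumes "\<And>g s. g \<in> carrier G \<Longrightarrow> s \<in> S \<Longrightarrow> lam' g s = lam g s + h (act g s) - h s"
    and "\<And>g h s. g \<in> carrier G \<Longrightarrow> h \<in> carrier G \<Longrightarrow> s \<in> S \<Longrightarrow>
      lam' (g \<otimes>\<^bsub>G\<^esub> h) s = lam' g s + lam' h (act g s)"
    and "set gs \<subseteq> carrier G" "s \<in> S"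
  shows "prism act lam lam' h (inner_coboundary fp_add U) gs s
    + inner_coboundary G (\<lambda>z. prism act lam lam' h U z s) gs = - U (path act lam gs s)"
  using assms(3,4)
proof (induction gs arbitrary: U s)
  case (Cons g w)
  let ?a = "lam g s" and ?a' = "lam' g s" and ?s = "act g s" and ?p = "path act lam' w (act g s)"
  let ?Q = "prism act lam lam' h" and ?D = "inner_coboundary fp_add :: _ \<Rightarrow> 'p mod_ring list \<Rightarrow> _"
  let ?DG = "inner_coboundary G"
  have g: "g \<in> carrier G" "s \<in> S" "?s \<in> S" "set w \<subseteq> carrier G"
    using Cons act_closed by auto
  have sum: "h s + ?a' = ?a + h ?s"
    using assms(1)[OF g(1,2)] by simp
  have IH: "?Q (?D (\<lambda>r. U (?a # r))) w ?s + ?DG (\<lambda>z. ?Q (\<lambda>r. U (?a # r)) z ?s) w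
      = - U (path act lam (g # w) s)"
    using Cons.IH[of ?s "\<lambda>r. U (?a # r)"] g by simp
  \<comment> \<open>The terms that merge the first two values of \<open>lam\<close>; they occur in
    both differentials with opposite signs.\<close>
  define E where "E = (case w of [] \<Rightarrow> 0 | g2 # w2 \<Rightarrow>
    ?Q (\<lambda>r. U ((?a + lam g2 ?s) # r)) w2 (act g2 ?s))"
  have merge: "?Q (merge_head fp_add U ?a) w ?s = U ((?a + h ?s) # ?p) - E"
    by (cases w) (auto simp: merge_head_def E_def)
  have "?Q (\<lambda>r. ?D U (?a # r)) w ?s =
      - ?Q (merge_head fp_add U ?a) w ?s - ?Q (?D (\<lambda>r. U (?a # r))) w ?s"
    by (simp only: inner_coboundary_Cons[of _ U] prism_diff prism_uminus)
  then have 1: "?Q (?D U) (g # w) s = ?D U (h s # ?a' # ?p) + U ((?a + h ?s) # ?p) - E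
      + ?Q (?D (\<lambda>r. U (?a # r))) w ?s"
    using merge by simp
  have 2: "?D U (h s # ?a' # ?p) = - U ((?a + h ?s) # ?p) - ?D (\<lambda>r. U (h s # r)) (?a' # ?p)"
    by (simp add: sum)
  define X where "X = ?DG (\<lambda>z. U (h s # path act lam' z s)) (g # w)"
  have 3: "?D (\<lambda>r. U (h s # r)) (?a' # ?p) = X"
  proof -
    interpret tw: action_cocycle G S act lam'
      using finite_S bij_act act_mult assms(2) by unfold_locales blast+
    show ?thesis
      using tw.inner_coboundary_path[of s "g # w" "\<lambda>r. U (h s # r)"] Cons.prems by (simp add: X_def)
  qed
  have 4: "?DG (\<lambda>z. ?Q U z s) (g # w) = X + E + ?DG (\<lambda>z. ?Q (\<lambda>r. U (?a # r)) z ?s) w"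
  proof -
    have a: "?DG (\<lambda>z. ?Q U (g # z) s) w =
        ?DG (\<lambda>z. U (h s # path act lam' (g # z) s)) w - ?DG (\<lambda>z. ?Q (\<lambda>r. U (?a # r)) z ?s) w"
      by (simp add: inner_coboundary_fun_diff)
    have "merge_head G (\<lambda>z. ?Q U z s) g w = merge_head G (\<lambda>z. U (h s # path act lam' z s)) g w - E"
    proof (cases w)
      case (Cons g2 w2)
      then have "g2 \<in> carrier G"
        using g by simp
      then show ?thesis
        using Cons g by (simp add: merge_head_def E_def act_mult lam_mult)
    qed (simp add: merge_head_def E_def)
    with a show ?thesis
      unfolding X_def inner_coboundary_Cons by simp
  qed
  show ?case
    using IH unfolding 1 2 3 4 by (simp add: algebra_simps)
qed simp

text \<open>The two transfers differ by the coboundary of the summed prism \<open>?R\<close>, hence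
  agree on cycles. The zeroth face of the prism yields the path of \<open>lam'\<close>; the moved
  starting point is again absorbed by the sum over \<open>S\<close>.\<close>

lemma transfer_twist:
  fixes Z :: "'g list \<Rightarrow>\<^sub>0 'k::comm_ring_1"
  assumes lam': "\<And>g s. g \<in> carrier G \<Longrightarrow> s \<in> S \<Longrightarrow> lam' g s = lam g s + h (act g s) - h s"
    and U: "\<And>xs. evaluate U (bar_boundary fp_add xs) = 0"
    and closed: "\<And>g h. g \<in> carrier G \<Longrightarrow> h \<in> carrier G \<Longrightarrow> g \<otimes>\<^bsub>G\<^esub> h \<in> carrier G"
    and Z: "Z \<in> bar_cycles G"
  shows "evaluate (\<lambda>gs. \<Sum>s\<in>S. U (path act lam gs s)) Z = evaluate (\<lambda>gs. \<Sum>s\<in>S. U (path act lam' gs s)) Z"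
proof -
  let ?Q = "prism act lam lam' h"
  let ?R = "\<lambda>gs. \<Sum>s\<in>S. ?Q U gs s"
  have mult': "lam' (g \<otimes>\<^bsub>G\<^esub> g') s = lam' g s + lam' g' (act g s)"
    if "g \<in> carrier G" "g' \<in> carrier G" "s \<in> S" for g g' s
    using that by (simp add: lam' closed act_mult lam_mult act_closed)
  have key: "(\<Sum>s\<in>S. U (path act lam' gs s)) - (\<Sum>s\<in>S. U (path act lam gs s)) =
      evaluate ?R (bar_boundary G gs)" if "set gs \<subseteq> carrier G" for gs
  proof (cases gs)
    case (Cons g w)
    have "U (path act lam' gs s) - U (path act lam gs s) =
        ?Q U w (act g s) + inner_coboundary G (\<lambda>z. ?Q U z s) gs" if s: "s \<in> S" for s
    proof -
      \<comment> \<open>The cocycle condition for \<open>U\<close> with its zeroth face split off,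
        so that the prism operator can be applied to it termwise.\<close>
      have dU: "(if r = [] then 0 else U (tl r)) + inner_coboundary fp_add U r = 0" for r
        using U[of r] by (cases r) (auto simp: evaluate_bar_boundary_Cons)
      have "?Q (\<lambda>r. (if r = [] then 0 else U (tl r)) + inner_coboundary fp_add U r) gs s = 0"
        unfolding dU using prism_diff[of act lam lam' h "\<lambda>r. 0 :: 'k" "\<lambda>r. 0" gs s] by simp
      then have "?Q (\<lambda>r. if r = [] then 0 else U (tl r)) gs s
          + ?Q (inner_coboundary fp_add U) gs s = 0"
        by (simp only: prism_add)
      moreover have "?Q (\<lambda>r. if r = [] then 0 else U (tl r)) gs s = U (path act lam' gs s) - ?Q U w (act g s)"
        unfolding Cons by (simp del: path.simps)
      moreover have "?Q (inner_coboundary fp_add U) gs s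
          = - U (path act lam gs s) - inner_coboundary G (\<lambda>z. ?Q U z s) gs"
        using prism_inner_coboundary[OF lam' mult' \<open>set gs \<subseteq> carrier G\<close> s, of U]
        unfolding eq_diff_eq .
      ultimately show ?thesis
        by (simp add: algebra_simps)
    qed
    then have "(\<Sum>s\<in>S. U (path act lam' gs s)) - (\<Sum>s\<in>S. U (path act lam gs s)) =
        (\<Sum>s\<in>S. ?Q U w (act g s)) + (\<Sum>s\<in>S. inner_coboundary G (\<lambda>z. ?Q U z s) gs)"
      unfolding sum_subtractf[symmetric] sum.distrib[symmetric] by (intro sum.cong refl)
    also have "(\<Sum>s\<in>S. ?Q U w (act g s)) = ?R w"
      using sum_act[of g "\<lambda>s. ?Q U w s"] that Cons by simp
    finally show ?thesis
      unfolding evaluate_fun_sum by (simp add: Cons evaluate_bar_boundary_Cons sum.distrib)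
  qed simp
  have "evaluate (\<lambda>gs. \<Sum>s\<in>S. U (path act lam' gs s)) Z - evaluate (\<lambda>gs. \<Sum>s\<in>S. U (path act lam gs s)) Z
      = evaluate (\<lambda>gs. evaluate ?R (bar_boundary G gs)) Z"
    unfolding evaluate_fun_diff[symmetric]
    by (rule evaluate_cong) (use Z key in \<open>auto simp: bar_cycles_def bar_chains_iff\<close>)
  also have "\<dots> = evaluate ?R (lin_ext (bar_boundary G) Z)"
    by (simp only: evaluate_lin_ext)
  also have "\<dots> = 0"
    using Z by (simp add: bar_cycles_def)
  finally show ?thesis
    by simp
qed

end

section \<open>Explicit cocycles and cycles on the cyclic group\<close>

lemma UNIV_mod_ring: "(UNIV :: 'p::prime_card mod_ring set) = of_nat ` {..<CARD('p)}"
  using surj_of_nat_mod_ring by fastforce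

lemma sum_UNIV_shift: "(\<Sum>i\<in>UNIV. f (i + c)) = (\<Sum>i\<in>UNIV. f i)" for c :: "'p::prime_card mod_ring"
  by (rule sum.reindex_bij_witness[of _ "\<lambda>i. i - c" "\<lambda>i. i + c"]) auto

text \<open>The integral cocycle representing the extension of \<open>\<F>\<^sub>p\<close> by \<open>\<int>/p\<close> with total group \<open>\<int>/p\<^sup>2\<close>.\<close>

definition carry_int :: "'p::prime_card mod_ring \<Rightarrow> 'p mod_ring \<Rightarrow> int" where
  "carry_int a b = (to_int_mod_ring a + to_int_mod_ring b) div int CARD('p)"

definition carry :: "'p::prime_card mod_ring \<Rightarrow> 'p mod_ring \<Rightarrow> 'p mod_ring" where
  "carry a b = of_int (carry_int a b)"

lemma carry_int_mult:
  "int CARD('p) * carry_int a b = to_int_mod_ring a + to_int_mod_ring b - to_int_mod_ring (a + b)"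
  for a b :: "'p::prime_card mod_ring"
  unfolding carry_int_def to_int_mod_ring_add by (simp add: minus_mod_eq_mult_div)

text \<open>By \<open>carry_int_mult\<close>, p times the carry is the coboundary of the integer
  representative; the cocycle identity holds after multiplication by p, and p cancels over the
  integers.\<close>

lemma carry_int_cocycle:
  "carry_int b c + carry_int a (b + c) = carry_int (a + b) c + carry_int a b"
  for a b c :: "'p::prime_card mod_ring"
proof -
  have "int CARD('p) * (carry_int b c + carry_int a (b + c)) =
      int CARD('p) * (carry_int (a + b) c + carry_int a b)"
    unfolding distrib_left carry_int_mult by (simp add: add.assoc)
  then show ?thesis
    by simp
qed

lemma carry_cocycle: "carry b c - carry (a + b) c + carry a (b + c) - carry a b = 0"
  using arg_cong[OF carry_int_cocycle[of b c a], of "of_int :: int \<Rightarrow> 'a mod_ring"]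
  by (simp add: carry_def algebra_simps)

lemma carry_commute: "carry a b = carry b a"
  by (simp add: carry_def carry_int_def add.commute)

lemma to_int_mod_ring_bounds: "0 \<le> to_int_mod_ring a" "to_int_mod_ring a < int CARD('p)"
  for a :: "'p::prime_card mod_ring"
  using range_to_int_mod_ring[where ?'a = 'p] by (metis atLeastLessThan_iff rangeI)+

lemma carry_zero [simp]: "carry 0 a = 0" "carry a 0 = 0" for a :: "'p::prime_card mod_ring"
  using to_int_mod_ring_bounds[of a] by (simp_all add: carry_def carry_int_def)

text \<open>Over the integers, p times the sum telescopes: the representatives of
  \<open>c * i\<close> and of \<open>c * (i + 1)\<close> run through the same values, leaving p
  copies of the representative of \<open>c\<close>. This is the value of the carry cocycle on the
  image under multiplication by \<open>c\<close> of the cycle of all [i|1].\<close>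

lemma sum_carry: "(\<Sum>i\<in>UNIV. carry (c * i) c) = c" for c :: "'p::prime_card mod_ring"
proof -
  have "int CARD('p) * (\<Sum>i\<in>UNIV. carry_int (c * i) c) =
      (\<Sum>i\<in>UNIV. to_int_mod_ring (c * i)) + (\<Sum>i\<in>(UNIV :: 'p mod_ring set). to_int_mod_ring c)
        - (\<Sum>i\<in>UNIV. to_int_mod_ring (c * (i + 1)))"
    unfolding sum_distrib_left carry_int_mult
    by (simp add: sum.distrib sum_subtractf distrib_left)
  also have "\<dots> = int CARD('p) * to_int_mod_ring c"
    by (simp only: sum_UNIV_shift[of "\<lambda>i. to_int_mod_ring (c * i)" 1]) simp
  finally have "(\<Sum>i\<in>UNIV. carry_int (c * i) c) = to_int_mod_ring c"
    by simp
  then have "(\<Sum>i\<in>UNIV. carry (c * i) c) = of_int (to_int_mod_ring c)"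
    by (simp add: carry_def flip: of_int_sum)
  then show ?thesis
    by (simp add: of_int_of_int_mod_ring)
qed

text \<open>The k-th cup power of \<open>carry\<close>, a product over consecutive pairs; zero on
  lists of any length other than 2k.\<close>

fun carry_power :: "nat \<Rightarrow> 'p::prime_card mod_ring list \<Rightarrow> 'p mod_ring" where
  "carry_power 0 xs = (if xs = [] then 1 else 0)"
| "carry_power (Suc k) (a # b # w) = carry a b * carry_power k w"
| "carry_power (Suc k) [] = 0"
| "carry_power (Suc k) [a] = 0"

text \<open>The k-th cup power of the identity homomorphism of F_p, the degree-one class that
  generates the cohomology for p = 2.\<close>

fun letter_power :: "nat \<Rightarrow> 'p::prime_card mod_ring list \<Rightarrow> 'p mod_ring" where
  "letter_power 0 xs = (if xs = [] then 1 else 0)"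
| "letter_power (Suc k) (a # w) = a * letter_power k w"
| "letter_power (Suc k) [] = 0"

lemma carry_power_length: "length xs \<noteq> 2 * k \<Longrightarrow> carry_power k xs = 0"
  by (induction k xs rule: carry_power.induct) auto

lemma letter_power_length: "length xs \<noteq> k \<Longrightarrow> letter_power k xs = 0"
  by (induction k xs rule: letter_power.induct) auto

text \<open>Normalisation: symbols with a trivial letter are killed. This is what later disposes of
  identity matrices in a block sum.\<close>

lemma carry_power_zero: "0 \<in> set xs \<Longrightarrow> carry_power k xs = 0"
  by (induction k xs rule: carry_power.induct) auto

lemma letter_power_zero: "0 \<in> set xs \<Longrightarrow> letter_power k xs = 0"
  by (induction k xs rule: letter_power.induct) auto

lemma inner_coboundary_singleton_unit:
  "inner_coboundary G (\<lambda>xs. if xs = [] then c else 0) xs = (if length xs = 1 then - c else 0)"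
  for c :: "'k::comm_ring_1"
proof (induction xs rule: induct_list012)
  case (3 x y w)
  have "inner_coboundary G (\<lambda>xs. 0 :: 'k) (y # w) = 0"
    by (simp add: inner_coboundary_eq_sum)
  then show ?case by simp
qed auto

text \<open>The right-hand side is minus the zeroth face, so this is the cocycle condition in a form
  fit for induction: the faces inside the first three letters combine by
  \<open>carry_cocycle\<close>, the others by induction.\<close>

lemma carry_power_inner_coboundary:
  "inner_coboundary fp_add (carry_power k) xs = (if xs = [] then 0 else - carry_power k (tl xs))"
proof (induction k arbitrary: xs)
  case 0
  have e: "carry_power 0 = (\<lambda>xs. if xs = [] then 1 else 0 :: 'a mod_ring)"
    by auto
  show ?case
    by (cases xs) (auto simp: e inner_coboundary_singleton_unit)
next
  case (Suc k)
  show ?case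
  proof (cases "length xs \<ge> 3")
    case True
    then obtain a b c w where xs: "xs = a # b # c # w"
      by (metis One_nat_def Suc_le_length_iff numeral_3_eq_3)
    have "inner_coboundary fp_add (\<lambda>r. carry a b * carry_power k r) (c # w) =
        - carry a b * carry_power k w"
      by (simp add: inner_coboundary_scale Suc)
    then have "inner_coboundary fp_add (carry_power (Suc k)) xs =
        (- carry (a + b) c + carry a (b + c) - carry a b) * carry_power k w"
      by (simp add: xs algebra_simps)
    also have "- carry (a + b) c + carry a (b + c) - carry a b = - carry b c"
      using carry_cocycle[of b c a] by (simp add: algebra_simps)
    finally show ?thesis
      by (simp add: xs)
  next
    case False
    then consider "xs = []" | a where "xs = [a]" | a b where "xs = [a, b]"
      by (cases xs; cases "tl xs"; cases "tl (tl xs)") auto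
    then show ?thesis
      by cases auto
  qed
qed

lemma letter_power_inner_coboundary:
  "inner_coboundary fp_add (letter_power k) xs = (if xs = [] then 0 else - letter_power k (tl xs))"
proof (induction k arbitrary: xs)
  case 0
  have e: "letter_power 0 = (\<lambda>xs. if xs = [] then 1 else 0 :: 'a mod_ring)"
    by auto
  show ?case
    by (cases xs) (auto simp: e inner_coboundary_singleton_unit)
next
  case (Suc k)
  show ?case
  proof (cases "length xs \<ge> 2")
    case True
    then obtain a b w where xs: "xs = a # b # w"
      by (metis One_nat_def Suc_1 Suc_le_length_iff)
    have "inner_coboundary fp_add (\<lambda>r. a * letter_power k r) (b # w) = - a * letter_power k w"
      by (simp add: inner_coboundary_scale Suc)
    then show ?thesis
      by (simp add: xs algebra_simps)
  next
    case False
    then consider "xs = []" | a where "xs = [a]"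
      by (cases xs; cases "tl xs") auto
    then show ?thesis
      by cases auto
  qed
qed

lemma carry_power_cocycle: "evaluate (carry_power k) (bar_boundary fp_add xs) = 0"
  by (cases xs) (auto simp: evaluate_bar_boundary_Cons carry_power_inner_coboundary)

lemma letter_power_cocycle: "evaluate (letter_power k) (bar_boundary fp_add xs) = 0"
  by (cases xs) (auto simp: evaluate_bar_boundary_Cons letter_power_inner_coboundary)

text \<open>The mixed terms of the shuffle product cancel because the carry cocycle is symmetric.\<close>

lemma carry_power_shuffle:
  assumes "length xs = 2 * j" "length ys = 2 * k"
  shows "evaluate (carry_power (j + k)) (shuffle_sum xs ys) =
    of_nat ((j + k) choose j) * carry_power j xs * carry_power k ys"
  using assms
proof (induction "j + k" arbitrary: j k xs ys)
  case (Suc n)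
  show ?case
  proof (cases "j = 0 \<or> k = 0")
    case True
    with Suc.prems show ?thesis
      by (auto simp del: shuffle_sum.simps)
  next
    case False
    then obtain j' k' where jk: "j = Suc j'" "k = Suc k'"
      by (metis not0_implies_Suc)
    from Suc.prems jk obtain a b xs' where xs: "xs = a # b # xs'" "length xs' = 2 * j'"
      by (cases xs; cases "tl xs") auto
    from Suc.prems jk obtain c d ys' where ys: "ys = c # d # ys'" "length ys' = 2 * k'"
      by (cases ys; cases "tl ys") auto
    have n: "n = j' + k" "n = j + k'"
      using Suc.hyps(2) jk by auto
    have IH1: "evaluate (carry_power n) (shuffle_sum xs' ys) =
        of_nat (n choose j') * carry_power j' xs' * carry_power k ys"
      using Suc.hyps(1)[OF n(1), of xs' ys] xs Suc.prems n by simp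
    have IH2: "evaluate (carry_power n) (shuffle_sum xs ys') =
        of_nat (n choose j) * carry_power j xs * carry_power k' ys'"
      using Suc.hyps(1)[OF n(2), of xs ys'] ys Suc.prems n by simp
    let ?c = "evaluate (carry_power n) (shuffle_sum (b # xs') (d # ys'))"
    have "evaluate (carry_power (Suc n)) (shuffle_sum xs ys) =
        carry a b * evaluate (carry_power n) (shuffle_sum xs' ys) - carry a c * ?c
        + (carry c a * ?c + carry c d * evaluate (carry_power n) (shuffle_sum xs ys'))"
      using xs ys by (simp add: evaluate_shuffle_Cons_Cons evaluate_fun_scale algebra_simps del: shuffle_sum.simps)
    also have "\<dots> = of_nat ((n choose j') + (n choose j)) * carry_power j xs * carry_power k ys"
      unfolding IH1 IH2 by (simp add: carry_commute[of a c] xs ys jk algebra_simps)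
    also have "(n choose j') + (n choose j) = (j + k) choose j"
      using jk n by (simp add: add.commute)
    finally show ?thesis
      using Suc.hyps(2) by simp
  qed
qed auto

text \<open>The first letter of a shuffle comes from \<open>xs\<close> or from \<open>ys\<close>, so
  the count of shuffles obeys Pascal's rule; in characteristic 2 the signs disappear.\<close>

lemma letter_power_shuffle:
  fixes xs ys :: "'p::prime_card mod_ring list"
  assumes "CARD('p) = 2" "length xs = j" "length ys = k"
  shows "evaluate (letter_power (j + k)) (shuffle_sum xs ys) =
    of_nat ((j + k) choose j) * letter_power j xs * letter_power k ys"
proof -
  have "(2 :: 'p mod_ring) = 0"
    using assms(1) of_nat_card_eq_0[where ?'a = 'p] by simp
  then have m1: "(- 1 :: 'p mod_ring) = 1"
    by (metis add_neg_numeral_special(7) one_add_one add.right_inverse minus_unique)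
  show ?thesis
    using assms(2,3)
  proof (induction "j + k" arbitrary: j k xs ys)
    case (Suc n)
    show ?case
    proof (cases "j = 0 \<or> k = 0")
      case True
      with Suc.prems show ?thesis
        by (auto simp del: shuffle_sum.simps)
    next
      case False
      then obtain j' k' where jk: "j = Suc j'" "k = Suc k'"
        by (metis not0_implies_Suc)
      from Suc.prems jk obtain a xs' where xs: "xs = a # xs'" "length xs' = j'"
        by (cases xs) auto
      from Suc.prems jk obtain c ys' where ys: "ys = c # ys'" "length ys' = k'"
        by (cases ys) auto
      have n: "n = j' + k" "n = j + k'"
        using Suc.hyps(2) jk by auto
      have IH1: "evaluate (letter_power n) (shuffle_sum xs' ys) =
          of_nat (n choose j') * letter_power j' xs' * letter_power k ys"
        using Suc.hyps(1)[OF n(1), of xs' ys] xs Suc.prems n by simp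
      have IH2: "evaluate (letter_power n) (shuffle_sum xs ys') =
          of_nat (n choose j) * letter_power j xs * letter_power k' ys'"
        using Suc.hyps(1)[OF n(2), of xs ys'] ys Suc.prems n by simp
      have "evaluate (letter_power (Suc n)) (shuffle_sum xs ys) =
          a * evaluate (letter_power n) (shuffle_sum xs' ys)
          + c * evaluate (letter_power n) (shuffle_sum xs ys')"
        using xs ys by (simp add: evaluate_shuffle_Cons_Cons evaluate_fun_scale m1 del: shuffle_sum.simps)
      also have "\<dots> = of_nat ((n choose j') + (n choose j)) * letter_power j xs * letter_power k ys"
        unfolding IH1 IH2 by (simp add: xs ys jk algebra_simps)
      also have "(n choose j') + (n choose j) = (j + k) choose j"
        using jk n by (simp add: add.commute)
      finally show ?thesis
        using Suc.hyps(2) by simp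
    qed
  qed auto
qed

text \<open>In degree \<open>2k\<close> the sum of all \<open>[i\<^sub>1|1|\<dots>|i\<^sub>k|1]\<close>; in odd degrees, relevant only for \<open>p = 2\<close>,
  the sum of all \<open>[1|i\<^sub>1|1|\<dots>|i\<^sub>k|1]\<close>.\<close>

fun even_cycle :: "nat \<Rightarrow> 'p::prime_card mod_ring list \<Rightarrow>\<^sub>0 'p mod_ring" where
  "even_cycle 0 = Poly_Mapping.single [] 1"
| "even_cycle (Suc k) = (\<Sum>i\<in>UNIV. pushforward (\<lambda>w. i # 1 # w) (even_cycle k))"

definition mod2_cycle :: "nat \<Rightarrow> 'p::prime_card mod_ring list \<Rightarrow>\<^sub>0 'p mod_ring" where
  "mod2_cycle k = (if even k then even_cycle (k div 2) else pushforward (Cons 1) (even_cycle (k div 2)))"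

lemma evaluate_even_cycle_Suc:
  "evaluate u (even_cycle (Suc k)) = (\<Sum>i\<in>UNIV. evaluate (\<lambda>w. u (i # 1 # w)) (even_cycle k))"
  by (simp add: evaluate_sum evaluate_pushforward)

text \<open>Adding 1 to the first letter \<open>i\<close> only permutes the summands of the cycle;
  for the empty symbol the merge just drops the letter.\<close>

lemma even_cycle_merge: "evaluate (merge_head fp_add u 1) (even_cycle k) = evaluate u (even_cycle k)"
proof (cases k)
  case (Suc k')
  have "evaluate (merge_head fp_add u 1) (even_cycle k) =
      (\<Sum>i\<in>UNIV. evaluate (\<lambda>w. u ((i + 1) # 1 # w)) (even_cycle k'))"
    unfolding Suc evaluate_even_cycle_Suc by (simp add: merge_head_def add.commute)
  also have "\<dots> = evaluate u (even_cycle k)"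
    unfolding Suc evaluate_even_cycle_Suc
    by (rule sum_UNIV_shift[of "\<lambda>i. evaluate (\<lambda>w. u (i # 1 # w)) (even_cycle k')"])
  finally show ?thesis .
qed (simp add: merge_head_def)

text \<open>In [i|1|w] the merge of i with 1 and the merge of 1 into w have opposite signs, and both
  become the sum of all [i|w]: the first by shifting i, the second by
  \<open>even_cycle_merge\<close>. Faces further to the right vanish by induction.\<close>

lemma even_cycle_inner_coboundary: "evaluate (inner_coboundary fp_add u) (even_cycle k) = 0"
proof (induction k arbitrary: u)
  case (Suc k)
  have "evaluate (inner_coboundary fp_add u) (even_cycle (Suc k)) =
      (\<Sum>i\<in>UNIV. - evaluate (\<lambda>w. u ((i + 1) # w)) (even_cycle k)
        + evaluate (merge_head fp_add (\<lambda>w. u (i # w)) 1) (even_cycle k)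
        + evaluate (inner_coboundary fp_add (\<lambda>w. u (i # 1 # w))) (even_cycle k))"
    unfolding evaluate_even_cycle_Suc
    by (intro sum.cong refl)
       (simp add: inner_coboundary_Cons[of _ _ 1] evaluate_fun_add evaluate_fun_diff evaluate_fun_uminus)
  also have "\<dots> = - (\<Sum>i\<in>UNIV. evaluate (\<lambda>w. u ((i + 1) # w)) (even_cycle k))
      + (\<Sum>i\<in>UNIV. evaluate (\<lambda>w. u (i # w)) (even_cycle k))"
    unfolding Suc even_cycle_merge by (simp only: sum.distrib sum_negf) simp
  also have "\<dots> = 0"
    using sum_UNIV_shift[of "\<lambda>i. evaluate (\<lambda>w. u (i # w)) (even_cycle k)" 1] by simp
  finally show ?case .
qed simp

lemma bar_cycles_UNIV:
  assumes "carrier G = UNIV" "\<And>u. evaluate (\<lambda>z. evaluate u (bar_boundary G z)) c = 0"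
  shows "c \<in> bar_cycles G"
proof -
  have "lin_ext (bar_boundary G) c = 0"
    by (rule chain_eqI) (simp add: evaluate_lin_ext assms)
  then show ?thesis
    unfolding bar_cycles_def mem_Collect_eq bar_chains_iff by (simp add: assms(1))
qed

text \<open>The zeroth face of [i|1|w] is [1|w] for every i, so it occurs p times and contributes
  zero.\<close>

lemma even_cycle_is_cycle: "even_cycle k \<in> bar_cycles (fp_add :: 'p::prime_card mod_ring monoid)"
proof (rule bar_cycles_UNIV)
  fix u :: "'p mod_ring list \<Rightarrow> 'p mod_ring"
  show "evaluate (\<lambda>z. evaluate u (bar_boundary fp_add z)) (even_cycle k) = 0"
  proof (cases k)
    case (Suc k')
    have "evaluate (\<lambda>z. evaluate u (bar_boundary fp_add z)) (even_cycle k) =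
        (\<Sum>i\<in>(UNIV :: 'p mod_ring set). evaluate (\<lambda>w. u (1 # w)) (even_cycle k'))
        + evaluate (inner_coboundary fp_add u) (even_cycle k)"
      unfolding Suc evaluate_even_cycle_Suc
      by (simp add: evaluate_bar_boundary_Cons evaluate_fun_add sum.distrib del: inner_coboundary.simps)
    also have "\<dots> = 0"
      unfolding even_cycle_inner_coboundary by simp
    finally show ?thesis .
  qed simp
qed simp

text \<open>In odd length the zeroth face of [1|w] and the merge of 1 into w cancel by
  \<open>even_cycle_merge\<close>.\<close>

lemma mod2_cycle_is_cycle: "mod2_cycle k \<in> bar_cycles (fp_add :: 'p::prime_card mod_ring monoid)"
proof (cases "even k")
  case False
  have "evaluate (\<lambda>w. evaluate u (bar_boundary fp_add (1 # w))) (even_cycle m) = 0"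
    for u :: "'p mod_ring list \<Rightarrow> 'p mod_ring" and m
    by (simp only: evaluate_bar_boundary_Cons inner_coboundary_Cons evaluate_fun_add evaluate_fun_diff
        evaluate_fun_uminus even_cycle_merge even_cycle_inner_coboundary) simp
  with False show ?thesis
    by (intro bar_cycles_UNIV) (simp_all add: mod2_cycle_def evaluate_pushforward)
qed (simp add: mod2_cycle_def even_cycle_is_cycle)

lemma keys_even_cycle: "w \<in> Poly_Mapping.keys (even_cycle k) \<Longrightarrow> length w = 2 * k"
proof (induction k arbitrary: w)
  case (Suc k)
  then obtain i where "w \<in> Poly_Mapping.keys (pushforward (\<lambda>w. i # 1 # w) (even_cycle k))"
    using subsetD[OF keys_sum_subset] by fastforce
  then obtain v where "v \<in> Poly_Mapping.keys (even_cycle k)" "w = i # 1 # v"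
    using subsetD[OF keys_pushforward] by fastforce
  with Suc.IH show ?case by auto
qed auto

lemma keys_mod2_cycle:
  assumes "w \<in> Poly_Mapping.keys (mod2_cycle k :: _ \<Rightarrow>\<^sub>0 'p::prime_card mod_ring)"
  shows "length w = k"
proof (cases "even k")
  case True
  with assms show ?thesis
    using keys_even_cycle[of w "k div 2"] by (simp add: mod2_cycle_def)
next
  case False
  with assms obtain v where "v \<in> Poly_Mapping.keys (even_cycle (k div 2) :: _ \<Rightarrow>\<^sub>0 'p mod_ring)" "w = 1 # v"
    unfolding mod2_cycle_def using subsetD[OF keys_pushforward] by fastforce
  with False keys_even_cycle[of v] show ?thesis
    by fastforce
qed

text \<open>One application of \<open>sum_carry\<close> for each pair. The factor \<open>c\<close>
  is there because the cycle will be pulled through a linear form whose restriction to one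
  coordinate is multiplication by \<open>c\<close>.\<close>

lemma carry_power_even_cycle:
  "evaluate (\<lambda>w. carry_power k (map ((*) c) w)) (even_cycle k) = c ^ k"
proof (induction k)
  case (Suc k)
  have "evaluate (\<lambda>w. carry_power (Suc k) (map ((*) c) w)) (even_cycle (Suc k)) =
      (\<Sum>i\<in>UNIV. carry (c * i) c * c ^ k)"
    unfolding evaluate_even_cycle_Suc by (simp add: evaluate_fun_scale Suc del: even_cycle.simps)
  also have "\<dots> = c ^ Suc k"
    by (simp add: sum_carry flip: sum_distrib_right)
  finally show ?case .
qed simp

lemma UNIV_mod2:
  assumes "CARD('p) = 2"
  shows "(UNIV :: 'p::prime_card mod_ring set) = {0, 1}"
  unfolding UNIV_mod_ring assms by (auto simp: lessThan_Suc numeral_2_eq_2)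

lemma letter_power_even_cycle:
  assumes "CARD('p) = 2"
  shows "evaluate (\<lambda>w. letter_power (2 * k) (map ((*) c) w)) (even_cycle k) = (c :: 'p::prime_card mod_ring) ^ (2 * k)"
proof (induction k)
  case (Suc k)
  have "evaluate (\<lambda>w. letter_power (2 * Suc k) (map ((*) c) w)) (even_cycle (Suc k)) =
      (\<Sum>i\<in>UNIV. c * i * (c * c ^ (2 * k)))"
    unfolding evaluate_even_cycle_Suc
    by (simp add: evaluate_fun_scale Suc mult.assoc del: even_cycle.simps)
  also have "\<dots> = c ^ (2 * Suc k)"
    by (simp add: UNIV_mod2[OF assms])
  finally show ?case .
qed simp

lemma letter_power_mod2_cycle:
  assumes "CARD('p) = 2"
  shows "evaluate (\<lambda>w. letter_power k (map ((*) c) w)) (mod2_cycle k) = (c :: 'p::prime_card mod_ring) ^ k"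
proof (cases "even k")
  case True
  then obtain m where "k = 2 * m" by (elim evenE)
  then show ?thesis
    using letter_power_even_cycle[OF assms, of m c] by (simp add: mod2_cycle_def)
next
  case False
  then obtain m where "k = Suc (2 * m)" by (elim oddE) simp
  then show ?thesis
    using letter_power_even_cycle[OF assms, of m c]
    by (simp add: mod2_cycle_def evaluate_pushforward evaluate_fun_scale)
qed

section \<open>The cohomology algebra and dual classes\<close>

definition cochain_class :: "('g, 'm) monoid_scheme \<Rightarrow> ('g list \<Rightarrow> 'k) \<Rightarrow> ('g list \<Rightarrow> 'k::comm_ring_1) set" where
  "cochain_class G u = {\<lambda>xs. i xs + u xs | i. i \<in> coboundaries G}"

lemma cochain_classI: "i \<in> coboundaries G \<Longrightarrow> w = (\<lambda>xs. i xs + u xs) \<Longrightarrow> w \<in> cochain_class G u"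
  by (auto simp: cochain_class_def)

lemma coboundariesI: "u \<in> cochains G \<Longrightarrow> w = coboundary G u \<Longrightarrow> w \<in> coboundaries G"
  by (simp add: coboundaries_def)

lemma coboundaries_zero: "(\<lambda>xs. 0) \<in> coboundaries G"
  by (rule coboundariesI[of "\<lambda>xs. 0"]) (auto simp: coboundary_def cochains_def)

lemma cochains_add:
  assumes "u \<in> cochains G" "v \<in> cochains G"
  shows "(\<lambda>xs. u xs + v xs) \<in> cochains G"
proof -
  obtain M N where "\<And>xs. length xs > M \<Longrightarrow> u xs = 0" "\<And>xs. length xs > N \<Longrightarrow> v xs = 0"
    using assms by (auto simp: cochains_def)
  then have "\<forall>xs. length xs > max M N \<longrightarrow> u xs + v xs = 0"
    by simp
  then show ?thesis
    using assms unfolding cochains_def mem_Collect_eq by (metis add.right_neutral)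
qed

lemma cochains_scale: "u \<in> cochains G \<Longrightarrow> (\<lambda>xs. c * u xs) \<in> cochains G"
  unfolding cochains_def mem_Collect_eq by (metis mult_zero_right)

lemma coboundary_add: "coboundary G (\<lambda>xs. u xs + v xs) = (\<lambda>xs. coboundary G u xs + coboundary G v xs)"
  by (auto simp: coboundary_def evaluate_fun_add)

lemma coboundary_scale: "coboundary G (\<lambda>xs. c * u xs) = (\<lambda>xs. c * coboundary G u xs)"
  by (auto simp: coboundary_def evaluate_fun_scale)

lemma coboundaries_add:
  assumes "u \<in> coboundaries G" "v \<in> coboundaries G"
  shows "(\<lambda>xs. u xs + v xs) \<in> coboundaries G"
proof -
  obtain a b where "a \<in> cochains G" "b \<in> cochains G" "u = coboundary G a" "v = coboundary G b"
    using assms by (auto simp: coboundaries_def)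
  then show ?thesis
    by (intro coboundariesI[OF cochains_add]) (simp_all add: coboundary_add)
qed

lemma coboundaries_scale:
  assumes "u \<in> coboundaries G"
  shows "(\<lambda>xs. c * u xs) \<in> coboundaries G"
proof -
  obtain a where "a \<in> cochains G" "u = coboundary G a"
    using assms by (auto simp: coboundaries_def)
  then show ?thesis
    by (intro coboundariesI[OF cochains_scale]) (simp_all add: coboundary_scale)
qed

lemma cochain_class_self: "u \<in> cochain_class G u"
  unfolding cochain_class_def using coboundaries_zero[of G] by force

lemma cochain_class_eq:
  assumes "v \<in> cochain_class G u"
  shows "cochain_class G u = cochain_class G v"
proof -
  obtain i where i: "i \<in> coboundaries G" "v = (\<lambda>xs. i xs + u xs)"
    using assms by (auto simp: cochain_class_def)
  have i': "(\<lambda>xs. - 1 * i xs) \<in> coboundaries G"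
    by (rule coboundaries_scale) fact
  show ?thesis
  proof (intro equalityI subsetI)
    fix w assume "w \<in> cochain_class G u"
    then obtain j where j: "j \<in> coboundaries G" "w = (\<lambda>xs. j xs + u xs)"
      by (auto simp: cochain_class_def)
    then have "w = (\<lambda>xs. (j xs + - 1 * i xs) + v xs)"
      using i by auto
    with coboundaries_add[OF j(1) i'] show "w \<in> cochain_class G v"
      by (rule cochain_classI)
  next
    fix w assume "w \<in> cochain_class G v"
    then obtain j where j: "j \<in> coboundaries G" "w = (\<lambda>xs. j xs + v xs)"
      by (auto simp: cochain_class_def)
    then have "w = (\<lambda>xs. (j xs + i xs) + u xs)"
      using i by auto
    with coboundaries_add[OF j(1) i(1)] show "w \<in> cochain_class G u"
      by (rule cochain_classI)
  qed
qed

lemma cocycle_ring_coset: "coboundaries G +>\<^bsub>cocycle_ring G\<^esub> u = cochain_class G u"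
  by (auto simp: a_r_coset_def r_coset_def cocycle_ring_def cochain_class_def)

definition cocycles :: "('g, 'm) monoid_scheme \<Rightarrow> ('g list \<Rightarrow> 'k::comm_ring_1) set" where
  "cocycles G = {u \<in> cochains G. coboundary G u = (\<lambda>xs. 0)}"

lemma cocycles_add: "u \<in> cocycles G \<Longrightarrow> v \<in> cocycles G \<Longrightarrow> (\<lambda>xs. u xs + v xs) \<in> cocycles G"
  by (simp add: cocycles_def cochains_add coboundary_add)

lemma cocycles_scale: "u \<in> cocycles G \<Longrightarrow> (\<lambda>xs. c * u xs) \<in> cocycles G"
  by (simp add: cocycles_def cochains_scale coboundary_scale)

lemma cocycles_zero: "(\<lambda>xs. 0) \<in> cocycles G"
  by (auto simp: cocycles_def cochains_def coboundary_def)

lemma cohomology_carrier: "carrier (cohomology_algebra G) = cochain_class G ` cocycles G"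
proof -
  have "carrier (cohomology_algebra G) =
      (\<Union>u\<in>carrier (cocycle_ring G). {coboundaries G +>\<^bsub>cocycle_ring G\<^esub> u})"
    by (simp add: cohomology_algebra_def FactRing_def A_RCOSETS_def RCOSETS_def a_r_coset_def ring.defs)
  then show ?thesis
    unfolding cocycle_ring_coset by (auto simp: cocycle_ring_def cocycles_def)
qed

lemma cohomology_add:
  "cochain_class G u \<oplus>\<^bsub>cohomology_algebra G\<^esub> cochain_class G v = cochain_class G (\<lambda>xs. u xs + v xs)"
proof -
  have "cochain_class G u \<oplus>\<^bsub>cohomology_algebra G\<^esub> cochain_class G v =
      {\<lambda>xs. a xs + b xs | a b. a \<in> cochain_class G u \<and> b \<in> cochain_class G v}"
    by (auto simp: cohomology_algebra_def FactRing_def set_add_def set_mult_def ring.defs cocycle_ring_def)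
  also have "\<dots> = cochain_class G (\<lambda>xs. u xs + v xs)"
  proof (intro equalityI subsetI)
    fix w assume "w \<in> {\<lambda>xs. a xs + b xs | a b. a \<in> cochain_class G u \<and> b \<in> cochain_class G v}"
    then obtain i j where ij: "i \<in> coboundaries G" "j \<in> coboundaries G"
        "w = (\<lambda>xs. (i xs + u xs) + (j xs + v xs))"
      by (auto simp: cochain_class_def)
    then have "w = (\<lambda>xs. (i xs + j xs) + (u xs + v xs))"
      by auto
    with coboundaries_add[OF ij(1,2)] show "w \<in> cochain_class G (\<lambda>xs. u xs + v xs)"
      by (rule cochain_classI)
  next
    fix w assume "w \<in> cochain_class G (\<lambda>xs. u xs + v xs)"
    then obtain i where i: "i \<in> coboundaries G" "w = (\<lambda>xs. i xs + (u xs + v xs))"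
      by (auto simp: cochain_class_def)
    then have "w = (\<lambda>xs. (i xs + u xs) + v xs)"
      by auto
    moreover have "(\<lambda>xs. i xs + u xs) \<in> cochain_class G u"
      using i by (auto simp: cochain_class_def)
    ultimately show "w \<in> {\<lambda>xs. a xs + b xs | a b. a \<in> cochain_class G u \<and> b \<in> cochain_class G v}"
      using cochain_class_self[of v G]
      by (intro CollectI exI[of _ "\<lambda>xs. i xs + u xs"] exI[of _ v]) simp
  qed
  finally show ?thesis .
qed

lemma cohomology_zero: "\<zero>\<^bsub>cohomology_algebra G\<^esub> = cochain_class G (\<lambda>xs. 0)"
  by (simp add: cohomology_algebra_def FactRing_def ring.defs cochain_class_def)

lemma cohomology_smult: "c \<odot>\<^bsub>cohomology_algebra G\<^esub> cochain_class G u = cochain_class G (\<lambda>xs. c * u xs)"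
proof -
  have "cochain_class G (\<lambda>xs. c * v xs) = cochain_class G (\<lambda>xs. c * u xs)"
    if v: "v \<in> cochain_class G u" for v
  proof -
    obtain i where i: "i \<in> coboundaries G" "v = (\<lambda>xs. i xs + u xs)"
      using v by (auto simp: cochain_class_def)
    then have "(\<lambda>xs. c * v xs) = (\<lambda>xs. c * i xs + c * u xs)"
      by (auto simp: algebra_simps)
    moreover have "(\<lambda>xs. c * i xs) \<in> coboundaries G"
      by (rule coboundaries_scale) fact
    ultimately show ?thesis
      by (intro cochain_class_eq[symmetric]) (auto simp: cochain_class_def)
  qed
  moreover have "c \<odot>\<^bsub>cohomology_algebra G\<^esub> cochain_class G u =
      (\<Union>v\<in>cochain_class G u. cochain_class G (\<lambda>xs. c * v xs))"
    by (simp add: cohomology_algebra_def ring.defs module.defs cocycle_ring_coset)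
  ultimately show ?thesis
    using cochain_class_self[of u G] by blast
qed

lemma cohomology_vectorspace:
  "vectorspace (class_ring :: 'k::field ring) (cohomology_algebra G :: ('k, ('g list \<Rightarrow> 'k) set) module)"
proof -
  let ?H = "cohomology_algebra G :: ('k, ('g list \<Rightarrow> 'k) set) module"
  have ag: "abelian_group ?H"
  proof (rule abelian_groupI)
    fix X assume "X \<in> carrier ?H"
    then obtain u where u: "u \<in> cocycles G" "X = cochain_class G u"
      by (auto simp: cohomology_carrier)
    have "cochain_class G (\<lambda>xs. - 1 * u xs) \<oplus>\<^bsub>?H\<^esub> X = \<zero>\<^bsub>?H\<^esub>"
      by (simp add: u cohomology_add cohomology_zero)
    moreover have "cochain_class G (\<lambda>xs. - 1 * u xs) \<in> carrier ?H"
      unfolding cohomology_carrier by (intro imageI cocycles_scale u)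
    ultimately show "\<exists>Y\<in>carrier ?H. Y \<oplus>\<^bsub>?H\<^esub> X = \<zero>\<^bsub>?H\<^esub>"
      by blast
  qed (auto simp: cohomology_carrier cohomology_add cohomology_zero add_ac
      intro!: imageI cocycles_add cocycles_zero)
  have "module (class_ring :: 'k ring) ?H"
    by (rule moduleI[OF fieldE(1)[OF class_field.field_axioms] ag])
       (auto simp: cohomology_carrier cohomology_add cohomology_smult algebra_simps
        intro!: imageI cocycles_scale)
  then show ?thesis
    by (intro vectorspace.intro class_field.field_axioms)
qed

section \<open>The pairing of cohomology with homology\<close>

lemma evaluate_coboundary:
  assumes "c \<in> chains_on (lists (carrier G))"
  shows "evaluate (coboundary G u) c = evaluate u (lin_ext (bar_boundary G) c)"
  unfolding evaluate_lin_ext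
  by (rule evaluate_cong) (use assms in \<open>auto simp: coboundary_def chains_on_def\<close>)

lemma evaluate_coboundaries:
  assumes "i \<in> coboundaries G" "c \<in> bar_cycles G"
  shows "evaluate i c = 0"
  using assms evaluate_coboundary by (fastforce simp: coboundaries_def bar_cycles_def)

lemma evaluate_cocycle_boundaries:
  assumes "u \<in> cocycles G" "b \<in> bar_boundaries G"
  shows "evaluate u b = 0"
proof -
  obtain e where e: "e \<in> chains_on (lists (carrier G))" "b = lin_ext (bar_boundary G) e"
    using assms(2) by (auto simp: bar_boundaries_def)
  have "evaluate u b = evaluate (coboundary G u) e"
    by (simp add: e evaluate_coboundary)
  also have "\<dots> = 0"
    using assms(1) by (simp add: cocycles_def)
  finally show ?thesis .
qed

text \<open>The values over all representatives form a singleton: coboundaries vanish on cycles,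
  cocycles vanish on boundaries, and coboundaries vanish on boundaries because the differential
  squares to zero.\<close>

lemma kronecker_classes:
  assumes "monoid G" "u \<in> cocycles G" "c \<in> bar_cycles G"
  shows "kronecker (cochain_class G u) (coset_of (bar_boundaries G) c) = evaluate u c"
proof -
  have "evaluate v a = evaluate u c"
    if va: "v \<in> cochain_class G u" "a \<in> coset_of (bar_boundaries G) c" for v a
  proof -
    obtain i b where ib: "i \<in> coboundaries G" "v = (\<lambda>xs. i xs + u xs)" "b \<in> bar_boundaries G" "a = b + c"
      using va by (auto simp: cochain_class_def coset_of_def)
    obtain e where e: "e \<in> chains_on (lists (carrier G))" "b = lin_ext (bar_boundary G) e"
      using ib by (auto simp: bar_boundaries_def)
    obtain w where w: "i = coboundary G w"
      using ib by (auto simp: coboundaries_def)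
    have "evaluate i b = evaluate (\<lambda>xs. evaluate i (bar_boundary G xs)) e"
      by (simp add: e evaluate_lin_ext)
    also have "\<dots> = 0"
    proof (rule evaluate_eq_0)
      fix xs assume "xs \<in> Poly_Mapping.keys e"
      then have xs: "set xs \<subseteq> carrier G"
        using e by (auto simp: bar_chains_iff)
      have "evaluate i (bar_boundary G xs) = evaluate (\<lambda>z. evaluate w (bar_boundary G z)) (bar_boundary G xs)"
        unfolding w
      proof (rule evaluate_cong)
        fix z assume "z \<in> Poly_Mapping.keys (bar_boundary G xs :: _ \<Rightarrow>\<^sub>0 'c)"
        then have "set z \<subseteq> carrier G"
          by (rule keys_bar_boundary_carrier[OF assms(1) xs])
        then show "coboundary G w z = evaluate w (bar_boundary G z)"
          by (auto simp: coboundary_def in_lists_conv_set)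
      qed
      also have "\<dots> = 0"
        by (rule bar_boundary_boundary[OF assms(1) xs])
      finally show "evaluate i (bar_boundary G xs) = 0" .
    qed
    finally have "evaluate i b = 0" .
    then show ?thesis
      using ib evaluate_coboundaries[OF ib(1) assms(3)] evaluate_cocycle_boundaries[OF assms(2) ib(3)]
      by (simp add: evaluate_add evaluate_fun_add)
  qed
  then have "{evaluate v a | v a. v \<in> cochain_class G u \<and> a \<in> coset_of (bar_boundaries G) c} = {evaluate u c}"
    using cochain_class_self[of u G] coset_of_self[OF bar_boundaries_zero, of c G] by blast
  then show ?thesis
    by (simp add: kronecker_def)
qed

lemma homology_group_carrier:
  "carrier (homology_group G) = coset_of (bar_boundaries G) ` bar_cycles G"
  by (auto simp: homology_group_def FactGroup_def RCOSETS_def r_coset_def coset_of_def)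

text \<open>A basis of the subspace \<open>B\<close> stays independent when \<open>c\<close> is
  added, so there is a linear map that is 1 at \<open>c\<close> and 0 on \<open>B\<close>; its
  values on single simplices give \<open>u\<close>.\<close>

lemma exists_linear_functional:
  fixes B :: "('a \<Rightarrow>\<^sub>0 'k::field) set"
  assumes "0 \<in> B" "\<And>x y. x \<in> B \<Longrightarrow> y \<in> B \<Longrightarrow> x + y \<in> B"
    "\<And>a x. x \<in> B \<Longrightarrow> Poly_Mapping.map ((*) a) x \<in> B" "c \<notin> B"
  shows "\<exists>u. (\<forall>b\<in>B. evaluate u b = 0) \<and> evaluate u c \<noteq> 0"
proof -
  let ?s = "\<lambda>a::'k. Poly_Mapping.map ((*) a) :: ('a \<Rightarrow>\<^sub>0 'k) \<Rightarrow> _"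
  interpret V: vector_space ?s
    by unfold_locales (auto intro!: poly_mapping_eqI simp: lookup_add algebra_simps)
  interpret K: vector_space "(*) :: 'k \<Rightarrow> 'k \<Rightarrow> 'k"
    by unfold_locales (auto simp: algebra_simps)
  interpret P: vector_space_pair ?s "(*) :: 'k \<Rightarrow> 'k \<Rightarrow> 'k" ..
  have sub: "V.subspace B"
    using assms by (auto simp: V.subspace_def)
  obtain Bs where Bs: "Bs \<subseteq> B" "V.independent Bs" "B \<subseteq> V.span Bs"
    using V.maximal_independent_subset by blast
  have span: "V.span Bs = B"
    using Bs V.span_minimal[OF Bs(1) sub] by auto
  have "V.independent (insert c Bs)"
    by (rule V.independent_insertI) (use Bs assms(4) span in auto)
  then obtain g where g: "Vector_Spaces.linear ?s (*) g" "\<forall>x\<in>insert c Bs. g x = (if x = c then 1 else 0)"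
    using P.linear_independent_extend[of "insert c Bs" "\<lambda>x. if x = c then 1 else 0"] by blast
  define u where "u x = g (Poly_Mapping.single x 1)" for x
  have gadd: "g (x + y) = g x + g y" and gscale: "g (?s a x) = a * g x" for x y a
    using g(1) by (auto simp: P.linear_add P.linear_scale)
  have g0: "g 0 = 0"
    using gscale[of 0 0] by simp
  have gsum: "g (sum f A) = (\<Sum>x\<in>A. g (f x))" for f and A :: "'a set"
    by (induction A rule: infinite_finite_induct) (auto simp: gadd g0)
  have ev: "evaluate u d = g d" for d
  proof -
    have "d = (\<Sum>x\<in>Poly_Mapping.keys d. ?s (Poly_Mapping.lookup d x) (Poly_Mapping.single x 1))"
      by (rule chain_eqI) (simp add: evaluate_sum evaluate_scale, simp add: evaluate_def)
    then have "g d = (\<Sum>x\<in>Poly_Mapping.keys d. Poly_Mapping.lookup d x * u x)"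
      by (metis (no_types, lifting) gsum gscale u_def sum.cong)
    then show ?thesis
      by (simp add: evaluate_def)
  qed
  have "c \<notin> Bs"
    using Bs(1) assms(4) by auto
  then have "g x = 0" if "x \<in> V.span Bs" for x
    using P.linear_eq_0_on_span[OF g(1) _ that] g(2) by fastforce
  then have "\<forall>b\<in>B. evaluate u b = 0"
    by (simp add: ev span)
  moreover have "evaluate u c \<noteq> 0"
    using g(2) by (simp add: ev)
  ultimately show ?thesis
    by blast
qed

text \<open>Universal coefficients over a field: a functional that kills all boundaries is a
  cocycle, so a cycle that is no boundary is detected by a cocycle.\<close>

lemma exists_detecting_cocycle:
  fixes c :: "'g list \<Rightarrow>\<^sub>0 'k::field"
  assumes "monoid G" "c \<in> bar_cycles G" "c \<notin> bar_boundaries G"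
  shows "\<exists>u\<in>cocycles G. evaluate u c \<noteq> 0"
proof -
  have "Poly_Mapping.map ((*) a) b \<in> bar_boundaries G" if "b \<in> bar_boundaries G" for a :: 'k and b
    using that unfolding bar_boundaries_def by (auto simp flip: lin_ext_scale intro!: chains_on_scale)
  then obtain u where u: "\<forall>b\<in>bar_boundaries G. evaluate u b = 0" "evaluate u c \<noteq> 0"
    using exists_linear_functional[of "bar_boundaries G" c] bar_boundaries_zero[of G]
      bar_boundaries_add[of _ G] assms(3) by blast
  define N where "N = Max (insert 0 (length ` Poly_Mapping.keys c))"
  \<comment> \<open>Cochains must be bounded in degree, so the functional is cut off above the
    largest length in \<open>c\<close>. The result is still a cocycle: symbols of length up to
    \<open>N + 1\<close> see only uncut values, longer ones only zeros.\<close>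
  define v where "v xs = (if xs \<in> lists (carrier G) \<and> length xs \<le> N then u xs else 0)" for xs
  have N: "length xs \<le> N" if "xs \<in> Poly_Mapping.keys c" for xs
    unfolding N_def using that by (intro Max_ge) auto
  have "evaluate v c = evaluate u c"
    by (rule evaluate_cong) (use N assms(2) in \<open>auto simp: v_def bar_cycles_def chains_on_def\<close>)
  moreover have "v \<in> cocycles G"
  proof -
    have "evaluate v (bar_boundary G xs) = 0" if xs: "xs \<in> lists (carrier G)" for xs
    proof (cases "length xs \<le> Suc N")
      case True
      have "evaluate v (bar_boundary G xs) = evaluate u (bar_boundary G xs)"
      proof (rule evaluate_cong)
        fix z assume z: "z \<in> Poly_Mapping.keys (bar_boundary G xs :: _ \<Rightarrow>\<^sub>0 'k)"
        have "set xs \<subseteq> carrier G"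
          using xs by auto
        then show "v z = u z"
          using keys_bar_boundary_carrier[OF assms(1) _ z] keys_bar_boundary_length[OF z] True
          by (auto simp: v_def)
      qed
      also have "\<dots> = 0"
      proof -
        have "lin_ext (bar_boundary G) (Poly_Mapping.single xs (1 :: 'k)) \<in> bar_boundaries G"
          using xs unfolding bar_boundaries_def chains_on_def by (intro imageI) simp
        moreover have "lin_ext (bar_boundary G) (Poly_Mapping.single xs (1 :: 'k)) = bar_boundary G xs"
          by (rule chain_eqI) (simp add: evaluate_lin_ext)
        ultimately show ?thesis
          using u by simp
      qed
      finally show ?thesis .
    next
      case False
      show ?thesis
        by (rule evaluate_eq_0) (use False keys_bar_boundary_length in \<open>fastforce simp: v_def\<close>)
    qed
    then show ?thesis
      by (auto simp: cocycles_def cochains_def coboundary_def v_def intro!: exI[of _ N])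
  qed
  ultimately show ?thesis
    using u by (intro bexI[of _ v]) simp_all
qed

lemma coboundaries_subset_cocycles:
  fixes G :: "('g, 'm) monoid_scheme"
  assumes "monoid G"
  shows "coboundaries G \<subseteq> (cocycles G :: ('g list \<Rightarrow> 'k::comm_ring_1) set)"
proof
  fix i :: "'g list \<Rightarrow> 'k" assume "i \<in> coboundaries G"
  then obtain w where w: "w \<in> cochains G" "i = coboundary G w"
    by (auto simp: coboundaries_def)
  obtain N where N: "\<And>xs. length xs > N \<Longrightarrow> w xs = 0"
    using w(1) by (auto simp: cochains_def)
  have "i xs = 0" if "length xs > Suc N" for xs
  proof -
    have "evaluate w (bar_boundary G xs) = 0"
    proof (rule evaluate_eq_0)
      fix z assume "z \<in> Poly_Mapping.keys (bar_boundary G xs :: _ \<Rightarrow>\<^sub>0 'k)"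
      then have "N < length z"
        using keys_bar_boundary_length that by fastforce
      then show "w z = 0"
        by (rule N)
    qed
    then show ?thesis
      by (simp add: w coboundary_def)
  qed
  moreover have "i xs = 0" if "xs \<notin> lists (carrier G)" for xs
    using that by (simp add: w coboundary_def)
  ultimately have "i \<in> cochains G"
    unfolding cochains_def by blast
  moreover have "evaluate i (bar_boundary G xs) = 0" if "xs \<in> lists (carrier G)" for xs
  proof -
    have xs: "set xs \<subseteq> carrier G"
      using that by auto
    have "evaluate i (bar_boundary G xs) = evaluate (\<lambda>z. evaluate w (bar_boundary G z)) (bar_boundary G xs)"
      unfolding w
    proof (rule evaluate_cong)
      fix z assume "z \<in> Poly_Mapping.keys (bar_boundary G xs :: _ \<Rightarrow>\<^sub>0 'k)"
      then have "set z \<subseteq> carrier G"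
        by (rule keys_bar_boundary_carrier[OF assms xs])
      then show "coboundary G w z = evaluate w (bar_boundary G z)"
        by (auto simp: coboundary_def in_lists_conv_set)
    qed
    then show ?thesis
      using bar_boundary_boundary[OF assms xs] by simp
  qed
  ultimately show "i \<in> cocycles G"
    by (auto simp: cocycles_def coboundary_def)
qed

lemma cohomology_class_rep:
  assumes "monoid G" "W \<in> carrier (cohomology_algebra G)" "m \<in> W"
  shows "W = cochain_class G m" "m \<in> cocycles G"
proof -
  obtain u where u: "u \<in> cocycles G" "W = cochain_class G u"
    using assms(2) by (auto simp: cohomology_carrier)
  then show "W = cochain_class G m"
    using assms(3) cochain_class_eq by blast
  obtain i where i: "i \<in> coboundaries G" "m = (\<lambda>xs. i xs + u xs)"
    using assms(3) u by (auto simp: cochain_class_def)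
  then have "i \<in> cocycles G"
    using coboundaries_subset_cocycles[OF assms(1)] by blast
  then show "m \<in> cocycles G"
    unfolding i(2) by (rule cocycles_add[OF _ u(1)])
qed

lemma kronecker_add:
  assumes "monoid G" "X \<in> carrier (cohomology_algebra G)" "Y \<in> carrier (cohomology_algebra G)" "c \<in> bar_cycles G"
  shows "kronecker (X \<oplus>\<^bsub>cohomology_algebra G\<^esub> Y) (coset_of (bar_boundaries G) c) =
    kronecker X (coset_of (bar_boundaries G) c) + kronecker Y (coset_of (bar_boundaries G) c)"
proof -
  obtain u v where uv: "u \<in> cocycles G" "v \<in> cocycles G" "X = cochain_class G u" "Y = cochain_class G v"
    using assms by (auto simp: cohomology_carrier)
  show ?thesis
    unfolding uv cohomology_add
    by (simp only: kronecker_classes[OF assms(1) _ assms(4)] uv cocycles_add evaluate_fun_add)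
qed

lemma kronecker_smult:
  assumes "monoid G" "X \<in> carrier (cohomology_algebra G)" "c \<in> bar_cycles G"
  shows "kronecker (a \<odot>\<^bsub>cohomology_algebra G\<^esub> X) (coset_of (bar_boundaries G) c) =
    a * kronecker X (coset_of (bar_boundaries G) c)"
proof -
  obtain u where u: "u \<in> cocycles G" "X = cochain_class G u"
    using assms by (auto simp: cohomology_carrier)
  show ?thesis
    unfolding u cohomology_smult
    by (simp only: kronecker_classes[OF assms(1) _ assms(3)] u cocycles_scale evaluate_fun_scale)
qed

text \<open>Pairing with a fixed cycle is additive and homogeneous on classes, so it respects the
  linear combinations provided by the basis.\<close>

lemma kronecker_basis_zero:
  fixes G :: "('g, 'm) monoid_scheme" and c :: "'g list \<Rightarrow>\<^sub>0 'k::field"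
  assumes "monoid G" "vectorspace.basis class_ring (cohomology_algebra G) B" "c \<in> bar_cycles G"
    and zero: "\<And>w. w \<in> B \<Longrightarrow> kronecker w (coset_of (bar_boundaries G) c) = 0"
    and W: "W \<in> carrier (cohomology_algebra G)"
  shows "kronecker W (coset_of (bar_boundaries G) c) = 0"
proof -
  let ?H = "cohomology_algebra G :: ('k, ('g list \<Rightarrow> 'k) set) module"
  let ?Z = "coset_of (bar_boundaries G) c"
  interpret vectorspace "class_ring :: 'k ring" ?H
    by (rule cohomology_vectorspace)
  have B: "span B = carrier ?H" "B \<subseteq> carrier ?H"
    using assms(2) basis_def[of B] by simp_all
  have "W \<in> span B"
    using W B(1) by simp
  then obtain a A where A: "finite A" "A \<subseteq> B" "W = lincomb a A"
    unfolding span_def mem_Collect_eq by (elim exE conjE)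
  have "kronecker (\<Oplus>\<^bsub>?H\<^esub>w\<in>A. a w \<odot>\<^bsub>?H\<^esub> w) ?Z = 0"
    using A(1,2)
  proof (induction A rule: finite_induct)
    case empty
    show ?case
      using kronecker_classes[OF assms(1) cocycles_zero assms(3)]
      by (simp add: cohomology_zero)
  next
    case (insert w A)
    have w: "w \<in> carrier ?H" "A \<subseteq> carrier ?H"
      using insert B(2) by auto
    have closed: "(\<lambda>w. a w \<odot>\<^bsub>?H\<^esub> w) \<in> A \<rightarrow> carrier ?H" "a w \<odot>\<^bsub>?H\<^esub> w \<in> carrier ?H"
      using w smult_closed by auto
    have "finsum ?H (\<lambda>w. a w \<odot>\<^bsub>?H\<^esub> w) (insert w A) =
        a w \<odot>\<^bsub>?H\<^esub> w \<oplus>\<^bsub>?H\<^esub> finsum ?H (\<lambda>w. a w \<odot>\<^bsub>?H\<^esub> w) A"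
      using insert closed by (intro M.finsum_insert) auto
    moreover have "finsum ?H (\<lambda>w. a w \<odot>\<^bsub>?H\<^esub> w) A \<in> carrier ?H"
      using closed by (intro M.finsum_closed) auto
    ultimately show ?case
      using insert zero[of w] w closed
      by (simp add: kronecker_add[OF assms(1) _ _ assms(3)] kronecker_smult[OF assms(1) _ assms(3)])
  qed
  then show ?thesis
    by (simp add: A(3) lincomb_def)
qed

section \<open>Cup powers and their values on the explicit cycles\<close>

definition homogeneous :: "nat \<Rightarrow> ('g list \<Rightarrow> 'k::zero) \<Rightarrow> bool" where
  "homogeneous d u \<longleftrightarrow> (\<forall>xs. length xs \<noteq> d \<longrightarrow> u xs = 0)"

fun cup_power :: "('g list \<Rightarrow> 'k) \<Rightarrow> nat \<Rightarrow> 'g list \<Rightarrow> 'k::comm_ring_1" where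
  "cup_power u 0 = (\<lambda>xs. if xs = [] then 1 else 0)"
| "cup_power u (Suc k) = cup (cup_power u k) u"

lemma cup_homogeneous_left:
  assumes "homogeneous d u"
  shows "cup u v xs = (if d \<le> length xs then u (take d xs) * v (drop d xs) else 0)"
proof -
  have "cup u v xs = (\<Sum>i\<le>length xs. if i = d then u (take d xs) * v (drop d xs) else 0)"
    unfolding cup_def using assms by (intro sum.cong refl) (auto simp: homogeneous_def min_def)
  then show ?thesis
    by simp
qed

lemma cup_homogeneous: "homogeneous d u \<Longrightarrow> homogeneous e v \<Longrightarrow> homogeneous (d + e) (cup u v)"
  by (auto simp: homogeneous_def[of "d + e"] cup_homogeneous_left) (auto simp: homogeneous_def)

lemma cup_power_homogeneous: "homogeneous d u \<Longrightarrow> homogeneous (d * k) (cup_power u k)"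
proof (induction k)
  case (Suc k)
  then show ?case
    using cup_homogeneous[of "d * k" "cup_power u k" d u] by (simp add: add.commute)
qed (simp add: homogeneous_def)

text \<open>Products in a quotient ring are unions over representatives. Tracking one member through
  products and powers is enough, since \<open>cohomology_class_rep\<close> recovers a class from any
  of its members.\<close>

lemma cohomology_mult_mem:
  assumes "a \<in> A" "b \<in> B"
  shows "cup a b \<in> A \<otimes>\<^bsub>cohomology_algebra G\<^esub> B"
proof -
  have "A \<otimes>\<^bsub>cohomology_algebra G\<^esub> B = (\<Union>a\<in>A. \<Union>b\<in>B. cochain_class G (cup a b))"
    by (simp add: cohomology_algebra_def ring.defs FactRing_def rcoset_mult_def cocycle_ring_coset)
       (simp add: cocycle_ring_def)
  then show ?thesis
    using assms cochain_class_self by blast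
qed

lemma cohomology_pow_mem:
  fixes u :: "'g list \<Rightarrow> 'k::comm_ring_1" and G :: "('g, 'm) monoid_scheme"
  assumes "u \<in> y"
  shows "cup_power u k \<in> y [^]\<^bsub>cohomology_algebra G\<^esub> k"
proof (induction k)
  case 0
  have "\<one>\<^bsub>cohomology_algebra G\<^esub> = cochain_class G (\<lambda>xs. if xs = [] then 1 else (0 :: 'k))"
    by (simp add: cohomology_algebra_def ring.defs FactRing_def cocycle_ring_coset)
       (simp add: cocycle_ring_def)
  then show ?case
    using cochain_class_self[of "cup_power u 0" G] by (simp add: nat_pow_def)
next
  case (Suc k)
  have "y [^]\<^bsub>cohomology_algebra G\<^esub> Suc k = y [^]\<^bsub>cohomology_algebra G\<^esub> k \<otimes>\<^bsub>cohomology_algebra G\<^esub> y"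
    by (simp add: nat_pow_def)
  with cohomology_mult_mem[OF Suc assms] show ?case
    by simp
qed

text \<open>The cycle with r + s pairs consists of concatenations of symbols with r and with s
  pairs, and a left factor of degree 2r makes the cup product cut exactly there.\<close>

lemma cup_even_cycle:
  assumes "homogeneous (2 * r) a"
  shows "evaluate (cup a b) (even_cycle (r + s)) = evaluate a (even_cycle r) * evaluate b (even_cycle s)"
  using assms
proof (induction r arbitrary: a)
  case 0
  then show ?case
    by (simp add: cup_homogeneous_left[of 0] evaluate_fun_scale)
next
  case (Suc r)
  have hom: "homogeneous (2 * r) (\<lambda>w. a (i # 1 # w))" for i
    using Suc.prems by (simp add: homogeneous_def)
  have "cup a b (i # 1 # w) = cup (\<lambda>w. a (i # 1 # w)) b w" for i w
    by (simp add: cup_homogeneous_left[OF Suc.prems] cup_homogeneous_left[OF hom])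
  then show ?case
    using Suc.IH[OF hom] by (simp add: evaluate_even_cycle_Suc sum_distrib_right del: even_cycle.simps)
qed

lemma cup_power_even_cycle:
  assumes "homogeneous 2 u"
  shows "evaluate (cup_power u k) (even_cycle k) = evaluate u (even_cycle 1) ^ k"
proof (induction k)
  case (Suc k)
  have "homogeneous (2 * k) (cup_power u k)"
    by (rule cup_power_homogeneous) fact
  from cup_even_cycle[OF this, of u 1] Suc show ?case
    by (simp add: mult.commute del: even_cycle.simps)
qed simp

lemma cup_power_homogeneous_1:
  assumes "homogeneous 1 u"
  shows "cup_power u k xs = (if length xs = k then prod_list (map (\<lambda>x. u [x]) xs) else 0)"
proof (induction k arbitrary: xs)
  case (Suc k)
  have "homogeneous k (cup_power u k)"
    using cup_power_homogeneous[OF assms, of k] by simp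
  note cup_homogeneous_left[OF this]
  moreover have "u (drop k xs) = 0" if "length xs \<noteq> Suc k"
    using that assms by (auto simp: homogeneous_def)
  moreover have "cup_power u k (take k xs) * u (drop k xs) = prod_list (map (\<lambda>x. u [x]) xs)"
    if "length xs = Suc k"
  proof -
    obtain zs z where "xs = zs @ [z]"
      using \<open>length xs = Suc k\<close> by (metis length_Suc_conv_rev)
    with that show ?thesis
      using Suc by simp
  qed
  ultimately show ?case
    by auto
qed auto

lemma letter_power_eq_prod_list: "letter_power k xs = (if length xs = k then prod_list xs else 0)"
  by (induction k xs rule: letter_power.induct) auto

lemma times_one_eq_id: "(*) (1 :: 'a::monoid_mult) = (\<lambda>x. x)"
  by auto

text \<open>Over F_2 a function on letters vanishing at 0 is a multiple of the identity, so
  \<open>cup_power u k\<close> is u [1] to the k-th power times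
  \<open>letter_power k\<close>.\<close>

lemma cup_power_mod2_cycle:
  fixes u :: "'p::prime_card mod_ring list \<Rightarrow> 'p mod_ring"
  assumes "CARD('p) = 2" "homogeneous 1 u" "u [0] = 0"
  shows "evaluate (cup_power u k) (mod2_cycle k) = evaluate u (mod2_cycle 1) ^ k"
proof -
  have u: "u [x] = u [1] * x" for x
  proof -
    have "x \<in> {0, 1}"
      using UNIV_mod2[OF assms(1)] by blast
    then show ?thesis
      using assms(3) by auto
  qed
  have "prod_list (map (\<lambda>x. u [1] * x) xs) = u [1] ^ length xs * prod_list xs" for xs
    by (induction xs) (auto simp: algebra_simps)
  moreover have "prod_list (map (\<lambda>x. u [x]) xs) = prod_list (map (\<lambda>x. u [1] * x) xs)" for xs
    by (intro arg_cong[of _ _ prod_list] map_cong refl u)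
  ultimately have "prod_list (map (\<lambda>x. u [x]) xs) = u [1] ^ length xs * prod_list xs" for xs
    by metis
  then have "cup_power u k = (\<lambda>xs. u [1] ^ k * letter_power k xs)"
    by (intro ext) (simp add: cup_power_homogeneous_1[OF assms(2)] letter_power_eq_prod_list)
  moreover have "evaluate (letter_power k) (mod2_cycle k :: _ \<Rightarrow>\<^sub>0 'p mod_ring) = 1"
    using letter_power_mod2_cycle[OF assms(1), of k 1] by (simp only: times_one_eq_id map_ident power_one)
  moreover have "evaluate u (mod2_cycle 1) = u [1]"
    by (simp add: mod2_cycle_def evaluate_pushforward)
  ultimately show ?thesis
    by (simp only: evaluate_fun_scale) simp
qed

text \<open>Let \<nu> be the value of \<open>y\<close> on \<zeta> 1. Then \<zeta> k pairs to \<nu>^k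
  with y^k and, by comparing lengths, to 0 with every other basis monomial, so dividing by \<nu>^k
  gives a class with the required pairings and \<mu> is the inverse of \<nu>. A second solution
  would differ by a cycle that the basis, hence every cocycle, annihilates, and such a cycle is a
  boundary.\<close>

lemma dual_class_eq:
  fixes x y :: "'p::prime_card cohomology_class" and \<zeta> :: "nat \<Rightarrow> 'p mod_ring list \<Rightarrow>\<^sub>0 'p mod_ring"
  assumes gen: "cohomology_generators x y"
    and D: "D = (if CARD('p) = 2 then 1 else 2)"
    and cycle: "\<And>k. \<zeta> k \<in> bar_cycles fp_add"
    and len: "\<And>k w. w \<in> Poly_Mapping.keys (\<zeta> k) \<Longrightarrow> length w = D * k"
    and pow: "\<And>u k. u \<in> cocycles fp_add \<Longrightarrow> homogeneous D u \<Longrightarrow>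
      evaluate (cup_power u k) (\<zeta> k) = evaluate u (\<zeta> 1) ^ k"
    and \<beta>: "\<beta> \<in> cocycles fp_add" "evaluate \<beta> (\<zeta> 1) = 1"
  shows "\<exists>\<mu>. \<mu> \<noteq> 0 \<and> (\<forall>k. dual_class x y k =
    coset_of (bar_boundaries fp_add) (Poly_Mapping.map ((*) (\<mu> ^ k)) (\<zeta> k)))"
proof -
  let ?G = "fp_add :: 'p mod_ring monoid"
  let ?H = "cohomology_algebra ?G :: ('p mod_ring, ('p mod_ring list \<Rightarrow> 'p mod_ring) set) module"
  let ?N = "bar_boundaries ?G :: ('p mod_ring list \<Rightarrow>\<^sub>0 'p mod_ring) set"
  let ?mon = "cohomology_monomial x y"
  have G: "monoid ?G"
    by unfold_locales auto
  have basis: "vectorspace.basis class_ring ?H (monomial_basis x y)"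
    and y: "y \<in> cohomology_degree ?G D"
    and x: "CARD('p) \<noteq> 2 \<Longrightarrow> x \<in> cohomology_degree ?G 1"
    using gen unfolding cohomology_generators_def additive_Fp_eq Let_def D by (auto split: if_splits)
  have basis_carrier: "monomial_basis x y \<subseteq> carrier ?H"
    using basis vectorspace.basis_def[OF cohomology_vectorspace] by blast
  obtain u where u: "u \<in> y" "homogeneous D u" "u \<in> cocycles ?G"
    using y cohomology_class_rep(2)[OF G] unfolding cohomology_degree_def homogeneous_def by blast
  obtain v where v: "homogeneous 1 v" "CARD('p) \<noteq> 2 \<Longrightarrow> v \<in> x"
  proof (cases "CARD('p) = 2")
    case True
    then show ?thesis by (intro that[of "\<lambda>xs. 0"]) (auto simp: homogeneous_def)
  next
    case False
    then show ?thesis using x that unfolding cohomology_degree_def homogeneous_def by blast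
  qed
  define m where "m \<epsilon> k = cup (cup_power v \<epsilon>) (cup_power u k)" for \<epsilon> k
  define ind where "ind \<epsilon> \<longleftrightarrow> \<epsilon> = 0 \<or> \<epsilon> = 1 \<and> CARD('p) \<noteq> 2" for \<epsilon> :: nat
  have mbasis: "monomial_basis x y = {?mon \<epsilon> k | \<epsilon> k. ind \<epsilon>}"
    unfolding monomial_basis_def ind_def by (auto simp: le_Suc_eq)
  have mhom: "homogeneous (\<epsilon> + D * k) (m \<epsilon> k)" for \<epsilon> k
    unfolding m_def using cup_homogeneous[OF cup_power_homogeneous[OF v(1), of \<epsilon>] cup_power_homogeneous[OF u(2), of k]]
    by simp
  have m0: "m 0 k = cup_power u k" for k
    by (rule ext) (simp add: m_def cup_homogeneous_left[of 0] homogeneous_def)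
  have mmem: "m \<epsilon> k \<in> ?mon \<epsilon> k" if "ind \<epsilon>" for \<epsilon> k
  proof -
    have "cup_power v \<epsilon> \<in> x [^]\<^bsub>?H\<^esub> \<epsilon>"
    proof (cases "\<epsilon> = 0")
      case True
      \<comment> \<open>The zeroth power does not depend on its base. A singleton stands in for
        \<open>x\<close>, which is arbitrary for p = 2 and may be empty.\<close>
      obtain a :: "'p mod_ring list \<Rightarrow> 'p mod_ring" where "a \<in> {a}" by blast
      have "cup_power a 0 \<in> {a} [^]\<^bsub>?H\<^esub> (0::nat)"
        by (rule cohomology_pow_mem) simp
      with True show ?thesis by (simp add: nat_pow_def)
    next
      case False
      show ?thesis
        by (intro cohomology_pow_mem v(2)) (use that False in \<open>simp add: ind_def\<close>)
    qed
    then show ?thesis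
      unfolding m_def cohomology_monomial_def additive_Fp_eq
      by (rule cohomology_mult_mem[OF _ cohomology_pow_mem[OF u(1)]])
  qed
  have mon: "?mon \<epsilon> k = cochain_class ?G (m \<epsilon> k)" "m \<epsilon> k \<in> cocycles ?G" if "ind \<epsilon>" for \<epsilon> k
    using cohomology_class_rep[OF G _ mmem[OF that]] basis_carrier that unfolding mbasis by blast+
  have kron: "kronecker (?mon \<epsilon> k) (coset_of ?N c) = evaluate (m \<epsilon> k) c" if "ind \<epsilon>" "c \<in> bar_cycles ?G" for \<epsilon> k c
    unfolding mon(1)[OF that(1)] by (rule kronecker_classes[OF G mon(2)[OF that(1)] that(2)])
  define \<nu> where "\<nu> = evaluate u (\<zeta> 1)"
  have ev: "evaluate (m \<epsilon> j) (\<zeta> k) = (if \<epsilon> = 0 \<and> j = k then \<nu> ^ k else 0)" if "ind \<epsilon>" for \<epsilon> j k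
  proof (cases "\<epsilon> = 0 \<and> j = k")
    case True
    then show ?thesis using pow[OF u(3,2)] by (simp add: m0 \<nu>_def)
  next
    case False
    \<comment> \<open>For D = 2 an exterior factor makes the degree odd; for D = 1
      \<open>ind\<close> only admits \<epsilon> = 0. So equal degrees force equal exponents.\<close>
    then have "\<epsilon> + D * j \<noteq> D * k"
      using that unfolding D ind_def by (auto split: if_splits) presburger
    then have "evaluate (m \<epsilon> j) (\<zeta> k) = 0"
      using mhom[of \<epsilon> j] len[of _ k] by (intro evaluate_eq_0) (auto simp: homogeneous_def)
    with False show ?thesis by auto
  qed
  \<comment> \<open>Otherwise the whole monomial basis would pair to zero with \<zeta> 1, and by
    linearity so would \<beta>, whose value there is 1.\<close>
  have \<nu>: "\<nu> \<noteq> 0"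
  proof
    assume "\<nu> = 0"
    have "kronecker (cochain_class ?G \<beta>) (coset_of ?N (\<zeta> 1)) = 0"
    proof (rule kronecker_basis_zero[OF G basis cycle])
      fix w assume "w \<in> monomial_basis x y"
      then show "kronecker w (coset_of ?N (\<zeta> 1)) = 0"
        using kron cycle ev \<open>\<nu> = 0\<close> unfolding mbasis by auto
    qed (use \<beta> in \<open>auto simp: cohomology_carrier\<close>)
    then show False
      using kronecker_classes[OF G \<beta>(1) cycle] \<beta>(2) by simp
  qed
  define z where "z k = Poly_Mapping.map ((*) (inverse \<nu> ^ k)) (\<zeta> k)" for k
  have zcycle: "z k \<in> bar_cycles ?G" for k
    using cycle[of k] by (auto simp: z_def bar_cycles_def lin_ext_scale intro!: chains_on_scale poly_mapping_eqI)
  have zev: "evaluate (m \<epsilon> j) (z k) = (if \<epsilon> = 0 \<and> j = k then 1 else 0)" if "ind \<epsilon>" for \<epsilon> j k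
    using ev[OF that, of j k] \<nu> by (simp add: z_def evaluate_scale power_inverse)
  have ind0: "ind 0"
    by (simp add: ind_def)
  have "dual_class x y k = coset_of ?N (z k)" for k
    unfolding dual_class_def additive_Fp_eq
  proof (rule the_equality)
    show "coset_of ?N (z k) \<in> carrier (homology_group ?G) \<and>
      (\<forall>w\<in>monomial_basis x y. kronecker w (coset_of ?N (z k)) = (if w = ?mon 0 k then 1 else 0))"
    proof (intro conjI ballI)
      show "coset_of ?N (z k) \<in> carrier (homology_group ?G)"
        unfolding homology_group_carrier by (intro imageI zcycle)
      fix w assume "w \<in> monomial_basis x y"
      then obtain \<epsilon> j where w: "w = ?mon \<epsilon> j" "ind \<epsilon>"
        unfolding mbasis by blast
      have a: "kronecker w (coset_of ?N (z k)) = (if \<epsilon> = 0 \<and> j = k then 1 else 0)"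
        using kron[OF w(2) zcycle] zev[OF w(2)] w(1) by simp
      have b: "kronecker (?mon 0 k) (coset_of ?N (z k)) = 1"
        using kron[OF ind0 zcycle] zev[OF ind0] by simp
      show "kronecker w (coset_of ?N (z k)) = (if w = ?mon 0 k then 1 else 0)"
        using a b w(1) by (cases "\<epsilon> = 0 \<and> j = k") auto
    qed
    fix Z assume Z: "Z \<in> carrier (homology_group ?G) \<and>
      (\<forall>w\<in>monomial_basis x y. kronecker w Z = (if w = ?mon 0 k then 1 else 0))"
    then obtain c where c: "c \<in> bar_cycles ?G" "Z = coset_of ?N c"
      unfolding homology_group_carrier by blast
    have d: "z k - c \<in> bar_cycles ?G"
      using c(1) zcycle[of k] chains_on_add[OF _ chains_on_uminus, of "z k" _ c]
      by (auto simp: bar_cycles_def lin_ext_diff)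
    have "z k - c \<in> ?N"
    proof (rule ccontr)
      assume "z k - c \<notin> ?N"
      then obtain t where t: "t \<in> cocycles ?G" "evaluate t (z k - c) \<noteq> 0"
        using exists_detecting_cocycle[OF G d] by blast
      have "kronecker (cochain_class ?G t) (coset_of ?N (z k - c)) = 0"
      proof (rule kronecker_basis_zero[OF G basis d])
        fix w assume wB: "w \<in> monomial_basis x y"
        then obtain \<epsilon> j where w: "w = ?mon \<epsilon> j" "ind \<epsilon>"
          unfolding mbasis by blast
        have "evaluate (m \<epsilon> j) c = (if w = ?mon 0 k then 1 else 0)"
          using Z wB kron[OF w(2) c(1), of j] c(2) w(1) by auto
        moreover have "evaluate (m \<epsilon> j) (z k) = (if w = ?mon 0 k then 1 else 0)"
        proof (cases "\<epsilon> = 0 \<and> j = k")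
          case False
          then have "evaluate (m \<epsilon> j) (z k) = 0" using zev[OF w(2)] by auto
          \<comment> \<open>The pairing with \<open>z k\<close> separates the classes, so different
            exponents cannot name the monomial y^k a second time.\<close>
          moreover have "evaluate (m 0 k) (z k) = 1" using zev[OF ind0] by simp
          ultimately have "w \<noteq> ?mon 0 k"
            using kron[OF w(2) zcycle, of j k] kron[OF ind0 zcycle, of k k] w(1) by auto
          with \<open>evaluate (m \<epsilon> j) (z k) = 0\<close> show ?thesis by simp
        qed (use zev[OF w(2)] w in auto)
        ultimately show "kronecker w (coset_of ?N (z k - c)) = 0"
          unfolding w(1) kron[OF w(2) d] by (simp add: evaluate_diff)
      qed (use t in \<open>auto simp: cohomology_carrier\<close>)
      then show False
        using kronecker_classes[OF G t(1) d] t(2) by simp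
    qed
    then show "Z = coset_of ?N (z k)"
      unfolding c(2) by (intro coset_of_eqI) (auto intro: bar_boundaries_add bar_boundaries_uminus)
  qed
  with \<nu> show ?thesis
    unfolding z_def by (intro exI[of _ "inverse \<nu>"]) simp
qed

lemma fp_add_cocycleI:
  fixes U :: "'p::prime_card mod_ring list \<Rightarrow> 'p mod_ring"
  assumes "homogeneous d U" "\<And>xs. evaluate U (bar_boundary fp_add xs) = 0"
  shows "U \<in> cocycles fp_add"
proof -
  have "\<forall>xs. d < length xs \<longrightarrow> U xs = 0"
    using assms(1) by (auto simp: homogeneous_def)
  then show ?thesis
    using assms(2) by (auto simp: cocycles_def cochains_def coboundary_def)
qed

lemma dual_class_odd:
  fixes x y :: "'p::prime_card cohomology_class"
  assumes "cohomology_generators x y" "CARD('p) \<noteq> 2"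
  shows "\<exists>\<mu>. \<mu> \<noteq> 0 \<and> (\<forall>k. dual_class x y k =
    coset_of (bar_boundaries fp_add) (Poly_Mapping.map ((*) (\<mu> ^ k)) (even_cycle k)))"
proof (rule dual_class_eq[OF assms(1)])
  show "carry_power 1 \<in> cocycles (fp_add :: 'p mod_ring monoid)"
    by (rule fp_add_cocycleI[of 2]) (auto simp: homogeneous_def carry_power_length carry_power_cocycle)
  show "evaluate (carry_power 1) (even_cycle 1 :: _ \<Rightarrow>\<^sub>0 'p mod_ring) = 1"
    using carry_power_even_cycle[of 1 "1 :: 'p mod_ring"] by (simp only: times_one_eq_id map_ident power_one)
qed (use assms(2) even_cycle_is_cycle keys_even_cycle cup_power_even_cycle in auto)

lemma dual_class_2:
  fixes x y :: "'p::prime_card cohomology_class"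
  assumes "cohomology_generators x y" "CARD('p) = 2"
  shows "\<exists>\<mu>. \<mu> \<noteq> 0 \<and> (\<forall>k. dual_class x y k =
    coset_of (bar_boundaries fp_add) (Poly_Mapping.map ((*) (\<mu> ^ k)) (mod2_cycle k)))"
proof (rule dual_class_eq[OF assms(1)])
  show "letter_power 1 \<in> cocycles (fp_add :: 'p mod_ring monoid)"
    by (rule fp_add_cocycleI[of 1]) (auto simp: homogeneous_def letter_power_length letter_power_cocycle)
  show "evaluate (letter_power 1) (mod2_cycle 1 :: _ \<Rightarrow>\<^sub>0 'p mod_ring) = 1"
    using letter_power_mod2_cycle[OF assms(2), of 1 "1 :: 'p mod_ring"] by (simp only: times_one_eq_id map_ident power_one)
  fix u :: "'p mod_ring list \<Rightarrow> 'p mod_ring" and k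
  assume u: "u \<in> cocycles fp_add" "homogeneous 1 u"
  \<comment> \<open>The boundary of [0|0] is [0], so every one-cocycle is normalised.\<close>
  then have "evaluate u (bar_boundary fp_add [0, 0]) = 0"
    by (auto simp: cocycles_def coboundary_def dest: fun_cong)
  then have "u [0] = 0"
    by (simp add: evaluate_bar_boundary_Cons)
  with u show "evaluate (cup_power u k) (mod2_cycle k) = evaluate u (mod2_cycle 1) ^ k"
    by (intro cup_power_mod2_cycle assms(2))
qed (use assms(2) mod2_cycle_is_cycle keys_mod2_cycle in auto)

section \<open>The characteristic cocycle on general linear groups\<close>

lemma finite_carrier_vec: "finite (carrier_vec n :: 'p::finite vec set)"
  and card_carrier_vec: "card (carrier_vec n :: 'p::finite vec set) = CARD('p) ^ n"
proof -
  let ?L = "{xs :: 'p list. set xs \<subseteq> UNIV \<and> length xs = n}"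
  have inj: "inj_on vec_of_list ?L"
    by (rule inj_on_inverseI[of _ list_of_vec]) (rule list_vec)
  have img: "vec_of_list ` ?L = carrier_vec n"
  proof (intro equalityI subsetI)
    fix v :: "'p vec" assume "v \<in> carrier_vec n"
    then have "list_of_vec v \<in> ?L"
      by (simp add: carrier_vecD)
    moreover have "v = vec_of_list (list_of_vec v)"
      by (rule vec_list[symmetric])
    ultimately show "v \<in> vec_of_list ` ?L"
      by (rule rev_image_eqI)
  next
    fix v assume "v \<in> vec_of_list ` ?L"
    then show "v \<in> carrier_vec n"
      by (elim imageE) (simp add: carrier_vecI)
  qed
  have L: "finite ?L" "card ?L = CARD('p) ^ n"
    by (rule finite_lists_length_eq card_lists_length_eq, simp)+
  show "finite (carrier_vec n :: 'p vec set)" "card (carrier_vec n :: 'p vec set) = CARD('p) ^ n"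
    unfolding img[symmetric] using L card_image[OF inj] by simp_all
qed

section \<open>Row vectors, leading coordinates and the cocycle of pairs\<close>

lemma smult_0_vec: "v \<in> carrier_vec n \<Longrightarrow> (0 :: 'a::field) \<cdot>\<^sub>v v = 0\<^sub>v n"
  by (intro eq_vecI) auto

lemma zero_mat_mult_vec': "v \<in> carrier_vec n \<Longrightarrow> 0\<^sub>m k n *\<^sub>v v = (0\<^sub>v k :: 'a::field vec)"
  by (intro eq_vecI) (auto simp: scalar_prod_def)

text \<open>The product v A for a row vector v. Rows give a right action, as
  \<open>action_cocycle\<close> requires.\<close>

definition row_mult :: "'a::field mat \<Rightarrow> 'a vec \<Rightarrow> 'a vec" where
  "row_mult A v = transpose_mat A *\<^sub>v v"

lemma row_mult_closed: "A \<in> carrier_mat n n \<Longrightarrow> v \<in> carrier_vec n \<Longrightarrow> row_mult A v \<in> carrier_vec n"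
  by (simp add: row_mult_def)

lemma row_mult_mult:
  assumes "A \<in> carrier_mat n n" "B \<in> carrier_mat n n" "v \<in> carrier_vec n"
  shows "row_mult (A * B) v = row_mult B (row_mult A v)"
  using assms by (simp add: row_mult_def transpose_mult assoc_mult_mat_vec)

lemma row_mult_one: "v \<in> carrier_vec n \<Longrightarrow> row_mult (1\<^sub>m n) v = v"
  by (simp add: row_mult_def)

lemma row_mult_add:
  assumes "A \<in> carrier_mat n n" "v \<in> carrier_vec n" "w \<in> carrier_vec n"
  shows "row_mult A (v + w) = row_mult A v + row_mult A w"
  using assms mult_add_distrib_mat_vec[of "transpose_mat A" n n v w] by (simp add: row_mult_def)

lemma row_mult_smult:
  assumes "A \<in> carrier_mat n n" "v \<in> carrier_vec n"
  shows "row_mult A (c \<cdot>\<^sub>v v) = c \<cdot>\<^sub>v row_mult A v"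
  using assms mult_mat_vec[of "transpose_mat A" n n v c] by (simp add: row_mult_def)

lemma row_mult_zero: "A \<in> carrier_mat n n \<Longrightarrow> row_mult A (0\<^sub>v n) = 0\<^sub>v n"
  using row_mult_smult[of A n "0\<^sub>v n" 0] by (simp add: row_mult_closed smult_0_vec[of _ n])

definition lead_index :: "'a::zero vec \<Rightarrow> nat" where
  "lead_index v = (LEAST i. i < dim_vec v \<and> v $ i \<noteq> 0)"

lemma lead_index:
  assumes "v \<in> carrier_vec n" "v \<noteq> 0\<^sub>v n"
  shows "lead_index v < n" "v $ lead_index v \<noteq> 0"
proof -
  have "\<exists>i. i < dim_vec v \<and> v $ i \<noteq> 0"
    using assms by (metis carrier_vecD eq_vecI index_zero_vec)
  then have "lead_index v < dim_vec v \<and> v $ lead_index v \<noteq> 0"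
    unfolding lead_index_def by (rule LeastI_ex)
  then show "lead_index v < n" "v $ lead_index v \<noteq> 0"
    using assms by auto
qed

text \<open>The scalar c for which u - c v has coordinate zero at \<open>lead_index v\<close>, for
  nonzero \<open>v\<close>.\<close>

definition lead_ratio :: "'a::field vec \<Rightarrow> 'a vec \<Rightarrow> 'a" where
  "lead_ratio v u = u $ lead_index v / v $ lead_index v"

text \<open>A pair \<open>(v, u)\<close> represents a nonzero vector \<open>v\<close> with an element of the quotient by the line
  through \<open>v\<close>; the latter is normalised so that its coordinate at \<open>lead_index v\<close> vanishes.\<close>

definition lead_pairs :: "nat \<Rightarrow> ('a::field vec \<times> 'a vec) set" where
  "lead_pairs n = {(v, u). v \<in> carrier_vec n \<and> v \<noteq> 0\<^sub>v n \<and> u \<in> carrier_vec n \<and> u $ lead_index v = 0}"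

text \<open>The multiple of v A that has to be subtracted from u A to normalise it: the deviation of
  the normalised section from being preserved by \<open>A\<close>.\<close>

definition pair_lam :: "'a::field mat \<Rightarrow> 'a vec \<times> 'a vec \<Rightarrow> 'a" where
  "pair_lam A = (\<lambda>(v, u). lead_ratio (row_mult A v) (row_mult A u))"

definition pair_act :: "'a::field mat \<Rightarrow> 'a vec \<times> 'a vec \<Rightarrow> 'a vec \<times> 'a vec" where
  "pair_act A = (\<lambda>(v, u). (row_mult A v, row_mult A u + (- pair_lam A (v, u)) \<cdot>\<^sub>v row_mult A v))"

lemma lead_ratio_add:
  assumes "v \<in> carrier_vec n" "v \<noteq> 0\<^sub>v n" "u \<in> carrier_vec n" "w \<in> carrier_vec n"
  shows "lead_ratio v (u + c \<cdot>\<^sub>v w) = lead_ratio v u + c * lead_ratio v w"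
  using assms lead_index[OF assms(1,2)] by (simp add: lead_ratio_def add_divide_distrib)

lemma lead_ratio_self:
  assumes "v \<in> carrier_vec n" "v \<noteq> 0\<^sub>v n"
  shows "lead_ratio v v = 1"
  using lead_index[OF assms] by (simp add: lead_ratio_def)

lemma lead_ratio_eq_0_iff:
  assumes "v \<in> carrier_vec n" "v \<noteq> 0\<^sub>v n"
  shows "lead_ratio v u = 0 \<longleftrightarrow> u $ lead_index v = 0"
  using lead_index[OF assms] by (simp add: lead_ratio_def)

lemma GL_carrier:
  "A \<in> carrier (GL n) \<longleftrightarrow> A \<in> carrier_mat n n \<and> (\<exists>B\<in>carrier_mat n n. A * B = 1\<^sub>m n \<and> B * A = 1\<^sub>m n)"
  by (auto simp: GL_def units_of_def Units_def ring_mat_def)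

lemma GL_mult [simp]: "A \<otimes>\<^bsub>GL n\<^esub> B = A * B"
  by (simp add: GL_def units_of_def ring_mat_def)

lemma GL_one [simp]: "\<one>\<^bsub>GL n\<^esub> = 1\<^sub>m n"
  by (simp add: GL_def units_of_def ring_mat_def)

lemma GL_group: "group (GL n :: 'a::comm_ring_1 mat monoid)"
proof -
  interpret R: ring "ring_mat TYPE('a) n ()"
    by (rule ring_mat)
  show ?thesis
    unfolding GL_def by (rule R.units_group)
qed

lemma GL_carrier_mat: "A \<in> carrier (GL n) \<Longrightarrow> A \<in> carrier_mat n n"
  by (simp add: GL_carrier)

lemma row_mult_nonzero:
  assumes "A \<in> carrier (GL n)" "v \<in> carrier_vec n" "v \<noteq> 0\<^sub>v n"
  shows "row_mult A v \<noteq> 0\<^sub>v n"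
proof
  assume *: "row_mult A v = 0\<^sub>v n"
  obtain B where B: "B \<in> carrier_mat n n" "A * B = 1\<^sub>m n" "A \<in> carrier_mat n n"
    using assms(1) by (auto simp: GL_carrier)
  have "v = row_mult B (row_mult A v)"
    using B assms(2) by (simp add: row_mult_one flip: row_mult_mult)
  also have "\<dots> = 0\<^sub>v n"
    by (simp add: * row_mult_zero B)
  finally show False
    using assms(3) by simp
qed

lemma pair_act_closed:
  assumes A: "A \<in> carrier (GL n)" and s: "s \<in> lead_pairs n"
  shows "pair_act A s \<in> lead_pairs n"
proof -
  obtain v u where vu: "s = (v, u)" "v \<in> carrier_vec n" "v \<noteq> 0\<^sub>v n" "u \<in> carrier_vec n"
    using s by (auto simp: lead_pairs_def)
  let ?v = "row_mult A v" and ?u = "row_mult A u"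
  have c: "?v \<in> carrier_vec n" "?v \<noteq> 0\<^sub>v n" "?u \<in> carrier_vec n"
    using vu A by (auto simp: row_mult_closed[OF GL_carrier_mat] row_mult_nonzero)
  have "lead_ratio ?v (?u + (- pair_lam A s) \<cdot>\<^sub>v ?v) = 0"
    using lead_ratio_add[OF c(1,2,3,1)] lead_ratio_self[OF c(1,2)] by (simp add: vu(1) pair_lam_def)
  then show ?thesis
    using c unfolding lead_ratio_eq_0_iff[OF c(1,2)] by (simp add: vu(1) pair_act_def lead_pairs_def)
qed

text \<open>Removing a multiple of v A before applying \<open>B\<close> removes the same multiple of
  v A B afterwards, so the multiples split off in two steps add up to the one split off at
  once.\<close>

lemma pair_lam_mult:
  assumes A: "A \<in> carrier (GL n)" and B: "B \<in> carrier (GL n)" and s: "s \<in> lead_pairs n"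
  shows "pair_lam (A * B) s = pair_lam A s + pair_lam B (pair_act A s)"
    and "pair_act (A * B) s = pair_act B (pair_act A s)"
proof -
  obtain v u where vu: "s = (v, u)" "v \<in> carrier_vec n" "v \<noteq> 0\<^sub>v n" "u \<in> carrier_vec n"
    using s by (auto simp: lead_pairs_def)
  note Am = GL_carrier_mat[OF A] and Bm = GL_carrier_mat[OF B]
  let ?v = "row_mult A v" and ?u = "row_mult A u"
  let ?v' = "row_mult B ?v" and ?u' = "row_mult B ?u"
  define l where "l = pair_lam A s"
  have c: "?v \<in> carrier_vec n" "?v \<noteq> 0\<^sub>v n" "?u \<in> carrier_vec n"
    using vu A by (auto simp: row_mult_closed[OF GL_carrier_mat] row_mult_nonzero)
  have c': "?v' \<in> carrier_vec n" "?v' \<noteq> 0\<^sub>v n" "?u' \<in> carrier_vec n"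
    using c B by (auto simp: row_mult_closed[OF GL_carrier_mat] row_mult_nonzero)
  have mult: "row_mult (A * B) v = ?v'" "row_mult (A * B) u = ?u'"
    using vu Am Bm by (auto simp: row_mult_mult)
  have act: "pair_act A s = (?v, ?u + (- l) \<cdot>\<^sub>v ?v)"
    by (simp add: pair_act_def vu(1) l_def)
  have uB: "row_mult B (?u + (- l) \<cdot>\<^sub>v ?v) = ?u' + (- l) \<cdot>\<^sub>v ?v'"
    using c Bm by (simp add: row_mult_add row_mult_smult)
  have 1: "pair_lam B (pair_act A s) = lead_ratio ?v' ?u' - l"
    unfolding act pair_lam_def prod.case uB
    by (simp add: lead_ratio_add[OF c'(1,2,3,1)] lead_ratio_self[OF c'(1,2)])
  have 2: "pair_lam (A * B) s = l + pair_lam B (pair_act A s)"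
    unfolding 1 by (simp add: pair_lam_def vu(1) mult)
  then show "pair_lam (A * B) s = pair_lam A s + pair_lam B (pair_act A s)"
    by (simp add: l_def)
  have actB: "pair_act B (pair_act A s) =
      (?v', ?u' + (- l) \<cdot>\<^sub>v ?v' + (- pair_lam B (pair_act A s)) \<cdot>\<^sub>v ?v')"
    using uB by (simp add: pair_act_def[of B] act)
  have "pair_act (A * B) s = (?v', ?u' + (- pair_lam (A * B) s) \<cdot>\<^sub>v ?v')"
    by (simp add: pair_act_def vu(1) mult)
  also have "?u' + (- pair_lam (A * B) s) \<cdot>\<^sub>v ?v' =
      ?u' + (- l) \<cdot>\<^sub>v ?v' + (- pair_lam B (pair_act A s)) \<cdot>\<^sub>v ?v'"
    unfolding 2 using c' by (intro eq_vecI) (auto simp: algebra_simps)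
  finally show "pair_act (A * B) s = pair_act B (pair_act A s)"
    unfolding actB .
qed

lemma pair_one:
  assumes "s \<in> lead_pairs n"
  shows "pair_lam (1\<^sub>m n) s = 0" "pair_act (1\<^sub>m n) s = s"
proof -
  obtain v u where vu: "s = (v, u)" "v \<in> carrier_vec n" "v \<noteq> 0\<^sub>v n" "u \<in> carrier_vec n" "u $ lead_index v = 0"
    using assms by (auto simp: lead_pairs_def)
  show l: "pair_lam (1\<^sub>m n) s = 0"
    using vu by (simp add: pair_lam_def row_mult_one lead_ratio_def)
  show "pair_act (1\<^sub>m n) s = s"
    using l vu by (simp add: pair_act_def row_mult_one smult_0_vec[of _ n])
qed

lemma finite_lead_pairs: "finite (lead_pairs n :: ('p::prime_card mod_ring vec \<times> _) set)"
  by (rule finite_subset[of _ "carrier_vec n \<times> carrier_vec n"]) (auto simp: lead_pairs_def finite_carrier_vec)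

text \<open>Stated along a homomorphism \<open>R\<close>, so that it serves both the families mapped
  to \<open>GL\<close> and the regular representation.\<close>

lemma action_cocycle_GL:
  fixes R :: "'g \<Rightarrow> 'p::prime_card mod_ring mat" and G :: "('g, 'm) monoid_scheme"
  assumes closed: "\<And>g. g \<in> carrier G \<Longrightarrow> R g \<in> carrier (GL n)"
    and hom: "\<And>g h. g \<in> carrier G \<Longrightarrow> h \<in> carrier G \<Longrightarrow> R (g \<otimes>\<^bsub>G\<^esub> h) = R g * R h"
  shows "action_cocycle G (lead_pairs n) (\<lambda>g. pair_act (R g)) (\<lambda>g. pair_lam (R g))"
proof
  fix g assume "g \<in> carrier G"
  then have g: "R g \<in> carrier (GL n)"
    by (rule closed)
  interpret group "GL n :: 'p mod_ring mat monoid"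
    by (rule GL_group)
  let ?i = "inv\<^bsub>GL n\<^esub> (R g)"
  have i: "?i \<in> carrier (GL n)" "R g * ?i = 1\<^sub>m n" "?i * R g = 1\<^sub>m n"
    using g inv_closed r_inv[OF g] l_inv[OF g] by simp_all
  show "bij_betw (pair_act (R g)) (lead_pairs n) (lead_pairs n)"
    by (rule bij_betw_byWitness[where f' = "pair_act ?i"])
       (auto simp: pair_one g i pair_act_closed simp flip: pair_lam_mult(2)[OF g i(1)] pair_lam_mult(2)[OF i(1) g])
next
  fix g h and s :: "'p mod_ring vec \<times> 'p mod_ring vec"
  assume "g \<in> carrier G" "h \<in> carrier G" "s \<in> lead_pairs n"
  then show "pair_act (R (g \<otimes>\<^bsub>G\<^esub> h)) s = pair_act (R h) (pair_act (R g) s)"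
    "pair_lam (R (g \<otimes>\<^bsub>G\<^esub> h)) s = pair_lam (R g) s + pair_lam (R h) (pair_act (R g) s)"
    using pair_lam_mult[OF closed closed] by (simp_all add: hom)
qed (rule finite_lead_pairs)

lemma path_map: "path (\<lambda>g. act (R g)) (\<lambda>g. lam (R g)) gs s = path act lam (map R gs) s"
  by (induction gs arbitrary: s) auto

definition char_cochain :: "('p::prime_card mod_ring list \<Rightarrow> 'p mod_ring) \<Rightarrow> nat \<Rightarrow> 'p mod_ring mat list \<Rightarrow> 'p mod_ring" where
  "char_cochain U n As = (\<Sum>s\<in>lead_pairs n. U (path pair_act pair_lam As s))"

lemma char_cochain_cocycle:
  fixes R :: "'g \<Rightarrow> 'p::prime_card mod_ring mat" and G :: "('g, 'm) monoid_scheme"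
  assumes "\<And>g. g \<in> carrier G \<Longrightarrow> R g \<in> carrier (GL n)"
    and "\<And>g h. g \<in> carrier G \<Longrightarrow> h \<in> carrier G \<Longrightarrow> R (g \<otimes>\<^bsub>G\<^esub> h) = R g * R h"
    and U: "\<And>xs. evaluate U (bar_boundary fp_add xs) = 0" and gs: "set gs \<subseteq> carrier G"
  shows "evaluate (\<lambda>gs. char_cochain U n (map R gs)) (bar_boundary G gs) = 0"
proof -
  interpret action_cocycle G "lead_pairs n" "\<lambda>g. pair_act (R g)" "\<lambda>g. pair_lam (R g)"
    by (rule action_cocycle_GL) (use assms in auto)
  have "transfer_cochain U = (\<lambda>gs. char_cochain U n (map R gs))"
    by (auto simp: transfer_cochain_def char_cochain_def path_map)
  then show ?thesis
    using transfer_cocycle[OF U gs] by simp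
qed

text \<open>The identity matrix preserves normalised pairs and hence contributes a letter 0 to every
  path, which a normalised \<open>U\<close> kills.\<close>

lemma char_cochain_one:
  assumes U: "\<And>xs. 0 \<in> set xs \<Longrightarrow> U xs = 0" and As: "set As \<subseteq> carrier (GL n)" "1\<^sub>m n \<in> set As"
  shows "char_cochain U n As = 0"
proof -
  have "0 \<in> set (path pair_act pair_lam As s)" if "s \<in> lead_pairs n" for s
    using As that
  proof (induction As arbitrary: s)
    case (Cons A As)
    show ?case
    proof (cases "A = 1\<^sub>m n")
      case True
      then show ?thesis
        using pair_one(1)[OF Cons.prems(3)] by simp
    next
      case False
      then have "0 \<in> set (path pair_act pair_lam As (pair_act A s))"
        using Cons.prems by (intro Cons.IH pair_act_closed) auto
      then show ?thesis
        by simp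
    qed
  qed simp
  then show ?thesis
    unfolding char_cochain_def using U by (intro sum.neutral) blast
qed

section \<open>The characteristic cochain on block sums\<close>

lemma row_mult_block_sum:
  assumes "A \<in> carrier_mat k k" "B \<in> carrier_mat m m" "v \<in> carrier_vec k" "w \<in> carrier_vec m"
  shows "row_mult (block_sum k m A B) (v @\<^sub>v w) = row_mult A v @\<^sub>v row_mult B w"
proof -
  have "transpose_mat (block_sum k m A B) = four_block_mat A\<^sup>T (0\<^sub>m k m) (0\<^sub>m m k) B\<^sup>T"
    using transpose_four_block_mat[OF assms(1) zero_carrier_mat zero_carrier_mat assms(2)]
    by (simp add: block_sum_def)
  moreover have "four_block_mat A\<^sup>T (0\<^sub>m k m) (0\<^sub>m m k) B\<^sup>T *\<^sub>v (v @\<^sub>v w) =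
      (A\<^sup>T *\<^sub>v v + 0\<^sub>m k m *\<^sub>v w) @\<^sub>v (0\<^sub>m m k *\<^sub>v v + B\<^sup>T *\<^sub>v w)"
    using assms by (intro four_block_mat_mult_vec) auto
  ultimately show ?thesis
    using assms by (simp add: row_mult_def zero_mat_mult_vec' mult_mat_vec_carrier[of _ k k] mult_mat_vec_carrier[of _ m m])
qed

lemma lead_index_append:
  assumes "v \<in> carrier_vec k" "v \<noteq> 0\<^sub>v k"
  shows "lead_index (v @\<^sub>v w) = lead_index v"
proof -
  note l = lead_index[OF assms]
  show ?thesis
    unfolding lead_index_def[of "v @\<^sub>v w"]
  proof (rule Least_equality)
    show "lead_index v < dim_vec (v @\<^sub>v w) \<and> (v @\<^sub>v w) $ lead_index v \<noteq> 0"
      using l assms by auto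
    fix i assume i: "i < dim_vec (v @\<^sub>v w) \<and> (v @\<^sub>v w) $ i \<noteq> 0"
    show "lead_index v \<le> i"
    proof (cases "i < k")
      case True
      then show ?thesis
        using i assms(1) unfolding lead_index_def by (intro Least_le) auto
    qed (use l in simp)
  qed
qed

lemma lead_index_append_zero:
  assumes "w \<in> carrier_vec m" "w \<noteq> 0\<^sub>v m"
  shows "lead_index (0\<^sub>v k @\<^sub>v w) = k + lead_index w"
proof -
  note l = lead_index[OF assms]
  show ?thesis
    unfolding lead_index_def[of "0\<^sub>v k @\<^sub>v w"]
  proof (rule Least_equality)
    show "k + lead_index w < dim_vec (0\<^sub>v k @\<^sub>v w) \<and> (0\<^sub>v k @\<^sub>v w) $ (k + lead_index w) \<noteq> 0"
      using l assms by auto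
    fix i assume i: "i < dim_vec (0\<^sub>v k @\<^sub>v w) \<and> (0\<^sub>v k @\<^sub>v w) $ i \<noteq> 0"
    then have "i \<ge> k"
      by (cases "i < k") auto
    moreover have "lead_index w \<le> i - k"
      using i \<open>i \<ge> k\<close> assms(1) unfolding lead_index_def by (intro Least_le) auto
    ultimately show "k + lead_index w \<le> i"
      by simp
  qed
qed

lemma lead_ratio_append:
  assumes "v \<in> carrier_vec k" "v \<noteq> 0\<^sub>v k" "u \<in> carrier_vec k"
  shows "lead_ratio (v @\<^sub>v w) (u @\<^sub>v t) = lead_ratio v u"
  using assms lead_index[OF assms(1,2)] by (simp add: lead_ratio_def lead_index_append)

lemma lead_ratio_append_zero:
  assumes "w \<in> carrier_vec m" "w \<noteq> 0\<^sub>v m" "u \<in> carrier_vec k" "t \<in> carrier_vec m"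
  shows "lead_ratio (0\<^sub>v k @\<^sub>v w) (u @\<^sub>v t) = lead_ratio w t"
  using assms lead_index[OF assms(1,2)] by (simp add: lead_ratio_def lead_index_append_zero)

lemma append_add_smult_vec:
  assumes "u \<in> carrier_vec k" "v \<in> carrier_vec k" "t \<in> carrier_vec m" "w \<in> carrier_vec m"
  shows "(u @\<^sub>v t) + c \<cdot>\<^sub>v (v @\<^sub>v w) = (u + c \<cdot>\<^sub>v v) @\<^sub>v (t + c \<cdot>\<^sub>v w)"
  using assms by (intro eq_vecI) auto

text \<open>With v nonzero the leading coordinate lies in the first block, and it stays there along
  the path. The values are therefore read off in that block; w and t move along but never influence
  them.\<close>

lemma path_block_sum_left:
  assumes "set ABs \<subseteq> carrier (GL k) \<times> carrier (GL m)"
    and "v \<in> carrier_vec k" "v \<noteq> 0\<^sub>v k" "u \<in> carrier_vec k" "w \<in> carrier_vec m" "t \<in> carrier_vec m"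
  shows "path pair_act pair_lam (map (\<lambda>(A, B). block_sum k m A B) ABs) (v @\<^sub>v w, u @\<^sub>v t) =
    path pair_act pair_lam (map fst ABs) (v, u)"
  using assms
proof (induction ABs arbitrary: v u w t)
  case (Cons AB ABs)
  obtain A B where AB: "AB = (A, B)" "A \<in> carrier (GL k)" "B \<in> carrier (GL m)"
    using Cons.prems(1) by auto
  note Am = GL_carrier_mat[OF AB(2)] and Bm = GL_carrier_mat[OF AB(3)]
  have c: "row_mult A v \<in> carrier_vec k" "row_mult A v \<noteq> 0\<^sub>v k" "row_mult A u \<in> carrier_vec k"
      "row_mult B w \<in> carrier_vec m" "row_mult B t \<in> carrier_vec m"
    using Cons.prems Am Bm AB by (auto intro!: row_mult_closed simp: row_mult_nonzero)
  have rm: "row_mult (block_sum k m A B) (v @\<^sub>v w) = row_mult A v @\<^sub>v row_mult B w"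
      "row_mult (block_sum k m A B) (u @\<^sub>v t) = row_mult A u @\<^sub>v row_mult B t"
    using Cons.prems Am Bm by (auto intro!: row_mult_block_sum)
  have lam: "pair_lam (block_sum k m A B) (v @\<^sub>v w, u @\<^sub>v t) = pair_lam A (v, u)"
    using c by (simp add: pair_lam_def rm lead_ratio_append)
  let ?l = "pair_lam A (v, u)"
  have act: "pair_act (block_sum k m A B) (v @\<^sub>v w, u @\<^sub>v t) =
      (row_mult A v @\<^sub>v row_mult B w,
       (row_mult A u + (- ?l) \<cdot>\<^sub>v row_mult A v) @\<^sub>v (row_mult B t + (- ?l) \<cdot>\<^sub>v row_mult B w))"
    unfolding pair_act_def prod.case lam rm using c by (simp add: append_add_smult_vec)
  have "path pair_act pair_lam (map (\<lambda>(A, B). block_sum k m A B) ABs)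
      (row_mult A v @\<^sub>v row_mult B w,
       (row_mult A u + (- ?l) \<cdot>\<^sub>v row_mult A v) @\<^sub>v (row_mult B t + (- ?l) \<cdot>\<^sub>v row_mult B w)) =
      path pair_act pair_lam (map fst ABs) (row_mult A v, row_mult A u + (- ?l) \<cdot>\<^sub>v row_mult A v)"
    by (rule Cons.IH) (use Cons.prems(1) c in auto)
  then show ?case
    by (simp add: AB(1) lam act) (simp add: pair_act_def)
qed simp

lemma path_block_sum_right:
  assumes "set ABs \<subseteq> carrier (GL k) \<times> carrier (GL m)"
    and "w \<in> carrier_vec m" "w \<noteq> 0\<^sub>v m" "u \<in> carrier_vec k" "t \<in> carrier_vec m"
  shows "path pair_act pair_lam (map (\<lambda>(A, B). block_sum k m A B) ABs) (0\<^sub>v k @\<^sub>v w, u @\<^sub>v t) =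
    path pair_act pair_lam (map snd ABs) (w, t)"
  using assms
proof (induction ABs arbitrary: u w t)
  case (Cons AB ABs)
  obtain A B where AB: "AB = (A, B)" "A \<in> carrier (GL k)" "B \<in> carrier (GL m)"
    using Cons.prems(1) by auto
  note Am = GL_carrier_mat[OF AB(2)] and Bm = GL_carrier_mat[OF AB(3)]
  have c: "row_mult B w \<in> carrier_vec m" "row_mult B w \<noteq> 0\<^sub>v m" "row_mult B t \<in> carrier_vec m"
      "row_mult A u \<in> carrier_vec k"
    using Cons.prems Am Bm AB by (auto intro!: row_mult_closed simp: row_mult_nonzero)
  have rm: "row_mult (block_sum k m A B) (0\<^sub>v k @\<^sub>v w) = 0\<^sub>v k @\<^sub>v row_mult B w"
      "row_mult (block_sum k m A B) (u @\<^sub>v t) = row_mult A u @\<^sub>v row_mult B t"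
    using Cons.prems Am Bm by (auto simp: row_mult_block_sum row_mult_zero)
  have lam: "pair_lam (block_sum k m A B) (0\<^sub>v k @\<^sub>v w, u @\<^sub>v t) = pair_lam B (w, t)"
    using c by (simp add: pair_lam_def rm lead_ratio_append_zero)
  let ?l = "pair_lam B (w, t)"
  have act: "pair_act (block_sum k m A B) (0\<^sub>v k @\<^sub>v w, u @\<^sub>v t) =
      (0\<^sub>v k @\<^sub>v row_mult B w,
       (row_mult A u + (- ?l) \<cdot>\<^sub>v 0\<^sub>v k) @\<^sub>v (row_mult B t + (- ?l) \<cdot>\<^sub>v row_mult B w))"
    unfolding pair_act_def prod.case lam rm using c by (simp add: append_add_smult_vec)
  have "path pair_act pair_lam (map (\<lambda>(A, B). block_sum k m A B) ABs)
      (0\<^sub>v k @\<^sub>v row_mult B w,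
       (row_mult A u + (- ?l) \<cdot>\<^sub>v 0\<^sub>v k) @\<^sub>v (row_mult B t + (- ?l) \<cdot>\<^sub>v row_mult B w)) =
      path pair_act pair_lam (map snd ABs) (row_mult B w, row_mult B t + (- ?l) \<cdot>\<^sub>v row_mult B w)"
    by (rule Cons.IH) (use Cons.prems(1) c in auto)
  then show ?case
    by (simp add: AB(1) lam act) (simp add: pair_act_def)
qed simp

text \<open>On block sums the path of \<open>(v \<oplus> w, u \<oplus> t)\<close> depends only on one of the pairs \<open>(v, u)\<close>,
  \<open>(w, t)\<close>, so the sum over the remaining free vectors is divisible by \<open>p\<close>.\<close>

lemma char_cochain_block_sum:
  fixes U :: "'p::prime_card mod_ring list \<Rightarrow> 'p mod_ring"
  assumes ABs: "set ABs \<subseteq> carrier (GL k) \<times> carrier (GL m)" and km: "k \<ge> 1" "m \<ge> 1"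
  shows "char_cochain U (k + m) (map (\<lambda>(A, B). block_sum k m A B) ABs) = 0"
proof -
  let ?V = "carrier_vec :: nat \<Rightarrow> 'p mod_ring vec set"
  let ?P = "lead_pairs :: nat \<Rightarrow> ('p mod_ring vec \<times> 'p mod_ring vec) set"
  let ?gs = "map (\<lambda>(A, B). block_sum k m A B) ABs"
  \<comment> \<open>\<open>f1\<close> covers the pairs whose first block v is nonzero, leaving w and
    t free; \<open>f2\<close> covers v = 0, leaving u free. The fibres have p^(2m) and p^k elements,
    both divisible by p because k and m are positive.\<close>
  define f1 where "f1 = (\<lambda>((v, u), (w, t)). (v @\<^sub>v w, u @\<^sub>v t) :: 'p mod_ring vec \<times> 'p mod_ring vec)"
  define f2 where "f2 = (\<lambda>((w, t), u). (0\<^sub>v k @\<^sub>v w, u @\<^sub>v t) :: 'p mod_ring vec \<times> 'p mod_ring vec)"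
  let ?A1 = "?P k \<times> (?V m \<times> ?V m)" and ?A2 = "?P m \<times> ?V k"
  have app: "v @\<^sub>v w = v' @\<^sub>v w' \<longleftrightarrow> v = v' \<and> w = w'"
    if "v \<in> ?V k" "v' \<in> ?V k" "w \<in> ?V m" "w' \<in> ?V m" for v v' w w'
    using that by (metis append_vec_eq)
  have app0: "v @\<^sub>v w = 0\<^sub>v (k + m) \<longleftrightarrow> v = 0\<^sub>v k \<and> w = 0\<^sub>v m" if "v \<in> ?V k" "w \<in> ?V m" for v w
  proof -
    have "0\<^sub>v (k + m) = 0\<^sub>v k @\<^sub>v (0\<^sub>v m :: 'p mod_ring vec)"
      by (intro eq_vecI) auto
    then show ?thesis
      using app[OF that(1) _ that(2), of "0\<^sub>v k" "0\<^sub>v m"] by simp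
  qed
  have split: "lead_pairs (k + m) = f1 ` ?A1 \<union> f2 ` ?A2"
  proof (intro equalityI subsetI)
    fix s assume "s \<in> ?P (k + m)"
    then obtain x z where s: "s = (x, z)" "x \<in> ?V (k + m)" "x \<noteq> 0\<^sub>v (k + m)" "z \<in> ?V (k + m)" "z $ lead_index x = 0"
      by (auto simp: lead_pairs_def)
    define v w u t where "v = vec_first x k" and "w = vec_last x m" and "u = vec_first z k" and "t = vec_last z m"
    have x: "x = v @\<^sub>v w" "z = u @\<^sub>v t"
      using s by (simp_all add: v_def w_def u_def t_def)
    have c: "v \<in> ?V k" "w \<in> ?V m" "u \<in> ?V k" "t \<in> ?V m"
      by (simp_all add: v_def w_def u_def t_def)
    show "s \<in> f1 ` ?A1 \<union> f2 ` ?A2"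
    proof (cases "v = 0\<^sub>v k")
      case False
      then have "((v, u), (w, t)) \<in> ?A1"
        using s(5) c lead_index[OF c(1) False] by (simp add: lead_pairs_def x lead_index_append)
      then show ?thesis
        by (intro UnI1 image_eqI[of _ _ "((v, u), (w, t))"]) (simp_all add: f1_def s x)
    next
      case True
      then have w: "w \<noteq> 0\<^sub>v m"
        using s(3) c by (simp add: x app0)
      then have "((w, t), u) \<in> ?A2"
        using s(5) c lead_index[OF c(2) w] by (simp add: lead_pairs_def x True lead_index_append_zero)
      then show ?thesis
        by (intro UnI2 image_eqI[of _ _ "((w, t), u)"]) (simp_all add: f2_def s x True)
    qed
  next
    fix s assume "s \<in> f1 ` ?A1 \<union> f2 ` ?A2"
    then show "s \<in> ?P (k + m)"
      using lead_index
      by (fastforce simp: f1_def f2_def lead_pairs_def app0 lead_index_append lead_index_append_zero)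
  qed
  have disj: "f1 ` ?A1 \<inter> f2 ` ?A2 = {}"
    by (auto simp: f1_def f2_def lead_pairs_def app)
  have inj1: "inj_on f1 ?A1"
    by (auto simp: inj_on_def f1_def lead_pairs_def app)
  have inj2: "inj_on f2 ?A2"
    by (auto simp: inj_on_def f2_def lead_pairs_def app)
  have fin: "finite ?A1" "finite ?A2"
    by (simp_all add: finite_lead_pairs finite_carrier_vec)
  have "char_cochain U (k + m) ?gs =
      (\<Sum>s\<in>?A1. U (path pair_act pair_lam ?gs (f1 s))) + (\<Sum>s\<in>?A2. U (path pair_act pair_lam ?gs (f2 s)))"
    unfolding char_cochain_def split using fin disj
    by (subst sum.union_disjoint) (auto simp: sum.reindex[OF inj1] sum.reindex[OF inj2])
  also have "(\<Sum>s\<in>?A1. U (path pair_act pair_lam ?gs (f1 s))) =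
      (\<Sum>s\<in>?A1. U (path pair_act pair_lam (map fst ABs) (fst s)))"
    by (intro sum.cong refl) (auto simp: f1_def lead_pairs_def path_block_sum_left[OF ABs])
  also have "\<dots> = (\<Sum>s\<in>?P k. \<Sum>z\<in>?V m \<times> ?V m. U (path pair_act pair_lam (map fst ABs) s))"
    by (simp add: sum.cartesian_product split_beta del: sum_constant)
  also have "\<dots> = 0"
    using km by (simp add: card_cartesian_product card_carrier_vec)
  also have "(\<Sum>s\<in>?A2. U (path pair_act pair_lam ?gs (f2 s))) =
      (\<Sum>s\<in>?A2. U (path pair_act pair_lam (map snd ABs) (fst s)))"
    by (intro sum.cong refl) (auto simp: f2_def lead_pairs_def path_block_sum_right[OF ABs])
  also have "\<dots> = (\<Sum>s\<in>?P m. \<Sum>z\<in>?V k. U (path pair_act pair_lam (map snd ABs) s))"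
    by (simp add: sum.cartesian_product split_beta del: sum_constant)
  also have "\<dots> = 0"
    using km by (simp add: card_carrier_vec)
  finally show ?thesis
    by simp
qed

lemma block_sum_carrier:
  "A \<in> carrier_mat k k \<Longrightarrow> B \<in> carrier_mat m m \<Longrightarrow> block_sum k m A B \<in> carrier_mat (k + m) (k + m)"
  by (simp add: block_sum_def)

lemma block_sum_mult:
  assumes "A \<in> carrier_mat k k" "A' \<in> carrier_mat k k" "B \<in> carrier_mat m m" "B' \<in> carrier_mat m m"
  shows "block_sum k m A B * block_sum k m A' B' = block_sum k m (A * A') (B * B')"
  unfolding block_sum_def
  by (subst mult_four_block_mat[OF assms(1) zero_carrier_mat zero_carrier_mat assms(3)
        assms(2) zero_carrier_mat zero_carrier_mat assms(4)]) (use assms in simp)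

lemma block_sum_one: "block_sum k m (1\<^sub>m k) (1\<^sub>m m) = 1\<^sub>m (k + m)"
  by (simp add: block_sum_def four_block_one_mat)

lemma block_sum_GL:
  assumes "A \<in> carrier (GL k)" "B \<in> carrier (GL m)"
  shows "block_sum k m A B \<in> carrier (GL (k + m))"
proof -
  obtain A' B' where "A' \<in> carrier_mat k k" "A * A' = 1\<^sub>m k" "A' * A = 1\<^sub>m k"
      "B' \<in> carrier_mat m m" "B * B' = 1\<^sub>m m" "B' * B = 1\<^sub>m m"
    using assms by (auto simp: GL_carrier)
  then show ?thesis
    using assms by (auto simp: GL_carrier block_sum_carrier block_sum_mult block_sum_one
        intro!: bexI[of _ "block_sum k m A' B'"])
qed

lemma block_sum_0_left:
  assumes "A \<in> carrier_mat 0 0" "B \<in> carrier_mat m m"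
  shows "block_sum 0 m A B = B"
  using assms by (intro eq_matI) (auto simp: block_sum_def)

lemma block_sum_0_right:
  assumes "A \<in> carrier_mat k k" "B \<in> carrier_mat 0 0"
  shows "block_sum k 0 A B = A"
  using assms by (intro eq_matI) (auto simp: block_sum_def)

text \<open>Vertices bound nothing: both faces of [x] are the vertex of the same component, with
  opposite signs, and longer symbols have no vertex among their faces.\<close>

lemma union_boundary_lookup_Nil:
  fixes b :: "nat \<times> 'g list \<Rightarrow>\<^sub>0 'k::comm_ring_1"
  assumes "b \<in> union_boundaries G"
  shows "Poly_Mapping.lookup b (k, []) = 0"
proof -
  obtain e where e: "b = lin_ext (union_boundary G) e"
    using assms by (auto simp: union_boundaries_def)
  let ?u = "\<lambda>s. if s = (k, []) then 1 else (0 :: 'k)"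
  have "evaluate ?u (union_boundary G s) = 0" for s
  proof -
    obtain m xs where s: "s = (m, xs)"
      by (cases s)
    let ?v = "\<lambda>z. if (m, z) = (k, []) then 1 else (0 :: 'k)"
    have "evaluate ?v (bar_boundary (G m) xs) = 0"
    proof (cases xs)
      case (Cons x w)
      show ?thesis
      proof (cases w)
        case Nil
        then show ?thesis
          by (simp add: Cons evaluate_bar_boundary_Cons)
      next
        case (Cons y w')
        then show ?thesis
          using keys_bar_boundary_length[of _ "G m" xs] \<open>xs = x # w\<close>
          by (intro evaluate_eq_0) fastforce
      qed
    qed simp
    then show ?thesis
      by (simp add: s evaluate_union_boundary)
  qed
  then have "evaluate ?u b = 0"
    by (simp add: e evaluate_lin_ext)
  then show ?thesis
    by (simp only: evaluate_indicator)
qed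

text \<open>The functional \<open>?X\<close> is zero on boundaries and on every product of two
  representatives of positive classes, hence on all chains in members of the ideal product, whereas
  \<open>detect\<close> says it is nonzero on \<open>a\<close>.\<close>

lemma indecomposable_criterion:
  fixes G :: "nat \<Rightarrow> 'g monoid" and R :: "nat \<Rightarrow> 'g \<Rightarrow> 'p::prime_card mod_ring mat"
    and a :: "nat \<times> 'g list \<Rightarrow>\<^sub>0 'p mod_ring"
  assumes monoid: "\<And>k. monoid (G k)"
    and closed: "\<And>k g. g \<in> carrier (G k) \<Longrightarrow> R k g \<in> carrier (GL k)"
    and hom: "\<And>k g h. g \<in> carrier (G k) \<Longrightarrow> h \<in> carrier (G k) \<Longrightarrow> R k (g \<otimes>\<^bsub>G k\<^esub> h) = R k g * R k h"
    and one: "\<And>k. R k \<one>\<^bsub>G k\<^esub> = 1\<^sub>m k"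
    and sum: "\<And>k m g h. g \<in> carrier (G k) \<Longrightarrow> h \<in> carrier (G m) \<Longrightarrow>
      R (k + m) (\<phi> k m g h) = block_sum k m (R k g) (R m h)"
    and cocycle: "\<And>xs. evaluate U (bar_boundary fp_add xs) = 0"
    and normalised: "\<And>xs. 0 \<in> set xs \<Longrightarrow> U xs = 0"
    and a: "a \<in> union_cycles G"
    and detect: "evaluate (\<lambda>(k, xs). char_cochain U k (map (R k) xs)) a \<noteq> 0"
  shows "indecomposable G \<phi> (coset_of (union_boundaries G) a)"
proof -
  let ?X = "\<lambda>(k, xs). char_cochain U k (map (R k) xs)"
  let ?N = "union_boundaries G :: (nat \<times> 'g list \<Rightarrow>\<^sub>0 'p mod_ring) set"
  let ?H = "homology_ring G (+) 0 \<phi>"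
  let ?I = "positive_ideal G :: (nat \<times> 'g list \<Rightarrow>\<^sub>0 'p mod_ring) set set"
  have boundary: "evaluate ?X b = 0" if b: "b \<in> ?N" for b
  proof -
    obtain e where e: "e \<in> union_chains G" "b = lin_ext (union_boundary G) e"
      using b by (auto simp: union_boundaries_def)
    have "evaluate ?X (union_boundary G s) = 0" if s: "s \<in> Poly_Mapping.keys e" for s
    proof -
      obtain k xs where kx: "s = (k, xs)"
        by (cases s)
      have "set xs \<subseteq> carrier (G k)"
        using e(1) s kx by (simp add: union_chains_iff)
      then have "evaluate (\<lambda>gs. char_cochain U k (map (R k) gs)) (bar_boundary (G k) xs) = 0"
        by (intro char_cochain_cocycle closed hom cocycle) auto
      then show ?thesis
        by (simp add: kx evaluate_union_boundary)
    qed
    then show ?thesis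
      by (simp add: e evaluate_lin_ext evaluate_eq_0)
  qed
  \<comment> \<open>Each letter of the product is a block sum. If both indices are positive,
    \<open>char_cochain_block_sum\<close> applies; if one is 0, that factor has a letter, whose 0 x
    0 matrix beside an identity block is an identity matrix.\<close>
  have simplex: "evaluate ?X (simplex_product G (+) \<phi> (k, xs) (m, ys)) = 0"
    if kx: "k \<ge> 1 \<or> xs \<noteq> []" and my: "m \<ge> 1 \<or> ys \<noteq> []"
      and xs: "set xs \<subseteq> carrier (G k)" and ys: "set ys \<subseteq> carrier (G m)" for k xs m ys
  proof (rule evaluate_eq_0)
    fix s assume s: "s \<in> Poly_Mapping.keys (simplex_product G (+) \<phi> (k, xs) (m, ys) :: _ \<Rightarrow>\<^sub>0 'p mod_ring)"
    obtain n z where nz: "s = (n, z)"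
      by (cases s)
    note oc = monoid.one_closed[OF monoid]
    from keys_simplex_product[OF s[unfolded nz]] have n: "n = k + m"
      and z: "set z = (\<lambda>g. \<phi> k m g \<one>\<^bsub>G m\<^esub>) ` set xs \<union> (\<lambda>h. \<phi> k m \<one>\<^bsub>G k\<^esub> h) ` set ys"
      by auto
    have "\<exists>AB\<in>carrier (GL k) \<times> carrier (GL m). R n t = (\<lambda>(A, B). block_sum k m A B) AB" if t: "t \<in> set z" for t
    proof -
      consider g where "g \<in> set xs" "t = \<phi> k m g \<one>\<^bsub>G m\<^esub>" | h where "h \<in> set ys" "t = \<phi> k m \<one>\<^bsub>G k\<^esub> h"
        using t z by blast
      then show ?thesis
      proof cases
        case (1 g)
        then have "R n t = block_sum k m (R k g) (R m \<one>\<^bsub>G m\<^esub>)" "g \<in> carrier (G k)"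
          using xs oc by (auto simp: n intro!: sum)
        then show ?thesis
          by (intro bexI[of _ "(R k g, R m \<one>\<^bsub>G m\<^esub>)"]) (simp_all add: closed oc)
      next
        case (2 h)
        then have "R n t = block_sum k m (R k \<one>\<^bsub>G k\<^esub>) (R m h)" "h \<in> carrier (G m)"
          using ys oc by (auto simp: n intro!: sum)
        then show ?thesis
          by (intro bexI[of _ "(R k \<one>\<^bsub>G k\<^esub>, R m h)"]) (simp_all add: closed oc)
      qed
    qed
    then have "\<forall>t\<in>set z. \<exists>AB. AB \<in> carrier (GL k) \<times> carrier (GL m) \<and> R n t = (\<lambda>(A, B). block_sum k m A B) AB"
      by blast
    from bchoice[OF this] obtain f where f: "\<And>t. t \<in> set z \<Longrightarrow> f t \<in> carrier (GL k) \<times> carrier (GL m)"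
        "\<And>t. t \<in> set z \<Longrightarrow> R n t = (\<lambda>(A, B). block_sum k m A B) (f t)"
      by blast
    have mapz: "map (R n) z = map (\<lambda>(A, B). block_sum k m A B) (map f z)"
      using f(2) by simp
    have GLz: "set (map (R n) z) \<subseteq> carrier (GL n)"
      using f block_sum_GL by (fastforce simp: n)
    have "char_cochain U n (map (R n) z) = 0"
    proof (cases "k \<ge> 1 \<and> m \<ge> 1")
      case True
      have "set (map f z) \<subseteq> carrier (GL k) \<times> carrier (GL m)"
        unfolding set_map using f(1) by (intro image_subsetI)
      with True show ?thesis
        unfolding mapz unfolding n by (intro char_cochain_block_sum) auto
    next
      case False
      have "1\<^sub>m n \<in> set (map (R n) z)"
      proof (cases "k = 0")
        case True
        then obtain g where g: "g \<in> set xs"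
          using kx by (cases xs) auto
        have "R n (\<phi> k m g \<one>\<^bsub>G m\<^esub>) = block_sum k m (R k g) (R m \<one>\<^bsub>G m\<^esub>)"
          unfolding n by (rule sum) (use g xs oc in auto)
        also have "\<dots> = 1\<^sub>m n"
          using block_sum_0_left[of "R k g" "1\<^sub>m m" m] closed[of g k] g xs
          by (auto simp: True one n dest: GL_carrier_mat)
        finally show ?thesis
          using g z by force
      next
        case False
        with \<open>\<not> (k \<ge> 1 \<and> m \<ge> 1)\<close> have m: "m = 0"
          by simp
        then obtain h where h: "h \<in> set ys"
          using my by (cases ys) auto
        have "R n (\<phi> k m \<one>\<^bsub>G k\<^esub> h) = block_sum k m (R k \<one>\<^bsub>G k\<^esub>) (R m h)"
          unfolding n by (rule sum) (use h ys oc in auto)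
        also have "\<dots> = 1\<^sub>m n"
          using block_sum_0_right[of "1\<^sub>m k" k "R m h"] closed[of h m] h ys
          by (auto simp: m one n dest: GL_carrier_mat)
        finally show ?thesis
          using h z by force
      qed
      then show ?thesis
        using GLz by (intro char_cochain_one normalised)
    qed
    then show "?X s = 0"
      by (simp add: nz)
  qed
  \<comment> \<open>Adding a boundary to a representative can bring in simplices over the index 0,
    but never the vertex there, by \<open>union_boundary_lookup_Nil\<close>.\<close>
  have keys_pos: "(k \<ge> 1 \<or> xs \<noteq> []) \<and> set xs \<subseteq> carrier (G k)"
    if A: "A \<in> ?I" "c \<in> A" "(k, xs) \<in> Poly_Mapping.keys c" for A c k xs
  proof -
    obtain b c' where bc: "b \<in> ?N" "c' \<in> union_cycles G" "Poly_Mapping.keys c' \<subseteq> {k. k \<ge> 1} \<times> UNIV" "c = b + c'"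
      using A by (auto simp: positive_ideal_def)
    have "k \<ge> 1" if "xs = []"
    proof (rule ccontr)
      assume "\<not> k \<ge> 1"
      then have "(k, xs) \<notin> Poly_Mapping.keys c'"
        using bc(3) by auto
      then have "Poly_Mapping.lookup c (k, xs) = 0"
        using union_boundary_lookup_Nil[OF bc(1), of k] that by (simp add: bc(4) lookup_add in_keys_iff)
      then show False
        using A(3) by (simp add: in_keys_iff)
    qed
    moreover have "c \<in> union_chains G"
    proof -
      have "b \<in> union_chains G"
        using bc(1) union_boundary_in_chains[OF monoid] by (auto simp: union_boundaries_def)
      then show ?thesis
        using bc(2) unfolding bc(4) by (auto simp: union_cycles_def union_chains_def intro: chains_on_add)
    qed
    ultimately show ?thesis
      using A(3) by (auto simp: union_chains_iff)
  qed
  \<comment> \<open>Quantifying over every chain in the class allows induction on the ideal product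
    straight from the set-theoretic definitions of product and sum in the quotient.\<close>
  have ideal: "\<forall>c\<in>A. evaluate ?X c = 0" if "A \<in> ideal_prod ?H ?I ?I" for A
    using that
  proof induction
    case (prod A B)
    show ?case
    proof
      fix c :: "nat \<times> 'g list \<Rightarrow>\<^sub>0 'p mod_ring" assume "c \<in> A \<otimes>\<^bsub>?H\<^esub> B"
      moreover have "A \<otimes>\<^bsub>?H\<^esub> B =
          (\<Union>x\<in>A. \<Union>y\<in>B. coset_of ?N (bilin_ext (simplex_product G (+) \<phi>) x y))"
        by (simp add: homology_ring_def FactRing_def rcoset_mult_def homology_ring_coset)
           (simp add: union_cycle_ring_def)
      ultimately obtain x y b where xy: "x \<in> A" "y \<in> B" "b \<in> ?N"
          "c = b + bilin_ext (simplex_product G (+) \<phi>) x y"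
        by (auto simp: coset_of_def)
      have "evaluate ?X (bilin_ext (simplex_product G (+) \<phi>) x y) = 0"
        unfolding evaluate_bilin_ext
      proof (rule evaluate_eq_0, rule evaluate_eq_0)
        fix s t assume st: "s \<in> Poly_Mapping.keys x" "t \<in> Poly_Mapping.keys y"
        obtain k xs m ys where kxmy: "s = (k, xs)" "t = (m, ys)"
          by (cases s, cases t)
        then show "evaluate ?X (simplex_product G (+) \<phi> s t) = 0"
          using keys_pos[OF prod(1) xy(1), of k xs] keys_pos[OF prod(2) xy(2), of m ys] st
          unfolding kxmy by (intro simplex) auto
      qed
      then show "evaluate ?X c = 0"
        using boundary[OF xy(3)] by (simp add: xy(4) evaluate_add)
    qed
  next
    case (sum A B)
    show ?case
    proof
      fix c :: "nat \<times> 'g list \<Rightarrow>\<^sub>0 'p mod_ring" assume "c \<in> A \<oplus>\<^bsub>?H\<^esub> B"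
      then obtain x y where "x \<in> A" "y \<in> B" "c = x + y"
        by (auto simp: homology_ring_def FactRing_def set_add_def set_mult_def union_cycle_ring_def)
      then show "evaluate ?X c = 0"
        using sum by (simp add: evaluate_add)
    qed
  qed
  have "a \<in> coset_of ?N a"
    by (rule coset_of_self[OF union_boundaries_zero])
  with ideal detect have "coset_of ?N a \<notin> ideal_prod ?H ?I ?I"
    by blast
  moreover have "coset_of ?N a \<in> carrier ?H"
    unfolding homology_ring_carrier using a by (rule imageI)
  ultimately show ?thesis
    unfolding indecomposable_def by blast
qed

section \<open>Automorphisms of free groups and abelianization\<close>

context
  notes One_nat_def [simp del]
begin

lemma exponent_sum_Nil [simp]: "exponent_sum s [] = 0"
  by (simp add: exponent_sum_def)

lemma exponent_sum_Cons: "exponent_sum s (a # w) = exponent_sum s [a] + exponent_sum s w"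
  by (simp add: exponent_sum_def)

lemma exponent_sum_letter_inv: "exponent_sum s [letter_inv a] = - exponent_sum s [a]"
  by (cases a) (simp add: exponent_sum_def letter_inv_def)

lemma exponent_sum_cons_reduced: "exponent_sum s (cons_reduced a w) = exponent_sum s [a] + exponent_sum s w"
proof (cases w)
  case (Cons b v)
  then show ?thesis
    using exponent_sum_Cons[of s a w] exponent_sum_Cons[of s b v]
    by (simp add: exponent_sum_letter_inv)
qed simp

text \<open>Cancelling a letter against its inverse leaves exponent sums unchanged, so they are
  additive on products of reduced words.\<close>

lemma exponent_sum_foldr: "exponent_sum s (foldr cons_reduced u v) = exponent_sum s u + exponent_sum s v"
proof (induction u)
  case (Cons a u)
  then show ?case
    using exponent_sum_Cons[of s a u] by (simp add: exponent_sum_cons_reduced)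
qed simp

lemma exponent_sum_outside:
  assumes "s \<notin> fst ` set w"
  shows "exponent_sum s w = 0"
  using assms
proof (induction w)
  case (Cons a w)
  then show ?case
    by (subst exponent_sum_Cons) (cases a, auto simp: exponent_sum_def)
qed simp

lemma exponent_sum_map:
  assumes "inj f"
  shows "exponent_sum (f s) (map (\<lambda>(i, b). (f i, b)) w) = exponent_sum s w"
proof (induction w)
  case (Cons a w)
  have "exponent_sum (f s) [(\<lambda>(i, b). (f i, b)) a] = exponent_sum s [a]"
    using assms by (cases a) (auto simp: exponent_sum_def dest: injD)
  then show ?case
    using Cons exponent_sum_Cons[of s a w] exponent_sum_Cons[of "f s" "(\<lambda>(i, b). (f i, b)) a" "map (\<lambda>(i, b). (f i, b)) w"]
    by simp
qed simp

lemma reduced_Cons: "reduced (a # w) \<longleftrightarrow> (w = [] \<or> hd w \<noteq> letter_inv a) \<and> reduced w"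
  by (cases w) (auto simp: reduced_def)

lemma reduced_cons_reduced: "reduced w \<Longrightarrow> reduced (cons_reduced a w)"
  by (cases w) (auto simp: reduced_Cons) 

lemma set_cons_reduced: "set (cons_reduced a w) \<subseteq> insert a (set w)"
  by (cases w) auto

lemma foldr_cons_reduced_closed:
  assumes "reduced v" "fst ` set u \<subseteq> S" "fst ` set v \<subseteq> S"
  shows "reduced (foldr cons_reduced u v) \<and> fst ` set (foldr cons_reduced u v) \<subseteq> S"
  using assms(2)
proof (induction u)
  case (Cons a u)
  then have IH: "reduced (foldr cons_reduced u v)" "insert (fst a) (fst ` set (foldr cons_reduced u v)) \<subseteq> S"
    by auto
  have "fst ` set (cons_reduced a (foldr cons_reduced u v)) \<subseteq> fst ` insert a (set (foldr cons_reduced u v))"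
    by (rule image_mono[OF set_cons_reduced])
  then have "fst ` set (cons_reduced a (foldr cons_reduced u v)) \<subseteq> S"
    using IH(2) unfolding image_insert by (rule subset_trans)
  then show ?case
    using reduced_cons_reduced[OF IH(1), of a] by simp
qed (use assms in auto)

lemma free_group_on_simps:
  "carrier (free_group_on S) = {w. fst ` set w \<subseteq> S \<and> reduced w}"
  "u \<otimes>\<^bsub>free_group_on S\<^esub> v = foldr cons_reduced u v"
  "\<one>\<^bsub>free_group_on S\<^esub> = []"
  by (simp_all add: free_group_on_def)

lemma free_group_mult_closed:
  "u \<in> carrier (free_group_on S) \<Longrightarrow> v \<in> carrier (free_group_on S) \<Longrightarrow>
     u \<otimes>\<^bsub>free_group_on S\<^esub> v \<in> carrier (free_group_on S)"
  using foldr_cons_reduced_closed[of v u S] by (simp add: free_group_on_simps)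

lemma foldr_cons_reduced_Cons:
  assumes "reduced (a # w)"
  shows "foldr cons_reduced [a] w = a # w"
  using assms by (cases w) (auto simp: reduced_Cons)

lemma free_gen_in_carrier: "i \<in> S \<Longrightarrow> free_gen i \<in> carrier (free_group_on S)"
  by (simp add: free_group_on_simps free_gen_def reduced_def)

lemma aut_free_carrier:
  "\<alpha> \<in> carrier (aut_free k) \<longleftrightarrow> \<alpha> \<in> hom (free_group k) (free_group k) \<and> \<alpha> \<in> Bij (carrier (free_group k))"
  by (simp add: aut_free_def AutoGroup_def auto_def)

lemma aut_free_mult:
  assumes "\<alpha> \<in> carrier (aut_free k)" "\<beta> \<in> carrier (aut_free k)"
  shows "\<alpha> \<otimes>\<^bsub>aut_free k\<^esub> \<beta> = compose (carrier (free_group k)) \<alpha> \<beta>"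
  using assms by (simp add: aut_free_carrier) (simp add: aut_free_def AutoGroup_def BijGroup_def)

lemma aut_free_one: "\<one>\<^bsub>aut_free k\<^esub> = (\<lambda>w\<in>carrier (free_group k). w)"
  by (simp add: aut_free_def AutoGroup_def BijGroup_def)

lemma aut_free_closed:
  assumes "\<alpha> \<in> carrier (aut_free k)" "w \<in> carrier (free_group k)"
  shows "\<alpha> w \<in> carrier (free_group k)"
  using assms by (auto simp: aut_free_carrier hom_def)

lemma aut_free_hom:
  assumes "\<alpha> \<in> carrier (aut_free k)" "u \<in> carrier (free_group k)" "v \<in> carrier (free_group k)"
  shows "\<alpha> (u \<otimes>\<^bsub>free_group k\<^esub> v) = \<alpha> u \<otimes>\<^bsub>free_group k\<^esub> \<alpha> v"
  using assms by (auto simp: aut_free_carrier hom_def)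

lemma compose_in_aut_free:
  assumes "\<alpha> \<in> carrier (aut_free k)" "\<beta> \<in> carrier (aut_free k)"
  shows "compose (carrier (free_group k)) \<alpha> \<beta> \<in> carrier (aut_free k)"
proof -
  have "compose (carrier (free_group k)) \<alpha> \<beta> \<in> hom (free_group k) (free_group k)"
    using assms by (auto simp: hom_def compose_def free_group_mult_closed aut_free_closed aut_free_hom)
  then show ?thesis
    using assms compose_Bij unfolding aut_free_carrier by blast
qed

lemma id_in_aut_free: "(\<lambda>w\<in>carrier (free_group k). w) \<in> carrier (aut_free k)"
  by (auto simp: aut_free_carrier id_Bij hom_def free_group_mult_closed)

lemma aut_free_extensional: "\<alpha> \<in> carrier (aut_free k) \<Longrightarrow> \<alpha> \<in> extensional (carrier (free_group k))"
  by (simp add: aut_free_carrier Bij_imp_extensional)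

lemma aut_free_funcset: "\<alpha> \<in> carrier (aut_free k) \<Longrightarrow> \<alpha> \<in> carrier (free_group k) \<rightarrow> carrier (free_group k)"
  by (simp add: aut_free_carrier Bij_imp_funcset)

lemma aut_free_monoid: "monoid (aut_free k)"
proof (rule monoidI)
  fix \<alpha> \<beta> \<gamma> assume *: "\<alpha> \<in> carrier (aut_free k)" "\<beta> \<in> carrier (aut_free k)" "\<gamma> \<in> carrier (aut_free k)"
  show "\<alpha> \<otimes>\<^bsub>aut_free k\<^esub> \<beta> \<otimes>\<^bsub>aut_free k\<^esub> \<gamma> = \<alpha> \<otimes>\<^bsub>aut_free k\<^esub> (\<beta> \<otimes>\<^bsub>aut_free k\<^esub> \<gamma>)"
    using * by (simp add: aut_free_mult compose_in_aut_free) (auto simp: compose_def aut_free_closed)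
qed (auto simp: aut_free_mult compose_in_aut_free aut_free_one id_in_aut_free
    intro!: Id_compose compose_Id aut_free_extensional aut_free_funcset)

text \<open>The inverse bijection, restricted to the carrier, is again a homomorphism. Its matrix
  inverts that of \<alpha>, which puts \<open>abelianize\<close> into \<open>GL\<close>.\<close>

lemma aut_free_inverse:
  assumes "\<alpha> \<in> carrier (aut_free k)"
  shows "\<exists>\<beta>\<in>carrier (aut_free k). \<alpha> \<otimes>\<^bsub>aut_free k\<^esub> \<beta> = \<one>\<^bsub>aut_free k\<^esub> \<and> \<beta> \<otimes>\<^bsub>aut_free k\<^esub> \<alpha> = \<one>\<^bsub>aut_free k\<^esub>"
proof -
  let ?S = "carrier (free_group k)"
  define \<beta> where "\<beta> = restrict (inv_into ?S \<alpha>) ?S"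
  have bij: "bij_betw \<alpha> ?S ?S" and B: "\<alpha> \<in> Bij ?S"
    using assms by (auto simp: aut_free_carrier Bij_def)
  have \<beta>B: "\<beta> \<in> Bij ?S"
    unfolding \<beta>_def by (rule restrict_inv_into_Bij[OF B])
  have "\<beta> \<in> hom (free_group k) (free_group k)"
  proof (unfold hom_def, intro CollectI conjI ballI)
    show "\<beta> \<in> ?S \<rightarrow> ?S"
      by (rule Bij_imp_funcset[OF \<beta>B])
    fix u v assume uv: "u \<in> ?S" "v \<in> ?S"
    have "inv_into ?S \<alpha> (u \<otimes>\<^bsub>free_group k\<^esub> v) = inv_into ?S \<alpha> u \<otimes>\<^bsub>free_group k\<^esub> inv_into ?S \<alpha> v"
      by (rule Bij_inv_into_lemma[OF _ B _ uv]) (auto simp: aut_free_hom[OF assms] free_group_mult_closed)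
    then show "\<beta> (u \<otimes>\<^bsub>free_group k\<^esub> v) = \<beta> u \<otimes>\<^bsub>free_group k\<^esub> \<beta> v"
      using uv by (simp add: \<beta>_def free_group_mult_closed)
  qed
  with \<beta>B have \<beta>: "\<beta> \<in> carrier (aut_free k)"
    by (simp add: aut_free_carrier)
  have "compose ?S \<beta> \<alpha> = (\<lambda>w\<in>?S. w)"
    unfolding \<beta>_def by (rule Bij_compose_restrict_eq[OF B])
  moreover have "compose ?S \<alpha> \<beta> = (\<lambda>w\<in>?S. w)"
  proof (intro ext)
    fix w show "compose ?S \<alpha> \<beta> w = (\<lambda>w\<in>?S. w) w"
      using bij by (auto simp: compose_def \<beta>_def bij_betw_inv_into_right)
  qed
  ultimately show ?thesis
    using \<beta> assms by (intro bexI[of _ \<beta>]) (simp_all add: aut_free_mult aut_free_one)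
qed

text \<open>Both sides are additive in the word, which is split letter by letter. Since \<alpha> []
  equals its own square, its exponent sum is zero, and this gives the inverse letters from the
  generators.\<close>

lemma exponent_sum_aut:
  assumes \<alpha>: "\<alpha> \<in> carrier (aut_free k)" and w: "w \<in> carrier (free_group k)"
  shows "exponent_sum s (\<alpha> w) = (\<Sum>l\<in>{1..k}. exponent_sum s (\<alpha> (free_gen l)) * exponent_sum l w)"
  using w
proof (induction w)
  case Nil
  have nil: "[] \<in> carrier (free_group k)"
    by (simp add: free_group_on_simps reduced_def)
  have "\<alpha> [] = foldr cons_reduced (\<alpha> []) (\<alpha> [])"
    using aut_free_hom[OF \<alpha> nil nil] by (simp add: free_group_on_simps)
  then have "exponent_sum s (\<alpha> []) = exponent_sum s (\<alpha> []) + exponent_sum s (\<alpha> [])"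
    by (metis exponent_sum_foldr)
  then show ?case by simp
next
  case (Cons a w)
  have nil: "[] \<in> carrier (free_group k)"
    by (simp add: free_group_on_simps reduced_def)
  obtain t b where a: "a = (t, b)" "t \<in> {1..k}"
    using Cons.prems by (cases a) (auto simp: free_group_on_simps)
  have w: "w \<in> carrier (free_group k)" and la: "[(t, c)] \<in> carrier (free_group k)" for c
    using Cons.prems a by (auto simp: free_group_on_simps reduced_Cons) (simp add: reduced_def)
  have "a # w = [a] \<otimes>\<^bsub>free_group k\<^esub> w"
    using Cons.prems foldr_cons_reduced_Cons[of a w] by (simp add: free_group_on_simps)
  then have "\<alpha> (a # w) = foldr cons_reduced (\<alpha> [a]) (\<alpha> w)"
    using aut_free_hom[OF \<alpha> la w, of b] a by (simp add: free_group_on_simps)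
  then have e1: "exponent_sum s (\<alpha> (a # w)) = exponent_sum s (\<alpha> [a]) + exponent_sum s (\<alpha> w)"
    by (simp add: exponent_sum_foldr)
  have e2: "exponent_sum s (\<alpha> [a]) = exponent_sum s (\<alpha> (free_gen t)) * (if b then 1 else - 1)"
  proof (cases b)
    case True
    then show ?thesis by (simp add: a free_gen_def)
  next
    case False
    have "[(t, True)] \<otimes>\<^bsub>free_group k\<^esub> [(t, False)] = []"
      by (simp add: free_group_on_simps letter_inv_def)
    then have "\<alpha> [] = foldr cons_reduced (\<alpha> [(t, True)]) (\<alpha> [(t, False)])"
      using aut_free_hom[OF \<alpha> la la, of True False] by (simp add: free_group_on_simps)
    moreover have "exponent_sum s (\<alpha> []) = 0"
    proof -
      have "\<alpha> [] = foldr cons_reduced (\<alpha> []) (\<alpha> [])"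
        using aut_free_hom[OF \<alpha> nil nil] by (simp add: free_group_on_simps)
      then have "exponent_sum s (\<alpha> []) = exponent_sum s (\<alpha> []) + exponent_sum s (\<alpha> [])"
        by (metis exponent_sum_foldr)
      then show ?thesis by simp
    qed
    ultimately have "exponent_sum s (\<alpha> [(t, True)]) + exponent_sum s (\<alpha> [(t, False)]) = 0"
      by (simp add: exponent_sum_foldr)
    with False show ?thesis by (simp add: a free_gen_def)
  qed
  have e3: "exponent_sum l [a] = (if l = t then (if b then 1 else - 1) else 0)" for l
    by (simp add: a exponent_sum_def)
  have "(\<Sum>l\<in>{1..k}. exponent_sum s (\<alpha> (free_gen l)) * exponent_sum l (a # w)) =
      (\<Sum>l\<in>{1..k}. exponent_sum s (\<alpha> (free_gen l)) * exponent_sum l [a])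
      + (\<Sum>l\<in>{1..k}. exponent_sum s (\<alpha> (free_gen l)) * exponent_sum l w)"
    by (subst exponent_sum_Cons) (simp add: distrib_left sum.distrib)
  also have "(\<Sum>l\<in>{1..k}. exponent_sum s (\<alpha> (free_gen l)) * exponent_sum l [a]) =
      (\<Sum>l\<in>{1..k}. if l = t then exponent_sum s (\<alpha> (free_gen t)) * (if b then 1 else - 1) else 0)"
    by (intro sum.cong refl) (simp add: e3)
  also have "\<dots> = exponent_sum s (\<alpha> [a])"
    using a(2) by (simp add: e2)
  also have "(\<Sum>l\<in>{1..k}. exponent_sum s (\<alpha> (free_gen l)) * exponent_sum l w) = exponent_sum s (\<alpha> w)"
    using Cons.IH[OF w] by simp
  finally show ?case
    by (simp add: e1)
qed

lemma abelianize_carrier: "abelianize k \<alpha> \<in> carrier_mat k k"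
  by (simp add: abelianize_def)

lemma abelianize_mult:
  assumes "\<alpha> \<in> carrier (aut_free k)" "\<beta> \<in> carrier (aut_free k)"
  shows "abelianize k (\<alpha> \<otimes>\<^bsub>aut_free k\<^esub> \<beta>) = abelianize k \<alpha> * abelianize k \<beta>"
proof (rule eq_matI)
  fix i j assume "i < dim_row (abelianize k \<alpha> * abelianize k \<beta>)" "j < dim_col (abelianize k \<alpha> * abelianize k \<beta>)"
  then have ij: "i < k" "j < k"
    by (simp_all add: abelianize_def)
  have gen: "free_gen (j + 1) \<in> carrier (free_group k)"
    using ij by (intro free_gen_in_carrier) auto
  have "abelianize k (\<alpha> \<otimes>\<^bsub>aut_free k\<^esub> \<beta>) $$ (i, j) = exponent_sum (i + 1) (\<alpha> (\<beta> (free_gen (j + 1))))"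
    using ij gen by (simp add: abelianize_def aut_free_mult[OF assms] compose_def)
  also have "\<dots> = (\<Sum>l\<in>{1..k}. exponent_sum (i + 1) (\<alpha> (free_gen l)) * exponent_sum l (\<beta> (free_gen (j + 1))))"
    by (rule exponent_sum_aut[OF assms(1) aut_free_closed[OF assms(2) gen]])
  also have "\<dots> = (\<Sum>l<k. exponent_sum (i + 1) (\<alpha> (free_gen (l + 1))) * exponent_sum (l + 1) (\<beta> (free_gen (j + 1))))"
    by (rule sum.reindex_bij_witness[of _ "\<lambda>l. l + 1" "\<lambda>l. l - 1"]) auto
  also have "\<dots> = (abelianize k \<alpha> * abelianize k \<beta>) $$ (i, j)"
    using ij by (simp add: abelianize_def scalar_prod_def lessThan_atLeast0)
  finally show "abelianize k (\<alpha> \<otimes>\<^bsub>aut_free k\<^esub> \<beta>) $$ (i, j) = (abelianize k \<alpha> * abelianize k \<beta>) $$ (i, j)" .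
qed (simp_all add: abelianize_def)

lemma abelianize_one: "abelianize k \<one>\<^bsub>aut_free k\<^esub> = 1\<^sub>m k"
proof (rule eq_matI)
  fix i j assume "i < dim_row (1\<^sub>m k :: int mat)" "j < dim_col (1\<^sub>m k :: int mat)"
  then have ij: "i < k" "j < k" by auto
  then have "free_gen (j + 1) \<in> carrier (free_group k)"
    by (intro free_gen_in_carrier) auto
  then show "abelianize k \<one>\<^bsub>aut_free k\<^esub> $$ (i, j) = 1\<^sub>m k $$ (i, j)"
    using ij by (auto simp: abelianize_def aut_free_one free_gen_def exponent_sum_def)
qed (simp_all add: abelianize_def)

lemma abelianize_GL: "\<alpha> \<in> carrier (aut_free k) \<Longrightarrow> abelianize k \<alpha> \<in> carrier (GL k)"
  using aut_free_inverse[of \<alpha> k] unfolding GL_carrier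
  by (metis abelianize_carrier abelianize_mult abelianize_one)

lemma abelianize_aut_sum:
  assumes \<alpha>: "\<alpha> \<in> carrier (aut_free k)" and \<beta>: "\<beta> \<in> carrier (aut_free m)"
  shows "abelianize (k + m) (aut_sum k m \<alpha> \<beta>) = block_sum k m (abelianize k \<alpha>) (abelianize m \<beta>)"
proof (rule eq_matI)
  fix i j assume "i < dim_row (block_sum k m (abelianize k \<alpha>) (abelianize m \<beta>))"
    "j < dim_col (block_sum k m (abelianize k \<alpha>) (abelianize m \<beta>))"
  then have ij: "i < k + m" "j < k + m"
    by (simp_all add: block_sum_def abelianize_def)
  let ?f = "\<lambda>i. if i \<le> k then \<alpha> (free_gen i) else map (\<lambda>(j, b). (j + k, b)) (\<beta> (free_gen (i - k)))"
  have gen: "free_gen (j + 1) \<in> carrier (free_group (k + m))"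
    using ij by (intro free_gen_in_carrier) auto
  \<comment> \<open>Extending to a one-letter word multiplies the image by the empty word, which
    might reduce it again; exponent sums are unaffected.\<close>
  have "aut_sum k m \<alpha> \<beta> (free_gen (j + 1)) = foldr cons_reduced (?f (j + 1)) []"
    using gen by (simp add: aut_sum_def free_extend_def free_gen_def free_group_on_simps)
  then have e: "exponent_sum (i + 1) (aut_sum k m \<alpha> \<beta> (free_gen (j + 1))) = exponent_sum (i + 1) (?f (j + 1))"
    by (simp add: exponent_sum_foldr)
  have "exponent_sum (i + 1) (?f (j + 1)) = block_sum k m (abelianize k \<alpha>) (abelianize m \<beta>) $$ (i, j)"
  proof (cases "j < k")
    case True
    have "\<alpha> (free_gen (j + 1)) \<in> carrier (free_group k)"
      using True by (intro aut_free_closed[OF \<alpha>] free_gen_in_carrier) auto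
    then have "exponent_sum (i + 1) (\<alpha> (free_gen (j + 1))) = 0" if "i \<ge> k"
      using that by (intro exponent_sum_outside) (auto simp: free_group_on_simps)
    with True ij show ?thesis
      by (auto simp: block_sum_def abelianize_def)
  next
    case False
    have c: "\<beta> (free_gen (j + 1 - k)) \<in> carrier (free_group m)"
      using False ij by (intro aut_free_closed[OF \<beta>] free_gen_in_carrier) auto
    let ?w = "map (\<lambda>(j, b). (j + k, b)) (\<beta> (free_gen (j + 1 - k)))"
    have lt: "exponent_sum (i + 1) ?w = 0" if "i < k"
      using that c by (intro exponent_sum_outside) (fastforce simp: free_group_on_simps)
    have ge: "exponent_sum (i + 1) ?w = exponent_sum (i + 1 - k) (\<beta> (free_gen (j + 1 - k)))" if "k \<le> i"
      using exponent_sum_map[of "\<lambda>j. j + k" "i + 1 - k" "\<beta> (free_gen (j + 1 - k))"] that by (simp add: inj_def)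
    have blk: "block_sum k m (abelianize k \<alpha>) (abelianize m \<beta>) $$ (i, j) =
        (if i < k then 0 else exponent_sum (i - k + 1) (\<beta> (free_gen (j - k + 1))))"
      using False ij by (auto simp: block_sum_def abelianize_def)
    have f: "?f (j + 1) = ?w"
      using False by simp
    have jk: "j + 1 - k = j - k + 1"
      using False by simp
    show ?thesis
    proof (cases "i < k")
      case True
      then show ?thesis
        unfolding f lt[OF True] blk by simp
    next
      case False
      then have ik: "k \<le> i" "i + 1 - k = i - k + 1"
        by simp_all
      have "exponent_sum (i + 1) ?w = exponent_sum (i - k + 1) (\<beta> (free_gen (j - k + 1)))"
        using ge[OF ik(1)] unfolding ik(2) jk .
      then show ?thesis
        unfolding f blk using False by (simp only: if_False)
    qed
  qed
  then show "abelianize (k + m) (aut_sum k m \<alpha> \<beta>) $$ (i, j) =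
      block_sum k m (abelianize k \<alpha>) (abelianize m \<beta>) $$ (i, j)"
    using ij e by (simp add: abelianize_def)
qed (simp_all add: abelianize_def block_sum_def)

section \<open>Permutations of the generators\<close>

lemma map_cons_reduced:
  assumes "inj f"
  shows "map (\<lambda>(i, b). (f i, b)) (cons_reduced a w) =
    cons_reduced ((\<lambda>(i, b). (f i, b)) a) (map (\<lambda>(i, b). (f i, b)) w)"
  using assms by (cases w; cases a) (auto simp: letter_inv_def dest: injD)

lemma map_foldr_cons_reduced:
  assumes "inj f"
  shows "map (\<lambda>(i, b). (f i, b)) (foldr cons_reduced u v) =
    foldr cons_reduced (map (\<lambda>(i, b). (f i, b)) u) (map (\<lambda>(i, b). (f i, b)) v)"
  by (induction u) (simp_all add: map_cons_reduced[OF assms])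

lemma reduced_map:
  assumes "inj f"
  shows "reduced (map (\<lambda>(i, b). (f i, b)) w) \<longleftrightarrow> reduced w"
proof (induction w)
  case (Cons a w)
  have "w = [] \<or> hd (map (\<lambda>(i, b). (f i, b)) w) \<noteq> letter_inv ((\<lambda>(i, b). (f i, b)) a) \<longleftrightarrow>
      w = [] \<or> hd w \<noteq> letter_inv a"
    using assms by (cases w; cases a) (auto simp: letter_inv_def dest: injD)
  with Cons show ?case
    by (simp add: reduced_Cons)
qed (simp add: reduced_def)

lemma perm_aut_closed:
  assumes "\<sigma> permutes {1..k}" "w \<in> carrier (free_group k)"
  shows "map (\<lambda>(i, b). (\<sigma> i, b)) w \<in> carrier (free_group k)"
proof -
  have "fst ` set (map (\<lambda>(i, b). (\<sigma> i, b)) w) = \<sigma> ` fst ` set w"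
    by (force simp: image_image)
  also have "\<dots> \<subseteq> {1..k}"
    using assms permutes_image[OF assms(1)] by (auto simp: free_group_on_simps)
  finally show ?thesis
    using assms reduced_map[OF permutes_inj[OF assms(1)]] by (simp add: free_group_on_simps)
qed

lemma perm_aut_mult:
  assumes "\<sigma> permutes {1..k}" "\<tau> permutes {1..k}"
  shows "perm_aut k (\<sigma> \<circ> \<tau>) = compose (carrier (free_group k)) (perm_aut k \<sigma>) (perm_aut k \<tau>)"
  using assms by (auto simp: perm_aut_def compose_def perm_aut_closed split_beta intro!: ext)

lemma perm_aut_in_aut_free:
  assumes "\<sigma> permutes {1..k}"
  shows "perm_aut k \<sigma> \<in> carrier (aut_free k)"
proof -
  let ?S = "carrier (free_group k)"
  note inv = permutes_inv[OF assms]
  have "perm_aut k \<sigma> \<in> hom (free_group k) (free_group k)"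
    by (auto simp: hom_def perm_aut_def perm_aut_closed[OF assms] free_group_mult_closed)
       (simp add: free_group_on_simps map_foldr_cons_reduced[OF permutes_inj[OF assms]])
  moreover have "bij_betw (perm_aut k \<sigma>) ?S ?S"
  proof (rule bij_betw_byWitness[where f' = "perm_aut k (inv_into UNIV \<sigma>)"])
    show "\<forall>w\<in>?S. perm_aut k (inv_into UNIV \<sigma>) (perm_aut k \<sigma> w) = w"
      using assms by (auto simp: perm_aut_def perm_aut_closed split_beta permutes_inverses intro!: map_idI)
    show "\<forall>w\<in>?S. perm_aut k \<sigma> (perm_aut k (inv_into UNIV \<sigma>) w) = w"
      using assms inv by (auto simp: perm_aut_def perm_aut_closed split_beta permutes_inverses intro!: map_idI)
  qed (use assms inv in \<open>auto simp: perm_aut_def perm_aut_closed\<close>)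
  ultimately show ?thesis
    by (simp add: aut_free_carrier Bij_def perm_aut_def)
qed

text \<open>Column j has its 1 in the row of the image of j, as for matrices of maps on columns; on
  rows this becomes v -> v o \<sigma>. The additions of 1 translate between matrix indices and the
  points {1..k}.\<close>

definition perm_mat :: "nat \<Rightarrow> (nat \<Rightarrow> nat) \<Rightarrow> 'a::{zero,one} mat" where
  "perm_mat k \<sigma> = mat k k (\<lambda>(i, j). if \<sigma> (j + 1) = i + 1 then 1 else 0)"

lemma abelianize_perm_aut: "abelianize k (perm_aut k \<sigma>) = perm_mat k \<sigma>"
proof (rule eq_matI)
  fix i j assume "i < dim_row (perm_mat k \<sigma> :: int mat)" "j < dim_col (perm_mat k \<sigma> :: int mat)"
  then have ij: "i < k" "j < k"
    by (simp_all add: perm_mat_def)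
  then have "free_gen (j + 1) \<in> carrier (free_group k)"
    by (intro free_gen_in_carrier) auto
  then show "abelianize k (perm_aut k \<sigma>) $$ (i, j) = perm_mat k \<sigma> $$ (i, j)"
    using ij by (simp add: abelianize_def perm_aut_def perm_mat_def free_gen_def exponent_sum_def)
qed (simp_all add: abelianize_def perm_mat_def)

end

section \<open>Products of permutations and of matrices\<close>

context
  notes One_nat_def [simp del]
begin

lemma mult_add_less: "a < k \<Longrightarrow> b < m \<Longrightarrow> a * m + b < k * (m::nat)"
proof -
  assume *: "a < k" "b < m"
  have "a * m + b < Suc a * m"
    using * by simp
  also have "\<dots> \<le> k * m"
    using * by (intro mult_le_mono1) simp
  finally show ?thesis .
qed

lemma div_mod_less: "i < k * m \<Longrightarrow> i div m < k" "i < k * m \<Longrightarrow> i mod m < (m::nat)"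
  by (auto simp: less_mult_imp_div_less mult.commute intro!: mod_less_divisor gr0I)

lemma interval_Suc: "i \<in> {1..n::nat} \<Longrightarrow> \<exists>j. i = j + 1 \<and> j < n"
  by (intro exI[of _ "i - 1"]) auto

text \<open>The permutation transported from {1..k} to {0..<k}, where \<open>div\<close> and
  \<open>mod\<close> express the lexicographic order.\<close>

definition perm0 :: "(nat \<Rightarrow> nat) \<Rightarrow> nat \<Rightarrow> nat" where
  "perm0 \<sigma> j = \<sigma> (j + 1) - 1"

lemma permutes_perm0:
  assumes "\<sigma> permutes {1..k}" "j < k"
  shows "perm0 \<sigma> j < k" "\<sigma> (j + 1) = perm0 \<sigma> j + 1"
proof -
  have "\<sigma> (j + 1) \<in> {1..k}"
    using assms(2) permutes_in_image[OF assms(1), of "j + 1"] by simp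
  then show "perm0 \<sigma> j < k" "\<sigma> (j + 1) = perm0 \<sigma> j + 1"
    by (auto simp: perm0_def)
qed

lemma perm_product_perm0:
  assumes "j < k * m" "\<sigma> permutes {1..k}" "\<tau> permutes {1..m}"
  shows "perm_product k m \<sigma> \<tau> (j + 1) = perm0 \<sigma> (j div m) * m + perm0 \<tau> (j mod m) + 1"
    and "perm0 (perm_product k m \<sigma> \<tau>) j = perm0 \<sigma> (j div m) * m + perm0 \<tau> (j mod m)"
proof -
  note jm = div_mod_less[OF assms(1)]
  show *: "perm_product k m \<sigma> \<tau> (j + 1) = perm0 \<sigma> (j div m) * m + perm0 \<tau> (j mod m) + 1"
    using assms(1) permutes_perm0[OF assms(2) jm(1)] permutes_perm0[OF assms(3) jm(2)]
    by (simp add: perm_product_def)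
  then show "perm0 (perm_product k m \<sigma> \<tau>) j = perm0 \<sigma> (j div m) * m + perm0 \<tau> (j mod m)"
    by (simp add: perm0_def[of "perm_product k m \<sigma> \<tau>"])
qed

lemma perm_product_outside: "i \<notin> {1..k * m} \<Longrightarrow> perm_product k m \<sigma> \<tau> i = i"
  unfolding perm_product_def by (simp only: if_False)

lemma perm_product_comp:
  assumes "\<sigma> permutes {1..k}" "\<sigma>' permutes {1..k}" "\<tau> permutes {1..m}" "\<tau>' permutes {1..m}"
  shows "perm_product k m (\<sigma> \<circ> \<sigma>') (\<tau> \<circ> \<tau>') = perm_product k m \<sigma> \<tau> \<circ> perm_product k m \<sigma>' \<tau>'"
proof
  fix i
  show "perm_product k m (\<sigma> \<circ> \<sigma>') (\<tau> \<circ> \<tau>') i = (perm_product k m \<sigma> \<tau> \<circ> perm_product k m \<sigma>' \<tau>') i"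
  proof (cases "i \<in> {1..k * m}")
    case True
    then obtain j where j: "i = j + 1" "j < k * m"
      using interval_Suc[OF True] by blast
    note jm = div_mod_less[OF j(2)]
    note p = permutes_perm0[OF assms(2) jm(1)] permutes_perm0[OF assms(4) jm(2)]
    let ?j = "perm0 \<sigma>' (j div m) * m + perm0 \<tau>' (j mod m)"
    have j': "?j < k * m" "?j div m = perm0 \<sigma>' (j div m)" "?j mod m = perm0 \<tau>' (j mod m)"
      using p by (auto intro: mult_add_less)
    have "perm0 (\<sigma> \<circ> \<sigma>') (j div m) = perm0 \<sigma> (perm0 \<sigma>' (j div m))"
      "perm0 (\<tau> \<circ> \<tau>') (j mod m) = perm0 \<tau> (perm0 \<tau>' (j mod m))"
      using p unfolding perm0_def[of "\<sigma> \<circ> \<sigma>'"] perm0_def[of "\<tau> \<circ> \<tau>'"] by (simp_all add: perm0_def[of \<sigma>] perm0_def[of \<tau>])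
    then show ?thesis
      using perm_product_perm0(1)[OF j(2) permutes_compose[OF assms(2,1)] permutes_compose[OF assms(4,3)]]
        perm_product_perm0(1)[OF j(2) assms(2,4)] perm_product_perm0(1)[OF j'(1) assms(1,3)] j'(2,3)
      by (simp add: j(1))
  qed (simp add: perm_product_outside)
qed

lemma perm_product_id: "perm_product k m id id = id"
proof
  fix i
  show "perm_product k m id id i = id i"
  proof (cases "i \<in> {1..k * m}")
    case True
    then obtain j where "i = j + 1"
      using interval_Suc by blast
    with True show ?thesis
      by (simp add: perm_product_def)
  qed (simp add: perm_product_outside)
qed

lemma perm_product_permutes:
  assumes "\<sigma> permutes {1..k}" "\<tau> permutes {1..m}"
  shows "perm_product k m \<sigma> \<tau> permutes {1..k * m}"
proof -
  have range: "perm_product k m \<sigma> \<tau> i \<in> {1..k * m}"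
    if i: "i \<in> {1..k * m}" and st: "\<sigma> permutes {1..k}" "\<tau> permutes {1..m}" for i \<sigma> \<tau>
  proof -
    obtain j where j: "i = j + 1" "j < k * m"
      using interval_Suc[OF i] by blast
    note jm = div_mod_less[OF j(2)]
    then have "perm0 \<sigma> (j div m) * m + perm0 \<tau> (j mod m) < k * m"
      using permutes_perm0[OF st(1)] permutes_perm0[OF st(2)] by (intro mult_add_less) auto
    then show ?thesis
      using perm_product_perm0(1)[OF j(2) st] by (simp add: j(1))
  qed
  have inv: "perm_product k m (inv_into UNIV \<sigma>) (inv_into UNIV \<tau>) \<circ> perm_product k m \<sigma> \<tau> = id"
      "perm_product k m \<sigma> \<tau> \<circ> perm_product k m (inv_into UNIV \<sigma>) (inv_into UNIV \<tau>) = id"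
    using perm_product_comp[OF permutes_inv[OF assms(1)] assms(1) permutes_inv[OF assms(2)] assms(2)]
      perm_product_comp[OF assms(1) permutes_inv[OF assms(1)] assms(2) permutes_inv[OF assms(2)]]
    by (simp_all add: permutes_inv_o[OF assms(1)] permutes_inv_o[OF assms(2)] perm_product_id)
  show ?thesis
  proof (rule bij_imp_permutes)
    show "bij_betw (perm_product k m \<sigma> \<tau>) {1..k * m} {1..k * m}"
    proof (rule bij_betw_byWitness[where f' = "perm_product k m (inv_into UNIV \<sigma>) (inv_into UNIV \<tau>)"])
      show "\<forall>i\<in>{1..k * m}. perm_product k m (inv_into UNIV \<sigma>) (inv_into UNIV \<tau>) (perm_product k m \<sigma> \<tau> i) = i"
        using fun_cong[OF inv(1)] by simp
      show "\<forall>i\<in>{1..k * m}. perm_product k m \<sigma> \<tau> (perm_product k m (inv_into UNIV \<sigma>) (inv_into UNIV \<tau>) i) = i"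
        using fun_cong[OF inv(2)] by simp
      show "perm_product k m \<sigma> \<tau> ` {1..k * m} \<subseteq> {1..k * m}"
        by (intro image_subsetI range assms)
      show "perm_product k m (inv_into UNIV \<sigma>) (inv_into UNIV \<tau>) ` {1..k * m} \<subseteq> {1..k * m}"
        by (intro image_subsetI range permutes_inv assms)
    qed
  qed (rule perm_product_outside)
qed

lemma sym_group_simps:
  "carrier (sym_group k) = {\<sigma>. \<sigma> permutes {1..k}}" "\<sigma> \<otimes>\<^bsub>sym_group k\<^esub> \<tau> = \<sigma> \<circ> \<tau>" "\<one>\<^bsub>sym_group k\<^esub> = id"
  by (simp_all add: sym_group_def)

lemma product_family_sym: "product_family sym_group (*) perm_product"
proof (rule product_family.intro)
  fix k show "monoid (sym_group k)"
    using sym_group_is_group by (simp add: group.is_monoid)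
qed (auto simp: sym_group_simps perm_product_permutes perm_product_comp)

lemma sum_mult_div_mod:
  "(\<Sum>l<k * m. f (l div m) (l mod m)) = (\<Sum>a<k. \<Sum>b<m. f a b)" for m :: nat
proof -
  have "(\<Sum>l<k * m. f (l div m) (l mod m)) = (\<Sum>(a, b)\<in>{..<k} \<times> {..<m}. f a b)"
    by (rule sum.reindex_bij_witness[of _ "\<lambda>(a, b). a * m + b" "\<lambda>l. (l div m, l mod m)"])
       (auto simp: mult_add_less div_mod_less)
  then show ?thesis
    by (simp add: sum.cartesian_product)
qed

section \<open>Tensor products, permutation matrices and reduction modulo p\<close>

lemma mat_tensor_carrier [simp]: "mat_tensor k m A B \<in> carrier_mat (k * m) (k * m)"
  by (simp add: mat_tensor_def)

lemma mat_tensor_mult: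
  assumes "A \<in> carrier_mat k k" "A' \<in> carrier_mat k k" "B \<in> carrier_mat m m" "B' \<in> carrier_mat m m"
  shows "mat_tensor k m (A * A') (B * B') = mat_tensor k m A B * mat_tensor k m A' B'"
proof (rule eq_matI)
  fix i j assume "i < dim_row (mat_tensor k m A B * mat_tensor k m A' B')"
    "j < dim_col (mat_tensor k m A B * mat_tensor k m A' B')"
  then have ij: "i < k * m" "j < k * m"
    by (simp_all add: mat_tensor_def)
  note d = div_mod_less[OF ij(1)] div_mod_less[OF ij(2)]
  have "(mat_tensor k m A B * mat_tensor k m A' B') $$ (i, j) =
      (\<Sum>l<k * m. (A $$ (i div m, l div m) * B $$ (i mod m, l mod m)) * (A' $$ (l div m, j div m) * B' $$ (l mod m, j mod m)))"
    using ij by (simp add: mat_tensor_def scalar_prod_def lessThan_atLeast0)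
  also have "\<dots> = (\<Sum>a<k. \<Sum>b<m. (A $$ (i div m, a) * B $$ (i mod m, b)) * (A' $$ (a, j div m) * B' $$ (b, j mod m)))"
    by (rule sum_mult_div_mod)
  also have "\<dots> = (\<Sum>a<k. A $$ (i div m, a) * A' $$ (a, j div m)) * (\<Sum>b<m. B $$ (i mod m, b) * B' $$ (b, j mod m))"
    by (simp add: sum_product algebra_simps)
  also have "\<dots> = mat_tensor k m (A * A') (B * B') $$ (i, j)"
    using ij d assms by (simp add: mat_tensor_def scalar_prod_def lessThan_atLeast0)
  finally show "mat_tensor k m (A * A') (B * B') $$ (i, j) = (mat_tensor k m A B * mat_tensor k m A' B') $$ (i, j)"
    by simp
qed (simp_all add: mat_tensor_def)

lemma mat_tensor_one: "mat_tensor k m (1\<^sub>m k) (1\<^sub>m m) = 1\<^sub>m (k * m)"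
proof (rule eq_matI)
  fix i j assume "i < dim_row (1\<^sub>m (k * m) :: 'a mat)" "j < dim_col (1\<^sub>m (k * m) :: 'a mat)"
  then have ij: "i < k * m" "j < k * m" by auto
  have "i = j \<longleftrightarrow> i div m = j div m \<and> i mod m = j mod m"
    by (metis div_mult_mod_eq)
  then show "mat_tensor k m (1\<^sub>m k) (1\<^sub>m m) $$ (i, j) = 1\<^sub>m (k * m) $$ (i, j)"
    using ij div_mod_less[OF ij(1)] div_mod_less[OF ij(2)] by (auto simp: mat_tensor_def)
qed (simp_all add: mat_tensor_def)

lemma mat_tensor_GL:
  assumes "A \<in> carrier (GL k)" "B \<in> carrier (GL m)"
  shows "mat_tensor k m A B \<in> carrier (GL (k * m))"
proof -
  obtain A' B' where "A' \<in> carrier_mat k k" "A * A' = 1\<^sub>m k" "A' * A = 1\<^sub>m k"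
      "B' \<in> carrier_mat m m" "B * B' = 1\<^sub>m m" "B' * B = 1\<^sub>m m"
    using assms by (auto simp: GL_carrier)
  then show ?thesis
    using assms by (auto simp: GL_carrier mat_tensor_one simp flip: mat_tensor_mult
        intro!: bexI[of _ "mat_tensor k m A' B'"])
qed

lemma product_family_GL: "product_family (GL :: nat \<Rightarrow> 'a::comm_ring_1 mat monoid) (*) mat_tensor"
proof (rule product_family.intro)
  fix k show "monoid (GL k :: 'a mat monoid)"
    by (rule group.is_monoid[OF GL_group])
qed (auto simp: mat_tensor_GL intro!: mat_tensor_mult dest: GL_carrier_mat)

lemma perm_mat_carrier [simp]: "perm_mat k \<sigma> \<in> carrier_mat k k"
  by (simp add: perm_mat_def)

lemma perm_mat_mult:
  assumes "\<sigma> permutes {1..k}" "\<tau> permutes {1..k}"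
  shows "perm_mat k (\<sigma> \<circ> \<tau>) = perm_mat k \<sigma> * (perm_mat k \<tau> :: 'a::comm_ring_1 mat)"
proof (rule eq_matI)
  fix i j assume "i < dim_row (perm_mat k \<sigma> * (perm_mat k \<tau> :: 'a mat))"
    "j < dim_col (perm_mat k \<sigma> * (perm_mat k \<tau> :: 'a mat))"
  then have ij: "i < k" "j < k"
    by (simp_all add: perm_mat_def)
  note t = permutes_perm0[OF assms(2) ij(2)]
  have "(perm_mat k \<sigma> * (perm_mat k \<tau> :: 'a mat)) $$ (i, j) =
      (\<Sum>l<k. (if \<sigma> (l + 1) = i + 1 then 1 else 0) * (if \<tau> (j + 1) = l + 1 then 1 else 0))"
    using ij by (simp add: perm_mat_def scalar_prod_def lessThan_atLeast0)
  also have "\<dots> = (\<Sum>l<k. if l = perm0 \<tau> j then (if \<sigma> (perm0 \<tau> j + 1) = i + 1 then 1 else 0) else 0)"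
    using t by (intro sum.cong) auto
  also have "\<dots> = perm_mat k (\<sigma> \<circ> \<tau>) $$ (i, j)"
    using ij t by (simp add: perm_mat_def)
  finally show "perm_mat k (\<sigma> \<circ> \<tau>) $$ (i, j) = (perm_mat k \<sigma> * (perm_mat k \<tau> :: 'a mat)) $$ (i, j)"
    by simp
qed (simp_all add: perm_mat_def)

lemma perm_mat_one: "perm_mat k id = 1\<^sub>m k"
  by (rule eq_matI) (auto simp: perm_mat_def)

lemma perm_mat_GL:
  assumes "\<sigma> permutes {1..k}"
  shows "(perm_mat k \<sigma> :: 'a::comm_ring_1 mat) \<in> carrier (GL k)"
  unfolding GL_carrier
  using perm_mat_mult[OF assms permutes_inv[OF assms], where ?'a = 'a]
    perm_mat_mult[OF permutes_inv[OF assms] assms, where ?'a = 'a]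
  by (auto simp: permutes_inv_o[OF assms] perm_mat_one intro!: bexI[of _ "perm_mat k (inv_into UNIV \<sigma>)"])

lemma mat_tensor_perm_mat:
  assumes "\<sigma> permutes {1..k}" "\<tau> permutes {1..m}"
  shows "mat_tensor k m (perm_mat k \<sigma>) (perm_mat m \<tau>) = (perm_mat (k * m) (perm_product k m \<sigma> \<tau>) :: 'a::comm_ring_1 mat)"
proof (rule eq_matI)
  fix i j assume "i < dim_row (perm_mat (k * m) (perm_product k m \<sigma> \<tau>) :: 'a mat)"
    "j < dim_col (perm_mat (k * m) (perm_product k m \<sigma> \<tau>) :: 'a mat)"
  then have ij: "i < k * m" "j < k * m"
    by (simp_all add: perm_mat_def)
  note d = div_mod_less[OF ij(1)] div_mod_less[OF ij(2)]
  note s = permutes_perm0[OF assms(1) d(3)] and t = permutes_perm0[OF assms(2) d(4)]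
  have "perm0 \<sigma> (j div m) * m + perm0 \<tau> (j mod m) = i \<longleftrightarrow>
      perm0 \<sigma> (j div m) = i div m \<and> perm0 \<tau> (j mod m) = i mod m"
    using t(1) by (metis div_mult_mod_eq div_mult_self3 div_less add.commute add_0 mod_less mod_mult_self3 not_less0)
  then show "mat_tensor k m (perm_mat k \<sigma>) (perm_mat m \<tau>) $$ (i, j) =
      (perm_mat (k * m) (perm_product k m \<sigma> \<tau>) :: 'a mat) $$ (i, j)"
    using ij d s t perm_product_perm0(1)[OF ij(2) assms] by (auto simp: mat_tensor_def perm_mat_def)
qed (simp_all add: mat_tensor_def perm_mat_def)

lemma reduce_mod_mult:
  assumes "A \<in> carrier_mat n n" "B \<in> carrier_mat n n"
  shows "reduce_mod (A * B) = reduce_mod A * (reduce_mod B :: 'p::prime_card mod_ring mat)"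
  using assms by (intro eq_matI) (auto simp: reduce_mod_def scalar_prod_def)

lemma reduce_mod_one: "reduce_mod (1\<^sub>m n) = 1\<^sub>m n"
  by (intro eq_matI) (auto simp: reduce_mod_def)

lemma reduce_mod_carrier: "A \<in> carrier_mat n n \<Longrightarrow> reduce_mod A \<in> carrier_mat n n"
  by (simp add: reduce_mod_def)

lemma reduce_mod_GL: "A \<in> carrier (GL n) \<Longrightarrow> (reduce_mod A :: 'p::prime_card mod_ring mat) \<in> carrier (GL n)"
  unfolding GL_carrier by (metis reduce_mod_carrier reduce_mod_mult reduce_mod_one)

lemma reduce_mod_block_sum:
  assumes "A \<in> carrier_mat k k" "B \<in> carrier_mat m m"
  shows "reduce_mod (block_sum k m A B) = block_sum k m (reduce_mod A) (reduce_mod B)"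
  using assms by (intro eq_matI) (auto simp: reduce_mod_def block_sum_def)

lemma reduce_mod_perm_mat: "reduce_mod (perm_mat k \<sigma>) = perm_mat k \<sigma>"
  by (intro eq_matI) (auto simp: reduce_mod_def perm_mat_def)

end

section \<open>Iterated products of classes\<close>

text \<open>The left-nested product of the factors with indices 0 to n, so n counts the
  multiplications, not the factors.\<close>

fun iterate :: "('a \<Rightarrow> 'a \<Rightarrow> 'a) \<Rightarrow> (nat \<Rightarrow> 'a) \<Rightarrow> nat \<Rightarrow> 'a" where
  "iterate f g 0 = g 0"
| "iterate f g (Suc n) = f (iterate f g n) (g (Suc n))"

lemma iterated_product_eq_iterate:
  assumes "length xs = Suc n"
  shows "iterated_product f (map g xs) = iterate f (\<lambda>i. g (xs ! i)) n"
proof -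
  have "iterated_product f (map h [0..<Suc n]) = iterate f h n" for h
  proof (induction n)
    case (Suc n)
    have "map h [0..<Suc (Suc n)] = map h [0..<Suc n] @ [h (Suc n)]"
      by simp
    moreover have "iterated_product f (as @ [a]) = f (iterated_product f as) a" if "as \<noteq> []" for as a
      using that by (cases as) (auto simp: iterated_product_def)
    ultimately show ?case
      using Suc by (metis iterate.simps(2) length_greater_0_conv length_map length_upt diff_zero zero_less_Suc)
  qed (simp add: iterated_product_def)
  moreover have "map g xs = map (\<lambda>i. g (xs ! i)) [0..<Suc n]"
    using assms by (metis (no_types, lifting) map_nth map_map comp_def map_cong)
  ultimately show ?thesis
    by simp
qed

context product_family
begin

lemma iterate_cycle:
  fixes c :: "nat \<Rightarrow> nat \<times> 'g list \<Rightarrow>\<^sub>0 'k::comm_ring_1"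
  assumes "\<And>i. c i \<in> union_cycles G"
  shows "iterate chain_product c n \<in> union_cycles G"
  by (induction n) (auto simp: assms intro!: cycle_product)

lemma iterate_coset_of:
  fixes c :: "nat \<Rightarrow> nat \<times> 'g list \<Rightarrow>\<^sub>0 'k::comm_ring_1"
  assumes "\<And>i. c i \<in> union_cycles G"
  shows "iterate (mult (homology_ring G \<mu> e \<phi>)) (\<lambda>i. coset_of (union_boundaries G) (c i)) n =
    coset_of (union_boundaries G) (iterate chain_product c n)"
  by (induction n) (simp_all add: mult_coset_of assms iterate_cycle)

end

lemma pushforward_chain_product:
  fixes G :: "nat \<Rightarrow> 'g monoid" and H :: "nat \<Rightarrow> 'h monoid" and a b :: "nat \<times> 'g list \<Rightarrow>\<^sub>0 'k::comm_ring_1"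
  assumes "a \<in> union_chains G" "b \<in> union_chains G"
    and "\<And>k m g h. g \<in> carrier (G k) \<Longrightarrow> h \<in> carrier (G m) \<Longrightarrow> f (\<mu> k m) (\<phi> k m g h) = \<psi> k m (f k g) (f m h)"
    and "\<And>k. f k \<one>\<^bsub>G k\<^esub> = \<one>\<^bsub>H k\<^esub>" "\<And>k. \<one>\<^bsub>G k\<^esub> \<in> carrier (G k)"
  shows "pushforward (\<lambda>(k, xs). (k, map (f k) xs)) (bilin_ext (simplex_product G \<mu> \<phi>) a b) =
    bilin_ext (simplex_product H \<mu> \<psi>) (pushforward (\<lambda>(k, xs). (k, map (f k) xs)) a)
      (pushforward (\<lambda>(k, xs). (k, map (f k) xs)) b)"
proof (rule chain_eqI)
  fix u :: "nat \<times> 'h list \<Rightarrow> 'k"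
  let ?F = "\<lambda>(k, xs). (k, map (f k) xs)"
  show "evaluate u (pushforward ?F (bilin_ext (simplex_product G \<mu> \<phi>) a b)) =
      evaluate u (bilin_ext (simplex_product H \<mu> \<psi>) (pushforward ?F a) (pushforward ?F b))"
    unfolding evaluate_pushforward evaluate_bilin_ext
  proof (rule evaluate_cong, rule evaluate_cong)
    fix s t assume st: "s \<in> Poly_Mapping.keys a" "t \<in> Poly_Mapping.keys b"
    obtain k xs m ys where kxmy: "s = (k, xs)" "t = (m, ys)"
      by (cases s, cases t)
    have xs: "set xs \<subseteq> carrier (G k)" and ys: "set ys \<subseteq> carrier (G m)"
      using st assms(1,2) by (auto simp: kxmy union_chains_iff)
    have "map (\<lambda>g. \<psi> k m g \<one>\<^bsub>H m\<^esub>) (map (f k) xs) = map (f (\<mu> k m)) (map (\<lambda>g. \<phi> k m g \<one>\<^bsub>G m\<^esub>) xs)"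
      using xs assms(3-5) by auto
    moreover have "map (\<lambda>h. \<psi> k m \<one>\<^bsub>H k\<^esub> h) (map (f m) ys) = map (f (\<mu> k m)) (map (\<lambda>h. \<phi> k m \<one>\<^bsub>G k\<^esub> h) ys)"
      using ys assms(3-5) by auto
    ultimately show "evaluate (\<lambda>x. u (?F x)) (simplex_product G \<mu> \<phi> s t) =
        evaluate u (simplex_product H \<mu> \<psi> (?F s) (?F t))"
      unfolding kxmy prod.case evaluate_simplex_product by (simp only: evaluate_shuffle_map)
  qed
qed

lemma pushforward_iterate:
  fixes G :: "nat \<Rightarrow> 'g monoid" and H :: "nat \<Rightarrow> 'h monoid" and c :: "nat \<Rightarrow> nat \<times> 'g list \<Rightarrow>\<^sub>0 'k::comm_ring_1"
  assumes "product_family G \<mu> \<phi>" "\<And>i. c i \<in> union_cycles G"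
    and "\<And>k m g h. g \<in> carrier (G k) \<Longrightarrow> h \<in> carrier (G m) \<Longrightarrow> f (\<mu> k m) (\<phi> k m g h) = \<psi> k m (f k g) (f m h)"
    and "\<And>k. f k \<one>\<^bsub>G k\<^esub> = \<one>\<^bsub>H k\<^esub>"
  shows "pushforward (\<lambda>(k, xs). (k, map (f k) xs)) (iterate (bilin_ext (simplex_product G \<mu> \<phi>)) c n) =
    iterate (bilin_ext (simplex_product H \<mu> \<psi>)) (\<lambda>i. pushforward (\<lambda>(k, xs). (k, map (f k) xs)) (c i)) n"
proof (induction n)
  case (Suc n)
  interpret product_family G \<mu> \<phi>
    by fact
  have "iterate chain_product c n \<in> union_chains G" "c (Suc n) \<in> union_chains G"
    using iterate_cycle[of c n] assms(2) by (auto simp: union_cycles_def)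
  then show ?case
    using Suc pushforward_chain_product[of "iterate chain_product c n" G "c (Suc n)" f \<mu> \<phi> \<psi> H, OF _ _ assms(3,4) one_closed]
    by simp
qed simp

section \<open>Vanishing of the transfer on free orbits\<close>

text \<open>One group of functions on all of \<open>nat\<close> serves for every rank; the chains
  used below have zero coordinates beyond the rank, by \<open>keys_product_cycle\<close>.\<close>

abbreviation fp_fun :: "(nat \<Rightarrow> 'p::prime_card mod_ring) monoid" where
  "fp_fun \<equiv> \<lparr>carrier = UNIV, mult = (\<lambda>f g i. f i + g i), one = (\<lambda>_. 0)\<rparr>"

text \<open>Each period of a point is divisible by p: otherwise it is prime to p, and then some
  power of \<open>T\<close> with exponent 1 modulo p would fix the point, so \<open>T\<close> itself
  would.\<close>

lemma free_power_eq:
  assumes T: "\<And>s. s \<in> S \<Longrightarrow> T s \<in> S" and Tp: "\<And>s. s \<in> S \<Longrightarrow> (T ^^ CARD('p)) s = s"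
    and free: "\<And>s. s \<in> S \<Longrightarrow> T s \<noteq> s" and t: "t \<in> S" and eq: "(T ^^ a) t = (T ^^ b) t"
  shows "(of_nat a :: 'p::prime_card mod_ring) = of_nat b"
  using t eq
proof (induction a b arbitrary: t rule: linorder_wlog)
  case (le a b)
  have pow: "(T ^^ i) s \<in> S" if "s \<in> S" for i s
    using that by (induction i) (auto intro: T)
  have powp: "(T ^^ (CARD('p) * i)) s = s" if "s \<in> S" for i s
    by (induction i) (auto simp: funpow_add Tp that)
  define s where "s = (T ^^ a) t"
  have "(T ^^ (b - a)) s = (T ^^ (b - a + a)) t"
    by (simp only: s_def funpow_add comp_apply)
  then have s: "s \<in> S" "(T ^^ (b - a)) s = s"
    using le pow by (simp_all add: s_def)
  have powd: "(T ^^ ((b - a) * i)) s = s" for i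
    by (induction i) (auto simp: funpow_add s)
  have "CARD('p) dvd b - a"
  proof (rule ccontr)
    assume "\<not> CARD('p) dvd b - a"
    then have "coprime (b - a) CARD('p)"
      using prime_imp_coprime[OF prime_card, of "b - a"] by (simp add: coprime_commute)
    moreover have "b - a \<noteq> 0"
      using \<open>\<not> CARD('p) dvd b - a\<close> by (metis dvd_0_right)
    \<comment> \<open>Bezout: a multiple of the period \<open>b - a\<close> is one more than a
      multiple of p, and both the period and p are periods of \<open>s\<close>.\<close>
    ultimately obtain x y where xy: "(b - a) * x = CARD('p) * y + 1"
      using bezout_nat[of "b - a" "CARD('p)"] by (auto simp: coprime_iff_gcd_eq_1)
    have "T s = (T ^^ (CARD('p) * y + 1)) s"
      using powp[OF T[OF s(1)]] by (simp add: funpow_add funpow_swap1)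
    also have "\<dots> = s"
      unfolding xy[symmetric] by (rule powd)
    finally show False
      using free[OF s(1)] by simp
  qed
  then obtain k where "b = a + CARD('p) * k"
    using le by (metis dvdE le_add_diff_inverse)
  then show ?case
    by simp
next
  case (sym a b)
  then show ?case
    by metis
qed

text \<open>Choose a representative in each orbit and let \<kappa> be the number of steps from it,
  which is well defined modulo p by \<open>free_power_eq\<close>.\<close>

lemma free_action_coordinate:
  assumes T: "\<And>s. s \<in> S \<Longrightarrow> T s \<in> S" and Tp: "\<And>s. s \<in> S \<Longrightarrow> (T ^^ CARD('p)) s = s"
    and free: "\<And>s. s \<in> S \<Longrightarrow> T s \<noteq> s"
  shows "\<exists>\<kappa> :: 's \<Rightarrow> 'p::prime_card mod_ring. \<forall>s\<in>S. \<kappa> (T s) = \<kappa> s + 1"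
proof -
  let ?p = "CARD('p)"
  have p: "?p > 0"
    by simp
  have pow: "(T ^^ i) s \<in> S" if "s \<in> S" for i s
    using that by (induction i) (auto intro: T)
  have powp: "(T ^^ (?p * i)) s = s" if "s \<in> S" for i s
    by (induction i) (auto simp: funpow_add Tp that)
  define orb where "orb s = range (\<lambda>i. (T ^^ i) s)" for s
  \<comment> \<open>The choice depends only on the orbit as a set, so \<open>s\<close> and
    \<open>T s\<close> get the same representative and their step counts can be compared.\<close>
  define rep where "rep s = (SOME t. t \<in> orb s)" for s
  define idx where "idx s = (SOME j. (T ^^ j) (rep s) = s)" for s
  have orbT: "orb (T s) = orb s" if s: "s \<in> S" for s
  proof (intro equalityI subsetI)
    fix x assume "x \<in> orb (T s)"
    then obtain i where "x = (T ^^ Suc i) s"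
      by (auto simp: orb_def funpow_swap1)
    then show "x \<in> orb s"
      unfolding orb_def by blast
  next
    fix x assume "x \<in> orb s"
    then obtain i where "x = (T ^^ i) s"
      by (auto simp: orb_def)
    also have "\<dots> = (T ^^ i) ((T ^^ Suc (?p - 1)) s)"
      using Tp[OF s] p by simp
    also have "\<dots> = (T ^^ (i + (?p - 1))) (T s)"
      by (simp only: funpow_Suc_right funpow_add comp_apply)
    finally show "x \<in> orb (T s)"
      unfolding orb_def by blast
  qed
  have rep: "rep s \<in> orb s" for s
    unfolding rep_def orb_def by (rule someI[of _ "(T ^^ 0) s"]) blast
  have idx: "rep s \<in> S" "(T ^^ idx s) (rep s) = s" if s: "s \<in> S" for s
  proof -
    obtain i where i: "rep s = (T ^^ i) s"
      using rep[of s] by (auto simp: orb_def)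
    then show "rep s \<in> S"
      using pow[OF s] by simp
    have "(T ^^ (i * (?p - 1))) (rep s) = (T ^^ (i * (?p - 1) + i)) s"
      by (simp add: i funpow_add)
    also have "i * (?p - 1) + i = ?p * i"
      using p by (cases ?p) (auto simp: algebra_simps)
    finally have "(T ^^ (i * (?p - 1))) (rep s) = s"
      using powp[OF s] by simp
    then show "(T ^^ idx s) (rep s) = s"
      unfolding idx_def by (rule someI)
  qed
  have "(of_nat (idx (T s)) :: 'p mod_ring) = of_nat (idx s) + 1" if s: "s \<in> S" for s
  proof -
    have "rep (T s) = rep s"
      by (simp add: rep_def orbT[OF s])
    then have "(T ^^ idx (T s)) (rep s) = (T ^^ Suc (idx s)) (rep s)"
      using idx(2)[OF T[OF s]] idx(2)[OF s] by simp
    from free_power_eq[where ?'p = 'p, OF T Tp free idx(1)[OF s] this] show ?thesis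
      by simp
  qed
  then show ?thesis
    by (intro exI[of _ "\<lambda>s. of_nat (idx s)"]) simp
qed

lemma action_zero:
  assumes "action_cocycle fp_fun S act lam" "s \<in> S"
  shows "act (\<lambda>_. 0) s = s" "lam (\<lambda>_. 0) s = 0"
proof -
  interpret action_cocycle fp_fun S act lam
    by fact
  have "act (\<lambda>_. 0) s = act (\<lambda>_. 0) (act (\<lambda>_. 0) s)"
    using act_mult[of "\<lambda>_. 0" "\<lambda>_. 0" s] assms(2) by simp
  then show *: "act (\<lambda>_. 0) s = s"
    using bij_act[of "\<lambda>_. 0"] assms(2) act_closed[of "\<lambda>_. 0" s]
    by (auto simp: bij_betw_def inj_on_def)
  have "lam (\<lambda>_. 0) s + 0 = lam (\<lambda>_. 0) s + lam (\<lambda>_. 0) s"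
    using lam_mult[of "\<lambda>_. 0" "\<lambda>_. 0" s] assms(2) * by (simp only: monoid.simps partial_object.simps UNIV_I add_0_right)
  then show "lam (\<lambda>_. 0) s = 0"
    by (metis add_left_imp_eq)
qed

lemma action_multiple:
  assumes "action_cocycle fp_fun S act lam" "s \<in> S"
  shows "act (\<lambda>i. of_nat m * e i) s = (act e ^^ m) s"
    and "lam (\<lambda>i. of_nat m * e i) s = (\<Sum>k<m. lam e ((act e ^^ k) s))"
proof -
  interpret action_cocycle fp_fun S act lam
    by fact
  have "act (\<lambda>i. of_nat m * e i) s = (act e ^^ m) s \<and>
      lam (\<lambda>i. of_nat m * e i) s = (\<Sum>k<m. lam e ((act e ^^ k) s))"
  proof (induction m)
    case 0
    then show ?case
      using action_zero[OF assms] by simp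
  next
    case (Suc m)
    have e: "(\<lambda>i. of_nat (Suc m) * e i) = (\<lambda>i. of_nat m * e i + e i)"
      by (auto simp: algebra_simps)
    show ?case
      unfolding e using Suc act_mult[of "\<lambda>i. of_nat m * e i" e s] lam_mult[of "\<lambda>i. of_nat m * e i" e s] assms(2)
      by simp
  qed
  then show "act (\<lambda>i. of_nat m * e i) s = (act e ^^ m) s"
    "lam (\<lambda>i. of_nat m * e i) s = (\<Sum>k<m. lam e ((act e ^^ k) s))"
    by auto
qed

text \<open>If \<open>e\<close> moves every point, then after a coboundary change \<open>h\<close> the cocycle \<open>lam\<close> becomes invariant
  under the free action of \<open>e\<close>, so that its transfer is divisible by \<open>p\<close>.\<close>

lemma transfer_free_zero:
  fixes act :: "(nat \<Rightarrow> 'p::prime_card mod_ring) \<Rightarrow> 's \<Rightarrow> 's" and U :: "'p mod_ring list \<Rightarrow> 'p mod_ring"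
  assumes ac: "action_cocycle fp_fun S act lam" and free: "\<And>s. s \<in> S \<Longrightarrow> act e s \<noteq> s"
    and U: "\<And>xs. evaluate U (bar_boundary fp_add xs) = 0" and Z: "Z \<in> bar_cycles fp_fun"
  shows "evaluate (\<lambda>gs. \<Sum>s\<in>S. U (path act lam gs s)) Z = 0"
proof -
  interpret action_cocycle fp_fun S act lam
    by fact
  let ?p = "CARD('p)" and ?T = "act e"
  have T: "?T s \<in> S" if "s \<in> S" for s
    using that act_closed by simp
  have p0: "(\<lambda>i. of_nat ?p * e i) = (\<lambda>_. 0)"
    by simp
  have Tp: "(?T ^^ ?p) s = s" "(\<Sum>k<?p. lam e ((?T ^^ k) s)) = 0" if "s \<in> S" for s
    using action_multiple[OF ac that, of ?p e] action_zero[OF ac that] unfolding p0 by simp_all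
  obtain \<kappa> :: "'s \<Rightarrow> 'p mod_ring" where \<kappa>: "\<And>s. s \<in> S \<Longrightarrow> \<kappa> (?T s) = \<kappa> s + 1"
    using free_action_coordinate[where ?'p = 'p, OF T Tp(1) free] by blast
  define j where "j s = nat (to_int_mod_ring (\<kappa> s))" for s
  \<comment> \<open>The sum of \<open>lam e\<close> along the orbit from \<open>s\<close> up to the
    point where \<kappa> returns to 0. At \<kappa> = 0 this is the sum over the full orbit, which
    vanishes because p times \<open>e\<close> is 0; so \<open>hT\<close> also holds across the
    wrap-around.\<close>
  define h where "h s = (\<Sum>k<?p - j s. lam e ((?T ^^ k) s))" for s
  have hT: "h (?T s) = h s - lam e s" if s: "s \<in> S" for s
  proof -
    have jp: "j s < ?p"
      using to_int_mod_ring_bounds[of "\<kappa> s"] by (simp add: j_def nat_less_iff)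
    have jT: "j (?T s) = (if j s + 1 < ?p then j s + 1 else 0)"
    proof -
      have "to_int_mod_ring (\<kappa> (?T s)) = (to_int_mod_ring (\<kappa> s) + 1) mod int ?p"
        by (simp add: \<kappa>[OF s] to_int_mod_ring_add)
      moreover have "to_int_mod_ring (\<kappa> s) = int (j s)"
        using to_int_mod_ring_bounds[of "\<kappa> s"] by (simp add: j_def)
      ultimately have "j (?T s) = (j s + 1) mod ?p"
        unfolding j_def[of "?T s"] by (metis nat_int of_nat_1 of_nat_add zmod_int)
      then show ?thesis
        using jp by (metis Suc_eq_plus1 Suc_lessI mod_less mod_self)
    qed
    have shift: "(\<Sum>k<Suc m. lam e ((?T ^^ k) s)) = lam e s + (\<Sum>k<m. lam e ((?T ^^ k) (?T s)))" for m
      by (subst sum.lessThan_Suc_shift) (simp add: funpow_swap1)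
    show ?thesis
    proof (cases "j s + 1 < ?p")
      case True
      then have "?p - j s = Suc (?p - j (?T s))"
        using jT by simp
      then show ?thesis
        using shift[of "?p - j (?T s)"] by (simp add: h_def)
    next
      case False
      then have "?p - j s = Suc 0" "j (?T s) = 0"
        using jT jp by simp_all
      then show ?thesis
        using Tp(2)[OF T[OF s]] by (simp add: h_def)
    qed
  qed
  define lam' where "lam' g s = lam g s + h (act g s) - h s" for g s
  have commute: "act g (?T s) = ?T (act g s)" if "s \<in> S" for g s
    using act_mult[of e g s] act_mult[of g e s] that by (simp add: add.commute)
  \<comment> \<open>Commutativity gives \<open>lam e\<close> and \<open>lam g\<close> in either
    order the same total; the discrepancy between \<open>lam g\<close> at \<open>?T s\<close> and at
    \<open>s\<close> is exactly what \<open>h\<close> compensates.\<close>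
  have lam'T: "lam' g (?T s) = lam' g s" if s: "s \<in> S" for g s
  proof -
    have "lam e s + lam g (?T s) = lam g s + lam e (act g s)"
      using lam_mult[of e g s] lam_mult[of g e s] s by (simp add: add.commute)
    then have "lam g (?T s) = lam g s + lam e (act g s) - lam e s"
      by (simp add: eq_diff_eq add.commute)
    moreover have "act g s \<in> S"
      using act_closed[of g s] s by simp
    ultimately show ?thesis
      unfolding lam'_def commute[OF s] using hT[OF s] hT[of "act g s"] by simp
  qed
  have pathT: "path act lam' gs (?T s) = path act lam' gs s" if "s \<in> S" for gs s
    using that
  proof (induction gs arbitrary: s)
    case (Cons g gs)
    then show ?case
      using Cons.IH[of "act g s"] act_closed[of g s] by (simp add: lam'T commute)
  qed simp
  \<comment> \<open>Paths are now invariant under \<open>?T\<close>, which carries each fibre of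
    \<kappa> to the next one. The p fibres have equal sums, so the total is 0.\<close>
  have zero: "(\<Sum>s\<in>S. U (path act lam' gs s)) = 0" for gs
  proof -
    let ?F = "\<lambda>s. U (path act lam' gs s)" and ?S = "\<lambda>c. {s \<in> S. \<kappa> s = c}"
    have step: "sum ?F (?S (c + 1)) = sum ?F (?S c)" for c
    proof -
      have bij: "bij_betw ?T (?S c) (?S (c + 1))"
      proof (rule bij_betw_imageI)
        show "inj_on ?T (?S c)"
          using bij_act[of e] by (auto simp: bij_betw_def inj_on_def)
        show "?T ` ?S c = ?S (c + 1)"
        proof (intro equalityI subsetI)
          fix s assume s: "s \<in> ?S (c + 1)"
          then obtain t where "t \<in> S" "s = ?T t"
            using bij_act[of e] by (auto simp: bij_betw_def)
          then show "s \<in> ?T ` ?S c"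
            using s \<kappa> by auto
        qed (use \<kappa> T in auto)
      qed
      have "sum ?F (?S (c + 1)) = (\<Sum>s\<in>?S c. ?F (?T s))"
        by (rule sum.reindex_bij_betw[OF bij, symmetric])
      also have "\<dots> = sum ?F (?S c)"
        by (intro sum.cong refl) (simp add: pathT)
      finally show ?thesis .
    qed
    have const: "sum ?F (?S c) = sum ?F (?S 0)" for c
    proof -
      obtain i where "c = of_nat i"
        using surj_of_nat_mod_ring by blast
      moreover have "sum ?F (?S (of_nat i)) = sum ?F (?S 0)" for i
        by (induction i) (simp_all add: step add.commute[of 1])
      ultimately show ?thesis by simp
    qed
    have "(\<Sum>s\<in>S. ?F s) = (\<Sum>c\<in>UNIV. sum ?F (?S c))"
      using sum.group[OF finite_S, of UNIV \<kappa> ?F] by simp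
    also have "\<dots> = (\<Sum>c\<in>(UNIV :: 'p mod_ring set). sum ?F (?S 0))"
      by (intro sum.cong refl const)
    also have "\<dots> = 0"
      by simp
    finally show ?thesis .
  qed
  have "evaluate (\<lambda>gs. \<Sum>s\<in>S. U (path act lam gs s)) Z = evaluate (\<lambda>gs. \<Sum>s\<in>S. U (path act lam' gs s)) Z"
    by (rule transfer_twist[where h = h]) (use U Z in \<open>simp_all add: lam'_def\<close>)
  then show ?thesis
    by (simp add: zero)
qed

definition unit_fun :: "nat \<Rightarrow> 'a \<Rightarrow> nat \<Rightarrow> 'a::zero" where
  "unit_fun i a = (\<lambda>k. if k = i then a else 0)"

lemma action_restrict:
  fixes act :: "(nat \<Rightarrow> 'p::prime_card mod_ring) \<Rightarrow> 's \<Rightarrow> 's"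
  assumes "action_cocycle fp_fun S act lam" "S' \<subseteq> S" "\<And>g s. s \<in> S' \<Longrightarrow> act g s \<in> S'"
  shows "action_cocycle fp_fun S' act lam"
proof -
  interpret action_cocycle fp_fun S act lam
    by fact
  show ?thesis
  proof
    show fin: "finite S'"
      using finite_S assms(2) by (rule rev_finite_subset)
    fix g :: "nat \<Rightarrow> 'p mod_ring"
    have "inj_on (act g) S'"
      using bij_act[of g] assms(2) by (auto simp: bij_betw_def intro: inj_on_subset)
    moreover have "act g ` S' \<subseteq> S'"
      using assms(3) by blast
    ultimately show "bij_betw (act g) S' S'"
      using endo_inj_surj[OF fin] by (simp add: bij_betw_def)
  qed (use assms(2) act_mult lam_mult in auto)
qed

text \<open>The unit functions are treated one at a time. The points fixed by the earlier ones but
  moved by the current one form an invariant set because the group is commutative, and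
  \<open>transfer_free_zero\<close> discards it.\<close>

lemma transfer_fixed_part:
  fixes act :: "(nat \<Rightarrow> 'p::prime_card mod_ring) \<Rightarrow> 's \<Rightarrow> 's" and U :: "'p mod_ring list \<Rightarrow> 'p mod_ring"
  assumes ac: "action_cocycle fp_fun S act lam"
    and U: "\<And>xs. evaluate U (bar_boundary fp_add xs) = 0" and Z: "Z \<in> bar_cycles fp_fun"
  shows "evaluate (\<lambda>gs. \<Sum>s\<in>S. U (path act lam gs s)) Z =
    evaluate (\<lambda>gs. \<Sum>s\<in>{s \<in> S. \<forall>i<m. act (unit_fun i 1) s = s}. U (path act lam gs s)) Z"
proof (induction m)
  case (Suc m)
  interpret action_cocycle fp_fun S act lam
    by fact
  let ?A = "{s \<in> S. \<forall>i<m. act (unit_fun i 1) s = s}"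
  let ?B = "{s \<in> ?A. act (unit_fun m 1) s \<noteq> s}"
  have commute: "act g (act e s) = act e (act g s)" if "s \<in> S" for e g s
    using act_mult[of e g s] act_mult[of g e s] that by (simp add: add.commute)
  have B: "action_cocycle fp_fun ?B act lam"
  proof (rule action_restrict[OF ac])
    fix g s assume s: "s \<in> ?B"
    then have "act g s \<in> S"
      using act_closed by simp
    moreover have "act (unit_fun i 1) (act g s) = act g s" if "i < m" for i
      using s that by (simp flip: commute)
    moreover have "act (unit_fun m 1) (act g s) \<noteq> act g s"
      using s bij_act[of g] act_closed[of "unit_fun m 1" s]
      by (auto simp: bij_betw_def inj_on_def simp flip: commute)
    ultimately show "act g s \<in> ?B"
      by simp
  qed blast
  have fin: "finite ?A"
    using finite_S by simp
  have split: "?A = {s \<in> S. \<forall>i<Suc m. act (unit_fun i 1) s = s} \<union> ?B"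
    by (auto simp: less_Suc_eq)
  have "(\<Sum>s\<in>?A. U (path act lam gs s)) =
      (\<Sum>s\<in>{s \<in> S. \<forall>i<Suc m. act (unit_fun i 1) s = s}. U (path act lam gs s)) + (\<Sum>s\<in>?B. U (path act lam gs s))" for gs
    by (subst split, rule sum.union_disjoint) (use finite_S in auto)
  then show ?case
    using Suc transfer_free_zero[OF B _ U Z, of "unit_fun m 1"] by (simp add: evaluate_fun_add)
qed simp

text \<open>At a common fixed point the cocycle rule is plain additivity, so \<open>lam\<close> is
  the linear form with the values at the unit functions as coefficients.\<close>

lemma fixed_point_lam:
  fixes act :: "(nat \<Rightarrow> 'p::prime_card mod_ring) \<Rightarrow> 's \<Rightarrow> 's"
  assumes ac: "action_cocycle fp_fun S act lam" and s: "s \<in> S" "\<And>i. i < m \<Longrightarrow> act (unit_fun i 1) s = s"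
    and g: "\<And>i. i \<ge> m \<Longrightarrow> g i = 0"
  shows "act g s = s \<and> lam g s = (\<Sum>i<m. g i * lam (unit_fun i 1) s)"
  using s(2) g
proof (induction m arbitrary: g)
  case 0
  then have "g = (\<lambda>_. 0)"
    by auto
  then show ?case
    using action_zero[OF ac s(1)] by simp
next
  case (Suc m)
  interpret action_cocycle fp_fun S act lam
    by fact
  let ?g = "g(m := 0)" and ?e = "unit_fun m 1 :: nat \<Rightarrow> 'p mod_ring"
  have IH: "act ?g s = s \<and> lam ?g s = (\<Sum>i<m. ?g i * lam (unit_fun i 1) s)"
    using Suc.prems by (intro Suc.IH) auto
  obtain k where k: "g m = of_nat k"
    using surj_of_nat_mod_ring by blast
  have e: "act ?e s = s"
    using Suc.prems by simp
  then have pow: "(act ?e ^^ i) s = s" for i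
    by (induction i) auto
  have ke: "act (\<lambda>i. of_nat k * ?e i) s = s" "lam (\<lambda>i. of_nat k * ?e i) s = g m * lam ?e s"
    using action_multiple[OF ac s(1), of k ?e] by (simp_all add: pow k)
  have "g = (\<lambda>i. ?g i + of_nat k * ?e i)"
    by (auto simp: unit_fun_def k)
  then have "act g s = act (\<lambda>i. of_nat k * ?e i) (act ?g s)"
    "lam g s = lam ?g s + lam (\<lambda>i. of_nat k * ?e i) (act ?g s)"
    using act_mult[of ?g "\<lambda>i. of_nat k * ?e i" s] lam_mult[of ?g "\<lambda>i. of_nat k * ?e i" s] s(1) by simp_all
  then show ?case
    using IH ke by simp
qed

section \<open>The regular representation\<close>

lemma of_nat_CARD_minus_1: "(of_nat (CARD('p) - 1) :: 'p::prime_card mod_ring) = - 1"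
proof -
  have "1 \<le> CARD('p)"
    by (simp add: Suc_leI)
  then show ?thesis
    by (simp add: of_nat_diff)
qed

context
  notes One_nat_def [simp del]
begin

lemma cayley_perm0:
  fixes a :: "'p::prime_card mod_ring"
  assumes "j < CARD('p)"
  shows "cayley a (j + 1) = nat (to_int_mod_ring (a + of_nat j)) + 1"
    and "perm0 (cayley a) j = nat (to_int_mod_ring (a + of_nat j))"
    and "perm0 (cayley a) j < CARD('p)"
    and "of_nat (perm0 (cayley a) j) = a + of_nat j"
proof -
  show 1: "cayley a (j + 1) = nat (to_int_mod_ring (a + of_nat j)) + 1"
    using assms by (simp add: cayley_def)
  then show 2: "perm0 (cayley a) j = nat (to_int_mod_ring (a + of_nat j))"
    by (simp add: perm0_def)
  show "perm0 (cayley a) j < CARD('p)"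
    unfolding 2 using to_int_mod_ring_bounds[of "a + of_nat j"] by (simp add: nat_less_iff)
  have "(of_nat (nat (to_int_mod_ring x)) :: 'p mod_ring) = x" for x
    using to_int_mod_ring_bounds[of x] by (simp add: of_nat_of_int_mod_ring)
  then show "of_nat (perm0 (cayley a) j) = a + of_nat j"
    unfolding 2 by simp
qed

lemma cayley_outside: "i \<notin> {1..CARD('p)} \<Longrightarrow> cayley (a :: 'p::prime_card mod_ring) i = i"
  unfolding cayley_def by (simp only: if_False)

lemma to_int_of_nat_mod_ring: "j < CARD('p) \<Longrightarrow> nat (to_int_mod_ring (of_nat j :: 'p::prime_card mod_ring)) = j"
  by (simp add: of_nat_of_int_mod_ring)

lemma cayley_add: "cayley (a + b) = cayley a \<circ> cayley (b :: 'p::prime_card mod_ring)"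
proof
  fix i
  show "cayley (a + b) i = (cayley a \<circ> cayley b) i"
  proof (cases "i \<in> {1..CARD('p)}")
    case True
    then obtain j where j: "i = j + 1" "j < CARD('p)"
      using interval_Suc by blast
    note b = cayley_perm0[OF j(2), of b]
    have "cayley a (cayley b i) = cayley a (perm0 (cayley b) j + 1)"
      using b(1,2) by (simp add: j(1))
    also have "\<dots> = nat (to_int_mod_ring (a + (b + of_nat j))) + 1"
      unfolding cayley_perm0(1)[OF b(3)] b(4) ..
    also have "\<dots> = cayley (a + b) i"
      unfolding j(1) cayley_perm0(1)[OF j(2)] by (simp add: add.assoc)
    finally show ?thesis by simp
  qed (simp add: cayley_outside)
qed

lemma cayley_zero: "cayley (0 :: 'p::prime_card mod_ring) = id"
proof
  fix i
  show "cayley (0 :: 'p mod_ring) i = id i"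
  proof (cases "i \<in> {1..CARD('p)}")
    case True
    then obtain j where j: "i = j + 1" "j < CARD('p)"
      using interval_Suc by blast
    show ?thesis
      unfolding j(1) cayley_perm0(1)[OF j(2)] by (simp add: to_int_of_nat_mod_ring[OF j(2)])
  qed (simp add: cayley_outside)
qed

lemma cayley_permutes: "cayley (a :: 'p::prime_card mod_ring) permutes {1..CARD('p)}"
proof (rule bij_imp_permutes)
  have range: "cayley c ` {1..CARD('p)} \<subseteq> {1..CARD('p)}" for c :: "'p mod_ring"
  proof (rule image_subsetI)
    fix i assume "i \<in> {1..CARD('p)}"
    then obtain j where j: "i = j + 1" "j < CARD('p)"
      using interval_Suc by blast
    show "cayley c i \<in> {1..CARD('p)}"
      using cayley_perm0(1-3)[OF j(2), of c] by (simp add: j(1))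
  qed
  show "bij_betw (cayley a) {1..CARD('p)} {1..CARD('p)}"
  proof (rule bij_betw_byWitness[where f' = "cayley (- a)"])
    show "\<forall>i\<in>{1..CARD('p)}. cayley (- a) (cayley a i) = i"
      using cayley_add[of "- a" a] by (simp add: cayley_zero fun_eq_iff)
    show "\<forall>i\<in>{1..CARD('p)}. cayley a (cayley (- a) i) = i"
      using cayley_add[of a "- a"] by (simp add: cayley_zero fun_eq_iff)
  qed (rule range)+
qed (rule cayley_outside)

text \<open>Translation of F_p^(n+1) on itself, its elements being numbered in base p with the last
  coordinate as the lowest digit. The recursion is that of the iterated circle product.\<close>

fun regular_rep :: "nat \<Rightarrow> (nat \<Rightarrow> 'p::prime_card mod_ring) \<Rightarrow> nat \<Rightarrow> nat" where
  "regular_rep 0 c = cayley (c 0)"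
| "regular_rep (Suc n) c = perm_product (CARD('p) ^ Suc n) CARD('p) (regular_rep n c) (cayley (c (Suc n)))"

lemma regular_rep_permutes: "regular_rep n (c :: nat \<Rightarrow> 'p::prime_card mod_ring) permutes {1..CARD('p) ^ Suc n}"
proof (induction n)
  case (Suc n)
  from perm_product_permutes[OF Suc cayley_permutes[of "c (Suc n)"]] show ?case
    by (simp add: mult.commute mult.left_commute)
qed (simp add: cayley_permutes)

lemma regular_rep_add:
  "regular_rep n (\<lambda>i. c i + d i) = regular_rep n c \<circ> regular_rep n (d :: nat \<Rightarrow> 'p::prime_card mod_ring)"
proof (induction n)
  case (Suc n)
  have "regular_rep (Suc n) (\<lambda>i. c i + d i) = perm_product (CARD('p) ^ Suc n) CARD('p)
      (regular_rep n c \<circ> regular_rep n d) (cayley (c (Suc n)) \<circ> cayley (d (Suc n)))"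
    by (simp only: regular_rep.simps Suc cayley_add)
  also have "\<dots> = regular_rep (Suc n) c \<circ> regular_rep (Suc n) d"
    by (simp only: regular_rep.simps)
       (rule perm_product_comp[OF regular_rep_permutes regular_rep_permutes cayley_permutes cayley_permutes])
  finally show ?case .
qed (simp add: cayley_add)

lemma regular_rep_cong:
  "(\<And>i. i \<le> n \<Longrightarrow> c i = d i) \<Longrightarrow> regular_rep n c = regular_rep n d"
  by (induction n) simp_all

lemma regular_rep_zero: "(\<And>i. i \<le> n \<Longrightarrow> c i = 0) \<Longrightarrow> regular_rep n c = id"
  by (induction n) (simp_all add: cayley_zero perm_product_id)

lemma perm0_regular_rep_Suc:
  fixes c :: "nat \<Rightarrow> 'p::prime_card mod_ring"
  assumes "j < CARD('p) ^ Suc (Suc n)"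
  shows "perm0 (regular_rep (Suc n) c) j =
    perm0 (regular_rep n c) (j div CARD('p)) * CARD('p) + perm0 (cayley (c (Suc n))) (j mod CARD('p))"
  unfolding regular_rep.simps
  by (rule perm_product_perm0(2)[OF _ regular_rep_permutes cayley_permutes])
     (use assms in \<open>simp add: mult.commute mult.left_commute\<close>)

lemma div_power_less: "j < p ^ Suc (Suc n) \<Longrightarrow> j div p < p ^ Suc n" for p :: nat
  by (rule div_mod_less(1)[of _ _ p]) (simp add: mult.commute mult.left_commute)

text \<open>The linear form with coefficients \<open>t\<close>, evaluated at the group element
  numbered \<open>j\<close>.\<close>

fun digit_sum :: "nat \<Rightarrow> (nat \<Rightarrow> 'p::prime_card mod_ring) \<Rightarrow> nat \<Rightarrow> 'p mod_ring" where
  "digit_sum 0 t j = t 0 * of_nat j"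
| "digit_sum (Suc n) t j = digit_sum n t (j div CARD('p)) + t (Suc n) * of_nat (j mod CARD('p))"

text \<open>The group element numbered \<open>j\<close>, when \<open>j\<close> has at most n + 1
  digits; translation by it takes 0 to \<open>j\<close>.\<close>

fun digits :: "nat \<Rightarrow> nat \<Rightarrow> nat \<Rightarrow> 'p::prime_card mod_ring" where
  "digits 0 j = unit_fun 0 (of_nat j)"
| "digits (Suc n) j = (digits n (j div CARD('p)))(Suc n := of_nat (j mod CARD('p)))"

lemma digit_sum_0: "digit_sum n t 0 = 0"
  by (induction n) auto

lemma digits_support: "i > n \<Longrightarrow> digits n j i = 0"
  by (induction n arbitrary: j) (auto simp: unit_fun_def)

lemma digit_sum_regular_rep:
  fixes g :: "nat \<Rightarrow> 'p::prime_card mod_ring"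
  assumes "j < CARD('p) ^ Suc n"
  shows "digit_sum n t (perm0 (regular_rep n g) j) = digit_sum n t j + (\<Sum>i\<le>n. g i * t i)"
  using assms
proof (induction n arbitrary: j)
  case 0
  then show ?case
    using cayley_perm0(4)[of j "g 0"] by (simp add: algebra_simps)
next
  case (Suc n)
  have m: "j mod CARD('p) < CARD('p)"
    by simp
  note c = cayley_perm0[OF m, of "g (Suc n)"]
  have "digit_sum (Suc n) t (perm0 (regular_rep (Suc n) g) j) =
      digit_sum n t (perm0 (regular_rep n g) (j div CARD('p))) + t (Suc n) * of_nat (perm0 (cayley (g (Suc n))) (j mod CARD('p)))"
    unfolding perm0_regular_rep_Suc[OF Suc.prems] digit_sum.simps using c(3) by simp
  also have "\<dots> = digit_sum (Suc n) t j + (\<Sum>i\<le>Suc n. g i * t i)"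
    unfolding Suc.IH[OF div_power_less[OF Suc.prems]] c(4) by (simp add: algebra_simps)
  finally show ?case .
qed

lemma regular_rep_transitive:
  assumes "j < CARD('p::prime_card) ^ Suc n"
  shows "perm0 (regular_rep n (digits n j :: nat \<Rightarrow> 'p mod_ring)) 0 = j"
  using assms
proof (induction n arbitrary: j)
  case 0
  then show ?case
    using cayley_perm0(2)[of 0 "of_nat j :: 'p mod_ring"] to_int_of_nat_mod_ring[of j, where ?'p = 'p]
    by (simp add: unit_fun_def)
next
  case (Suc n)
  have z: "0 < CARD('p) ^ Suc (Suc n)"
    by simp
  have "regular_rep n (digits (Suc n) j :: nat \<Rightarrow> 'p mod_ring) =
      regular_rep n (digits n (j div CARD('p)) :: nat \<Rightarrow> 'p mod_ring)"
    by (rule regular_rep_cong) simp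
  moreover have "perm0 (cayley (of_nat (j mod CARD('p)) :: 'p mod_ring)) 0 = j mod CARD('p)"
    using cayley_perm0(2)[of 0 "of_nat (j mod CARD('p)) :: 'p mod_ring"]
      to_int_of_nat_mod_ring[of "j mod CARD('p)", where ?'p = 'p] by simp
  moreover have "digits (Suc n) j (Suc n) = (of_nat (j mod CARD('p)) :: 'p mod_ring)"
    by simp
  ultimately show ?case
    unfolding perm0_regular_rep_Suc[OF z] using Suc.IH[OF div_power_less[OF Suc.prems]]
    by (simp del: digits.simps regular_rep.simps)
qed

section \<open>The fixed pairs of the regular representation\<close>

lemma row_mult_perm_mat:
  assumes "\<sigma> permutes {1..k}" "v \<in> carrier_vec k"
  shows "row_mult (perm_mat k \<sigma>) v = vec k (\<lambda>j. v $ perm0 \<sigma> j)"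
proof (rule eq_vecI)
  fix j assume "j < dim_vec (vec k (\<lambda>j. v $ perm0 \<sigma> j))"
  then have j: "j < k"
    by simp
  note s = permutes_perm0[OF assms(1) j]
  have "row_mult (perm_mat k \<sigma>) v $ j = (\<Sum>i<k. (if \<sigma> (j + 1) = i + 1 then 1 else 0) * v $ i)"
    using j assms(2) by (simp add: row_mult_def perm_mat_def scalar_prod_def lessThan_atLeast0)
  also have "\<dots> = (\<Sum>i<k. if i = perm0 \<sigma> j then v $ perm0 \<sigma> j else 0)"
    using s by (intro sum.cong) auto
  also have "\<dots> = v $ perm0 \<sigma> j"
    using s by simp
  finally show "row_mult (perm_mat k \<sigma>) v $ j = vec k (\<lambda>j. v $ perm0 \<sigma> j) $ j"
    using j by simp
qed (simp add: row_mult_def perm_mat_def)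

definition reg_mat :: "nat \<Rightarrow> (nat \<Rightarrow> 'p::prime_card mod_ring) \<Rightarrow> 'p mod_ring mat" where
  "reg_mat n g = perm_mat (CARD('p) ^ Suc n) (regular_rep n g)"

lemma reg_mat_action:
  "action_cocycle fp_fun (lead_pairs (CARD('p) ^ Suc n))
     (\<lambda>g :: nat \<Rightarrow> 'p::prime_card mod_ring. pair_act (reg_mat n g)) (\<lambda>g. pair_lam (reg_mat n g))"
proof (rule action_cocycle_GL)
  fix g h :: "nat \<Rightarrow> 'p mod_ring"
  show "reg_mat n g \<in> carrier (GL (CARD('p) ^ Suc n))"
    unfolding reg_mat_def by (rule perm_mat_GL[OF regular_rep_permutes])
  show "reg_mat n (g \<otimes>\<^bsub>fp_fun\<^esub> h) = reg_mat n g * reg_mat n h"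
    unfolding reg_mat_def monoid.simps regular_rep_add
    by (rule perm_mat_mult[OF regular_rep_permutes regular_rep_permutes])
qed

definition fixed_pairs :: "nat \<Rightarrow> ('p::prime_card mod_ring vec \<times> 'p mod_ring vec) set" where
  "fixed_pairs n = {s \<in> lead_pairs (CARD('p) ^ Suc n). \<forall>i<Suc n. pair_act (reg_mat n (unit_fun i 1)) s = s}"

text \<open>The first vector is the constant c, the second c times a linear form. Translation by g
  adds t(g) times the first vector, which normalisation removes; the form vanishes at 0, the leading
  position.\<close>

definition fixed_pair :: "nat \<Rightarrow> 'p::prime_card mod_ring \<Rightarrow> (nat \<Rightarrow> 'p mod_ring) \<Rightarrow> 'p mod_ring vec \<times> 'p mod_ring vec" where
  "fixed_pair n c t = (vec (CARD('p) ^ Suc n) (\<lambda>_. c), vec (CARD('p) ^ Suc n) (\<lambda>j. c * digit_sum n t j))"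

lemma lead_index_const:
  assumes "v \<in> carrier_vec k" "k > 0" "v $ 0 \<noteq> 0"
  shows "lead_index v = 0"
  unfolding lead_index_def by (rule Least_equality) (use assms in auto)

lemma fixed_pair:
  fixes c :: "'p::prime_card mod_ring"
  assumes c: "c \<noteq> 0"
  shows "fixed_pair n c t \<in> lead_pairs (CARD('p) ^ Suc n)"
    and "pair_lam (reg_mat n g) (fixed_pair n c t) = (\<Sum>i\<le>n. g i * t i)"
    and "pair_act (reg_mat n g) (fixed_pair n c t) = fixed_pair n c t"
proof -
  define N where "N = CARD('p) ^ Suc n"
  let ?v = "vec N (\<lambda>_. c)" and ?u = "vec N (\<lambda>j. c * digit_sum n t j)"
  have N: "N > 0"
    by (simp add: N_def)
  have fp: "fixed_pair n c t = (?v, ?u)"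
    by (simp only: fixed_pair_def N_def)
  have row: "row_mult (reg_mat n g) w = vec N (\<lambda>j. w $ perm0 (regular_rep n g) j)" if "w \<in> carrier_vec N" for w
    using that unfolding reg_mat_def N_def by (rule row_mult_perm_mat[OF regular_rep_permutes])
  have perm: "perm0 (regular_rep n g) j < N" if "j < N" for j
    using that unfolding N_def by (rule permutes_perm0(1)[OF regular_rep_permutes])
  have dig: "digit_sum n t (perm0 (regular_rep n g) j) = digit_sum n t j + (\<Sum>i\<le>n. g i * t i)" if "j < N" for j
    using that unfolding N_def by (rule digit_sum_regular_rep)
  have lead: "lead_index ?v = 0"
    by (rule lead_index_const[of _ N]) (use N c in auto)
  have "?v \<noteq> 0\<^sub>v N"
    using c N by (metis index_vec index_zero_vec(1))
  then have "fixed_pair n c t \<in> lead_pairs N"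
    using N by (simp add: fp lead_pairs_def lead digit_sum_0)
  then show "fixed_pair n c t \<in> lead_pairs (CARD('p) ^ Suc n)"
    by (simp only: N_def)
  have v: "row_mult (reg_mat n g) ?v = ?v"
    using perm by (subst row) auto
  have u: "row_mult (reg_mat n g) ?u = vec N (\<lambda>j. c * digit_sum n t j + c * (\<Sum>i\<le>n. g i * t i))"
    using perm by (subst row) (auto simp: dig distrib_left)
  show lam: "pair_lam (reg_mat n g) (fixed_pair n c t) = (\<Sum>i\<le>n. g i * t i)"
    unfolding fp pair_lam_def prod.case v u lead_ratio_def lead
    using N c by (simp add: digit_sum_0)
  show "pair_act (reg_mat n g) (fixed_pair n c t) = fixed_pair n c t"
    unfolding pair_act_def lam unfolding fp prod.case v u
    using lam[unfolded fp] by (auto simp: algebra_simps intro!: eq_vecI)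
qed

text \<open>Translations are transitive, so an invariant v is constant. Invariance of u modulo v
  means that translating by g adds \<open>pair_lam\<close> of g times v; translating position 0,
  where u vanishes, to position j determines u there.\<close>

lemma fixed_pairs_image:
  assumes s: "s \<in> fixed_pairs n"
  shows "\<exists>c. c \<noteq> (0 :: 'p::prime_card mod_ring) \<and> s = fixed_pair n c (\<lambda>i. pair_lam (reg_mat n (unit_fun i 1)) s)"
proof -
  define N where "N = CARD('p) ^ Suc n"
  let ?t = "\<lambda>i. pair_lam (reg_mat n (unit_fun i 1)) s"
  have N: "0 < N"
    by (simp add: N_def)
  have sL: "s \<in> lead_pairs N"
    using s unfolding fixed_pairs_def N_def by blast
  obtain v u where vu: "s = (v, u)" "v \<in> carrier_vec N" "v \<noteq> 0\<^sub>v N" "u \<in> carrier_vec N" "u $ lead_index v = 0"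
    using sL by (auto simp: lead_pairs_def)
  have fixed: "pair_act (reg_mat n g) s = s" "pair_lam (reg_mat n g) s = (\<Sum>i\<le>n. g i * ?t i)"
    if "\<And>i. i > n \<Longrightarrow> g i = 0" for g
    using fixed_point_lam[OF reg_mat_action sL[unfolded N_def], of "Suc n" g] s that
    by (simp_all add: fixed_pairs_def lessThan_Suc_atMost)
  define c where "c = v $ 0"
  have row: "row_mult (reg_mat n g) w = vec N (\<lambda>j. w $ perm0 (regular_rep n g) j)" if "w \<in> carrier_vec N" for g :: "nat \<Rightarrow> 'p mod_ring" and w
    using that unfolding reg_mat_def N_def by (rule row_mult_perm_mat[OF regular_rep_permutes])
  have vg: "row_mult (reg_mat n g) v = v" if "\<And>i. i > n \<Longrightarrow> g i = 0" for g
    using fixed(1)[OF that] by (simp add: vu(1) pair_act_def)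
  have vj: "v $ j = c" if j: "j < N" for j
  proof -
    let ?g = "digits n j :: nat \<Rightarrow> 'p mod_ring"
    have "vec N (\<lambda>i. v $ perm0 (regular_rep n ?g) i) = v"
      by (rule trans[OF row[OF vu(2), symmetric] vg]) (rule digits_support)
    then have "v $ perm0 (regular_rep n ?g) 0 = v $ 0"
      using index_vec[OF N, of "\<lambda>i. v $ perm0 (regular_rep n ?g) i"] by simp
    then show ?thesis
      using regular_rep_transitive[OF j[unfolded N_def]] by (simp add: c_def)
  qed
  have c: "c \<noteq> 0"
  proof
    assume "c = 0"
    then have "v = 0\<^sub>v N"
      using vj vu(2) by (intro eq_vecI) auto
    with vu(3) show False ..
  qed
  have lead: "lead_index v = 0"
    by (rule lead_index_const[OF vu(2) N]) (use c in \<open>simp add: c_def\<close>)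
  have uj: "u $ j = c * digit_sum n ?t j" if j: "j < N" for j
  proof -
    let ?g = "digits n j :: nat \<Rightarrow> 'p mod_ring"
    have vg': "row_mult (reg_mat n ?g) v = v"
      by (rule vg) (rule digits_support)
    have "pair_lam (reg_mat n ?g) s = u $ j / c"
      unfolding vu(1) pair_lam_def prod.case vg' row[OF vu(4)] lead_ratio_def lead
      using N regular_rep_transitive[OF j[unfolded N_def]] by (simp add: c_def)
    moreover have "pair_lam (reg_mat n ?g) s = (\<Sum>i\<le>n. ?g i * ?t i)"
      by (rule fixed(2)) (rule digits_support)
    moreover have "digit_sum n ?t j = (\<Sum>i\<le>n. ?g i * ?t i)"
      using digit_sum_regular_rep[OF N[unfolded N_def], of ?t ?g] regular_rep_transitive[OF j[unfolded N_def]] by (simp add: digit_sum_0)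
    ultimately show ?thesis
      using c by (simp add: field_simps)
  qed
  have "s = fixed_pair n c ?t"
    unfolding fixed_pair_def N_def[symmetric] using vj uj vu by (auto intro!: eq_vecI)
  with c show ?thesis
    by blast
qed

text \<open>Fixed pairs correspond to a nonzero c and a form t, and \<open>pair_lam\<close> only
  sees t; so every t is counted p - 1 times, which is the factor -1. Extensional functions on {..n}
  make t unique.\<close>

lemma sum_fixed_pairs:
  fixes f :: "(nat \<Rightarrow> 'p::prime_card mod_ring) \<Rightarrow> 'p mod_ring"
  assumes f: "\<And>t t'. (\<And>i. i \<le> n \<Longrightarrow> t i = t' i) \<Longrightarrow> f t = f t'"
  shows "(\<Sum>s\<in>fixed_pairs n. f (\<lambda>i. pair_lam (reg_mat n (unit_fun i 1)) s)) =
    - (\<Sum>t\<in>{..n} \<rightarrow>\<^sub>E UNIV. f t)"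
proof -
  let ?t = "\<lambda>s i. pair_lam (reg_mat n (unit_fun i 1)) s"
  let ?A = "{c :: 'p mod_ring. c \<noteq> 0} \<times> ({..n} \<rightarrow>\<^sub>E (UNIV :: 'p mod_ring set))"
  have t: "?t (fixed_pair n c t) i = t i" if "c \<noteq> 0" "i \<le> n" for c t i
  proof -
    have "(\<Sum>k\<le>n. unit_fun i 1 k * t k) = (\<Sum>k\<le>n. if k = i then t i else 0)"
      by (intro sum.cong) (auto simp: unit_fun_def)
    then show ?thesis
      using that by (simp add: fixed_pair(2))
  qed
  have cong: "fixed_pair n c t = fixed_pair n c t'" if "\<And>i. i \<le> n \<Longrightarrow> t i = t' i" for c t t'
  proof -
    have "digit_sum n t j = digit_sum n t' j" for j
      using that by (induction n arbitrary: j) auto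
    then show ?thesis
      by (simp add: fixed_pair_def)
  qed
  have img: "fixed_pairs n = (\<lambda>(c, t). fixed_pair n c t) ` ?A"
  proof (intro equalityI subsetI)
    fix s :: "'p mod_ring vec \<times> 'p mod_ring vec" assume "s \<in> fixed_pairs n"
    then obtain c where c: "c \<noteq> 0" "s = fixed_pair n c (?t s)"
      using fixed_pairs_image by blast
    moreover have "fixed_pair n c (?t s) = fixed_pair n c (restrict (?t s) {..n})"
      by (rule cong) simp
    ultimately show "s \<in> (\<lambda>(c, t). fixed_pair n c t) ` ?A"
      by (intro image_eqI[of _ _ "(c, restrict (?t s) {..n})"]) simp_all
  next
    fix s assume "s \<in> (\<lambda>(c, t). fixed_pair n c t) ` ?A"
    then obtain c t where "c \<noteq> 0" "s = fixed_pair n c t"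
      by auto
    then show "s \<in> fixed_pairs n"
      unfolding fixed_pairs_def by (simp only: mem_Collect_eq fixed_pair simp_thms not_False_eq_True)
  qed
  \<comment> \<open>The first vector recovers \<open>c\<close>; the values of
    \<open>pair_lam\<close> at the unit functions recover \<open>t\<close>.\<close>
  have inj: "inj_on (\<lambda>(c, t). fixed_pair n c t) ?A"
  proof (rule inj_onI, clarify)
    fix c c' :: "'p mod_ring" and t t' assume *: "c \<noteq> 0" "c' \<noteq> 0" "t \<in> {..n} \<rightarrow>\<^sub>E UNIV" "t' \<in> {..n} \<rightarrow>\<^sub>E UNIV"
      "fixed_pair n c t = fixed_pair n c' t'"
    have "vec (CARD('p) ^ Suc n) (\<lambda>_. c) $ 0 = vec (CARD('p) ^ Suc n) (\<lambda>_. c') $ 0"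
      using *(5) by (simp add: fixed_pair_def)
    then have "c = c'"
      by (simp del: power_Suc)
    moreover have "t = t'"
      using * t[OF *(1), of _ t] t[OF *(2), of _ t'] by (intro PiE_ext[OF *(3,4)]) (metis atMost_iff)
    ultimately show "c = c' \<and> t = t'" ..
  qed
  have "(\<Sum>s\<in>fixed_pairs n. f (?t s)) = (\<Sum>(c, t)\<in>?A. f (?t (fixed_pair n c t)))"
    unfolding img by (subst sum.reindex[OF inj]) (simp add: split_beta)
  also have "\<dots> = (\<Sum>(c, t)\<in>?A. f t)"
    by (intro sum.cong refl) (auto intro!: f simp: t)
  also have "\<dots> = of_nat (card {c :: 'p mod_ring. c \<noteq> 0}) * (\<Sum>t\<in>{..n} \<rightarrow>\<^sub>E UNIV. f t)"
    by (simp add: sum.cartesian_product[symmetric])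
  also have "card {c :: 'p mod_ring. c \<noteq> 0} = CARD('p) - 1"
  proof -
    have "{c :: 'p mod_ring. c \<noteq> 0} = UNIV - {0}"
      by auto
    then show ?thesis
      by (simp add: card_Diff_singleton)
  qed
  also have "(of_nat (CARD('p) - 1) :: 'p mod_ring) = - 1"
    by (rule of_nat_CARD_minus_1)
  finally show ?thesis
    by simp
qed

end

section \<open>Binomial coefficients without carries\<close>

text \<open>Among the factors of the factorial, the multiples of p contribute p^m times m!, and
  \<open>c\<close> collects all the others.\<close>

lemma fact_mult_add:
  fixes p :: nat
  assumes p: "prime p" and r: "r < p"
  shows "\<exists>c. \<not> p dvd c \<and> fact (p * m + r) = p ^ m * fact m * c"
proof -
  have step: "\<exists>c. \<not> p dvd c \<and> fact (p * m + r) = fact (p * m) * c" if "r < p" for m r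
    using that
  proof (induction r)
    case 0
    show ?case
      using p by (intro exI[of _ 1]) (auto simp: prime_nat_iff)
  next
    case (Suc r)
    then obtain c where c: "\<not> p dvd c" "fact (p * m + r) = fact (p * m) * c"
      by auto
    have "\<not> p dvd p * m + Suc r"
    proof
      assume "p dvd p * m + Suc r"
      then have "p dvd Suc r"
        using dvd_add_right_iff[OF dvd_triv_left, of p m "Suc r"] by blast
      then show False
        using Suc.prems dvd_imp_le[of p "Suc r"] by simp
    qed
    then have "\<not> p dvd (p * m + Suc r) * c"
      using prime_dvd_mult_iff[OF p, of "p * m + Suc r" c] c(1) by blast
    moreover have "fact (p * m + Suc r) = fact (p * m) * ((p * m + Suc r) * c)"
      using c(2) by (simp add: algebra_simps)
    ultimately show ?case
      by blast
  qed
  have base: "\<exists>c. \<not> p dvd c \<and> fact (p * m) = p ^ m * fact m * c" for m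
  proof (induction m)
    case 0
    show ?case
      using p by (intro exI[of _ 1]) (auto simp: prime_nat_iff)
  next
    case (Suc m)
    then obtain c where c: "\<not> p dvd c" "fact (p * m) = p ^ m * fact m * c"
      by blast
    have p0: "p > 0"
      using p by (rule prime_gt_0_nat)
    obtain d where d: "\<not> p dvd d" "fact (p * m + (p - 1)) = fact (p * m) * d"
      using step[of "p - 1" m] p0 by auto
    have eq: "p * Suc m = Suc (p * m + (p - 1))"
      using p0 by simp
    have "fact (p * Suc m) = p * Suc m * fact (p * m + (p - 1))"
      by (simp only: fact_Suc of_nat_id eq)
    also have "\<dots> = p ^ Suc m * fact (Suc m) * (c * d)"
      unfolding d(2) c(2) by (simp add: algebra_simps)
    finally show ?case
      using c(1) d(1) p by (auto simp: prime_dvd_mult_iff)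
  qed
  obtain c d where "\<not> p dvd c" "fact (p * m) = p ^ m * fact m * c"
      "\<not> p dvd d" "fact (p * m + r) = fact (p * m) * d"
    using step[OF r] base by blast
  then show ?thesis
    using p by (intro exI[of _ "c * d"]) (auto simp: prime_dvd_mult_iff)
qed

text \<open>One direction of Kummer's theorem, by stripping the lowest digit. Without a carry there,
  the quotients by p add up, the powers of p in the three factorials cancel, and what remains
  relates the binomial coefficient to that of the quotients through a factor prime to p.\<close>

lemma binomial_not_dvd:
  fixes p a b :: nat
  assumes p: "prime p" and "\<And>j. a div p ^ j mod p + b div p ^ j mod p < p"
  shows "\<not> p dvd (a + b choose a)"
  using assms(2)
proof (induction "a + b" arbitrary: a b rule: less_induct)
  case less
  have p1: "p > 1"
    using p by (rule prime_gt_1_nat)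
  show ?case
  proof (cases "a + b = 0")
    case True
    then show ?thesis
      using p1 by simp
  next
    case False
    define a' b' where "a' = a div p" and "b' = b div p"
    let ?r = "a mod p + b mod p"
    have r: "?r < p" "a mod p < p" "b mod p < p"
      using less.prems[of 0] p1 by auto
    have ab: "a = p * a' + a mod p" "b = p * b' + b mod p"
      by (simp_all add: a'_def b'_def)
    have sum: "a + b = p * (a' + b') + ?r"
      using ab by (metis add.assoc add.left_commute distrib_left)
    have "a' + b' < a + b"
    proof -
      have "2 * (a' + b') \<le> p * (a' + b')"
        using p1 by (intro mult_le_mono1) simp
      moreover have "p * (a' + b') \<le> a + b"
        unfolding sum by simp
      ultimately have "2 * (a' + b') \<le> a + b"
        by (rule order_trans)
      then show ?thesis
        using False by arith
    qed
    moreover have "a' div p ^ j mod p + b' div p ^ j mod p < p" for j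
      using less.prems[of "Suc j"] by (simp add: a'_def b'_def div_mult2_eq)
    ultimately have IH: "\<not> p dvd (a' + b' choose a')"
      by (rule less.hyps)
    obtain c where c: "\<not> p dvd c" "fact (a + b) = p ^ (a' + b') * fact (a' + b') * c"
      using fact_mult_add[OF p r(1), of "a' + b'"] sum by metis
    obtain c1 where c1: "fact a = p ^ a' * fact a' * c1"
      using fact_mult_add[OF p r(2), of a'] ab(1) by metis
    obtain c2 where c2: "fact b = p ^ b' * fact b' * c2"
      using fact_mult_add[OF p r(3), of b'] ab(2) by metis
    define F :: nat where "F = p ^ (a' + b') * (fact a' * fact b')"
    have 1: "fact a * fact b * (a + b choose a) = fact (a + b)"
      using binomial_fact_lemma[of a "a + b"] by simp
    have 2: "fact a' * fact b' * (a' + b' choose a') = fact (a' + b')"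
      using binomial_fact_lemma[of a' "a' + b'"] by simp
    have "F * (c1 * c2 * (a + b choose a)) = fact a * fact b * (a + b choose a)"
      unfolding c1 c2 F_def power_add by (simp only: ac_simps)
    also have "\<dots> = F * ((a' + b' choose a') * c)"
      unfolding 1 c(2) 2[symmetric] F_def by (simp only: ac_simps)
    finally have "c1 * c2 * (a + b choose a) = (a' + b' choose a') * c"
      using p1 by (simp add: F_def)
    then show ?thesis
      using IH c(1) p by (metis dvd_mult prime_dvd_mult_iff)
  qed
qed

text \<open>Without carries the digits of a partial sum are the sums of the digits, so adding the
  next summand produces no carry either; this permits adding the numbers one by one.\<close>

lemma no_carry_partial_sum:
  fixes b :: "nat \<Rightarrow> nat"
  assumes p: "p > 1" and nc: "\<And>j. (\<Sum>i\<le>n. b i div p ^ j mod p) < p" and m: "m \<le> n"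
  shows "(\<Sum>i\<le>m. b i) div p ^ j mod p = (\<Sum>i\<le>m. b i div p ^ j mod p)"
proof -
  have lt: "(\<Sum>i\<le>m. b i div p ^ j mod p) < p" for j
    by (rule le_less_trans[OF _ nc[of j]]) (use m in \<open>auto intro!: sum_mono2\<close>)
  have "(\<Sum>i\<le>m. b i) div p ^ j = (\<Sum>i\<le>m. b i div p ^ j)" for j
  proof (induction j)
    case (Suc j)
    have "(\<Sum>i\<le>m. b i div p ^ j) = (\<Sum>i\<le>m. b i div p ^ j div p * p + b i div p ^ j mod p)"
      by simp
    also have "\<dots> = (\<Sum>i\<le>m. b i div p ^ j div p) * p + (\<Sum>i\<le>m. b i div p ^ j mod p)"
      by (simp only: sum.distrib sum_distrib_right)
    finally have "(\<Sum>i\<le>m. b i div p ^ j) div p = (\<Sum>i\<le>m. b i div p ^ j div p)"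
      using lt[of j] p by simp
    then show ?case
      by (simp only: power_Suc2 div_mult2_eq Suc)
  qed simp
  moreover have "(\<Sum>i\<le>m. b i div p ^ j) mod p = (\<Sum>i\<le>m. b i div p ^ j mod p)"
    unfolding mod_sum_eq[of "\<lambda>i. b i div p ^ j" p "{..m}", symmetric] by (rule mod_less[OF lt])
  ultimately show ?thesis
    by simp
qed

section \<open>Products of cycles on elementary abelian groups\<close>

text \<open>The cross product of the cycles, formed inside one commutative group: factor i is placed
  on coordinate i, and shuffling replaces the Eilenberg-Zilber map to a product group.\<close>

fun product_cycle :: "(nat \<Rightarrow> 'p mod_ring list \<Rightarrow>\<^sub>0 'k) \<Rightarrow> nat \<Rightarrow> ((nat \<Rightarrow> 'p::prime_card mod_ring) list \<Rightarrow>\<^sub>0 'k::comm_ring_1)" where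
  "product_cycle c 0 = pushforward (map (unit_fun 0)) (c 0)"
| "product_cycle c (Suc n) =
     bilin_ext shuffle_sum (product_cycle c n) (pushforward (map (unit_fun (Suc n))) (c (Suc n)))"

lemma keys_product_cycle:
  fixes c :: "nat \<Rightarrow> 'p::prime_card mod_ring list \<Rightarrow>\<^sub>0 'k::comm_ring_1"
  assumes "\<And>i w. w \<in> Poly_Mapping.keys (c i) \<Longrightarrow> length w = l i"
    and "xs \<in> Poly_Mapping.keys (product_cycle c n)"
  shows "length xs = (\<Sum>i\<le>n. l i) \<and> (\<forall>g\<in>set xs. \<forall>i>n. g i = 0)"
  using assms(2)
proof (induction n arbitrary: xs)
  case 0
  then obtain w where "w \<in> Poly_Mapping.keys (c 0)" "xs = map (unit_fun 0) w"
    using subsetD[OF keys_pushforward, of xs "map (unit_fun 0)" "c 0"] by auto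
  then show ?case
    using assms(1) by (auto simp: unit_fun_def)
next
  case (Suc n)
  let ?d = "pushforward (map (unit_fun (Suc n))) (c (Suc n))"
  have "xs \<in> (\<Union>x\<in>Poly_Mapping.keys (product_cycle c n). \<Union>y\<in>Poly_Mapping.keys ?d.
      Poly_Mapping.keys (shuffle_sum x y :: _ \<Rightarrow>\<^sub>0 'k))"
    using Suc.prems by (intro subsetD[OF keys_bilin_ext]) simp
  then obtain x y where xy: "x \<in> Poly_Mapping.keys (product_cycle c n)" "y \<in> Poly_Mapping.keys ?d"
      "xs \<in> Poly_Mapping.keys (shuffle_sum x y :: _ \<Rightarrow>\<^sub>0 'k)"
    by blast
  obtain w where w: "w \<in> Poly_Mapping.keys (c (Suc n))" "y = map (unit_fun (Suc n)) w"
    using subsetD[OF keys_pushforward xy(2)] by auto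
  show ?case
    using keys_shuffle_sum[OF xy(3)] Suc.IH[OF xy(1)] assms(1)[OF w(1)] by (auto simp: w(2) unit_fun_def)
qed

lemma pushforward_map_cycle:
  assumes "c \<in> bar_cycles G" "carrier G = UNIV" "carrier H = UNIV"
    and "\<And>x y. f (x \<otimes>\<^bsub>G\<^esub> y) = f x \<otimes>\<^bsub>H\<^esub> f y"
  shows "pushforward (map f) c \<in> bar_cycles H"
proof (rule bar_cycles_UNIV[OF assms(3)])
  fix u
  have "evaluate (\<lambda>z. evaluate u (bar_boundary H z)) (pushforward (map f) c) =
      evaluate (\<lambda>z. evaluate (\<lambda>z. u (map f z)) (bar_boundary G z)) c"
    unfolding evaluate_pushforward
    by (intro evaluate_cong evaluate_bar_boundary_map) (simp_all add: assms)
  also have "\<dots> = evaluate (\<lambda>z. u (map f z)) (lin_ext (bar_boundary G) c)"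
    by (simp only: evaluate_lin_ext)
  also have "\<dots> = 0"
    using assms(1) by (simp add: bar_cycles_def)
  finally show "evaluate (\<lambda>z. evaluate u (bar_boundary H z)) (pushforward (map f) c) = 0" .
qed

lemma shuffle_cycle:
  assumes a: "a \<in> bar_cycles G" and b: "b \<in> bar_cycles G" and G: "carrier G = UNIV"
    and comm: "\<And>x y. x \<otimes>\<^bsub>G\<^esub> y = y \<otimes>\<^bsub>G\<^esub> x"
  shows "bilin_ext shuffle_sum a b \<in> bar_cycles G"
proof (rule bar_cycles_UNIV[OF G])
  fix u
  have za: "evaluate (\<lambda>x. evaluate v (bar_boundary G x)) a = 0" for v
    using a evaluate_lin_ext[of v "bar_boundary G" a] by (simp add: bar_cycles_def)
  have zb: "evaluate (\<lambda>x. evaluate v (bar_boundary G x)) b = 0" for v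
    using b evaluate_lin_ext[of v "bar_boundary G" b] by (simp add: bar_cycles_def)
  have "evaluate (\<lambda>z. evaluate u (bar_boundary G z)) (bilin_ext shuffle_sum a b) =
      evaluate (\<lambda>x. evaluate (\<lambda>y. evaluate (\<lambda>z. evaluate u (shuffle_sum z y)) (bar_boundary G x)
        + (- 1) ^ length x * evaluate (\<lambda>z. evaluate u (shuffle_sum x z)) (bar_boundary G y)) b) a"
    unfolding evaluate_bilin_ext by (intro evaluate_cong shuffle_coboundary comm)
  also have "\<dots> = evaluate (\<lambda>x. evaluate (\<lambda>y. evaluate (\<lambda>z. evaluate u (shuffle_sum z y)) (bar_boundary G x)) b) a"
    by (simp only: evaluate_fun_add evaluate_fun_scale zb mult_zero_right add_0_right)
  also have "\<dots> = evaluate (\<lambda>y. evaluate (\<lambda>x. evaluate (\<lambda>z. evaluate u (shuffle_sum z y)) (bar_boundary G x)) a) b"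
    by (rule evaluate_swap)
  also have "\<dots> = 0"
    by (simp only: za evaluate_fun_zero)
  finally show "evaluate (\<lambda>z. evaluate u (bar_boundary G z)) (bilin_ext shuffle_sum a b) = 0" .
qed

lemma product_cycle_is_cycle:
  assumes "\<And>i. c i \<in> bar_cycles fp_add"
  shows "product_cycle c n \<in> bar_cycles fp_fun"
proof (induction n)
  case 0
  show ?case
    unfolding product_cycle.simps
    by (rule pushforward_map_cycle[OF assms]) (auto simp: unit_fun_def)
next
  case (Suc n)
  have "pushforward (map (unit_fun (Suc n))) (c (Suc n)) \<in> bar_cycles fp_fun"
    by (rule pushforward_map_cycle[OF assms]) (auto simp: unit_fun_def)
  then show ?case
    unfolding product_cycle.simps by (intro shuffle_cycle Suc) (auto simp: add.commute)
qed

abbreviation cayley_chain :: "('p::prime_card mod_ring list \<Rightarrow>\<^sub>0 'k) \<Rightarrow> (nat \<times> (nat \<Rightarrow> nat) list \<Rightarrow>\<^sub>0 'k::comm_ring_1)" where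
  "cayley_chain \<equiv> pushforward (\<lambda>xs. (CARD('p), map cayley xs))"

text \<open>The circle product of Cayley classes is the image of the product cycle under the regular
  representation: letters from either factor have a trivial component in the other, and there
  \<open>perm_product\<close> inserts an identity.\<close>

lemma iterate_cayley_chain:
  fixes c :: "nat \<Rightarrow> 'p::prime_card mod_ring list \<Rightarrow>\<^sub>0 'k::comm_ring_1"
  assumes len: "\<And>i w. w \<in> Poly_Mapping.keys (c i) \<Longrightarrow> length w = l i"
  shows "iterate (bilin_ext (simplex_product sym_group (*) perm_product)) (\<lambda>i. cayley_chain (c i)) n =
    pushforward (\<lambda>xs. (CARD('p) ^ Suc n, map (regular_rep n) xs)) (product_cycle c n)"
proof (induction n)
  case 0
  show ?case
    by (simp add: pushforward_pushforward comp_def unit_fun_def)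
next
  case (Suc n)
  let ?P = "bilin_ext (simplex_product sym_group (*) perm_product)"
  let ?Z = "product_cycle c n" and ?N = "CARD('p) ^ Suc n"
  show ?case
  proof (rule chain_eqI)
    fix u :: "nat \<times> (nat \<Rightarrow> nat) list \<Rightarrow> 'k"
    have "evaluate u (iterate ?P (\<lambda>i. cayley_chain (c i)) (Suc n)) =
        evaluate (\<lambda>xs. evaluate (\<lambda>ys. evaluate u (simplex_product sym_group (*) perm_product
          (?N, map (regular_rep n) xs) (CARD('p), map cayley ys))) (c (Suc n))) ?Z"
      unfolding iterate.simps Suc.IH evaluate_bilin_ext evaluate_pushforward ..
    also have "\<dots> = evaluate (\<lambda>xs. evaluate (\<lambda>ys. evaluate (\<lambda>z. u (CARD('p) ^ Suc (Suc n), map (regular_rep (Suc n)) z))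
        (shuffle_sum xs (map (unit_fun (Suc n)) ys))) (c (Suc n))) ?Z"
    proof (rule evaluate_cong, rule evaluate_cong)
      fix xs :: "(nat \<Rightarrow> 'p mod_ring) list" and ys :: "'p mod_ring list"
      assume xs: "xs \<in> Poly_Mapping.keys ?Z"
      \<comment> \<open>Letters of the earlier factors have coordinate 0 at \<open>Suc n\<close>, so
        their last Cayley permutation is the identity; in \<open>2\<close> the roles are
        exchanged.\<close>
      have 1: "map (\<lambda>g. perm_product ?N CARD('p) g id) (map (regular_rep n) xs) = map (regular_rep (Suc n)) xs"
        unfolding map_map comp_def
      proof (rule map_cong[OF refl])
        fix x assume "x \<in> set xs"
        then have "x (Suc n) = 0"
          using keys_product_cycle[of c l xs n, OF len xs] by simp
        then show "perm_product ?N CARD('p) (regular_rep n x) id = regular_rep (Suc n) x"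
          by (simp add: cayley_zero del: power_Suc)
      qed
      have "regular_rep n (unit_fun (Suc n) a) = id" for a :: "'p mod_ring"
        by (rule regular_rep_zero) (simp add: unit_fun_def)
      then have 2: "map (perm_product ?N CARD('p) id) (map cayley ys) =
          map (regular_rep (Suc n)) (map (unit_fun (Suc n)) ys)"
        by (simp add: unit_fun_def del: power_Suc)
      show "evaluate u (simplex_product sym_group (*) perm_product (?N, map (regular_rep n) xs) (CARD('p), map cayley ys)) =
          evaluate (\<lambda>z. u (CARD('p) ^ Suc (Suc n), map (regular_rep (Suc n)) z)) (shuffle_sum xs (map (unit_fun (Suc n)) ys))"
        unfolding evaluate_simplex_product sym_group_simps 1 2 evaluate_shuffle_map by (simp add: mult.commute mult.left_commute)
    qed
    also have "\<dots> = evaluate u (pushforward (\<lambda>xs. (CARD('p) ^ Suc (Suc n), map (regular_rep (Suc n)) xs)) (product_cycle c (Suc n)))"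
      unfolding product_cycle.simps evaluate_pushforward evaluate_bilin_ext ..
    finally show "evaluate u (iterate ?P (\<lambda>i. cayley_chain (c i)) (Suc n)) =
        evaluate u (pushforward (\<lambda>xs. (CARD('p) ^ Suc (Suc n), map (regular_rep (Suc n)) xs)) (product_cycle c (Suc n)))" .
  qed
qed

lemma mod_ring_power_eq:
  fixes a :: "'p::prime_card mod_ring"
  assumes "b > 0" "(CARD('p) - 1) dvd b"
  shows "a ^ b = (if a = 0 then 0 else 1)"
proof (cases "a = 0")
  case False
  have "a ^ CARD('p) = a"
    using finite_field_power_card_eq_same[of a] by simp
  moreover have "CARD('p) = Suc (CARD('p) - 1)"
    by simp
  ultimately have "a * a ^ (CARD('p) - 1) = a * 1"
    by (metis mult.right_neutral power_Suc)
  then have "a ^ (CARD('p) - 1) = 1"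
    using False by simp
  then show ?thesis
    using assms(2) False by (auto elim!: dvdE simp: power_mult)
qed (use assms in simp)

text \<open>Positivity of the exponent removes the term of 0, and Fermat makes each other term 1;
  there are p - 1 of them.\<close>

lemma sum_mod_ring_power:
  assumes "b > 0" "(CARD('p) - 1) dvd b"
  shows "(\<Sum>a\<in>UNIV. (a :: 'p::prime_card mod_ring) ^ b) = - 1"
proof -
  have "(\<Sum>a\<in>UNIV. (a :: 'p mod_ring) ^ b) = (\<Sum>a\<in>UNIV - {0 :: 'p mod_ring}. 1)"
    by (rule sum.mono_neutral_cong_right) (auto simp: mod_ring_power_eq[OF assms])
  also have "\<dots> = - 1"
    using of_nat_CARD_minus_1[where ?'p = 'p] by (simp add: card_Diff_singleton)
  finally show ?thesis .
qed

section \<open>Detection of the products\<close>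

text \<open>The product is the multinomial coefficient, built by adding one summand at a time; each
  binomial factor is prime to p by \<open>binomial_not_dvd\<close>.\<close>

lemma of_nat_binomial_product_nonzero:
  fixes b :: "nat \<Rightarrow> nat"
  assumes digits: "\<And>j. (\<Sum>i\<le>n. b i div CARD('p) ^ j mod CARD('p)) < CARD('p)"
  shows "(of_nat (\<Prod>i<n. (\<Sum>j\<le>Suc i. b j) choose (\<Sum>j\<le>i. b j)) :: 'p::prime_card mod_ring) \<noteq> 0"
proof -
  let ?p = "CARD('p)"
  have p: "prime ?p"
    by (rule prime_card)
  have p1: "?p > 1"
    using p by (rule prime_gt_1_nat)
  have "(of_nat ((\<Sum>j\<le>Suc i. b j) choose (\<Sum>j\<le>i. b j)) :: 'p mod_ring) \<noteq> 0" if i: "i < n" for i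
  proof
    assume "(of_nat ((\<Sum>j\<le>Suc i. b j) choose (\<Sum>j\<le>i. b j)) :: 'p mod_ring) = 0"
    then have "?p dvd ((\<Sum>j\<le>Suc i. b j) choose (\<Sum>j\<le>i. b j))"
      by (rule of_nat_0_mod_ring_dvd)
    moreover have "\<not> ?p dvd ((\<Sum>j\<le>i. b j) + b (Suc i) choose (\<Sum>j\<le>i. b j))"
    proof (rule binomial_not_dvd[OF p])
      fix j
      have "(\<Sum>k\<le>i. b k) div ?p ^ j mod ?p + b (Suc i) div ?p ^ j mod ?p =
          (\<Sum>k\<le>Suc i. b k div ?p ^ j mod ?p)"
        using no_carry_partial_sum[of ?p b n, OF p1 digits, of i j] i by simp
      also have "\<dots> \<le> (\<Sum>k\<le>n. b k div ?p ^ j mod ?p)"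
        by (rule sum_mono2) (use i in auto)
      also have "\<dots> < ?p"
        by (rule digits)
      finally show "(\<Sum>k\<le>i. b k) div ?p ^ j mod ?p + b (Suc i) div ?p ^ j mod ?p < ?p" .
    qed
    ultimately show False
      by simp
  qed
  then show ?thesis
    unfolding of_nat_prod prod_zero_iff[OF finite_lessThan] by blast
qed

text \<open>The interface shared by odd p, with carry powers and D = 2, and p = 2, with letter
  powers and D = 1. Here D is the degree of y, and \<open>U_shuffle\<close> is the rule that
  produces the binomial coefficients.\<close>

locale power_system =
  fixes D :: nat and U :: "nat \<Rightarrow> 'p::prime_card mod_ring list \<Rightarrow> 'p mod_ring"
    and \<zeta> :: "nat \<Rightarrow> 'p mod_ring list \<Rightarrow>\<^sub>0 'p mod_ring"
  assumes U_cocycle: "evaluate (U k) (bar_boundary fp_add xs) = 0"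
    and U_zero: "0 \<in> set xs \<Longrightarrow> U k xs = 0"
    and U_shuffle: "length xs = D * j \<Longrightarrow> length ys = D * k \<Longrightarrow>
      evaluate (U (j + k)) (shuffle_sum xs ys) = of_nat ((j + k) choose j) * U j xs * U k ys"
    and \<zeta>_cycle: "\<zeta> k \<in> bar_cycles fp_add"
    and \<zeta>_keys: "w \<in> Poly_Mapping.keys (\<zeta> k) \<Longrightarrow> length w = D * k"
    and \<zeta>_power: "evaluate (\<lambda>w. U k (map ((*) c) w)) (\<zeta> k) = c ^ k"
begin

text \<open>The shape in which \<open>dual_class_eq\<close> delivers the dual classes; the unit
  \<mu> reflects the choice of the generator y.\<close>

definition scaled_cycle :: "'p mod_ring \<Rightarrow> nat \<Rightarrow> 'p mod_ring list \<Rightarrow>\<^sub>0 'p mod_ring" where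
  "scaled_cycle \<mu> k = Poly_Mapping.map ((*) (\<mu> ^ k)) (\<zeta> k)"

lemma scaled_cycle_is_cycle: "scaled_cycle \<mu> k \<in> bar_cycles fp_add"
  unfolding scaled_cycle_def
proof (rule bar_cycles_UNIV)
  fix u :: "'p mod_ring list \<Rightarrow> 'p mod_ring"
  have "evaluate (\<lambda>z. evaluate u (bar_boundary fp_add z)) (\<zeta> k) = 0"
    using \<zeta>_cycle[of k] evaluate_lin_ext[of u "bar_boundary fp_add" "\<zeta> k"] by (simp add: bar_cycles_def)
  then show "evaluate (\<lambda>z. evaluate u (bar_boundary fp_add z)) (Poly_Mapping.map ((*) (\<mu> ^ k)) (\<zeta> k)) = 0"
    by (simp add: evaluate_scale)
qed simp

lemma scaled_cycle_keys:
  assumes "w \<in> Poly_Mapping.keys (scaled_cycle \<mu> k)"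
  shows "length w = D * k"
proof (rule \<zeta>_keys)
  show "w \<in> Poly_Mapping.keys (\<zeta> k)"
    using assms by (auto simp: scaled_cycle_def in_keys_iff)
qed

text \<open>Every letter of the product cycle lives on a single coordinate, where \<open>l\<close>
  is multiplication by t i. Each shuffle splits \<open>U\<close> with a binomial factor by
  \<open>U_shuffle\<close>, and the i-th factor contributes its power by
  \<open>\<zeta>_power\<close>.\<close>

lemma evaluate_product_cycle:
  assumes l: "\<And>i a. i \<le> n \<Longrightarrow> l (unit_fun i a) = t i * a"
  shows "evaluate (\<lambda>xs. U (\<Sum>i\<le>n. b i) (map l xs)) (product_cycle (\<lambda>i. scaled_cycle \<mu> (b i)) n) =
    of_nat (\<Prod>i<n. (\<Sum>j\<le>Suc i. b j) choose (\<Sum>j\<le>i. b j)) * (\<Prod>i\<le>n. (\<mu> * t i) ^ b i)"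
  using assms
proof (induction n)
  have single: "evaluate (\<lambda>y. U (b i) (map l y)) (pushforward (map (unit_fun i)) (scaled_cycle \<mu> (b i))) =
      (\<mu> * t i) ^ b i" if "\<And>a. l (unit_fun i a) = t i * a" for i
    unfolding evaluate_pushforward scaled_cycle_def evaluate_scale
    using \<zeta>_power[of "b i" "t i"] by (simp add: comp_def that power_mult_distrib)
  {
    case 0
    then show ?case
      using single[of 0] by simp
  next
    case (Suc n)
    let ?c = "\<lambda>i. scaled_cycle \<mu> (b i)"
    let ?Z = "product_cycle ?c n" and ?d = "pushforward (map (unit_fun (Suc n))) (?c (Suc n))"
    let ?S = "\<Sum>i\<le>n. b i" and ?T = "\<Sum>i\<le>Suc n. b i"
    have "evaluate (\<lambda>xs. U ?T (map l xs)) (product_cycle ?c (Suc n)) =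
        evaluate (\<lambda>x. evaluate (\<lambda>y. evaluate (\<lambda>z. U ?T (map l z)) (shuffle_sum x y)) ?d) ?Z"
      by (simp only: product_cycle.simps evaluate_bilin_ext)
    also have "\<dots> = evaluate (\<lambda>x. evaluate (\<lambda>y. of_nat (?T choose ?S) * U ?S (map l x) * U (b (Suc n)) (map l y)) ?d) ?Z"
    proof (rule evaluate_cong, rule evaluate_cong)
      fix x y assume x: "x \<in> Poly_Mapping.keys ?Z" and y: "y \<in> Poly_Mapping.keys ?d"
      have "length x = (\<Sum>i\<le>n. D * b i)"
        using keys_product_cycle[of ?c "\<lambda>i. D * b i" x n, OF scaled_cycle_keys[where \<mu> = \<mu>] x] by simp
      moreover have "length y = D * b (Suc n)"
        using subsetD[OF keys_pushforward y] scaled_cycle_keys by auto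
      ultimately show "evaluate (\<lambda>z. U ?T (map l z)) (shuffle_sum x y) =
          of_nat (?T choose ?S) * U ?S (map l x) * U (b (Suc n)) (map l y)"
        using U_shuffle[of "map l x" ?S "map l y" "b (Suc n)"]
        by (simp add: evaluate_shuffle_map sum_distrib_left)
    qed
    also have "\<dots> = evaluate (\<lambda>x. of_nat (?T choose ?S) * (\<mu> * t (Suc n)) ^ b (Suc n) * U ?S (map l x)) ?Z"
    proof (rule evaluate_cong)
      fix x
      show "evaluate (\<lambda>y. of_nat (?T choose ?S) * U ?S (map l x) * U (b (Suc n)) (map l y)) ?d =
          of_nat (?T choose ?S) * (\<mu> * t (Suc n)) ^ b (Suc n) * U ?S (map l x)"
        unfolding evaluate_fun_scale using single[of "Suc n"] Suc.prems by (simp only: order_refl mult_ac)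
    qed
    also have "\<dots> = of_nat (?T choose ?S) * (\<mu> * t (Suc n)) ^ b (Suc n) *
        (of_nat (\<Prod>i<n. (\<Sum>j\<le>Suc i. b j) choose (\<Sum>j\<le>i. b j)) * (\<Prod>i\<le>n. (\<mu> * t i) ^ b i))"
      unfolding evaluate_fun_scale using Suc.IH Suc.prems by simp
    also have "\<dots> = of_nat (\<Prod>i<Suc n. (\<Sum>j\<le>Suc i. b j) choose (\<Sum>j\<le>i. b j)) * (\<Prod>i\<le>Suc n. (\<mu> * t i) ^ b i)"
      by (simp only: prod.lessThan_Suc prod.atMost_Suc of_nat_mult mult_ac)
    finally show ?case .
  }
qed

text \<open>The value comes out as minus the multinomial coefficient times the product of all -
  \<mu>^(b i), every factor of which is a unit.\<close>

lemma char_cochain_product_cycle: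
  assumes \<mu>: "\<mu> \<noteq> 0" and b: "\<And>i. i \<le> n \<Longrightarrow> b i > 0 \<and> (CARD('p) - 1) dvd b i"
    and digits: "\<And>j. (\<Sum>i\<le>n. b i div CARD('p) ^ j mod CARD('p)) < CARD('p)"
  shows "evaluate (\<lambda>xs. char_cochain (U (\<Sum>i\<le>n. b i)) (CARD('p) ^ Suc n) (map (reg_mat n) xs))
    (product_cycle (\<lambda>i. scaled_cycle \<mu> (b i)) n) \<noteq> 0"
proof -
  let ?Z = "product_cycle (\<lambda>i. scaled_cycle \<mu> (b i)) n"
  let ?B = "\<Sum>i\<le>n. b i"
  let ?C = "of_nat (\<Prod>i<n. (\<Sum>j\<le>Suc i. b j) choose (\<Sum>j\<le>i. b j)) :: 'p mod_ring"
  define act where "act = (\<lambda>g :: nat \<Rightarrow> 'p mod_ring. pair_act (reg_mat n g))"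
  define lam where "lam = (\<lambda>g :: nat \<Rightarrow> 'p mod_ring. pair_lam (reg_mat n g))"
  let ?S = "lead_pairs (CARD('p) ^ Suc n) :: ('p mod_ring vec \<times> 'p mod_ring vec) set"
  let ?f = "\<lambda>t. ?C * (\<Prod>i\<le>n. (\<mu> * t i) ^ b i)"
  have ac: "action_cocycle fp_fun ?S act lam"
    unfolding act_def lam_def by (rule reg_mat_action)
  have fixed: "fixed_pairs n = {s \<in> ?S. \<forall>i<Suc n. act (unit_fun i 1) s = s}"
    by (simp only: fixed_pairs_def act_def)
  have "evaluate (\<lambda>xs. char_cochain (U ?B) (CARD('p) ^ Suc n) (map (reg_mat n) xs)) ?Z =
      evaluate (\<lambda>xs. \<Sum>s\<in>?S. U ?B (path act lam xs s)) ?Z"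
    unfolding char_cochain_def act_def lam_def path_map ..
  \<comment> \<open>Only pairs fixed by all unit functions survive; at these a path is just the list
    of values of a linear form.\<close>
  also have "\<dots> = evaluate (\<lambda>xs. \<Sum>s\<in>fixed_pairs n. U ?B (path act lam xs s)) ?Z"
    unfolding fixed
    by (rule transfer_fixed_part[OF ac U_cocycle product_cycle_is_cycle[OF scaled_cycle_is_cycle]])
  also have "\<dots> = (\<Sum>s\<in>fixed_pairs n. evaluate (\<lambda>xs. U ?B (path act lam xs s)) ?Z)"
    by (rule evaluate_fun_sum)
  also have "\<dots> = (\<Sum>s\<in>fixed_pairs n. ?f (\<lambda>i. lam (unit_fun i 1) s))"
  proof (rule sum.cong[OF refl])
    fix s :: "'p mod_ring vec \<times> 'p mod_ring vec"
    assume s: "s \<in> fixed_pairs n"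
    have fix_s: "act g s = s \<and> lam g s = (\<Sum>i<Suc n. g i * lam (unit_fun i 1) s)"
      if "\<And>i. i \<ge> Suc n \<Longrightarrow> g i = 0" for g
      by (rule fixed_point_lam[OF ac]) (use s that in \<open>auto simp: fixed\<close>)
    have path: "path act lam xs s = map (\<lambda>g. lam g s) xs"
      if "\<forall>g\<in>set xs. \<forall>i>n. g i = 0" for xs
      using that
    proof (induction xs)
      case (Cons g xs)
      then have "act g s = s"
        using fix_s[of g] by auto
      then show ?case
        using Cons by simp
    qed simp
    have "evaluate (\<lambda>xs. U ?B (path act lam xs s)) ?Z = evaluate (\<lambda>xs. U ?B (map (\<lambda>g. lam g s) xs)) ?Z"
    proof (rule evaluate_cong)
      fix xs assume "xs \<in> Poly_Mapping.keys ?Z"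
      then have "\<forall>g\<in>set xs. \<forall>i>n. g i = 0"
        using keys_product_cycle[of "\<lambda>i. scaled_cycle \<mu> (b i)" "\<lambda>i. D * b i" xs n, OF scaled_cycle_keys[where \<mu> = \<mu>]] by blast
      then show "U ?B (path act lam xs s) = U ?B (map (\<lambda>g. lam g s) xs)"
        by (simp only: path)
    qed
    also have "\<dots> = ?f (\<lambda>i. lam (unit_fun i 1) s)"
    proof (rule evaluate_product_cycle)
      fix i a assume i: "i \<le> n"
      have "lam (unit_fun i a) s = (\<Sum>k<Suc n. unit_fun i a k * lam (unit_fun k 1) s)"
        using fix_s[of "unit_fun i a"] i by (simp add: unit_fun_def)
      also have "\<dots> = (\<Sum>k<Suc n. if k = i then lam (unit_fun i 1) s * a else 0)"
        by (intro sum.cong) (auto simp: unit_fun_def)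
      also have "\<dots> = lam (unit_fun i 1) s * a"
        using i by (subst sum.delta) auto
      finally show "lam (unit_fun i a) s = lam (unit_fun i 1) s * a" .
    qed
    finally show "evaluate (\<lambda>xs. U ?B (path act lam xs s)) ?Z = ?f (\<lambda>i. lam (unit_fun i 1) s)" .
  qed
  also have "\<dots> = - (\<Sum>t\<in>{..n} \<rightarrow>\<^sub>E UNIV. ?f t)"
    unfolding lam_def by (rule sum_fixed_pairs) (auto intro!: prod.cong)
  \<comment> \<open>The summand is a product of functions of the separate coordinates of t, so the
    sum over all t becomes a product of power sums over F_p.\<close>
  also have "(\<Sum>t\<in>{..n} \<rightarrow>\<^sub>E UNIV. ?f t) = ?C * (\<Prod>i\<le>n. \<Sum>a\<in>UNIV. (\<mu> * a) ^ b i)"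
    by (simp only: prod_sum_PiE finite_atMost finite sum_distrib_left)
  also have "(\<Prod>i\<le>n. \<Sum>a\<in>UNIV. (\<mu> * a) ^ b i) = (\<Prod>i\<le>n. \<mu> ^ b i * - 1)"
  proof (rule prod.cong[OF refl])
    fix i assume "i \<in> {..n}"
    then have "(\<Sum>a\<in>UNIV. (a :: 'p mod_ring) ^ b i) = - 1"
      using b by (intro sum_mod_ring_power) auto
    then show "(\<Sum>a\<in>UNIV. (\<mu> * a) ^ b i) = \<mu> ^ b i * - 1"
      by (simp only: power_mult_distrib flip: sum_distrib_left)
  qed
  finally show ?thesis
    using \<mu> of_nat_binomial_product_nonzero[where ?'p = 'p, OF digits] by simp
qed

abbreviation symmetric_cycle :: "'p mod_ring \<Rightarrow> (nat \<Rightarrow> nat) \<Rightarrow> nat \<Rightarrow> (nat \<times> (nat \<Rightarrow> nat) list \<Rightarrow>\<^sub>0 'p mod_ring)" where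
  "symmetric_cycle \<mu> b n \<equiv>
     iterate (bilin_ext (simplex_product sym_group (*) perm_product)) (\<lambda>i. cayley_chain (scaled_cycle \<mu> (b i))) n"

lemma cayley_chain_cycle: "cayley_chain (scaled_cycle \<mu> k) \<in> union_cycles sym_group"
  by (rule pushforward_bar_cycle[OF scaled_cycle_is_cycle])
    (use cayley_permutes in \<open>auto simp: sym_group_simps cayley_add\<close>)

lemma symmetric_cycle_is_cycle: "symmetric_cycle \<mu> b n \<in> union_cycles sym_group"
  by (rule product_family.iterate_cycle[OF product_family_sym cayley_chain_cycle])

text \<open>One statement for the three target families. Since \<open>R\<close> after
  \<open>f\<close> gives permutation matrices in every case, the detecting value is that of
  \<open>char_cochain_product_cycle\<close> each time.\<close>

lemma image_indecomposable:
  fixes H :: "nat \<Rightarrow> 'h monoid" and R :: "nat \<Rightarrow> 'h \<Rightarrow> 'p mod_ring mat"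
  assumes \<mu>: "\<mu> \<noteq> 0" and b: "\<And>i. i \<le> n \<Longrightarrow> b i > 0 \<and> (CARD('p) - 1) dvd b i"
    and digits: "\<And>j. (\<Sum>i\<le>n. b i div CARD('p) ^ j mod CARD('p)) < CARD('p)"
    and monoid: "\<And>k. monoid (H k)"
    and closed: "\<And>k g. g \<in> carrier (H k) \<Longrightarrow> R k g \<in> carrier (GL k)"
    and hom: "\<And>k g h. g \<in> carrier (H k) \<Longrightarrow> h \<in> carrier (H k) \<Longrightarrow> R k (g \<otimes>\<^bsub>H k\<^esub> h) = R k g * R k h"
    and one: "\<And>k. R k \<one>\<^bsub>H k\<^esub> = 1\<^sub>m k"
    and sum: "\<And>k m g h. g \<in> carrier (H k) \<Longrightarrow> h \<in> carrier (H m) \<Longrightarrow>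
      R (k + m) (\<psi> k m g h) = block_sum k m (R k g) (R m h)"
    and f_closed: "\<And>k \<sigma>. \<sigma> permutes {1..k} \<Longrightarrow> f k \<sigma> \<in> carrier (H k)"
    and f_hom: "\<And>k \<sigma> \<tau>. \<sigma> permutes {1..k} \<Longrightarrow> \<tau> permutes {1..k} \<Longrightarrow> f k (\<sigma> \<circ> \<tau>) = f k \<sigma> \<otimes>\<^bsub>H k\<^esub> f k \<tau>"
    and Rf: "\<And>k \<sigma>. \<sigma> permutes {1..k} \<Longrightarrow> R k (f k \<sigma>) = perm_mat k \<sigma>"
    and A: "A = coset_of (union_boundaries H) (pushforward (\<lambda>(k, xs). (k, map (f k) xs)) (symmetric_cycle \<mu> b n))"
  shows "A \<in> homology_part H (CARD('p) ^ Suc n) (D * (\<Sum>i\<le>n. b i)) \<and> indecomposable H \<psi> A"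
proof -
  define N where "N = CARD('p) ^ Suc n"
  let ?Z = "product_cycle (\<lambda>i. scaled_cycle \<mu> (b i)) n"
  let ?a = "pushforward (\<lambda>(k, xs). (k, map (f k) xs)) (symmetric_cycle \<mu> b n)"
  have eq: "symmetric_cycle \<mu> b n = pushforward (\<lambda>xs. (CARD('p) ^ Suc n, map (regular_rep n) xs)) ?Z"
    by (rule iterate_cayley_chain) (rule scaled_cycle_keys)
  have a: "?a = pushforward (\<lambda>xs. (N, map (\<lambda>g. f N (regular_rep n g)) xs)) ?Z"
    unfolding N_def eq pushforward_pushforward
    by (simp only: prod.case map_map comp_def)
  have cycle: "?a \<in> union_cycles H"
  proof (rule pushforward_union_cycle[OF symmetric_cycle_is_cycle])
    fix k and \<sigma> \<tau> :: "nat \<Rightarrow> nat"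
    assume \<sigma>: "\<sigma> \<in> carrier (sym_group k)"
    then show "f k \<sigma> \<in> carrier (H k)"
      unfolding sym_group_simps mem_Collect_eq by (rule f_closed)
    assume "\<tau> \<in> carrier (sym_group k)"
    with \<sigma> show "f k (\<sigma> \<otimes>\<^bsub>sym_group k\<^esub> \<tau>) = f k \<sigma> \<otimes>\<^bsub>H k\<^esub> f k \<tau>"
      unfolding sym_group_simps mem_Collect_eq by (rule f_hom)
  qed
  have keys: "Poly_Mapping.keys ?a \<subseteq> {N} \<times> {xs. length xs = D * (\<Sum>i\<le>n. b i)}"
  proof
    fix z assume "z \<in> Poly_Mapping.keys ?a"
    then have "z \<in> (\<lambda>xs. (N, map (\<lambda>g. f N (regular_rep n g)) xs)) ` Poly_Mapping.keys ?Z"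
      unfolding a by (rule subsetD[OF keys_pushforward])
    then obtain xs where xs: "z = (N, map (\<lambda>g. f N (regular_rep n g)) xs)" "xs \<in> Poly_Mapping.keys ?Z"
      by (rule imageE)
    have "length xs = (\<Sum>i\<le>n. D * b i)"
      using keys_product_cycle[of "\<lambda>i. scaled_cycle \<mu> (b i)" "\<lambda>i. D * b i" xs n, OF scaled_cycle_keys[where \<mu> = \<mu>] xs(2)] by blast
    then show "z \<in> {N} \<times> {xs. length xs = D * (\<Sum>i\<le>n. b i)}"
      by (simp add: xs(1) sum_distrib_left)
  qed
  have "A \<in> homology_part H N (D * (\<Sum>i\<le>n. b i))"
    unfolding homology_part_def A coset_of_def mem_Collect_eq
    by (intro exI[of _ ?a] conjI refl cycle keys)
  moreover have "indecomposable H \<psi> A"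
    unfolding A
  proof (rule indecomposable_criterion[OF monoid closed hom one sum U_cocycle U_zero cycle])
    have "evaluate (\<lambda>(k, xs). char_cochain (U (\<Sum>i\<le>n. b i)) k (map (R k) xs)) ?a =
        evaluate (\<lambda>xs. char_cochain (U (\<Sum>i\<le>n. b i)) N (map (reg_mat n) xs)) ?Z"
    proof -
      have "R N (f N (regular_rep n g)) = reg_mat n g" for g :: "nat \<Rightarrow> 'p mod_ring"
        unfolding reg_mat_def N_def by (rule Rf[OF regular_rep_permutes])
      then show ?thesis
        unfolding a evaluate_pushforward by (simp add: comp_def)
    qed
    also have "\<dots> \<noteq> 0"
      unfolding N_def by (rule char_cochain_product_cycle[OF \<mu> b digits])
    finally show "evaluate (\<lambda>(k, xs). char_cochain (U (\<Sum>i\<le>n. b i)) k (map (R k) xs)) ?a \<noteq> 0" .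
  qed
  ultimately show ?thesis
    unfolding N_def by blast
qed

text \<open>All three classes are images of the one symmetric cycle: for the two \<open>GL\<close>
  families this rests on circle products being respected, as a tensor product of permutation
  matrices is the matrix of the product permutation.\<close>

lemma products_indecomposable:
  fixes x y :: "'p cohomology_class"
  assumes dual: "\<And>k. dual_class x y k = coset_of (bar_boundaries fp_add) (scaled_cycle \<mu> k)"
    and \<mu>: "\<mu> \<noteq> 0" and len: "length Bs = Suc n"
    and Bs: "\<forall>b\<in>set Bs. b > 0 \<and> (CARD('p) - 1) dvd b" and nc: "no_carry CARD('p) Bs"
  shows "(let a = homology_map aut_free perm_aut (iterated_product circ_sym (map (E_sym x y) Bs)) in
      a \<in> homology_part aut_free (CARD('p) ^ Suc n) (D * sum_list Bs) \<and> indecomposable aut_free aut_sum a) \<and>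
    (let a = iterated_product circ_GL (map (E_Z x y) Bs) in
      a \<in> homology_part GL (CARD('p) ^ Suc n) (D * sum_list Bs) \<and> indecomposable GL block_sum a) \<and>
    (let a = iterated_product circ_GL (map (E_Fp x y) Bs) in
      a \<in> homology_part GL (CARD('p) ^ Suc n) (D * sum_list Bs) \<and> indecomposable GL block_sum a)"
proof -
  define b where "b = (\<lambda>i. Bs ! i)"
  have b: "b i > 0 \<and> (CARD('p) - 1) dvd b i" if "i \<le> n" for i
    using Bs len that by (simp add: b_def)
  have sum_nth: "sum_list (map h Bs) = (\<Sum>i\<le>n. h (b i))" for h :: "nat \<Rightarrow> nat"
    using len by (simp add: sum_list_sum_nth b_def atLeast0LessThan lessThan_Suc_atMost)
  have B: "sum_list Bs = (\<Sum>i\<le>n. b i)"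
    using sum_nth[of "\<lambda>x. x"] by simp
  have digits: "(\<Sum>i\<le>n. b i div CARD('p) ^ j mod CARD('p)) < CARD('p)" for j
    using nc by (simp add: no_carry_def sum_nth)
  let ?c = "\<lambda>i. cayley_chain (scaled_cycle \<mu> (b i))"
  let ?Z = "symmetric_cycle \<mu> b n"
  have sym: "E_sym x y k = coset_of (union_boundaries sym_group) (cayley_chain (scaled_cycle \<mu> k))" for k
    unfolding E_sym_def additive_Fp_eq dual
    by (rule homology_map_into_coset_of) (use cayley_permutes in \<open>auto simp: sym_group_simps cayley_add\<close>)
  have perm_hom: "perm_mat k (\<sigma> \<otimes>\<^bsub>sym_group k\<^esub> \<tau>) = (perm_mat k \<sigma> :: 'a::comm_ring_1 mat) \<otimes>\<^bsub>GL k\<^esub> perm_mat k \<tau>"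
    if "\<sigma> \<in> carrier (sym_group k)" "\<tau> \<in> carrier (sym_group k)" for k \<sigma> \<tau>
    using that by (simp add: sym_group_simps perm_mat_mult)
  have perm_closed: "(perm_mat k \<sigma> :: 'a::comm_ring_1 mat) \<in> carrier (GL k)"
    if "\<sigma> \<in> carrier (sym_group k)" for k \<sigma>
    using that by (simp add: sym_group_simps perm_mat_GL)
  have perm_map: "homology_map GL perm_mat (coset_of (union_boundaries sym_group) a) =
      coset_of (union_boundaries (GL :: nat \<Rightarrow> 'a::comm_ring_1 mat monoid))
        (pushforward (\<lambda>(k, xs). (k, map (perm_mat k) xs)) a)" for a :: "nat \<times> (nat \<Rightarrow> nat) list \<Rightarrow>\<^sub>0 'p mod_ring"
    by (rule homology_map_coset_of) (simp_all only: perm_hom perm_closed)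
  have gl: "E_Z x y k = coset_of (union_boundaries GL)
      (pushforward (\<lambda>(k, xs). (k, map (perm_mat k) xs)) (cayley_chain (scaled_cycle \<mu> k)))" for k
  proof -
    have "(\<lambda>m. abelianize m \<circ> perm_aut m) = perm_mat"
      by (simp add: fun_eq_iff abelianize_perm_aut)
    then show ?thesis
      unfolding E_Z_def sym by (simp only: perm_map)
  qed
  have fp: "E_Fp x y k = coset_of (union_boundaries GL)
      (pushforward (\<lambda>(k, xs). (k, map (perm_mat k) xs)) (cayley_chain (scaled_cycle \<mu> k)))" for k
  proof -
    have "homology_map GL (\<lambda>m. reduce_mod) (coset_of (union_boundaries GL)
        (pushforward (\<lambda>(k, xs). (k, map (perm_mat k) xs)) (cayley_chain (scaled_cycle \<mu> k)))) =
      coset_of (union_boundaries GL) (pushforward (\<lambda>(k, xs). (k, map reduce_mod xs))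
        (pushforward (\<lambda>(k, xs). (k, map (perm_mat k) xs)) (cayley_chain (scaled_cycle \<mu> k))))"
      by (rule homology_map_coset_of)
        (simp_all add: reduce_mod_mult[OF GL_carrier_mat GL_carrier_mat] reduce_mod_GL)
    then show ?thesis
      unfolding E_Fp_def gl
      by (simp add: pushforward_pushforward split_beta comp_def reduce_mod_perm_mat)
  qed
  \<comment> \<open>Proved for an arbitrary coefficient ring, so that it applies to the integers and
    to F_p alike.\<close>
  have GL_product: "iterate circ_GL (\<lambda>i. coset_of (union_boundaries GL)
        (pushforward (\<lambda>(k, xs). (k, map (perm_mat k) xs)) (?c i))) n =
      coset_of (union_boundaries (GL :: nat \<Rightarrow> 'a::comm_ring_1 mat monoid))
        (pushforward (\<lambda>(k, xs). (k, map (perm_mat k) xs)) ?Z)"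
  proof -
    have "pushforward (\<lambda>(k, xs). (k, map (perm_mat k :: _ \<Rightarrow> 'a mat) xs)) (?c i) \<in> union_cycles GL" for i
      by (rule pushforward_union_cycle[OF cayley_chain_cycle]) (simp_all only: perm_hom perm_closed)
    note product_family.iterate_coset_of[OF product_family_GL this]
    moreover have "pushforward (\<lambda>(k, xs). (k, map (perm_mat k :: _ \<Rightarrow> 'a mat) xs)) ?Z =
        iterate (bilin_ext (simplex_product GL (*) mat_tensor))
          (\<lambda>i. pushforward (\<lambda>(k, xs). (k, map (perm_mat k) xs)) (?c i)) n"
      by (rule pushforward_iterate[OF product_family_sym cayley_chain_cycle])
        (simp_all add: sym_group_simps mat_tensor_perm_mat perm_mat_one)
    ultimately show ?thesis
      by (simp add: circ_GL_def)
  qed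
  have GL_monoid: "monoid (GL k :: 'a::comm_ring_1 mat monoid)" for k
    by (rule group.is_monoid[OF GL_group])
  have aut: "homology_map aut_free perm_aut (iterated_product circ_sym (map (E_sym x y) Bs)) =
      coset_of (union_boundaries aut_free) (pushforward (\<lambda>(k, xs). (k, map (perm_aut k) xs)) ?Z)"
  proof -
    have "iterated_product circ_sym (map (E_sym x y) Bs) = coset_of (union_boundaries sym_group) ?Z"
      unfolding iterated_product_eq_iterate[OF len] sym circ_sym_def b_def
      by (rule product_family.iterate_coset_of[OF product_family_sym cayley_chain_cycle])
    moreover have "homology_map aut_free perm_aut (coset_of (union_boundaries sym_group) ?Z) =
        coset_of (union_boundaries aut_free) (pushforward (\<lambda>(k, xs). (k, map (perm_aut k) xs)) ?Z)"
      by (rule homology_map_coset_of)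
        (simp_all add: sym_group_simps aut_free_mult perm_aut_mult perm_aut_in_aut_free)
    ultimately show ?thesis
      by simp
  qed
  have Z: "iterated_product circ_GL (map (E_Z x y) Bs) =
      coset_of (union_boundaries GL) (pushforward (\<lambda>(k, xs). (k, map (perm_mat k) xs)) ?Z)"
    unfolding iterated_product_eq_iterate[OF len] gl using GL_product by (simp add: b_def)
  have F: "iterated_product circ_GL (map (E_Fp x y) Bs) =
      coset_of (union_boundaries GL) (pushforward (\<lambda>(k, xs). (k, map (perm_mat k) xs)) ?Z)"
    unfolding iterated_product_eq_iterate[OF len] fp using GL_product by (simp add: b_def)
  have 1: "coset_of (union_boundaries aut_free) (pushforward (\<lambda>(k, xs). (k, map (perm_aut k) xs)) ?Z)
        \<in> homology_part aut_free (CARD('p) ^ Suc n) (D * (\<Sum>i\<le>n. b i)) \<and>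
      indecomposable aut_free aut_sum
        (coset_of (union_boundaries aut_free) (pushforward (\<lambda>(k, xs). (k, map (perm_aut k) xs)) ?Z))"
  \<comment> \<open>Automorphisms reach \<open>GL\<close> over F_p by abelianizing and then reducing
    modulo p.\<close>
  proof (rule image_indecomposable[where R = "\<lambda>k g. reduce_mod (abelianize k g)", OF \<mu> b digits aut_free_monoid _ _ _ _ _ _ _ refl])
    fix k m g h
    show "g \<in> carrier (aut_free k) \<Longrightarrow> reduce_mod (abelianize k g) \<in> carrier (GL k)"
      by (intro reduce_mod_GL abelianize_GL)
    show "g \<in> carrier (aut_free k) \<Longrightarrow> h \<in> carrier (aut_free k) \<Longrightarrow>
        reduce_mod (abelianize k (g \<otimes>\<^bsub>aut_free k\<^esub> h)) = reduce_mod (abelianize k g) * reduce_mod (abelianize k h)"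
      by (simp add: abelianize_mult reduce_mod_mult[where n = k] GL_carrier_mat abelianize_GL)
    show "reduce_mod (abelianize k \<one>\<^bsub>aut_free k\<^esub>) = 1\<^sub>m k"
      by (simp only: abelianize_one reduce_mod_one)
    show "g \<in> carrier (aut_free k) \<Longrightarrow> h \<in> carrier (aut_free m) \<Longrightarrow>
        reduce_mod (abelianize (k + m) (aut_sum k m g h)) =
        block_sum k m (reduce_mod (abelianize k g)) (reduce_mod (abelianize m h))"
      by (simp add: abelianize_aut_sum reduce_mod_block_sum GL_carrier_mat abelianize_GL)
  next
    fix k and \<sigma> \<tau> :: "nat \<Rightarrow> nat"
    show "\<sigma> permutes {1..k} \<Longrightarrow> perm_aut k \<sigma> \<in> carrier (aut_free k)"
      by (rule perm_aut_in_aut_free)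
    show "\<sigma> permutes {1..k} \<Longrightarrow> \<tau> permutes {1..k} \<Longrightarrow>
        perm_aut k (\<sigma> \<circ> \<tau>) = perm_aut k \<sigma> \<otimes>\<^bsub>aut_free k\<^esub> perm_aut k \<tau>"
      by (simp only: aut_free_mult perm_aut_mult perm_aut_in_aut_free)
    show "reduce_mod (abelianize k (perm_aut k \<sigma>)) = perm_mat k \<sigma>"
      by (simp only: abelianize_perm_aut reduce_mod_perm_mat)
  qed
  have 2: "A \<in> homology_part GL (CARD('p) ^ Suc n) (D * (\<Sum>i\<le>n. b i)) \<and> indecomposable GL block_sum A"
    if A: "A = coset_of (union_boundaries (GL :: nat \<Rightarrow> int mat monoid))
      (pushforward (\<lambda>(k, xs). (k, map (perm_mat k) xs)) ?Z)" for A
    by (rule image_indecomposable[where R = "\<lambda>k. reduce_mod" and f = perm_mat, OF \<mu> b digits GL_monoid _ _ _ _ _ _ _ A])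
      (simp_all add: reduce_mod_GL reduce_mod_mult[OF GL_carrier_mat GL_carrier_mat] reduce_mod_one
        reduce_mod_block_sum[OF GL_carrier_mat GL_carrier_mat] perm_mat_GL perm_mat_mult reduce_mod_perm_mat)
  have 3: "A \<in> homology_part GL (CARD('p) ^ Suc n) (D * (\<Sum>i\<le>n. b i)) \<and> indecomposable GL block_sum A"
    if A: "A = coset_of (union_boundaries (GL :: nat \<Rightarrow> 'p mod_ring mat monoid))
      (pushforward (\<lambda>(k, xs). (k, map (perm_mat k) xs)) ?Z)" for A
    by (rule image_indecomposable[where R = "\<lambda>k A. A" and f = perm_mat, OF \<mu> b digits GL_monoid _ _ _ _ _ _ _ A])
      (simp_all add: perm_mat_GL perm_mat_mult)
  show ?thesis
    unfolding Let_def B aut using 1 2[OF Z] 3[OF F] by blast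
qed

end

theorem theorem47:
  fixes p n B :: nat
    and Bs :: "nat list"
    and x y :: "'p::prime_card cohomology_class"
  assumes "p = CARD('p)"
    and "cohomology_generators x y"
    and "length Bs = n" and "n \<ge> 1"
    and "\<forall>b\<in>set Bs. b > 0 \<and> (p - 1) dvd b"
    and "no_carry p Bs"
    and "B = sum_list Bs"
  shows
    "(let a = homology_map aut_free perm_aut (iterated_product circ_sym (map (E_sym x y) Bs)) in
        a \<in> homology_part aut_free (p ^ n) (if p = 2 then B else 2 * B) \<and>
        indecomposable aut_free aut_sum a) \<and>
     (let a = iterated_product circ_GL (map (E_Z x y) Bs) in
        a \<in> homology_part GL (p ^ n) (if p = 2 then B else 2 * B) \<and>
        indecomposable GL block_sum a) \<and>
     (let a = iterated_product circ_GL (map (E_Fp x y) Bs) in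
        a \<in> homology_part GL (p ^ n) (if p = 2 then B else 2 * B) \<and>
        indecomposable GL block_sum a)"
proof -
  \<comment> \<open>\<open>iterate\<close> and \<open>regular_rep\<close> index the factors from 0,
    so n factors correspond to rank index n - 1.\<close>
  obtain n' where n': "n = Suc n'"
    using assms(4) by (cases n) auto
  note * = assms(5,6)[unfolded assms(1)] assms(3)[unfolded n']
  show ?thesis
  \<comment> \<open>The degree of y is 1 for p = 2 and 2 otherwise; this selects the instance of
    \<open>power_system\<close>.\<close>
  proof (cases "CARD('p) = 2")
    case True
    interpret power_system 1 letter_power "mod2_cycle :: nat \<Rightarrow> 'p mod_ring list \<Rightarrow>\<^sub>0 'p mod_ring"
      by unfold_locales (use True in \<open>auto simp: letter_power_cocycle letter_power_zero letter_power_shuffle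
        mod2_cycle_is_cycle keys_mod2_cycle letter_power_mod2_cycle\<close>)
    obtain \<mu> :: "'p mod_ring" where "\<mu> \<noteq> 0" "\<And>k. dual_class x y k = coset_of (bar_boundaries fp_add) (scaled_cycle \<mu> k)"
      using dual_class_2[OF assms(2) True] unfolding scaled_cycle_def by blast
    from products_indecomposable[OF this(2,1) *(3,1,2)] show ?thesis
      unfolding assms(1,7) n' using True by (simp only: refl if_True mult_1)
  next
    case False
    interpret power_system 2 carry_power "even_cycle :: nat \<Rightarrow> 'p mod_ring list \<Rightarrow>\<^sub>0 'p mod_ring"
      by unfold_locales (auto simp: carry_power_cocycle carry_power_zero carry_power_shuffle
        even_cycle_is_cycle keys_even_cycle carry_power_even_cycle)
    obtain \<mu> :: "'p mod_ring" where "\<mu> \<noteq> 0" "\<And>k. dual_class x y k = coset_of (bar_boundaries fp_add) (scaled_cycle \<mu> k)"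
      using dual_class_odd[OF assms(2) False] unfolding scaled_cycle_def by blast
    from products_indecomposable[OF this(2,1) *(3,1,2)] show ?thesis
      unfolding assms(1,7) n' using False by (simp only: if_False)
  qed
qed

end
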